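(* Let $A$ be an abelian category and $F:J\to B(A)$ a contravariant differential graded functor, with the associated functors $G$, $E$, $G_b$, and $F_N^b$ ($b\in\mathbb{Z}$, $N\ge 0$). For every $X=(P^i,q_{ij})\in\mathrm{Obj}\,\mathfrak{H}$ the filtration of the complex $G(X)$ by the subcomplexes $G_b(X)$ yields a convergent spectral sequence (the spectral sequence of motivic descent) $$S:\ E_1^{ij}(S)=H^{i+j}(F_0^j(X))\Longrightarrow H^{i+j}(E(X)),$$ such that: (a) $E_1^{ij}(S)$ is the $i$-th cohomology group of the complex $(A_l)$ with $A_l=H^j(F([P^{-l}]))$; so the $E_1$-terms are functorial in $t_0(X)$. (b) For all $n\ge1$, $$E_n^{ij}(S)=\frac{\mathrm{Im}\big(H^{i+j}(F^{j}_{n-1}(X))\to H^{i+j}(F^{j+n-1}_{2n-2}(X))\big)}{\mathrm{Im}\big(H^{i+j}(F^{j-1}_{n-2}(X))\to H^{i+j}(F^{j+n-1}_{2n-2}(X))\big)}$$ (where $F^{j-1}_{-1}=0$). Hence for any $n\ge 1$ the $E_n$-terms of $S$ depend only on $t_{2n-2}(X)$. (c) $S$ (from $E_1$ on) is contravariantly functorial in $X\in\mathfrak{H}$; and if $F\to F'$ is a differential graded transformation of functors, then the corresponding map of spectral sequences depends only on the transformation of the functors $\mathfrak{H}\to K(A)$ induced by it.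
   Context: $k$ is a field of characteristic $0$; $SmPrVar$ are the smooth projective varieties over $k$; $SmCor$ is the category of smooth varieties and finite correspondences. Cubical Suslin complexes. For $P,Y$ smooth, $i\le 0$ put $C'^i(P)(Y)=SmCor(\mathbb{A}^{-i}\times Y,P)$. For $1\le j\le -i$, $x\in\{0,1\}$ let $d_{jx}:C'^i\to C'^{i+1}$ be composition with the map induced by $(x_1,\dots,x_{-1-i})\mapsto(x_1,\dots,x_{j-1},x,x_j,\dots,x_{-1-i})$. Put $C^i(P)(Y)=\bigcap_j\ker d_{j0}$, $\delta^i=\sum_{1\le j\le -i}(-1)^jd_{j1}$, $C^i=0$ for $i>0$. For $f\in C^i(P)(Y)$, $l\le 0$ let $f^l:C^l(Y)\to C^{l+i}(P)$ send $h\in SmCor(\mathbb{A}^{-l}\times Z,Y)$ to $(-1)^{li}f\circ(\mathrm{id}_{\mathbb{A}^{-i}}\otimes h)$. $J$ is the differential graded category with objects $[P]$, $P\in SmPrVar$, $J^i([P],[Q])=C^i(Q)(P)$, composition of $g\in C^j(Y)(Z)$, $f\in C^i(X)(Y)$ equal to $f^j(g)$, differential $\delta$; it has no morphisms of positive degree. Twisted complexes. For a differential graded category $C$, $\mathrm{PreTr}(C)$ has objects $(P^i,q_{ij})$, $P^i\in\mathrm{Obj}\,C$ almost all $0$, $q_{ij}\in C^{i-j+1}(P^i,P^j)$, $\delta q_{ij}+\sum_lq_{lj}\circ q_{il}=0$, and $\mathrm{PreTr}(C)^l((P^i,q_{ij}),(P'^i,q'_{ij}))=\bigoplus C^{l+i-j}(P^i,P'^j)$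 with differential $\delta_Cf+\sum_m(q'_{jm}\circ f-(-1)^{(i-m)l}f\circ q_{mi})$ for $f\in C^{l+i-j}(P^i,P'^j)$; $\mathrm{Tr}(C)$ is its homotopy category ($H^0$ of morphism complexes). $J'=\mathrm{PreTr}(J)$, $\mathfrak{H}=\mathrm{Tr}(J)$, $\mathrm{Obj}\,\mathfrak{H}=\mathrm{Obj}\,J'$. $B(A)$ is the differential graded category of unbounded complexes over $A$, and $K(A)$ its homotopy category; $\mathrm{PreTr}(B(A))\cong B(A)$ by total complexes. $G=\mathrm{PreTr}(F):J'\to B(A)$ and $E=\mathrm{Tr}(F):\mathfrak{H}\to K(A)$ (contravariant), so $H^s(G(X))=H^s(E(X))$. Truncations. For a complex $Y$ over $A$: $\tau_{\le b}Y=(\dots\to Y^{b-1}\to\ker(Y^b\to Y^{b+1}))$; for $a\le b$ the canonical $[a,b]$-truncation is $Y^a/dY^{a-1}\to Y^{a+1}\to\dots\to Y^{b-1}\to\ker(Y^b\to Y^{b+1})$ (and $H^a(Y)$ in degree $a$ if $a=b$). Since $J$ has no morphisms of positive degree, composing $F$ with these truncations gives differential graded functors on $J$. $G_b=\mathrm{PreTr}(\tau_{\le b}F):J'\to B(A)$; $F_N^b:\mathfrak{H}\to K(A)$ is $\mathrm{Tr}$ of the functor sending $[P]$ to the canonical $[b-N,b]$-truncation of $F([P])$ (the truncated realizations of length $N$). The complexes $G_b(X)$ form an increasing filtration of $G(X)$ and $G_b(X)/G_{b-N-1}(X)$ is naturally quasi-isomorphic to $F_N^b(X)$; hence for $0\le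 l\le N$ there are natural maps $H^s(F^{b-l}_{N-l}(X))\to H^s(F^b_N(X))$. In $E_r^{ij}(S)$ the index $j$ is the filtration index and $i+j$ the total degree. Truncation functors $t_N$. For $N\ge0$ let $C_N(P)$ be the quotient complex of $C(P)$ with $C_N^i=C^i$ for $i>-N$, $C_N^{-N}=C^{-N}/\delta C^{-N-1}$, and $0$ below; $J_N$ has objects $[P]$, $J_N^i([P],[Q])=C_N^i(Q)(P)$ with composition and differential induced from $J$; $\mathfrak{H}_N=\mathrm{Tr}(J_N)$, $t_N:\mathfrak{H}\to\mathfrak{H}_N$ is induced by $J\to J_N$. $\mathfrak{H}_0=K^b(Corr_{rat})$ where $Corr_{rat}$ has morphisms $H^0(C(Q)(P))$.
   Formalization: In PreTr the Maurer–Cartan equation and the term q'∘f of the differential carry the sign (-1)^deg of the morphism applied first; with the signs as printed the differential does not square to zero and the total complex G(X) is not a complex. *)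

theory Defs
  imports
    "HOL-Library.Poly_Mapping"
    "HOL-Library.Product_Lexorder"
    "HOL-Computational_Algebra.Fraction_Field"
    "HOL-Combinatorics.Permutations"
    "HOL-Algebra.Embedded_Algebras"
    "HOL-Algebra.QuotRing"
    "HOL-Algebra.Module"
    "HOL-Analysis.Abstract_Topology_2"
begin

section \<open>Varieties and finite correspondences\<close>

text \<open>
  The varieties needed are reduced closed subschemes of finite products of affine lines and
  projective spaces over a field \<open>k\<close>.  The ambient product is a list of factors; the variable
  \<open>(i, j)\<close> is the \<open>j\<close>-th (homogeneous) coordinate on the \<open>i\<close>-th factor.  A scheme-theoretic point
  of the ambient product is a multihomogeneous prime ideal of the coordinate ring that contains no
  irrelevant ideal, and a reduced closed subscheme is a Zariski closed set of such points.
\<close>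

datatype factor = Aff | Proj nat

type_synonym 'k mpol = "((nat \<times> nat) \<Rightarrow>\<^sub>0 nat) \<Rightarrow>\<^sub>0 'k"
type_synonym 'k variety = "factor list \<times> 'k mpol set set"
type_synonym 'k cycle = "'k mpol set \<Rightarrow>\<^sub>0 int"

definition vars :: "factor list \<Rightarrow> (nat \<times> nat) set" where
  "vars L = {(i, j). i < length L \<and> (case L ! i of Aff \<Rightarrow> j = 0 | Proj n \<Rightarrow> j \<le> n)}"

definition proj_idx :: "factor list \<Rightarrow> nat set" where
  "proj_idx L = {i. i < length L \<and> L ! i \<noteq> Aff}"

definition polys :: "factor list \<Rightarrow> 'k::field_char_0 mpol set" where
  "polys L = {f. \<forall>m\<in>Poly_Mapping.keys f. Poly_Mapping.keys m \<subseteq> vars L}"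

definition polyring :: "factor list \<Rightarrow> 'k::field_char_0 mpol ring" where
  "polyring L = \<lparr>carrier = polys L, mult = (*), one = 1, zero = 0, add = (+)\<rparr>"

definition pvar :: "nat \<times> nat \<Rightarrow> 'k::field_char_0 mpol" where
  "pvar v = Poly_Mapping.single (Poly_Mapping.single v 1) 1"

definition mdeg :: "((nat \<times> nat) \<Rightarrow>\<^sub>0 nat) \<Rightarrow> nat \<Rightarrow> nat" where
  "mdeg m i = (\<Sum>v\<in>{v \<in> Poly_Mapping.keys m. fst v = i}. Poly_Mapping.lookup m v)"

text \<open>Multidegrees \<open>D\<close> matter only at the projective factors.\<close>

definition mhom :: "factor list \<Rightarrow> (nat \<Rightarrow> nat) \<Rightarrow> 'k::field_char_0 mpol \<Rightarrow> bool" where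
  "mhom L D f \<longleftrightarrow> (\<forall>m\<in>Poly_Mapping.keys f. \<forall>i\<in>proj_idx L. mdeg m i = D i)"

definition hcomp :: "factor list \<Rightarrow> (nat \<Rightarrow> nat) \<Rightarrow> 'k::field_char_0 mpol \<Rightarrow> 'k mpol" where
  "hcomp L D f = (\<Sum>m\<in>{m \<in> Poly_Mapping.keys f. \<forall>i\<in>proj_idx L. mdeg m i = D i}.
     Poly_Mapping.single m (Poly_Mapping.lookup f m))"

definition psubst :: "(nat \<times> nat \<Rightarrow> 'k::field_char_0 mpol) \<Rightarrow> 'k mpol \<Rightarrow> 'k mpol" where
  "psubst \<phi> f = (\<Sum>m\<in>Poly_Mapping.keys f.
     Poly_Mapping.single 0 (Poly_Mapping.lookup f m) *
     (\<Prod>v\<in>Poly_Mapping.keys m. \<phi> v ^ Poly_Mapping.lookup m v))"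

text \<open>Pullback of polynomials along the projection to the factors listed by \<open>\<sigma>\<close>.\<close>

definition reindex :: "(nat \<Rightarrow> nat) \<Rightarrow> 'k::field_char_0 mpol \<Rightarrow> 'k mpol" where
  "reindex \<sigma> = psubst (\<lambda>(i, j). pvar (\<sigma> i, j))"

definition pderv :: "nat \<times> nat \<Rightarrow> 'k::field_char_0 mpol \<Rightarrow> 'k mpol" where
  "pderv v f = (\<Sum>m\<in>Poly_Mapping.keys f. Poly_Mapping.single (m - Poly_Mapping.single v 1)
     (of_nat (Poly_Mapping.lookup m v) * Poly_Mapping.lookup f m))"

definition points :: "factor list \<Rightarrow> 'k::field_char_0 mpol set set" where
  "points L = {p. primeideal p (polyring L) \<and> (\<forall>f\<in>p. \<forall>D. hcomp L D f \<in> p) \<and>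
     (\<forall>i\<in>proj_idx L. \<exists>j. (i, j) \<in> vars L \<and> pvar (i, j) \<notin> p)}"

definition zariski_closed :: "factor list \<Rightarrow> 'k::field_char_0 mpol set set \<Rightarrow> bool" where
  "zariski_closed L Z \<longleftrightarrow> (\<exists>S\<subseteq>polys L. Z = {p \<in> points L. S \<subseteq> p})"

definition zariski :: "'k::field_char_0 variety \<Rightarrow> 'k mpol set topology" where
  "zariski X = topology (\<lambda>U. \<exists>S\<subseteq>polys (fst X). U = {p \<in> snd X. \<not> S \<subseteq> p})"

definition vanishing :: "'k::field_char_0 variety \<Rightarrow> 'k mpol set" where
  "vanishing X = {f \<in> polys (fst X). \<forall>p\<in>snd X. f \<in> p}"

definition minimal_elts :: "'a set set \<Rightarrow> 'a set set" where
  "minimal_elts S = {r \<in> S. \<forall>r'\<in>S. r' \<subseteq> r \<longrightarrow> r' = r}"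

text \<open>
  Smoothness over \<open>k\<close>: near each point the ideal is generated by \<open>c\<close> equations some
  \<open>c \<times> c\<close> minor of whose Jacobian matrix does not vanish there.  By Euler's relation
  the Jacobian with respect to the homogeneous coordinates has the same rank at a point as
  the Jacobian in an affine chart.
\<close>

definition jacobian_minor :: "'k::field_char_0 mpol list \<Rightarrow> (nat \<times> nat) list \<Rightarrow> 'k mpol" where
  "jacobian_minor fs vs = (\<Sum>\<pi>\<in>{\<pi>. \<pi> permutes {..<length fs}}.
     of_int (sign \<pi>) * (\<Prod>a<length fs. pderv (vs ! \<pi> a) (fs ! a)))"

definition smooth :: "'k::field_char_0 variety \<Rightarrow> bool" where
  "smooth X \<longleftrightarrow> (\<forall>p\<in>snd X. \<exists>fs vs.
     set fs \<subseteq> vanishing X \<and> (\<forall>f\<in>set fs. \<exists>D. mhom (fst X) D f) \<and>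
     (\<forall>f\<in>vanishing X. \<exists>g\<in>polys (fst X). g \<notin> p \<and> g * f \<in> Idl\<^bsub>polyring (fst X)\<^esub> (set fs)) \<and>
     length vs = length fs \<and> set vs \<subseteq> vars (fst X) \<and> jacobian_minor fs vs \<notin> p)"

definition SmPrVar :: "'k::field_char_0 variety set" where
  "SmPrVar = {X. (\<exists>n. fst X = [Proj n]) \<and> zariski_closed (fst X) (snd X) \<and> smooth X}"

definition contract :: "(nat \<Rightarrow> nat) \<Rightarrow> factor list \<Rightarrow> 'k::field_char_0 mpol set \<Rightarrow> 'k mpol set" where
  "contract \<sigma> L p = {f \<in> polys L. reindex \<sigma> f \<in> p}"

text \<open>In characteristic \<open>0\<close> a fibre product over \<open>k\<close> of reduced schemes is reduced, so it is
  determined by its set of points.\<close>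

definition vprod :: "'k::field_char_0 variety \<Rightarrow> 'k variety \<Rightarrow> 'k variety" where
  "vprod X Y = (fst X @ fst Y, {p \<in> points (fst X @ fst Y).
     contract id (fst X) p \<in> snd X \<and> contract (\<lambda>i. i + length (fst X)) (fst Y) p \<in> snd Y})"

definition affine_space :: "nat \<Rightarrow> 'k::field_char_0 variety" where
  "affine_space m = (replicate m Aff, points (replicate m Aff))"

subsection \<open>Local rings and residue fields\<close>

text \<open>All local rings of the ambient product are subrings of the fraction field of polynomials.\<close>

definition loc_fractions ::
  "factor list \<Rightarrow> 'k::field_char_0 mpol set \<Rightarrow> 'k mpol set \<Rightarrow> 'k mpol fract set" where
  "loc_fractions L p J = {Fraction_Field.Fract f g | f g. \<exists>D.
     f \<in> J \<and> f \<in> polys L \<and> g \<in> polys L \<and> mhom L D f \<and> mhom L D g \<and> g \<notin> p}"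

definition locring :: "factor list \<Rightarrow> 'k::field_char_0 mpol set \<Rightarrow> 'k mpol fract ring" where
  "locring L p =
     \<lparr>carrier = loc_fractions L p (polys L), mult = (*), one = 1, zero = 0, add = (+)\<rparr>"

definition residue_field :: "factor list \<Rightarrow> 'k::field_char_0 mpol set \<Rightarrow> 'k mpol fract set ring" where
  "residue_field L p = locring L p Quot loc_fractions L p p"

definition residue_class ::
  "factor list \<Rightarrow> 'k::field_char_0 mpol set \<Rightarrow> 'k mpol fract \<Rightarrow> 'k mpol fract set" where
  "residue_class L p a = a_r_coset (locring L p) (loc_fractions L p p) a"

definition var_locring ::
  "'k::field_char_0 variety \<Rightarrow> 'k mpol set \<Rightarrow> 'k mpol fract set ring" where
  "var_locring X p = locring (fst X) p Quot loc_fractions (fst X) p (vanishing X)"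

definition residue_degree ::
  "(nat \<Rightarrow> nat) \<Rightarrow> factor list \<Rightarrow> 'k::field_char_0 mpol set \<Rightarrow> factor list \<Rightarrow> 'k mpol set \<Rightarrow> nat" where
  "residue_degree \<sigma> L r L' s = (THE n. ring.dimension (residue_field L r) n
     {residue_class L r (Fraction_Field.Fract (reindex \<sigma> f) (reindex \<sigma> g)) | f g. \<exists>D.
        f \<in> polys L' \<and> g \<in> polys L' \<and> mhom L' D f \<and> mhom L' D g \<and> g \<notin> s}
     (carrier (residue_field L r)))"

subsection \<open>Elementary correspondences\<close>

text \<open>
  An integral closed subscheme \<open>V\<close> is represented by its generic point \<open>p\<close>.  It is finite over
  \<open>X\<close> if \<open>X\<close> is covered by affine opens \<open>D(g)\<close> (\<open>g\<close> of positive degree in every projective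
  factor) whose preimage in \<open>V\<close> is empty or the spectrum of a finite algebra \<open>R\<close> over the ring
  of functions on \<open>D(g)\<close>.  The integral separated scheme \<open>V \<inter> D(g)\<close> is the spectrum of a
  subring \<open>R\<close> of the function field of \<open>V\<close> iff its local rings are the localizations of \<open>R\<close>.
\<close>

definition finite_over ::
  "'k::field_char_0 variety \<Rightarrow> factor list \<Rightarrow> 'k mpol set \<Rightarrow> bool" where
  "finite_over X L p \<longleftrightarrow> (\<forall>x\<in>snd X. \<exists>g D.
     g \<in> polys (fst X) \<and> mhom (fst X) D g \<and> (\<forall>i\<in>proj_idx (fst X). 0 < D i) \<and> g \<notin> x \<and>
     (g \<in> p \<or> (\<exists>R.
        let K = residue_field L p;
            B = {residue_class L p (Fraction_Field.Fract f (g ^ n)) | f n.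
                   f \<in> polys (fst X) \<and> mhom (fst X) (\<lambda>i. n * D i) f}
        in subring R K \<and> B \<subseteq> R \<and>
           (\<exists>S. finite S \<and> S \<subseteq> R \<and>
              (\<forall>a\<in>R. \<exists>c\<in>S \<rightarrow> B. a = finsum K (\<lambda>s. c s \<otimes>\<^bsub>K\<^esub> s) S)) \<and>
           {residue_class L p ` loc_fractions L q (polys L) | q. q \<in> points L \<and> p \<subseteq> q \<and> g \<notin> q} =
           {{a \<otimes>\<^bsub>K\<^esub> inv\<^bsub>K\<^esub> b | a b. a \<in> R \<and> b \<in> R - Q} | Q. primeideal Q (K\<lparr>carrier := R\<rparr>)})))"

definition elementary ::
  "'k::field_char_0 variety \<Rightarrow> 'k variety \<Rightarrow> 'k mpol set \<Rightarrow> bool" where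
  "elementary X Y p \<longleftrightarrow> p \<in> snd (vprod X Y) \<and> finite_over X (fst X @ fst Y) p \<and>
     (\<exists>C\<in>connected_components_of (zariski X).
        contract id (fst X) ` {q \<in> points (fst X @ fst Y). p \<subseteq> q} = C)"

definition SmCor :: "'k::field_char_0 variety \<Rightarrow> 'k variety \<Rightarrow> 'k cycle set" where
  "SmCor X Y = {c. \<forall>p\<in>Poly_Mapping.keys c. elementary X Y p}"

subsection \<open>Intersection multiplicities\<close>

text \<open>Serre's formula: the alternating sum of the lengths of \<open>Tor\<^sub>i(O/a, O/b)\<close>, computed from a
  resolution of \<open>O/a\<close> by free modules of ranks \<open>n i\<close> with \<open>n 0 = 1\<close>.\<close>

definition vecs :: "('a, 'b) ring_scheme \<Rightarrow> nat \<Rightarrow> 'a set \<Rightarrow> (nat \<Rightarrow> 'a) set" where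
  "vecs R n a = ({..<n} \<rightarrow>\<^sub>E a)"

definition free_module :: "('a, 'b) ring_scheme \<Rightarrow> nat \<Rightarrow> ('a, nat \<Rightarrow> 'a) module" where
  "free_module R n = \<lparr>carrier = vecs R n (carrier R), mult = undefined, one = undefined,
     zero = (\<lambda>j\<in>{..<n}. \<zero>\<^bsub>R\<^esub>), add = (\<lambda>v w. \<lambda>j\<in>{..<n}. v j \<oplus>\<^bsub>R\<^esub> w j),
     smult = (\<lambda>c v. \<lambda>j\<in>{..<n}. c \<otimes>\<^bsub>R\<^esub> v j)\<rparr>"

definition mat_app ::
  "('a, 'b) ring_scheme \<Rightarrow> nat \<Rightarrow> nat \<Rightarrow> (nat \<Rightarrow> nat \<Rightarrow> 'a) \<Rightarrow> (nat \<Rightarrow> 'a) \<Rightarrow> (nat \<Rightarrow> 'a)" where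
  "mat_app R m n D v = (\<lambda>j\<in>{..<m}. finsum R (\<lambda>l. D j l \<otimes>\<^bsub>R\<^esub> v l) {..<n})"

definition free_resolution ::
  "('a, 'b) ring_scheme \<Rightarrow> 'a set \<Rightarrow> (nat \<Rightarrow> nat) \<Rightarrow> (nat \<Rightarrow> nat \<Rightarrow> nat \<Rightarrow> 'a) \<Rightarrow> bool" where
  "free_resolution R a n D \<longleftrightarrow> n 0 = 1 \<and>
     (\<forall>i j l. j < n i \<longrightarrow> l < n (Suc i) \<longrightarrow> D i j l \<in> carrier R) \<and>
     mat_app R (n 0) (n 1) (D 0) ` vecs R (n 1) (carrier R) = vecs R 1 a \<and>
     (\<forall>i. mat_app R (n (Suc i)) (n (Suc (Suc i))) (D (Suc i)) ` vecs R (n (Suc (Suc i))) (carrier R) =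
        {v \<in> vecs R (n (Suc i)) (carrier R).
           mat_app R (n i) (n (Suc i)) (D i) v = \<zero>\<^bsub>free_module R (n i)\<^esub>})"

definition subquotient_length ::
  "('a, 'b) ring_scheme \<Rightarrow> ('a, 'x) module \<Rightarrow> 'x set \<Rightarrow> 'x set \<Rightarrow> nat" where
  "subquotient_length R M P N = Max {l. \<exists>c. c 0 = N \<and> c l = P \<and>
     (\<forall>i\<le>l. submodule (c i) R M) \<and> (\<forall>i<l. c i \<subset> c (Suc i))}"

definition tor_length ::
  "('a, 'b) ring_scheme \<Rightarrow> (nat \<Rightarrow> nat) \<Rightarrow> (nat \<Rightarrow> nat \<Rightarrow> nat \<Rightarrow> 'a) \<Rightarrow> 'a set \<Rightarrow> nat \<Rightarrow> nat" where
  "tor_length R n D b i = subquotient_length R (free_module R (n i))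
     {v \<in> vecs R (n i) (carrier R).
        i = 0 \<or> mat_app R (n (i - 1)) (n i) (D (i - 1)) v \<in> vecs R (n (i - 1)) b}
     {mat_app R (n i) (n (Suc i)) (D i) w \<oplus>\<^bsub>free_module R (n i)\<^esub> u | w u.
        w \<in> vecs R (n (Suc i)) (carrier R) \<and> u \<in> vecs R (n i) b}"

definition serre_mult :: "('a, 'b) ring_scheme \<Rightarrow> 'a set \<Rightarrow> 'a set \<Rightarrow> int" where
  "serre_mult R a b = (let (n, D) = (SOME (n, D). free_resolution R a n D)
     in \<Sum>i\<in>{i. tor_length R n D b i \<noteq> 0}. (-1) ^ i * int (tor_length R n D b i))"

text \<open>The ideal of the pullback of \<open>p\<close> along a projection, in the local ring of \<open>X\<close> at \<open>r\<close>.\<close>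

definition pulled_ideal ::
  "'k::field_char_0 variety \<Rightarrow> 'k mpol set \<Rightarrow> (nat \<Rightarrow> nat) \<Rightarrow> 'k mpol set \<Rightarrow> 'k mpol fract set set" where
  "pulled_ideal X r \<sigma> p = Idl\<^bsub>var_locring X r\<^esub>
     (a_r_coset (locring (fst X) r) (loc_fractions (fst X) r (vanishing X)) `
        loc_fractions (fst X) r (reindex \<sigma> ` p))"

subsection \<open>The category of finite correspondences\<close>

definition cor_comp ::
  "'k::field_char_0 variety \<Rightarrow> 'k variety \<Rightarrow> 'k variety \<Rightarrow> 'k cycle \<Rightarrow> 'k cycle \<Rightarrow> 'k cycle" where
  "cor_comp X Y Z h f = (let
       T = vprod (vprod X Y) Z; a = length (fst X); b = length (fst Y);
       \<sigma>23 = (\<lambda>i. i + a); \<sigma>13 = (\<lambda>i. if i < a then i else i + b)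
     in \<Sum>p\<in>Poly_Mapping.keys f. \<Sum>q\<in>Poly_Mapping.keys h.
        \<Sum>r\<in>minimal_elts {r \<in> snd T. p \<subseteq> contract id (fst X @ fst Y) r \<and>
                                    q \<subseteq> contract \<sigma>23 (fst Y @ fst Z) r}.
          Poly_Mapping.single (contract \<sigma>13 (fst X @ fst Z) r)
            (Poly_Mapping.lookup f p * Poly_Mapping.lookup h q *
             serre_mult (var_locring T r) (pulled_ideal T r id p) (pulled_ideal T r \<sigma>23 q) *
             int (residue_degree \<sigma>13 (fst T) r (fst X @ fst Z)
                    (contract \<sigma>13 (fst X @ fst Z) r))))"

text \<open>
  The graph of the morphism \<open>X \<rightarrow> Y\<close> given in coordinates by \<open>\<phi>\<close>, as the sum of its components:
  the point of \<open>X \<times> Y\<close> over \<open>x\<close> is the ideal of the forms that vanish at \<open>x\<close> after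
  substituting \<open>\<phi>\<close> for the coordinates on \<open>Y\<close>.
\<close>

definition graph_point ::
  "factor list \<Rightarrow> factor list \<Rightarrow> (nat \<times> nat \<Rightarrow> 'k::field_char_0 mpol) \<Rightarrow> 'k mpol set \<Rightarrow> 'k mpol set" where
  "graph_point L M \<phi> x = {f \<in> polys (L @ M). \<forall>D.
     psubst (\<lambda>(i, j). if i < length L then pvar (i, j) else \<phi> (i - length L, j))
       (hcomp (L @ M) D f) \<in> x}"

definition graph ::
  "'k::field_char_0 variety \<Rightarrow> 'k variety \<Rightarrow> (nat \<times> nat \<Rightarrow> 'k mpol) \<Rightarrow> 'k cycle" where
  "graph X Y \<phi> = (\<Sum>x\<in>minimal_elts (snd X).
     Poly_Mapping.single (graph_point (fst X) (fst Y) \<phi> x) 1)"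

definition cor_id :: "'k::field_char_0 variety \<Rightarrow> 'k cycle" where
  "cor_id X = graph X X pvar"

text \<open>External product of \<open>f : X \<rightarrow> Y\<close> and \<open>g : X' \<rightarrow> Y'\<close>; products of integral schemes are reduced in
  characteristic \<open>0\<close>, so every component has multiplicity \<open>1\<close>.\<close>

definition cor_tensor ::
  "'k::field_char_0 variety \<Rightarrow> 'k variety \<Rightarrow> 'k variety \<Rightarrow> 'k variety \<Rightarrow>
   'k cycle \<Rightarrow> 'k cycle \<Rightarrow> 'k cycle" where
  "cor_tensor X Y X' Y' f g = (let
       a = length (fst X); a' = length (fst X'); b = length (fst Y);
       \<sigma> = (\<lambda>i. if i < a then i else i + a');
       \<sigma>' = (\<lambda>i. if i < a' then i + a else i + a + b)
     in \<Sum>p\<in>Poly_Mapping.keys f. \<Sum>q\<in>Poly_Mapping.keys g.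
        \<Sum>r\<in>minimal_elts {r \<in> points (fst X @ fst X' @ fst Y @ fst Y').
               p \<subseteq> contract \<sigma> (fst X @ fst Y) r \<and> q \<subseteq> contract \<sigma>' (fst X' @ fst Y') r}.
          Poly_Mapping.single r (Poly_Mapping.lookup f p * Poly_Mapping.lookup g q))"

definition ksgn :: "int \<Rightarrow> 'm::ab_group_add \<Rightarrow> 'm" where
  "ksgn i x = (if even i then x else - x)"

subsection \<open>Cubical Suslin complexes\<close>

definition cyl :: "nat \<Rightarrow> 'k::field_char_0 variety \<Rightarrow> 'k variety" where
  "cyl m Y = vprod (affine_space m) Y"

text \<open>Composition of a correspondence from \<open>A\<^sup>m \<times> Y\<close> (\<open>m \<ge> 1\<close>) to \<open>P\<close> with the face map that inserts
  the constant \<open>x\<close> as \<open>j\<close>-th coordinate (\<open>1 \<le> j \<le> m\<close>).\<close>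

definition cube_face ::
  "nat \<Rightarrow> 'k::field_char_0 variety \<Rightarrow> 'k variety \<Rightarrow> nat \<Rightarrow> 'k \<Rightarrow> 'k cycle \<Rightarrow> 'k cycle" where
  "cube_face m Y P j x c = cor_comp (cyl (m - 1) Y) (cyl m Y) P c
     (graph (cyl (m - 1) Y) (cyl m Y)
        (\<lambda>(i, s). if i < j - 1 then pvar (i, s)
                 else if i = j - 1 then Poly_Mapping.single 0 x
                 else pvar (i - 1, s)))"

definition suslin :: "int \<Rightarrow> 'k::field_char_0 variety \<Rightarrow> 'k variety \<Rightarrow> 'k cycle set" where
  "suslin i P Y = (if i > 0 then {0} else
     {c \<in> SmCor (cyl (nat (- i)) Y) P. \<forall>j\<in>{1..nat (- i)}. cube_face (nat (- i)) Y P j 0 c = 0})"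

definition suslin_diff :: "int \<Rightarrow> 'k::field_char_0 variety \<Rightarrow> 'k variety \<Rightarrow> 'k cycle \<Rightarrow> 'k cycle" where
  "suslin_diff i P Y c = (\<Sum>j = 1..nat (- i). ksgn (int j) (cube_face (nat (- i)) Y P j 1 c))"

section \<open>Differential graded categories\<close>

text \<open>
  \<open>dcmp C P Q R i j g f\<close> is the composite of \<open>f\<close> of degree \<open>i\<close> from \<open>P\<close> to \<open>Q\<close> and \<open>g\<close> of degree \<open>j\<close> from
  \<open>Q\<close> to \<open>R\<close>.  The morphism groups are subgroups of one ambient abelian group (for instance their direct sum).
\<close>

record ('p, 'm) dgcat =
  dobj :: "'p set"
  dhom :: "int \<Rightarrow> 'p \<Rightarrow> 'p \<Rightarrow> 'm set"
  dcmp :: "'p \<Rightarrow> 'p \<Rightarrow> 'p \<Rightarrow> int \<Rightarrow> int \<Rightarrow> 'm \<Rightarrow> 'm \<Rightarrow> 'm"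
  did :: "'p \<Rightarrow> 'm"
  ddiff :: "int \<Rightarrow> 'p \<Rightarrow> 'p \<Rightarrow> 'm \<Rightarrow> 'm"

text \<open>The category \<open>J\<close>: a morphism of degree \<open>i\<close> from \<open>[P]\<close> to \<open>[Q]\<close> lies in \<open>C\<^sup>i(Q)(P)\<close>.\<close>

definition Jcat :: "('k::field_char_0 variety, 'k cycle) dgcat" where
  "Jcat = \<lparr>
     dobj = SmPrVar,
     dhom = (\<lambda>i P Q. suslin i Q P),
     dcmp = (\<lambda>P Q R i j g f. if i > 0 \<or> j > 0 then 0 else
        ksgn (i * j) (cor_comp (cyl (nat (- j)) (cyl (nat (- i)) P)) (cyl (nat (- j)) Q) R g
          (cor_tensor (affine_space (nat (- j))) (affine_space (nat (- j))) (cyl (nat (- i)) P) Q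
             (cor_id (affine_space (nat (- j)))) f))),
     did = cor_id,
     ddiff = (\<lambda>i P Q. suslin_diff i Q P)\<rparr>"

definition subgrp :: "'m::ab_group_add set \<Rightarrow> bool" where
  "subgrp S \<longleftrightarrow> 0 \<in> S \<and> (\<forall>x\<in>S. \<forall>y\<in>S. x - y \<in> S)"

text \<open>The Leibniz rule has the sign of the first morphism applied; this is the rule satisfied by the
  composition and the differential of \<open>J\<close>.\<close>

definition dg_category :: "('p, 'm::ab_group_add) dgcat \<Rightarrow> bool" where
  "dg_category C \<longleftrightarrow>
     (\<forall>i. \<forall>P\<in>dobj C. \<forall>Q\<in>dobj C. subgrp (dhom C i P Q) \<and>
        (\<forall>f\<in>dhom C i P Q. ddiff C i P Q f \<in> dhom C (i + 1) P Q \<and>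
           ddiff C (i + 1) P Q (ddiff C i P Q f) = 0 \<and>
           (\<forall>g\<in>dhom C i P Q. ddiff C i P Q (f + g) = ddiff C i P Q f + ddiff C i P Q g) \<and>
           dcmp C P P Q 0 i f (did C P) = f \<and> dcmp C P Q Q i 0 (did C Q) f = f)) \<and>
     (\<forall>P\<in>dobj C. did C P \<in> dhom C 0 P P) \<and>
     (\<forall>i j. \<forall>P\<in>dobj C. \<forall>Q\<in>dobj C. \<forall>R\<in>dobj C. \<forall>f\<in>dhom C i P Q. \<forall>g\<in>dhom C j Q R.
        dcmp C P Q R i j g f \<in> dhom C (i + j) P R \<and>
        (\<forall>f'\<in>dhom C i P Q. dcmp C P Q R i j g (f + f') = dcmp C P Q R i j g f + dcmp C P Q R i j g f') \<and>
        (\<forall>g'\<in>dhom C j Q R. dcmp C P Q R i j (g + g') f = dcmp C P Q R i j g f + dcmp C P Q R i j g' f) \<and>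
        ddiff C (i + j) P R (dcmp C P Q R i j g f) =
          dcmp C P Q R (i + 1) j g (ddiff C i P Q f) +
          ksgn i (dcmp C P Q R i (j + 1) (ddiff C j Q R g) f) \<and>
        (\<forall>l. \<forall>S\<in>dobj C. \<forall>h\<in>dhom C l R S.
           dcmp C P R S (i + j) l h (dcmp C P Q R i j g f) =
           dcmp C P Q S i (j + l) (dcmp C Q R S j l h g) f))"

subsection \<open>Twisted complexes\<close>

text \<open>
  Twisted complexes over the quotient of \<open>C\<close> by a graded differential ideal \<open>I\<close>; morphisms of the
  quotient are given by representatives in \<open>C\<close>.  The case \<open>I = zero_ideal\<close> is \<open>C\<close> itself.
  The sums run over the finitely many indices whose object is not zero.

  Signs: with the above Leibniz rule \<open>tw_diff\<close> squares to zero exactly when \<open>q\<close> satisfies the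
  Maurer--Cartan equation in \<open>tw_obj\<close>; both need the sign of the degree of the first morphism
  applied in the composites with \<open>q\<close> on the left.  A morphism of degree \<open>l\<close> has
  components \<open>f i j\<close> of degree \<open>l + i - j\<close>.
\<close>

type_synonym ('p, 'm) tw = "(int \<Rightarrow> 'p) \<times> (int \<Rightarrow> int \<Rightarrow> 'm)"
type_synonym ('p, 'm) dgideal = "int \<Rightarrow> 'p \<Rightarrow> 'p \<Rightarrow> 'm set"

definition zero_ideal :: "('p, 'm::ab_group_add) dgideal" where
  "zero_ideal i P Q = {0}"

text \<open>The quotient of \<open>J\<close> by this ideal is \<open>J\<^sub>N\<close>.\<close>

definition trunc_ideal :: "('p, 'm::ab_group_add) dgcat \<Rightarrow> int \<Rightarrow> ('p, 'm) dgideal" where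
  "trunc_ideal C N i P Q =
     (if i < - N then dhom C i P Q
      else if i = - N then ddiff C (i - 1) P Q ` dhom C (i - 1) P Q else {0})"

definition tw_supp :: "('p, 'm) dgcat \<Rightarrow> ('p, 'm) dgideal \<Rightarrow> ('p, 'm) tw \<Rightarrow> int set" where
  "tw_supp C I X = {i. did C (fst X i) \<notin> I 0 (fst X i) (fst X i)}"

definition tw_obj :: "('p, 'm::ab_group_add) dgcat \<Rightarrow> ('p, 'm) dgideal \<Rightarrow> ('p, 'm) tw set" where
  "tw_obj C I = {X. (\<forall>i. fst X i \<in> dobj C) \<and> finite (tw_supp C I X) \<and>
     (\<forall>i j. snd X i j \<in> dhom C (i - j + 1) (fst X i) (fst X j)) \<and>
     (\<forall>i j. ddiff C (i - j + 1) (fst X i) (fst X j) (snd X i j) +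
        (\<Sum>l\<in>tw_supp C I X. ksgn (i - l + 1)
          (dcmp C (fst X i) (fst X l) (fst X j) (i - l + 1) (l - j + 1) (snd X l j) (snd X i l)))
        \<in> I (i - j + 2) (fst X i) (fst X j))}"

definition tw_hom ::
  "('p, 'm) dgcat \<Rightarrow> int \<Rightarrow> ('p, 'm) tw \<Rightarrow> ('p, 'm) tw \<Rightarrow> (int \<Rightarrow> int \<Rightarrow> 'm) set" where
  "tw_hom C l X Y = {f. \<forall>i j. f i j \<in> dhom C (l + i - j) (fst X i) (fst Y j)}"

definition tw_diff ::
  "('p, 'm::ab_group_add) dgcat \<Rightarrow> ('p, 'm) dgideal \<Rightarrow> int \<Rightarrow> ('p, 'm) tw \<Rightarrow> ('p, 'm) tw \<Rightarrow>
   (int \<Rightarrow> int \<Rightarrow> 'm) \<Rightarrow> (int \<Rightarrow> int \<Rightarrow> 'm)" where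
  "tw_diff C I l X Y f = (\<lambda>i j. ddiff C (l + i - j) (fst X i) (fst Y j) (f i j) +
     (\<Sum>m\<in>tw_supp C I Y. ksgn (l + i - m)
       (dcmp C (fst X i) (fst Y m) (fst Y j) (l + i - m) (m - j + 1) (snd Y m j) (f i m))) -
     (\<Sum>m\<in>tw_supp C I X. ksgn ((m - i) * l)
       (dcmp C (fst X i) (fst X m) (fst Y j) (i - m + 1) (l + m - j) (f m j) (snd X i m))))"

definition Tr_mor ::
  "('p, 'm::ab_group_add) dgcat \<Rightarrow> ('p, 'm) dgideal \<Rightarrow> ('p, 'm) tw \<Rightarrow> ('p, 'm) tw \<Rightarrow>
   (int \<Rightarrow> int \<Rightarrow> 'm) set" where
  "Tr_mor C I X Y = {f \<in> tw_hom C 0 X Y.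
     \<forall>i j. tw_diff C I 0 X Y f i j \<in> I (i - j + 1) (fst X i) (fst Y j)}"

text \<open>Equality of the morphisms in the homotopy category that are represented by \<open>f\<close> and \<open>g\<close>.\<close>

definition Tr_eq ::
  "('p, 'm::ab_group_add) dgcat \<Rightarrow> ('p, 'm) dgideal \<Rightarrow> ('p, 'm) tw \<Rightarrow> ('p, 'm) tw \<Rightarrow>
   (int \<Rightarrow> int \<Rightarrow> 'm) \<Rightarrow> (int \<Rightarrow> int \<Rightarrow> 'm) \<Rightarrow> bool" where
  "Tr_eq C I X Y f g \<longleftrightarrow> (\<exists>h\<in>tw_hom C (- 1) X Y.
     \<forall>i j. f i j - g i j - tw_diff C I (- 1) X Y h i j \<in> I (i - j) (fst X i) (fst Y j))"

definition Tr_comp ::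
  "('p, 'm::ab_group_add) dgcat \<Rightarrow> ('p, 'm) dgideal \<Rightarrow> ('p, 'm) tw \<Rightarrow> ('p, 'm) tw \<Rightarrow> ('p, 'm) tw \<Rightarrow>
   (int \<Rightarrow> int \<Rightarrow> 'm) \<Rightarrow> (int \<Rightarrow> int \<Rightarrow> 'm) \<Rightarrow> (int \<Rightarrow> int \<Rightarrow> 'm)" where
  "Tr_comp C I X Y Z g f = (\<lambda>i k. \<Sum>j\<in>tw_supp C I Y.
     dcmp C (fst X i) (fst Y j) (fst Z k) (i - j) (j - k) (g j k) (f i j))"

definition Tr_id :: "('p, 'm::ab_group_add) dgcat \<Rightarrow> ('p, 'm) tw \<Rightarrow> (int \<Rightarrow> int \<Rightarrow> 'm)" where
  "Tr_id C X = (\<lambda>i j. if i = j then did C (fst X i) else 0)"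

section \<open>Abelian categories\<close>

record ('o, 'a) acat =
  obj :: "'o set"
  arr :: "'o \<Rightarrow> 'o \<Rightarrow> 'a set"
  cmp :: "'a \<Rightarrow> 'a \<Rightarrow> 'a"
  idt :: "'o \<Rightarrow> 'a"

definition preadditive :: "('o, 'a::ab_group_add) acat \<Rightarrow> bool" where
  "preadditive A \<longleftrightarrow>
     (\<forall>X\<in>obj A. idt A X \<in> arr A X X) \<and>
     (\<forall>X\<in>obj A. \<forall>Y\<in>obj A. subgrp (arr A X Y) \<and>
        (\<forall>f\<in>arr A X Y. cmp A f (idt A X) = f \<and> cmp A (idt A Y) f = f)) \<and>
     (\<forall>X\<in>obj A. \<forall>Y\<in>obj A. \<forall>Z\<in>obj A. \<forall>f\<in>arr A X Y. \<forall>g\<in>arr A Y Z.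
        cmp A g f \<in> arr A X Z \<and>
        (\<forall>f'\<in>arr A X Y. cmp A g (f + f') = cmp A g f + cmp A g f') \<and>
        (\<forall>g'\<in>arr A Y Z. cmp A (g + g') f = cmp A g f + cmp A g' f) \<and>
        (\<forall>W\<in>obj A. \<forall>h\<in>arr A Z W. cmp A h (cmp A g f) = cmp A (cmp A h g) f))"

definition is_mono :: "('o, 'a::ab_group_add) acat \<Rightarrow> 'o \<Rightarrow> 'a \<Rightarrow> bool" where
  "is_mono A X f \<longleftrightarrow>
     (\<forall>T\<in>obj A. \<forall>x\<in>arr A T X. \<forall>y\<in>arr A T X. cmp A f x = cmp A f y \<longrightarrow> x = y)"

definition is_epi :: "('o, 'a::ab_group_add) acat \<Rightarrow> 'o \<Rightarrow> 'a \<Rightarrow> bool" where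
  "is_epi A Y f \<longleftrightarrow>
     (\<forall>T\<in>obj A. \<forall>x\<in>arr A Y T. \<forall>y\<in>arr A Y T. cmp A x f = cmp A y f \<longrightarrow> x = y)"

definition is_iso :: "('o, 'a::ab_group_add) acat \<Rightarrow> 'o \<Rightarrow> 'o \<Rightarrow> 'a \<Rightarrow> bool" where
  "is_iso A X Y f \<longleftrightarrow> f \<in> arr A X Y \<and>
     (\<exists>g\<in>arr A Y X. cmp A g f = idt A X \<and> cmp A f g = idt A Y)"

definition is_kernel :: "('o, 'a::ab_group_add) acat \<Rightarrow> 'o \<Rightarrow> 'a \<Rightarrow> 'o \<Rightarrow> 'a \<Rightarrow> bool" where
  "is_kernel A X f K k \<longleftrightarrow> K \<in> obj A \<and> k \<in> arr A K X \<and> cmp A f k = 0 \<and>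
     (\<forall>T\<in>obj A. \<forall>x\<in>arr A T X. cmp A f x = 0 \<longrightarrow> (\<exists>!w. w \<in> arr A T K \<and> cmp A k w = x))"

definition is_cokernel :: "('o, 'a::ab_group_add) acat \<Rightarrow> 'o \<Rightarrow> 'a \<Rightarrow> 'o \<Rightarrow> 'a \<Rightarrow> bool" where
  "is_cokernel A Y f Q c \<longleftrightarrow> Q \<in> obj A \<and> c \<in> arr A Y Q \<and> cmp A c f = 0 \<and>
     (\<forall>T\<in>obj A. \<forall>y\<in>arr A Y T. cmp A y f = 0 \<longrightarrow> (\<exists>!w. w \<in> arr A Q T \<and> cmp A w c = y))"

definition is_biproduct ::
  "('o, 'a::ab_group_add) acat \<Rightarrow> 'i set \<Rightarrow> ('i \<Rightarrow> 'o) \<Rightarrow> 'o \<times> ('i \<Rightarrow> 'a) \<times> ('i \<Rightarrow> 'a) \<Rightarrow> bool" where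
  "is_biproduct A I X = (\<lambda>(S, \<iota>, \<pi>). S \<in> obj A \<and>
     (\<forall>i\<in>I. \<iota> i \<in> arr A (X i) S \<and> \<pi> i \<in> arr A S (X i)) \<and>
     (\<forall>i\<in>I. \<forall>j\<in>I. cmp A (\<pi> i) (\<iota> j) = (if i = j then idt A (X i) else 0)) \<and>
     (\<Sum>i\<in>I. cmp A (\<iota> i) (\<pi> i)) = idt A S)"

definition abelian_category :: "('o, 'a::ab_group_add) acat \<Rightarrow> bool" where
  "abelian_category A \<longleftrightarrow> preadditive A \<and>
     (\<exists>Z\<in>obj A. idt A Z = 0) \<and>
     (\<forall>X\<in>obj A. \<forall>Y\<in>obj A.
        \<exists>s. is_biproduct A (UNIV :: bool set) (\<lambda>b. if b then X else Y) s) \<and>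
     (\<forall>X\<in>obj A. \<forall>Y\<in>obj A. \<forall>f\<in>arr A X Y.
        (\<exists>K k. is_kernel A X f K k) \<and> (\<exists>Q c. is_cokernel A Y f Q c) \<and>
        (is_mono A X f \<longrightarrow> (\<exists>W\<in>obj A. \<exists>g\<in>arr A Y W. is_kernel A Y g X f)) \<and>
        (is_epi A Y f \<longrightarrow> (\<exists>W\<in>obj A. \<exists>g\<in>arr A W X. is_cokernel A X g Y f)))"

subsection \<open>Subquotients\<close>

text \<open>
  A subquotient of an object \<open>Y\<close>: a subobject \<open>sub_ar : sub_ob \<rightarrow> Y\<close> and a quotient
  \<open>quo_ar : sub_ob \<rightarrow> quo_ob\<close> of it.  \<open>subquot A Y G B\<close> is a choice of the common kernel of the arrows
  in \<open>G\<close> modulo the images of the arrows \<open>b : U \<rightarrow> Y\<close>, \<open>(U, b) \<in> B\<close>.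
\<close>

record ('o, 'a) subq =
  sub_ob :: 'o
  sub_ar :: 'a
  quo_ob :: 'o
  quo_ar :: 'a

definition is_subquot ::
  "('o, 'a::ab_group_add) acat \<Rightarrow> 'o \<Rightarrow> 'a set \<Rightarrow> ('o \<times> 'a) set \<Rightarrow> ('o, 'a) subq \<Rightarrow> bool" where
  "is_subquot A Y G B s \<longleftrightarrow>
     sub_ob s \<in> obj A \<and> sub_ar s \<in> arr A (sub_ob s) Y \<and> (\<forall>g\<in>G. cmp A g (sub_ar s) = 0) \<and>
     (\<forall>T\<in>obj A. \<forall>x\<in>arr A T Y. (\<forall>g\<in>G. cmp A g x = 0) \<longrightarrow>
        (\<exists>!w. w \<in> arr A T (sub_ob s) \<and> cmp A (sub_ar s) w = x)) \<and>
     quo_ob s \<in> obj A \<and> quo_ar s \<in> arr A (sub_ob s) (quo_ob s) \<and>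
     (\<forall>(U, b)\<in>B. \<forall>w\<in>arr A U (sub_ob s). cmp A (sub_ar s) w = b \<longrightarrow> cmp A (quo_ar s) w = 0) \<and>
     (\<forall>T\<in>obj A. \<forall>y\<in>arr A (sub_ob s) T.
        (\<forall>(U, b)\<in>B. \<forall>w\<in>arr A U (sub_ob s). cmp A (sub_ar s) w = b \<longrightarrow> cmp A y w = 0) \<longrightarrow>
        (\<exists>!t. t \<in> arr A (quo_ob s) T \<and> cmp A t (quo_ar s) = y))"

definition subquot ::
  "('o, 'a::ab_group_add) acat \<Rightarrow> 'o \<Rightarrow> 'a set \<Rightarrow> ('o \<times> 'a) set \<Rightarrow> ('o, 'a) subq" where
  "subquot A Y G B = (SOME s. is_subquot A Y G B s)"

definition whole :: "('o, 'a::ab_group_add) acat \<Rightarrow> 'o \<Rightarrow> ('o, 'a) subq" where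
  "whole A Y = \<lparr>sub_ob = Y, sub_ar = idt A Y, quo_ob = Y, quo_ar = idt A Y\<rparr>"

text \<open>The arrow of subquotients induced by \<open>\<phi>\<close>.\<close>

definition sq_map ::
  "('o, 'a::ab_group_add) acat \<Rightarrow> ('o, 'a) subq \<Rightarrow> ('o, 'a) subq \<Rightarrow> 'a \<Rightarrow> 'a" where
  "sq_map A s s' \<phi> = (THE t. t \<in> arr A (quo_ob s) (quo_ob s') \<and>
     (\<exists>w\<in>arr A (sub_ob s) (sub_ob s'). cmp A (sub_ar s') w = cmp A \<phi> (sub_ar s) \<and>
        cmp A t (quo_ar s) = cmp A (quo_ar s') w))"

definition coker_ar :: "('o, 'a::ab_group_add) acat \<Rightarrow> 'o \<Rightarrow> 'a \<Rightarrow> 'a" where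
  "coker_ar A Y f = (SOME c. \<exists>Q. is_cokernel A Y f Q c)"

text \<open>\<open>Im \<alpha> / Im \<beta>\<close> for \<open>\<alpha> : U \<rightarrow> Y\<close> and \<open>\<beta> : V \<rightarrow> Y\<close>.\<close>

definition im_quot ::
  "('o, 'a::ab_group_add) acat \<Rightarrow> 'o \<Rightarrow> 'a \<Rightarrow> 'o \<Rightarrow> 'a \<Rightarrow> ('o, 'a) subq" where
  "im_quot A Y \<alpha> V \<beta> = subquot A Y {coker_ar A Y \<alpha>} {(V, \<beta>)}"

subsection \<open>Complexes\<close>

record ('o, 'a) cpx =
  cob :: "int \<Rightarrow> 'o"
  cdf :: "int \<Rightarrow> 'a"

definition is_complex :: "('o, 'a::ab_group_add) acat \<Rightarrow> ('o, 'a) cpx \<Rightarrow> bool" where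
  "is_complex A Y \<longleftrightarrow> (\<forall>n. cob Y n \<in> obj A \<and> cdf Y n \<in> arr A (cob Y n) (cob Y (n + 1)) \<and>
     cmp A (cdf Y (n + 1)) (cdf Y n) = 0)"

definition cpx_hom ::
  "('o, 'a::ab_group_add) acat \<Rightarrow> int \<Rightarrow> ('o, 'a) cpx \<Rightarrow> ('o, 'a) cpx \<Rightarrow> (int \<Rightarrow> 'a) set" where
  "cpx_hom A i Y Y' = {\<phi>. \<forall>n. \<phi> n \<in> arr A (cob Y n) (cob Y' (n + i))}"

definition cpx_diff ::
  "('o, 'a::ab_group_add) acat \<Rightarrow> int \<Rightarrow> ('o, 'a) cpx \<Rightarrow> ('o, 'a) cpx \<Rightarrow> (int \<Rightarrow> 'a) \<Rightarrow> (int \<Rightarrow> 'a)" where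
  "cpx_diff A i Y Y' \<phi> =
     (\<lambda>n. cmp A (cdf Y' (n + i)) (\<phi> n) - ksgn i (cmp A (\<phi> (n + 1)) (cdf Y n)))"

definition chain_map ::
  "('o, 'a::ab_group_add) acat \<Rightarrow> ('o, 'a) cpx \<Rightarrow> ('o, 'a) cpx \<Rightarrow> (int \<Rightarrow> 'a) \<Rightarrow> bool" where
  "chain_map A Y Y' \<phi> \<longleftrightarrow> \<phi> \<in> cpx_hom A 0 Y Y' \<and> (\<forall>n. cpx_diff A 0 Y Y' \<phi> n = 0)"

definition homotopic ::
  "('o, 'a::ab_group_add) acat \<Rightarrow> ('o, 'a) cpx \<Rightarrow> ('o, 'a) cpx \<Rightarrow> (int \<Rightarrow> 'a) \<Rightarrow> (int \<Rightarrow> 'a) \<Rightarrow> bool" where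
  "homotopic A Y Y' \<phi> \<psi> \<longleftrightarrow>
     (\<exists>h\<in>cpx_hom A (- 1) Y Y'. \<forall>n. \<phi> n - \<psi> n = cpx_diff A (- 1) Y Y' h n)"

definition coh :: "('o, 'a::ab_group_add) acat \<Rightarrow> ('o, 'a) cpx \<Rightarrow> int \<Rightarrow> ('o, 'a) subq" where
  "coh A Y n = subquot A (cob Y n) {cdf Y n} {(cob Y (n - 1), cdf Y (n - 1))}"

definition coh_map ::
  "('o, 'a::ab_group_add) acat \<Rightarrow> ('o, 'a) cpx \<Rightarrow> ('o, 'a) cpx \<Rightarrow> (int \<Rightarrow> 'a) \<Rightarrow> int \<Rightarrow> 'a" where
  "coh_map A Y Y' \<phi> n = sq_map A (coh A Y n) (coh A Y' n) (\<phi> n)"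

text \<open>
  The terms of the truncations, as subquotients of \<open>Y n\<close>: the truncation in degrees at most \<open>b\<close> for
  \<open>lo = None\<close>, and the canonical \<open>[a, b]\<close>-truncation for \<open>lo = Some a\<close>, which is zero if \<open>b < a\<close>.
\<close>

definition trunc_sq ::
  "('o, 'a::ab_group_add) acat \<Rightarrow> int option \<Rightarrow> int \<Rightarrow> ('o, 'a) cpx \<Rightarrow> int \<Rightarrow> ('o, 'a) subq" where
  "trunc_sq A lo b Y n = subquot A (cob Y n)
     (if n > b \<or> (\<exists>a. lo = Some a \<and> b < a) then {idt A (cob Y n)}
      else if n = b then {cdf Y n} else {})
     (case lo of None \<Rightarrow> {} | Some a \<Rightarrow>
        (if n > a then {} else if n = a then {(cob Y (n - 1), cdf Y (n - 1))}
         else {(cob Y n, idt A (cob Y n))}))"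

section \<open>Realizations\<close>

text \<open>\<open>fmor F i P Q f\<close> is the value on a morphism \<open>f\<close> of degree \<open>i\<close> from \<open>P\<close> to \<open>Q\<close>, of degree \<open>i\<close> from \<open>F Q\<close> to \<open>F P\<close>.\<close>

record ('p, 'm, 'o, 'a) cfun =
  fob :: "'p \<Rightarrow> ('o, 'a) cpx"
  fmor :: "int \<Rightarrow> 'p \<Rightarrow> 'p \<Rightarrow> 'm \<Rightarrow> int \<Rightarrow> 'a"

text \<open>No sign is needed in the compatibility with composition: reversing composition turns the Leibniz rule
  of \<open>dg_category\<close> into the one satisfied by \<open>cpx_diff\<close>.\<close>

definition contra_dg_functor ::
  "('p, 'm::ab_group_add) dgcat \<Rightarrow> ('o, 'a::ab_group_add) acat \<Rightarrow> ('p, 'm, 'o, 'a) cfun \<Rightarrow> bool" where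
  "contra_dg_functor C A F \<longleftrightarrow> dg_category C \<and>
     (\<forall>P\<in>dobj C. is_complex A (fob F P) \<and>
        (\<forall>n. fmor F 0 P P (did C P) n = idt A (cob (fob F P) n))) \<and>
     (\<forall>i. \<forall>P\<in>dobj C. \<forall>Q\<in>dobj C. \<forall>f\<in>dhom C i P Q.
        fmor F i P Q f \<in> cpx_hom A i (fob F Q) (fob F P) \<and>
        (\<forall>g\<in>dhom C i P Q. \<forall>n. fmor F i P Q (f + g) n = fmor F i P Q f n + fmor F i P Q g n) \<and>
        (\<forall>n. fmor F (i + 1) P Q (ddiff C i P Q f) n =
             cpx_diff A i (fob F Q) (fob F P) (fmor F i P Q f) n) \<and>
        (\<forall>j. \<forall>R\<in>dobj C. \<forall>g\<in>dhom C j Q R. \<forall>n.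
           fmor F (i + j) P R (dcmp C P Q R i j g f) n =
           cmp A (fmor F i P Q f (n + j)) (fmor F j Q R g n)))"

definition dg_transformation ::
  "('p, 'm::ab_group_add) dgcat \<Rightarrow> ('o, 'a::ab_group_add) acat \<Rightarrow> ('p, 'm, 'o, 'a) cfun \<Rightarrow>
   ('p, 'm, 'o, 'a) cfun \<Rightarrow> ('p \<Rightarrow> int \<Rightarrow> 'a) \<Rightarrow> bool" where
  "dg_transformation C A F F' \<eta> \<longleftrightarrow>
     (\<forall>P\<in>dobj C. chain_map A (fob F P) (fob F' P) (\<eta> P)) \<and>
     (\<forall>i. \<forall>P\<in>dobj C. \<forall>Q\<in>dobj C. \<forall>f\<in>dhom C i P Q. \<forall>n.
        cmp A (\<eta> P (n + i)) (fmor F i P Q f n) = cmp A (fmor F' i P Q f n) (\<eta> Q n))"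

definition trunc_cpx ::
  "('o, 'a::ab_group_add) acat \<Rightarrow> int option \<Rightarrow> int \<Rightarrow> ('o, 'a) cpx \<Rightarrow> ('o, 'a) cpx" where
  "trunc_cpx A lo b Y = \<lparr>cob = (\<lambda>n. quo_ob (trunc_sq A lo b Y n)),
     cdf = (\<lambda>n. sq_map A (trunc_sq A lo b Y n) (trunc_sq A lo b Y (n + 1)) (cdf Y n))\<rparr>"

definition trunc_fun ::
  "('o, 'a::ab_group_add) acat \<Rightarrow> int option \<Rightarrow> int \<Rightarrow> ('p, 'm, 'o, 'a) cfun \<Rightarrow> ('p, 'm, 'o, 'a) cfun" where
  "trunc_fun A lo b F = \<lparr>fob = (\<lambda>P. trunc_cpx A lo b (fob F P)),
     fmor = (\<lambda>i P Q f n. sq_map A (trunc_sq A lo b (fob F Q) n)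
       (trunc_sq A lo b (fob F P) (n + i)) (fmor F i P Q f n))\<rparr>"

text \<open>
  The total complex \<open>PreTr(F)(X)\<close>, with terms the direct sums of \<open>F(P\<^sup>i)\<close> in degree \<open>n + i\<close>, a chosen
  biproduct.  The signs make it a complex, and make \<open>G(tw_diff f)\<close> the differential of \<open>G(f)\<close> where
  \<open>G(f)\<close> has components \<open>(-1)^(i l) F(f i j)\<close> for \<open>f\<close> of degree \<open>l\<close>.
\<close>

definition tot_sum ::
  "('o, 'a::ab_group_add) acat \<Rightarrow> ('p, 'm::ab_group_add) dgcat \<Rightarrow> ('p, 'm, 'o, 'a) cfun \<Rightarrow>
   ('p, 'm) tw \<Rightarrow> int \<Rightarrow> 'o \<times> (int \<Rightarrow> 'a) \<times> (int \<Rightarrow> 'a)" where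
  "tot_sum A C F X n =
     (SOME s. is_biproduct A (tw_supp C zero_ideal X) (\<lambda>i. cob (fob F (fst X i)) (n + i)) s)"

abbreviation "tot_in A C F X n \<equiv> fst (snd (tot_sum A C F X n))"
abbreviation "tot_pr A C F X n \<equiv> snd (snd (tot_sum A C F X n))"

definition tot ::
  "('o, 'a::ab_group_add) acat \<Rightarrow> ('p, 'm::ab_group_add) dgcat \<Rightarrow> ('p, 'm, 'o, 'a) cfun \<Rightarrow>
   ('p, 'm) tw \<Rightarrow> ('o, 'a) cpx" where
  "tot A C F X = \<lparr>cob = (\<lambda>n. fst (tot_sum A C F X n)),
     cdf = (\<lambda>n. \<Sum>i\<in>tw_supp C zero_ideal X. \<Sum>j\<in>tw_supp C zero_ideal X.
       cmp A (tot_in A C F X (n + 1) i) (cmp A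
         (ksgn i ((if i = j then cdf (fob F (fst X i)) (n + i) else 0) -
            fmor F (i - j + 1) (fst X i) (fst X j) (snd X i j) (n + j)))
         (tot_pr A C F X n j)))\<rparr>"

definition tot_map ::
  "('o, 'a::ab_group_add) acat \<Rightarrow> ('p, 'm::ab_group_add) dgcat \<Rightarrow> ('p, 'm, 'o, 'a) cfun \<Rightarrow>
   ('p, 'm) tw \<Rightarrow> ('p, 'm) tw \<Rightarrow> (int \<Rightarrow> int \<Rightarrow> 'm) \<Rightarrow> int \<Rightarrow> 'a" where
  "tot_map A C F X X' f n =
     (\<Sum>i\<in>tw_supp C zero_ideal X. \<Sum>j\<in>tw_supp C zero_ideal X'.
       cmp A (tot_in A C F X n i) (cmp A (fmor F (i - j) (fst X i) (fst X' j) (f i j) (n + j))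
         (tot_pr A C F X' n j)))"

definition tot_nat ::
  "('o, 'a::ab_group_add) acat \<Rightarrow> ('p, 'm::ab_group_add) dgcat \<Rightarrow> ('p, 'm, 'o, 'a) cfun \<Rightarrow>
   ('p, 'm, 'o, 'a) cfun \<Rightarrow> ('p \<Rightarrow> int \<Rightarrow> 'a) \<Rightarrow> ('p, 'm) tw \<Rightarrow> int \<Rightarrow> 'a" where
  "tot_nat A C F F' \<eta> X n = (\<Sum>i\<in>tw_supp C zero_ideal X.
     cmp A (tot_in A C F' X n i) (cmp A (\<eta> (fst X i) (n + i)) (tot_pr A C F X n i)))"

text \<open>\<open>treal A C F b N X\<close> is \<open>F\<^sub>N\<^sup>b(X)\<close>; it is zero for \<open>N = -1\<close>.\<close>

definition treal_fun ::
  "('o, 'a::ab_group_add) acat \<Rightarrow> ('p, 'm, 'o, 'a) cfun \<Rightarrow> int \<Rightarrow> int \<Rightarrow> ('p, 'm, 'o, 'a) cfun" where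
  "treal_fun A F b N = trunc_fun A (Some (b - N)) b F"

definition treal ::
  "('o, 'a::ab_group_add) acat \<Rightarrow> ('p, 'm::ab_group_add) dgcat \<Rightarrow> ('p, 'm, 'o, 'a) cfun \<Rightarrow>
   int \<Rightarrow> int \<Rightarrow> ('p, 'm) tw \<Rightarrow> ('o, 'a) cpx" where
  "treal A C F b N X = tot A C (treal_fun A F b N) X"

definition treal_nat ::
  "('o, 'a::ab_group_add) acat \<Rightarrow> ('p, 'm::ab_group_add) dgcat \<Rightarrow> ('p, 'm, 'o, 'a) cfun \<Rightarrow>
   int \<Rightarrow> int \<Rightarrow> int \<Rightarrow> ('p, 'm) tw \<Rightarrow> int \<Rightarrow> 'a" where
  "treal_nat A C F b N l X = tot_nat A C (treal_fun A F (b - l) (N - l)) (treal_fun A F b N)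
     (\<lambda>P n. sq_map A (trunc_sq A (Some (b - N)) (b - l) (fob F P) n)
       (trunc_sq A (Some (b - N)) b (fob F P) n) (idt A (cob (fob F P) n))) X"

section \<open>Spectral sequences\<close>

subsection \<open>Spectral sequences in general\<close>

text \<open>
  Indexing: \<open>j\<close> is the filtration index of an increasing filtration and \<open>i + j\<close> the total degree, so
  \<open>d\<^sub>r\<close> goes from \<open>(i, j)\<close> to \<open>(i + r + 1, j - r)\<close>.
\<close>

record ('o, 'a) specseq =
  page :: "nat \<Rightarrow> int \<Rightarrow> int \<Rightarrow> 'o"
  sdiff :: "nat \<Rightarrow> int \<Rightarrow> int \<Rightarrow> 'a"
  snext :: "nat \<Rightarrow> int \<Rightarrow> int \<Rightarrow> 'a"

definition page_coh ::
  "('o, 'a::ab_group_add) acat \<Rightarrow> ('o, 'a) specseq \<Rightarrow> nat \<Rightarrow> int \<Rightarrow> int \<Rightarrow> ('o, 'a) subq" where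
  "page_coh A S r i j = subquot A (page S r i j) {sdiff S r i j}
     {(page S r (i - int r - 1) (j + int r), sdiff S r (i - int r - 1) (j + int r))}"

definition is_spectral_sequence :: "('o, 'a::ab_group_add) acat \<Rightarrow> ('o, 'a) specseq \<Rightarrow> bool" where
  "is_spectral_sequence A S \<longleftrightarrow> (\<forall>r\<ge>1. \<forall>i j.
     page S r i j \<in> obj A \<and>
     sdiff S r i j \<in> arr A (page S r i j) (page S r (i + int r + 1) (j - int r)) \<and>
     cmp A (sdiff S r (i + int r + 1) (j - int r)) (sdiff S r i j) = 0 \<and>
     is_iso A (page S (Suc r) i j) (quo_ob (page_coh A S r i j)) (snext S r i j))"

definition is_ss_morphism ::
  "('o, 'a::ab_group_add) acat \<Rightarrow> ('o, 'a) specseq \<Rightarrow> ('o, 'a) specseq \<Rightarrow>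
   (nat \<Rightarrow> int \<Rightarrow> int \<Rightarrow> 'a) \<Rightarrow> bool" where
  "is_ss_morphism A S S' \<phi> \<longleftrightarrow> (\<forall>r\<ge>1. \<forall>i j.
     \<phi> r i j \<in> arr A (page S r i j) (page S' r i j) \<and>
     cmp A (\<phi> r (i + int r + 1) (j - int r)) (sdiff S r i j) = cmp A (sdiff S' r i j) (\<phi> r i j) \<and>
     cmp A (snext S' r i j) (\<phi> (Suc r) i j) =
       cmp A (sq_map A (page_coh A S r i j) (page_coh A S' r i j) (\<phi> r i j)) (snext S r i j))"

subsection \<open>The spectral sequence of a filtered complex\<close>

record ('o, 'a) fcpx =
  amb :: "('o, 'a) cpx"
  stage :: "int \<Rightarrow> ('o, 'a) cpx"
  incl :: "int \<Rightarrow> int \<Rightarrow> 'a"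

definition is_filtered :: "('o, 'a::ab_group_add) acat \<Rightarrow> ('o, 'a) fcpx \<Rightarrow> bool" where
  "is_filtered A \<Phi> \<longleftrightarrow> is_complex A (amb \<Phi>) \<and> (\<forall>p. is_complex A (stage \<Phi> p) \<and>
     chain_map A (stage \<Phi> p) (amb \<Phi>) (incl \<Phi> p) \<and>
     (\<forall>n. is_mono A (cob (stage \<Phi> p) n) (incl \<Phi> p n) \<and>
        (\<exists>u\<in>arr A (cob (stage \<Phi> p) n) (cob (stage \<Phi> (p + 1)) n).
           cmp A (incl \<Phi> (p + 1) n) u = incl \<Phi> p n)))"

text \<open>\<open>Z\<^sub>r\<close> consists of the elements of the \<open>p\<close>-th stage with differential in the \<open>(p - r)\<close>-th stage.\<close>

definition fil_conds ::
  "('o, 'a::ab_group_add) acat \<Rightarrow> ('o, 'a) fcpx \<Rightarrow> nat \<Rightarrow> int \<Rightarrow> int \<Rightarrow> 'a set" where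
  "fil_conds A \<Phi> r p n =
     {coker_ar A (cob (amb \<Phi>) n) (incl \<Phi> p n),
      cmp A (coker_ar A (cob (amb \<Phi>) (n + 1)) (incl \<Phi> (p - int r) (n + 1))) (cdf (amb \<Phi>) n)}"

definition fil_Z ::
  "('o, 'a::ab_group_add) acat \<Rightarrow> ('o, 'a) fcpx \<Rightarrow> nat \<Rightarrow> int \<Rightarrow> int \<Rightarrow> ('o, 'a) subq" where
  "fil_Z A \<Phi> r p n = subquot A (cob (amb \<Phi>) n) (fil_conds A \<Phi> r p n) {}"

text \<open>\<open>E\<^sub>r = Z\<^sub>r(p, n) / (Z\<^sub>r\<^sub>-\<^sub>1(p - 1, n) + d Z\<^sub>r\<^sub>-\<^sub>1(p + r - 1, n - 1))\<close>, for \<open>r \<ge> 1\<close>.\<close>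

definition fil_E ::
  "('o, 'a::ab_group_add) acat \<Rightarrow> ('o, 'a) fcpx \<Rightarrow> nat \<Rightarrow> int \<Rightarrow> int \<Rightarrow> ('o, 'a) subq" where
  "fil_E A \<Phi> r p n = (let
       U = fil_Z A \<Phi> (r - 1) (p - 1) n; V = fil_Z A \<Phi> (r - 1) (p + int r - 1) (n - 1)
     in subquot A (cob (amb \<Phi>) n) (fil_conds A \<Phi> r p n)
       {(sub_ob U, sub_ar U), (sub_ob V, cmp A (cdf (amb \<Phi>) (n - 1)) (sub_ar V))})"

text \<open>The identification of \<open>E\<^sub>r\<^sub>+\<^sub>1\<close> with the cohomology of \<open>E\<^sub>r\<close> sends the class of an element of
  \<open>Z\<^sub>r\<^sub>+\<^sub>1\<close> to the class of its class in \<open>E\<^sub>r\<close>.\<close>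

definition ss_pre :: "('o, 'a::ab_group_add) acat \<Rightarrow> ('o, 'a) fcpx \<Rightarrow> ('o, 'a) specseq" where
  "ss_pre A \<Phi> = \<lparr>page = (\<lambda>r i j. quo_ob (fil_E A \<Phi> r j (i + j))),
     sdiff = (\<lambda>r i j. sq_map A (fil_E A \<Phi> r j (i + j)) (fil_E A \<Phi> r (j - int r) (i + j + 1))
       (cdf (amb \<Phi>) (i + j))),
     snext = undefined\<rparr>"

definition ss_of :: "('o, 'a::ab_group_add) acat \<Rightarrow> ('o, 'a) fcpx \<Rightarrow> ('o, 'a) specseq" where
  "ss_of A \<Phi> = (ss_pre A \<Phi>)\<lparr>snext := (\<lambda>r i j. let
       e' = fil_E A \<Phi> (Suc r) j (i + j); e = fil_E A \<Phi> r j (i + j);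
       h = page_coh A (ss_pre A \<Phi>) r i j
     in THE t. t \<in> arr A (quo_ob e') (quo_ob h) \<and>
       (\<exists>w\<in>arr A (sub_ob e') (sub_ob e). \<exists>s\<in>arr A (sub_ob e') (sub_ob h).
          cmp A (sub_ar e) w = sub_ar e' \<and> cmp A (sub_ar h) s = cmp A (quo_ar e) w \<and>
          cmp A t (quo_ar e') = cmp A (quo_ar h) s))\<rparr>"

definition ss_map ::
  "('o, 'a::ab_group_add) acat \<Rightarrow> ('o, 'a) fcpx \<Rightarrow> ('o, 'a) fcpx \<Rightarrow> (int \<Rightarrow> 'a) \<Rightarrow>
   nat \<Rightarrow> int \<Rightarrow> int \<Rightarrow> 'a" where
  "ss_map A \<Phi> \<Phi>' \<phi> r i j = sq_map A (fil_E A \<Phi> r j (i + j)) (fil_E A \<Phi>' r j (i + j)) (\<phi> (i + j))"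

text \<open>The graded pieces of the filtration of \<open>H\<^sup>n\<close> by the images of the cohomology of the stages.\<close>

definition coh_gr ::
  "('o, 'a::ab_group_add) acat \<Rightarrow> ('o, 'a) fcpx \<Rightarrow> int \<Rightarrow> int \<Rightarrow> ('o, 'a) subq" where
  "coh_gr A \<Phi> p n = im_quot A (quo_ob (coh A (amb \<Phi>) n))
     (coh_map A (stage \<Phi> p) (amb \<Phi>) (incl \<Phi> p) n)
     (quo_ob (coh A (stage \<Phi> (p - 1)) n))
     (coh_map A (stage \<Phi> (p - 1)) (amb \<Phi>) (incl \<Phi> (p - 1)) n)"

text \<open>For large \<open>r\<close>, the comparison sends the class in \<open>E\<^sub>r\<close> of a cocycle of the \<open>p\<close>-th stage to the
  class in the graded piece of its cohomology class.\<close>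

definition ss_limit ::
  "('o, 'a::ab_group_add) acat \<Rightarrow> ('o, 'a) fcpx \<Rightarrow> nat \<Rightarrow> int \<Rightarrow> int \<Rightarrow> 'a" where
  "ss_limit A \<Phi> r i j = (let
       e = fil_E A \<Phi> r j (i + j); c = coh A (stage \<Phi> j) (i + j); g = coh_gr A \<Phi> j (i + j)
     in THE t. t \<in> arr A (quo_ob e) (quo_ob g) \<and>
       (\<exists>w\<in>arr A (sub_ob c) (sub_ob e). \<exists>s\<in>arr A (sub_ob c) (sub_ob g).
          cmp A (sub_ar e) w = cmp A (incl \<Phi> j (i + j)) (sub_ar c) \<and>
          cmp A (sub_ar g) s =
            cmp A (coh_map A (stage \<Phi> j) (amb \<Phi>) (incl \<Phi> j) (i + j)) (quo_ar c) \<and>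
          cmp A t (cmp A (quo_ar e) w) = cmp A (quo_ar g) s))"

text \<open>Convergence to the cohomology of the ambient complex: the filtration of every \<open>H\<^sup>n\<close> is finite, and for
  every \<open>(i, j)\<close> the terms are constant from some page on and equal to the graded piece.\<close>

definition ss_converges :: "('o, 'a::ab_group_add) acat \<Rightarrow> ('o, 'a) fcpx \<Rightarrow> bool" where
  "ss_converges A \<Phi> \<longleftrightarrow>
     (\<forall>n. (\<exists>p0. \<forall>p\<le>p0. coh_map A (stage \<Phi> p) (amb \<Phi>) (incl \<Phi> p) n = 0) \<and>
        (\<exists>p1. \<forall>p\<ge>p1. is_epi A (quo_ob (coh A (amb \<Phi>) n))
           (coh_map A (stage \<Phi> p) (amb \<Phi>) (incl \<Phi> p) n))) \<and>
     (\<forall>i j. \<exists>r0\<ge>1. \<forall>r\<ge>r0.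
        sdiff (ss_of A \<Phi>) r i j = 0 \<and> sdiff (ss_of A \<Phi>) r (i - int r - 1) (j + int r) = 0 \<and>
        is_iso A (page (ss_of A \<Phi>) r i j) (quo_ob (coh_gr A \<Phi> j (i + j))) (ss_limit A \<Phi> r i j))"

text \<open>Compatibility of a map of spectral sequences with the map of abutments induced by \<open>\<phi>\<close>.\<close>

definition abutment_compat ::
  "('o, 'a::ab_group_add) acat \<Rightarrow> ('o, 'a) fcpx \<Rightarrow> ('o, 'a) fcpx \<Rightarrow> (int \<Rightarrow> 'a) \<Rightarrow> bool" where
  "abutment_compat A \<Phi> \<Phi>' \<phi> \<longleftrightarrow> (\<forall>i j. \<exists>r0\<ge>1. \<forall>r\<ge>r0.
     cmp A (sq_map A (coh_gr A \<Phi> j (i + j)) (coh_gr A \<Phi>' j (i + j))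
              (coh_map A (amb \<Phi>) (amb \<Phi>') \<phi> (i + j))) (ss_limit A \<Phi> r i j) =
     cmp A (ss_limit A \<Phi>' r i j) (ss_map A \<Phi> \<Phi>' \<phi> r i j))"

subsection \<open>Motivic descent\<close>

definition descent_fil ::
  "('o, 'a::ab_group_add) acat \<Rightarrow> ('p, 'm::ab_group_add) dgcat \<Rightarrow> ('p, 'm, 'o, 'a) cfun \<Rightarrow>
   ('p, 'm) tw \<Rightarrow> ('o, 'a) fcpx" where
  "descent_fil A C F X = \<lparr>amb = tot A C F X,
     stage = (\<lambda>b. tot A C (trunc_fun A None b F) X),
     incl = (\<lambda>b. tot_nat A C (trunc_fun A None b F) F
       (\<lambda>P n. sq_map A (trunc_sq A None b (fob F P) n) (whole A (cob (fob F P) n))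
         (idt A (cob (fob F P) n))) X)\<rparr>"

definition descent_ss ::
  "('o, 'a::ab_group_add) acat \<Rightarrow> ('p, 'm::ab_group_add) dgcat \<Rightarrow> ('p, 'm, 'o, 'a) cfun \<Rightarrow>
   ('p, 'm) tw \<Rightarrow> ('o, 'a) specseq" where
  "descent_ss A C F X = ss_of A (descent_fil A C F X)"

definition descent_map ::
  "('o, 'a::ab_group_add) acat \<Rightarrow> ('p, 'm::ab_group_add) dgcat \<Rightarrow> ('p, 'm, 'o, 'a) cfun \<Rightarrow>
   ('p, 'm) tw \<Rightarrow> ('p, 'm) tw \<Rightarrow> (int \<Rightarrow> int \<Rightarrow> 'm) \<Rightarrow> nat \<Rightarrow> int \<Rightarrow> int \<Rightarrow> 'a" where
  "descent_map A C F X X' f =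
     ss_map A (descent_fil A C F X') (descent_fil A C F X) (tot_map A C F X X' f)"

definition descent_nat ::
  "('o, 'a::ab_group_add) acat \<Rightarrow> ('p, 'm::ab_group_add) dgcat \<Rightarrow> ('p, 'm, 'o, 'a) cfun \<Rightarrow>
   ('p, 'm, 'o, 'a) cfun \<Rightarrow> ('p \<Rightarrow> int \<Rightarrow> 'a) \<Rightarrow> ('p, 'm) tw \<Rightarrow> nat \<Rightarrow> int \<Rightarrow> int \<Rightarrow> 'a" where
  "descent_nat A C F F' \<eta> X =
     ss_map A (descent_fil A C F X) (descent_fil A C F' X) (tot_nat A C F F' \<eta> X)"

section \<open>Contravariant functors on homotopy categories of twisted complexes\<close>

type_synonym ('p, 'm, 'o, 'a) trfun =
  "(('p, 'm) tw \<Rightarrow> 'o) \<times> (('p, 'm) tw \<Rightarrow> ('p, 'm) tw \<Rightarrow> (int \<Rightarrow> int \<Rightarrow> 'm) \<Rightarrow> 'a)"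

definition tr_functor ::
  "('p, 'm::ab_group_add) dgcat \<Rightarrow> ('p, 'm) dgideal \<Rightarrow> ('o, 'a::ab_group_add) acat \<Rightarrow>
   ('p, 'm, 'o, 'a) trfun \<Rightarrow> bool" where
  "tr_functor C I A T \<longleftrightarrow>
     (\<forall>X\<in>tw_obj C I. fst T X \<in> obj A \<and> snd T X X (Tr_id C X) = idt A (fst T X)) \<and>
     (\<forall>X\<in>tw_obj C I. \<forall>Y\<in>tw_obj C I. \<forall>f\<in>Tr_mor C I X Y.
        snd T X Y f \<in> arr A (fst T Y) (fst T X) \<and>
        (\<forall>g\<in>Tr_mor C I X Y. Tr_eq C I X Y f g \<longrightarrow> snd T X Y f = snd T X Y g) \<and>
        (\<forall>Z\<in>tw_obj C I. \<forall>g\<in>Tr_mor C I Y Z.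
           snd T X Z (Tr_comp C I X Y Z g f) = cmp A (snd T X Y f) (snd T Y Z g)))"

definition tr_nat_iso ::
  "('p, 'm::ab_group_add) dgcat \<Rightarrow> ('p, 'm) dgideal \<Rightarrow> ('o, 'a::ab_group_add) acat \<Rightarrow>
   ('p, 'm, 'o, 'a) trfun \<Rightarrow> ('p, 'm, 'o, 'a) trfun \<Rightarrow> bool" where
  "tr_nat_iso C I A T T' \<longleftrightarrow> (\<exists>\<theta>.
     (\<forall>X\<in>tw_obj C I. is_iso A (fst T X) (fst T' X) (\<theta> X)) \<and>
     (\<forall>X\<in>tw_obj C I. \<forall>Y\<in>tw_obj C I. \<forall>f\<in>Tr_mor C I X Y.
        cmp A (\<theta> X) (snd T X Y f) = cmp A (snd T' X Y f) (\<theta> Y)))"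

text \<open>On representatives \<open>t\<^sub>N\<close> is the identity, so a functor on the target of \<open>t\<^sub>N\<close> is composed with \<open>t\<^sub>N\<close> by
  restricting it.\<close>

definition factors_through_t ::
  "('p, 'm::ab_group_add) dgcat \<Rightarrow> int \<Rightarrow> ('o, 'a::ab_group_add) acat \<Rightarrow> ('p, 'm, 'o, 'a) trfun \<Rightarrow> bool" where
  "factors_through_t C N A T \<longleftrightarrow>
     (\<exists>T'. tr_functor C (trunc_ideal C N) A T' \<and> tr_nat_iso C zero_ideal A T T')"

definition E_term ::
  "('o, 'a::ab_group_add) acat \<Rightarrow> ('p, 'm::ab_group_add) dgcat \<Rightarrow> ('p, 'm, 'o, 'a) cfun \<Rightarrow>
   nat \<Rightarrow> int \<Rightarrow> int \<Rightarrow> ('p, 'm, 'o, 'a) trfun" where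
  "E_term A C F r i j =
     ((\<lambda>X. page (descent_ss A C F X) r i j), (\<lambda>X X' f. descent_map A C F X X' f r i j))"

text \<open>\<open>X \<mapsto> H\<^sup>s(F\<^sub>N\<^sup>b(X))\<close>\<close>

definition treal_coh ::
  "('o, 'a::ab_group_add) acat \<Rightarrow> ('p, 'm::ab_group_add) dgcat \<Rightarrow> ('p, 'm, 'o, 'a) cfun \<Rightarrow>
   int \<Rightarrow> int \<Rightarrow> int \<Rightarrow> ('p, 'm, 'o, 'a) trfun" where
  "treal_coh A C F b N s =
     ((\<lambda>X. quo_ob (coh A (treal A C F b N X) s)),
      (\<lambda>X X' f. coh_map A (treal A C F b N X') (treal A C F b N X)
         (tot_map A C (treal_fun A F b N) X X' f) s))"

text \<open>\<open>X \<mapsto>\<close> the complex with terms \<open>A\<^sub>l = H\<^sup>j(F(P\<^sup>-\<^sup>l))\<close>, and its cohomology\<close>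

definition row_cpx ::
  "('o, 'a::ab_group_add) acat \<Rightarrow> ('p, 'm, 'o, 'a) cfun \<Rightarrow> int \<Rightarrow> ('p, 'm) tw \<Rightarrow> ('o, 'a) cpx" where
  "row_cpx A F j X = \<lparr>cob = (\<lambda>l. quo_ob (coh A (fob F (fst X (- l))) j)),
     cdf = (\<lambda>l. coh_map A (fob F (fst X (- l))) (fob F (fst X (- l - 1)))
       (fmor F 0 (fst X (- l - 1)) (fst X (- l)) (snd X (- l - 1) (- l))) j)\<rparr>"

definition row_coh ::
  "('o, 'a::ab_group_add) acat \<Rightarrow> ('p, 'm, 'o, 'a) cfun \<Rightarrow> int \<Rightarrow> int \<Rightarrow> ('p, 'm, 'o, 'a) trfun" where
  "row_coh A F i j =
     ((\<lambda>X. quo_ob (coh A (row_cpx A F j X) i)),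
      (\<lambda>X X' f. coh_map A (row_cpx A F j X') (row_cpx A F j X)
         (\<lambda>l. coh_map A (fob F (fst X' (- l))) (fob F (fst X (- l)))
            (fmor F 0 (fst X (- l)) (fst X' (- l)) (f (- l) (- l))) j) i))"

text \<open>The quotient of images of the cohomology of truncated realizations that computes \<open>E\<^sub>n\<close>.\<close>

definition descent_im ::
  "('o, 'a::ab_group_add) acat \<Rightarrow> ('p, 'm::ab_group_add) dgcat \<Rightarrow> ('p, 'm, 'o, 'a) cfun \<Rightarrow>
   nat \<Rightarrow> int \<Rightarrow> int \<Rightarrow> ('p, 'm) tw \<Rightarrow> ('o, 'a) subq" where
  "descent_im A C F n i j X = (let
       b = j + int n - 1; N = 2 * int n - 2; T = treal A C F b N X;
       U = treal A C F j (int n - 1) X; V = treal A C F (j - 1) (int n - 2) X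
     in im_quot A (quo_ob (coh A T (i + j)))
       (coh_map A U T (treal_nat A C F b N (int n - 1) X) (i + j))
       (quo_ob (coh A V (i + j)))
       (coh_map A V T (treal_nat A C F b N (int n) X) (i + j)))"

definition descent_im_fun ::
  "('o, 'a::ab_group_add) acat \<Rightarrow> ('p, 'm::ab_group_add) dgcat \<Rightarrow> ('p, 'm, 'o, 'a) cfun \<Rightarrow>
   nat \<Rightarrow> int \<Rightarrow> int \<Rightarrow> ('p, 'm, 'o, 'a) trfun" where
  "descent_im_fun A C F n i j =
     ((\<lambda>X. quo_ob (descent_im A C F n i j X)),
      (\<lambda>X X' f. sq_map A (descent_im A C F n i j X') (descent_im A C F n i j X)
         (snd (treal_coh A C F (j + int n - 1) (2 * int n - 2) (i + j)) X X' f)))"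

end

theory Submission
  imports Defs
begin

text \<open>Everything is expressed through generalised elements \<open>x : T \<rightarrow> X\<close>, up to composition with epimorphisms \<open>T' \<rightarrow> T\<close>;
subquotients are then relations between elements, and diagram chases work as for modules. Since \<open>J\<close> has no morphisms
of positive degree, the filtration \<open>W\<close> of \<open>G(X)\<close> by the degree of the terms in the \<open>F([P\<^sup>i])\<close> is preserved by all
components except the differentials of the \<open>F([P\<^sup>i])\<close>, which raise it by one. The descent filtration is its decalage,
\<open>G\<^sub>b = W\<^sub>b \<inter> d\<inverse> W\<^sub>b\<close>, and the truncated realization \<open>F\<^sub>N\<^sup>b(X)\<close> is \<open>G\<^sub>b / (W\<^sub>c + d W\<^sub>c)\<close> with \<open>c = b - N - 1\<close>,
while \<open>W\<^sub>c + d W\<^sub>c\<close> is quasi-isomorphic to \<open>G\<^sub>c\<close>. The formula for \<open>E\<^sub>n\<close> is the description of \<open>Z\<^sub>n / B\<^sub>n\<close> by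
subquotients \<open>G\<^sub>b / G\<^sub>c\<close>. Homotopies respect \<open>W\<close>, hence move \<open>G\<^sub>b\<close> at most into \<open>G\<^sub>b\<^sub>+\<^sub>1\<close> and act by zero
from \<open>E\<^sub>1\<close> on.\<close>

section \<open>Generalised elements in an abelian category\<close>

text \<open>The length 2n - 2 in (b) comes from the range of page n: Z_n of stage j tests
  differentials against stage j - n, and the boundaries divided out start in stage j + n - 1. All of
  E_n is therefore visible in G_b / (W_c + d W_c) with b = j + n - 1 and c = j - n, the truncation
  to [j - n + 1, j + n - 1]. Two obstacles shape the rest. Over J_N the equations for objects,
  morphisms and homotopies hold only modulo an ideal, so total complexes are developed for functors
  that annihilate an ideal (\<open>kills\<close>), which is either zero or
  \<open>trunc_ideal\<close>. In the last claim of (c) the homotopies are given for each X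
  separately, neither natural nor related to W; they are exploited only for a single [P], where they
  say that the two transformations differ by boundaries on cocycles. This suffices because an
  element of Z_n of stage j has cocycles as components of degree j, and lower components lie in
  W_(j-1). Since all subquotients and biproducts are \<open>SOME\<close> choices, arrows between
  them are always characterised by what they do to the classes of elements.\<close>

lemma subgrp_zero: "subgrp S ==> 0 : S"
 by (simp add: subgrp_def)

lemma subgrp_diff: "subgrp S ==> x : S ==> y : S ==> x - y : S"
 by (simp add: subgrp_def)

lemma subgrp_minus: "subgrp S ==> x : S ==> - x : S"
 using subgrp_diff[of S 0 x] by (simp add: subgrp_zero)

lemma subgrp_add: "subgrp S ==> x : S ==> y : S ==> x + y : S"
 using subgrp_diff[of S x "- y"] by (simp add: subgrp_minus)

lemma subgrp_sum: "subgrp S ==> (\<And>i. i : I ==> f i : S) ==> sum f I : S"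
 by (induction I rule: infinite_finite_induct) (auto simp: subgrp_zero subgrp_add)

lemma subgrp_ksgn: "subgrp S ==> x : S ==> ksgn k x : S"
 by (simp add: ksgn_def subgrp_minus)

lemma ksgn_zero [simp]: "ksgn k 0 = 0"
 by (simp add: ksgn_def)

lemma ksgn_ksgn: "ksgn k (ksgn l x) = ksgn (k + l) x"
 by (simp add: ksgn_def)

lemma ksgn_add: "ksgn k (x + y) = ksgn k x + ksgn k y"
 by (simp add: ksgn_def)

lemma ksgn_diff: "ksgn k (x - y) = ksgn k x - ksgn k y"
 by (simp add: ksgn_def)

lemma ksgn_uminus: "ksgn k (- x) = - ksgn k x"
 by (simp add: ksgn_def)

lemma ksgn_sum: "ksgn k (sum f I) = (\<Sum>i\<in>I. ksgn k (f i))"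
 by (simp add: ksgn_def sum_negf)

lemma ksgn_eq_0 [simp]: "ksgn k x = 0 \<longleftrightarrow> x = 0"
 by (simp add: ksgn_def)

lemma ksgn_even: "even k ==> ksgn k x = x"
 by (simp add: ksgn_def)

abbreviation (input) "supp0 C \<equiv> tw_supp C zero_ideal"
abbreviation (input) "ob0 C \<equiv> tw_obj C zero_ideal"
abbreviation (input) "Fo F P n \<equiv> cob (fob F P) n"
abbreviation (input) "Fd F P n \<equiv> cdf (fob F P) n"
abbreviation (input) "Mo D n \<equiv> cob (amb D) n"
abbreviation (input) "Md D n \<equiv> cdf (amb D) n"

locale abcat =
 fixes A :: "('o, 'a::ab_group_add) acat"
 assumes ab: "abelian_category A"
begin

abbreviation comp_infix (infixl "**" 70) where "g ** f \<equiv> cmp A g f"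

text \<open>The laws in \<open>preadditive\<close> are guarded by membership in
  \<open>obj A\<close>, while \<open>arr A X Y\<close> makes sense for any \<open>X\<close> and
  \<open>Y\<close>; carrying the objects along discharges these guards.\<close>

definition hom :: "'a => 'o => 'o => bool" where
 "hom f X Y \<longleftrightarrow> X : obj A & Y : obj A & f : arr A X Y"

text \<open>By \<open>cov_pullback\<close> below, epimorphisms behave like the coverings of a
  Grothendieck topology; "locally" means after composition with some \<open>cov\<close>.\<close>

definition cov :: "'a => 'o => 'o => bool" where
 "cov e T' T \<longleftrightarrow> hom e T' T & is_epi A T e"

lemma preadd: "preadditive A"
 using ab by (simp add: abelian_category_def)

lemma hom_dom: "hom f X Y ==> X : obj A" and hom_cod: "hom f X Y ==> Y : obj A"
 and hom_arr: "hom f X Y ==> f : arr A X Y"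
 by (simp_all add: hom_def)

lemma subgrp_arr: "X : obj A ==> Y : obj A ==> subgrp (arr A X Y)"
 using preadd by (simp add: preadditive_def)

lemma hom_zero: "X : obj A ==> Y : obj A ==> hom 0 X Y"
 by (simp add: hom_def subgrp_arr subgrp_zero)

lemma hom_diff: "hom f X Y ==> hom g X Y ==> hom (f - g) X Y"
 by (simp add: hom_def subgrp_arr subgrp_diff)

lemma hom_add: "hom f X Y ==> hom g X Y ==> hom (f + g) X Y"
 by (simp add: hom_def subgrp_arr subgrp_add)

lemma hom_minus: "hom f X Y ==> hom (- f) X Y"
 by (simp add: hom_def subgrp_arr subgrp_minus)

lemma hom_ksgn: "hom f X Y ==> hom (ksgn k f) X Y"
 by (simp add: hom_def subgrp_arr subgrp_ksgn)

lemma hom_sum: "X : obj A ==> Y : obj A ==> (\<And>i. i : I ==> hom (f i) X Y) ==> hom (sum f I) X Y"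
 by (simp add: hom_def subgrp_arr subgrp_sum)

lemma hom_id: "X : obj A ==> hom (idt A X) X X"
 using preadd by (simp add: preadditive_def hom_def)

lemma hom_comp: "hom f X Y ==> hom g Y Z ==> hom (g ** f) X Z"
 using preadd unfolding preadditive_def hom_def by blast

lemma comp_id: "hom f X Y ==> f ** idt A X = f"
 using preadd unfolding preadditive_def hom_def by blast

lemma id_comp: "hom f X Y ==> idt A Y ** f = f"
 using preadd unfolding preadditive_def hom_def by blast

lemma assoc: "hom f X Y ==> hom g Y Z ==> hom h Z W ==> h ** g ** f = h ** (g ** f)"
proof -
 assume f: "hom f X Y" and g: "hom g Y Z" and h: "hom h Z W"
 have "ALL W:obj A. ALL h:arr A Z W. h ** (g ** f) = h ** g ** f"
  using preadd f g unfolding preadditive_def hom_def by blast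
 hence "h ** (g ** f) = h ** g ** f"
  using h unfolding hom_def by blast
 thus ?thesis by simp
qed

lemma comp_add: "hom f X Y ==> hom f' X Y ==> hom g Y Z ==> g ** (f + f') = g ** f + g ** f'"
 using preadd unfolding preadditive_def hom_def by blast

lemma add_comp: "hom f X Y ==> hom g Y Z ==> hom g' Y Z ==> (g + g') ** f = g ** f + g' ** f"
 using preadd unfolding preadditive_def hom_def by blast

lemma comp_zero: "X : obj A ==> hom g Y Z ==> g ** 0 = 0"
 using comp_add[of 0 X Y 0 g Z] hom_zero hom_dom by force

lemma zero_comp: "hom f X Y ==> Z : obj A ==> 0 ** f = 0"
 using add_comp[of f X Y 0 Z 0] hom_zero hom_cod by force

lemma comp_diff: "hom f X Y ==> hom f' X Y ==> hom g Y Z ==> g ** (f - f') = g ** f - g ** f'"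
 using comp_add[of "f - f'" X Y f' g Z] hom_diff by (simp add: eq_diff_eq)

lemma diff_comp: "hom f X Y ==> hom g Y Z ==> hom g' Y Z ==> (g - g') ** f = g ** f - g' ** f"
 using add_comp[of f X Y "g - g'" Z g'] hom_diff by (simp add: eq_diff_eq)

lemma comp_minus: "hom f X Y ==> hom g Y Z ==> g ** (- f) = - (g ** f)"
 using comp_diff[of 0 X Y f g Z] hom_zero[OF hom_dom hom_cod, of f X Y f X Y]
  comp_zero[OF hom_dom, of f X Y g Y Z] by simp

lemma minus_comp: "hom f X Y ==> hom g Y Z ==> (- g) ** f = - (g ** f)"
 using diff_comp[of f X Y 0 Z g] hom_zero[OF hom_dom hom_cod, of g Y Z g Y Z]
  zero_comp[OF _ hom_cod, of f X Y g Y Z] by simp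

lemma comp_ksgn: "hom f X Y ==> hom g Y Z ==> g ** ksgn k f = ksgn k (g ** f)"
 by (simp add: ksgn_def comp_minus)

lemma ksgn_comp: "hom f X Y ==> hom g Y Z ==> ksgn k g ** f = ksgn k (g ** f)"
 by (simp add: ksgn_def minus_comp)

lemma comp_sum:
 assumes g: "hom g Y Z" and X: "X : obj A" and f: "\<And>i. i : I ==> hom (f i) X Y"
 shows "g ** sum f I = (\<Sum>i\<in>I. g ** f i)"
 using f
proof (induction I rule: infinite_finite_induct)
 case (insert i I)
 thus ?case
  using comp_add[OF _ _ g, of "f i" X "sum f I"] hom_sum[OF X hom_dom[OF g], of I f] by auto
qed (use comp_zero[OF X g] in auto)

lemma sum_comp:
 assumes f: "hom f X Y" and Z: "Z : obj A" and g: "\<And>i. i : I ==> hom (g i) Y Z"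
 shows "sum g I ** f = (\<Sum>i\<in>I. g i ** f)"
 using g
proof (induction I rule: infinite_finite_induct)
 case (insert i I)
 thus ?case
  using add_comp[OF f, of "g i" Z "sum g I"] hom_sum[OF hom_cod[OF f] Z, of I g] by auto
qed (use zero_comp[OF f Z] in auto)

section \<open>Monomorphisms, epimorphisms, kernels and cokernels\<close>

lemma mono_iff:
 assumes "hom f X Y"
 shows "is_mono A X f \<longleftrightarrow> (ALL T x. hom x T X & f ** x = 0 --> x = 0)"
proof
 assume m: "is_mono A X f"
 show "ALL T x. hom x T X & f ** x = 0 --> x = 0"
 proof (intro allI impI)
  fix T x assume x: "hom x T X & f ** x = 0"
  hence "f ** 0 = 0" using comp_zero[OF hom_dom assms] by blast
  thus "x = 0" using m x hom_zero[OF hom_dom hom_cod, of x T X x T X]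
   unfolding is_mono_def hom_def by metis
 qed
next
 assume z: "ALL T x. hom x T X & f ** x = 0 --> x = 0"
 show "is_mono A X f" unfolding is_mono_def
 proof (intro ballI impI)
  fix T x y assume "T : obj A" "x : arr A T X" "y : arr A T X" and e: "f ** x = f ** y"
  hence xy: "hom x T X" "hom y T X" using assms by (auto simp: hom_def)
  hence "f ** (x - y) = 0" using comp_diff[OF xy assms] e by simp
  thus "x = y" using z hom_diff[OF xy] by fastforce
 qed
qed

lemma epi_iff:
 assumes "hom f X Y"
 shows "is_epi A Y f \<longleftrightarrow> (ALL T y. hom y Y T & y ** f = 0 --> y = 0)"
proof
 assume m: "is_epi A Y f"
 show "ALL T y. hom y Y T & y ** f = 0 --> y = 0"
 proof (intro allI impI)
  fix T y assume y: "hom y Y T & y ** f = 0"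
  hence "0 ** f = 0" using zero_comp[OF assms hom_cod] by blast
  thus "y = 0" using m y hom_zero[OF hom_dom hom_cod, of y Y T y Y T]
   unfolding is_epi_def hom_def by metis
 qed
next
 assume z: "ALL T y. hom y Y T & y ** f = 0 --> y = 0"
 show "is_epi A Y f" unfolding is_epi_def
 proof (intro ballI impI)
  fix T x y assume "T : obj A" "x : arr A Y T" "y : arr A Y T" and e: "x ** f = y ** f"
  hence xy: "hom x Y T" "hom y Y T" using assms by (auto simp: hom_def)
  hence "(x - y) ** f = 0" using diff_comp[OF assms xy] e by simp
  thus "x = y" using z hom_diff[OF xy] by fastforce
 qed
qed

lemma mono_zero: "is_mono A X f ==> hom f X Y ==> hom x T X ==> f ** x = 0 ==> x = 0"
 using mono_iff[of f X Y] by blast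

lemma mono_cancel:
 "is_mono A X f ==> hom x T X ==> hom y T X ==> f ** x = f ** y ==> x = y"
 unfolding is_mono_def hom_def by blast

lemma epi_cancel:
 "is_epi A Y f ==> hom x Y T ==> hom y Y T ==> x ** f = y ** f ==> x = y"
 unfolding is_epi_def hom_def by blast

lemma cov_hom: "cov e T' T ==> hom e T' T"
 by (simp add: cov_def)

lemma cov_cancel: "cov e T' T ==> hom x T Y ==> hom y T Y ==> x ** e = y ** e ==> x = y"
 unfolding cov_def by (blast intro: epi_cancel)

lemma cov_zero: "cov e T' T ==> hom x T Y ==> x ** e = 0 ==> x = 0"
 using epi_iff unfolding cov_def by blast

lemma cov_id: "T : obj A ==> cov (idt A T) T T"
 unfolding cov_def by (auto simp: hom_id is_epi_def comp_id[unfolded hom_def])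

lemma cov_comp:
 assumes e: "cov e T' T" and e': "cov e' T'' T'"
 shows "cov (e ** e') T'' T"
proof -
 have h: "hom e T' T" "hom e' T'' T'" using assms by (auto simp: cov_def)
 have "ALL S y. hom y T S & y ** (e ** e') = 0 --> y = 0"
 proof (intro allI impI)
  fix S y assume y: "hom y T S & y ** (e ** e') = 0"
  hence "y ** e ** e' = 0" using assoc[OF h(2,1), of y S] by simp
  hence "y ** e = 0" using cov_zero[OF e'] hom_comp[OF h(1)] y by blast
  thus "y = 0" using cov_zero[OF e] y by blast
 qed
 thus ?thesis using epi_iff[OF hom_comp[OF h(2,1)]] hom_comp[OF h(2,1)] unfolding cov_def by simp
qed

lemma kernel_ex: "hom f X Y ==> EX K k. is_kernel A X f K k"
 using ab unfolding abelian_category_def hom_def by blast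

lemma cokernel_ex: "hom f X Y ==> EX Q c. is_cokernel A Y f Q c"
 using ab unfolding abelian_category_def hom_def by blast

lemma kernelD:
 assumes "is_kernel A X f K k" "X : obj A"
 shows "hom k K X" "f ** k = 0" "hom x T X ==> f ** x = 0 ==> EX w. hom w T K & k ** w = x"
 using assms unfolding is_kernel_def hom_def by blast+

lemma kernel_mono:
 assumes k: "is_kernel A X f K k" and f: "hom f X Y"
 shows "is_mono A K k"
proof -
 have X: "X : obj A" using f by (simp add: hom_def)
 have hk: "hom k K X" using kernelD[OF k X] by blast
 have "ALL T x. hom x T K & k ** x = 0 --> x = 0"
 proof (intro allI impI)
  fix T x assume x: "hom x T K & k ** x = 0"
  have T: "T : obj A" using x hom_dom by blast
  have "f ** 0 = 0" using comp_zero[OF T f] .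
  hence "EX! w. w : arr A T K & k ** w = 0"
   using k hom_zero[OF T X] T unfolding is_kernel_def hom_def by blast
  moreover have "hom 0 T K" "k ** 0 = 0" using hom_zero[OF T hom_dom[OF hk]] comp_zero[OF T hk] by auto
  ultimately show "x = 0" using x unfolding hom_def by blast
 qed
 thus ?thesis using mono_iff[OF hk] by blast
qed

lemma cokernelD:
 assumes "is_cokernel A Y f Q c" "Y : obj A"
 shows "hom c Y Q" "c ** f = 0" "hom y Y T ==> y ** f = 0 ==> EX w. hom w Q T & w ** c = y"
 using assms unfolding is_cokernel_def hom_def by blast+

lemma mono_kernel: "hom f X Y ==> is_mono A X f ==> EX W g. hom g Y W & is_kernel A Y g X f"
 using ab unfolding abelian_category_def hom_def by blast

lemma epi_cokernel: "hom f X Y ==> is_epi A Y f ==> EX W g. hom g W X & is_cokernel A X g Y f"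
 using ab unfolding abelian_category_def hom_def by blast

text \<open>An epimorphism is the cokernel of some \<open>g\<close>, and \<open>k\<close> applied to
  this \<open>g\<close> gives the factorisation. This is gluing along a covering; since arrows can
  be subtracted, only arrows killed by \<open>e\<close> have to be tested.\<close>

lemma cov_descent:
 assumes e: "cov e T' T" and x: "hom x T' Y" and k: "\<And>S k. hom k S T' ==> e ** k = 0 ==> x ** k = 0"
 shows "EX y. hom y T Y & y ** e = x"
proof -
 have he: "hom e T' T" "is_epi A T e" using e by (auto simp: cov_def)
 obtain W g where g: "hom g W T'" "is_cokernel A T' g T e" using epi_cokernel[OF he] by blast
 have T': "T' : obj A" using hom_dom[OF he(1)] .
 have "x ** g = 0" using k[OF g(1)] cokernelD(2)[OF g(2) T'] by blast
 thus ?thesis using cokernelD(3)[OF g(2) T' x] by blast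
qed

lemma biprod2_ex:
 assumes "X : obj A" "Y : obj A"
 shows "EX S i j p q. hom i X S & hom j Y S & hom p S X & hom q S Y &
  p ** i = idt A X & q ** j = idt A Y & p ** j = 0 & q ** i = 0 & i ** p + j ** q = idt A S"
proof -
 obtain s where s: "is_biproduct A (UNIV :: bool set) (\<lambda>b. if b then X else Y) s"
  using ab assms unfolding abelian_category_def by blast
 obtain S i p where [simp]: "s = (S, i, p)" by (cases s)
 have t: "S : obj A &
   (ALL b. i b : arr A (if b then X else Y) S & p b : arr A S (if b then X else Y)) &
   (ALL b c. p b ** i c = (if b = c then idt A (if b then X else Y) else 0)) &
   i True ** p True + i False ** p False = idt A S"
  using s by (simp add: is_biproduct_def UNIV_bool add.commute)
 have "i True : arr A X S & p True : arr A S X" "i False : arr A Y S & p False : arr A S Y"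
  using t by (auto dest: spec[of _ True] spec[of _ False])
 hence "hom (i True) X S & hom (i False) Y S & hom (p True) S X & hom (p False) S Y &
  p True ** i True = idt A X & p False ** i False = idt A Y & p True ** i False = 0 & p False ** i True = 0 &
  i True ** p True + i False ** p False = idt A S"
  using t assms unfolding hom_def by simp
 thus ?thesis by blast
qed

text \<open>The axioms supply kernels and biproducts but no fibre products; the fibre product of
  \<open>e\<close> and \<open>x\<close> is the kernel of the difference \<open>f\<close> of the two
  maps on the biproduct.\<close>

lemma cov_pullback:
 assumes e: "cov e T' T" and x: "hom x S T"
 shows "EX S' e' x'. cov e' S' S & hom x' S' T' & e ** x' = x ** e'"
proof -
 have he: "hom e T' T" using e by (simp add: cov_def)
 obtain B i j p q where B: "hom i T' B" "hom j S B" "hom p B T'" "hom q B S"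
  "p ** i = idt A T'" "q ** j = idt A S" "p ** j = 0" "q ** i = 0"
  using biprod2_ex[OF hom_dom[OF he] hom_dom[OF x]] by blast
 define f where "f = e ** p - x ** q"
 have hep: "hom (e ** p) B T" "hom (x ** q) B T" using hom_comp B he x by blast+
 hence f: "hom f B T" unfolding f_def by (rule hom_diff)
 have fi: "f ** i = e"
  unfolding f_def using diff_comp[OF B(1) hep] assoc[OF B(1) B(3) he] assoc[OF B(1) B(4) x] B(5,8)
   comp_id[OF he] comp_zero[OF hom_dom[OF B(1)] x] by simp
 have fe: "cov f B T"
  unfolding cov_def using f
 proof
  show "is_epi A T f" unfolding epi_iff[OF f]
  proof (intro allI impI)
   fix W y assume "hom y T W & y ** f = 0"
   hence y: "hom y T W" "y ** f = 0" by auto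
   have "y ** e = 0" using assoc[OF B(1) f y(1)] fi zero_comp[OF B(1) hom_cod[OF y(1)]] y(2) by simp
   thus "y = 0" using cov_zero[OF e] y by blast
  qed
 qed
 obtain P k where k: "is_kernel A B f P k" using kernel_ex[OF f] by blast
 note kd = kernelD[OF k hom_cod[OF B(1)]]
 have qk: "hom (q ** k) P S" and pk: "hom (p ** k) P T'" using hom_comp kd(1) B by blast+
 have "cov (q ** k) P S"
  unfolding cov_def using qk
 proof
  show "is_epi A S (q ** k)" unfolding epi_iff[OF qk]
  proof (intro allI impI)
   fix W u assume u: "hom u S W & u ** (q ** k) = 0"
   hence hu: "hom u S W" by blast
   have uq: "hom (u ** q) B W" using hom_comp[OF B(4) hu] .
   have "u ** q ** k = 0" using u assoc[OF kd(1) B(4) hu] by simp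
   \<comment> \<open>\<open>u ** q\<close> vanishes on the kernel of the epimorphism
     \<open>f\<close>, so it factors through \<open>f\<close>; the factor \<open>v\<close> is killed
     by \<open>e\<close> and hence zero.\<close>
   have "EX v. hom v T W & v ** f = u ** q"
   proof (rule cov_descent[OF fe uq])
    fix R l assume l: "hom l R B" "f ** l = 0"
    then obtain w where w: "hom w R P" "k ** w = l" using kd(3) by blast
    thus "u ** q ** l = 0"
     using assoc[OF w(1) kd(1) uq] \<open>u ** q ** k = 0\<close> zero_comp[OF w(1) hom_cod[OF hu]] by simp
   qed
   then obtain v where v: "hom v T W" "v ** f = u ** q" by blast
   have "v ** e = u ** q ** i" using assoc[OF B(1) f v(1)] fi v(2) by simp
   also have "\<dots> = 0" using assoc[OF B(1) B(4) hu] B(8) comp_zero[OF hom_dom[OF B(1)] hu] by simp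
   finally have "v = 0" using cov_zero[OF e v(1)] by blast
   hence "u ** q = 0" using v(2) zero_comp[OF f hom_cod[OF hu]] by simp
   hence "u ** q ** j = 0" using zero_comp[OF B(2) hom_cod[OF hu]] by simp
   thus "u = 0" using assoc[OF B(2) B(4) hu] B(6) comp_id[OF hu] by simp
  qed
 qed
 moreover have "e ** (p ** k) = x ** (q ** k)"
  using kd(2) diff_comp[OF kd(1) hep] assoc[OF kd(1) B(3) he] assoc[OF kd(1) B(4) x]
  unfolding f_def by simp
 ultimately show ?thesis using pk by blast
qed

lemma cov_common:
 assumes e: "cov e T1 T" and f: "cov f T2 T"
 shows "EX T' g h. cov g T' T1 & hom h T' T2 & e ** g = f ** h"
 using cov_pullback[OF f cov_hom[OF e]] by metis

text \<open>Finitely many coverings have a common refinement. This is what allows biproducts over a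
  finite index set to be treated component by component.\<close>

lemma finite_cov:
 assumes "finite I" and T: "T : obj A"
  and ex: "\<And>i. i : I ==> EX T' e. cov e T' T & P i T' e"
  and restr: "\<And>i T' e T'' g. i : I ==> P i T' e ==> hom e T' T ==> hom g T'' T' ==> P i T'' (e ** g)"
 shows "EX T' e. cov e T' T & (ALL i:I. P i T' e)"
 using assms(1) ex restr
proof (induction I rule: finite_induct)
 case empty
 thus ?case using cov_id[OF T] by blast
next
 case (insert i I)
 obtain T1 e1 where 1: "cov e1 T1 T" "P i T1 e1" using insert.prems(1) by blast
 have "EX T' e. cov e T' T & (ALL i:I. P i T' e)"
  by (rule insert.IH) (use insert.prems in blast)+
 then obtain T2 e2 where 2: "cov e2 T2 T" "ALL i:I. P i T2 e2" by blast
 obtain T' g h where g: "cov g T' T1" "hom h T' T2" "e1 ** g = e2 ** h"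
  using cov_common[OF 1(1) 2(1)] by blast
 have "cov (e1 ** g) T' T" using cov_comp[OF 1(1) g(1)] .
 moreover have "P i T' (e1 ** g)"
  using insert.prems(2)[OF _ 1(2) cov_hom[OF 1(1)] cov_hom[OF g(1)]] by blast
 moreover have "ALL j:I. P j T' (e1 ** g)"
  using insert.prems(2)[OF _ _ cov_hom[OF 2(1)] g(2)] 2(2) g(3) by auto
 ultimately show ?case by blast
qed

text \<open>Exactness for elements. The point is that \<open>U\<close> maps epimorphically onto the
  kernel \<open>I\<close> of the cokernel; lifting along this epimorphism needs a covering.\<close>

lemma image_local:
 assumes f: "hom f U Y" and c: "is_cokernel A Y f Q c" and x: "hom x T Y" and "c ** x = 0"
 shows "EX T' e u. cov e T' T & hom u T' U & x ** e = f ** u"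
proof -
 have Y: "Y : obj A" using hom_cod[OF f] .
 note cd = cokernelD[OF c Y]
 obtain I i where i: "is_kernel A Y c I i" using kernel_ex[OF cd(1)] by blast
 note id = kernelD[OF i Y]
 have im: "is_mono A I i" using kernel_mono[OF i cd(1)] .
 obtain p where p: "hom p U I" "i ** p = f" using id(3)[OF f cd(2)] by blast
 obtain x' where x': "hom x' T I" "i ** x' = x" using id(3)[OF x assms(4)] by blast
 have "is_epi A I p" unfolding epi_iff[OF p(1)]
 proof (intro allI impI)
  fix W v assume "hom v I W & v ** p = 0"
  hence v: "hom v I W" "v ** p = 0" by auto
  \<comment> \<open>To get \<open>v = 0\<close>, its kernel \<open>k\<close> is shown to be a split
    epimorphism: \<open>i ** k\<close> is mono, hence the kernel of some \<open>g\<close>; this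
    \<open>g\<close> kills \<open>f\<close>, so it factors through \<open>c\<close> and kills
    \<open>i\<close>, and therefore \<open>i\<close> factors through \<open>i ** k\<close>.\<close>
  obtain K k where k: "is_kernel A I v K k" using kernel_ex[OF v(1)] by blast
  note kd = kernelD[OF k hom_dom[OF v(1)]]
  obtain p' where p': "hom p' U K" "k ** p' = p" using kd(3)[OF p(1) v(2)] by blast
  have ik: "hom (i ** k) K Y" using hom_comp[OF kd(1) id(1)] .
  have ikm: "is_mono A K (i ** k)" unfolding mono_iff[OF ik]
  proof (intro allI impI)
   fix S s assume "hom s S K & i ** k ** s = 0"
   hence s: "hom s S K" "i ** (k ** s) = 0" using assoc[OF _ kd(1) id(1)] by auto
   have "k ** s = 0" using im s(2) hom_comp[OF s(1) kd(1)] mono_iff[OF id(1)] by blast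
   thus "s = 0" using s(1) kernel_mono[OF k v(1)] mono_iff[OF kd(1)] by blast
  qed
  obtain V g where g: "hom g Y V" "is_kernel A Y g K (i ** k)" using mono_kernel[OF ik ikm] by blast
  note gd = kernelD[OF g(2) Y]
  have "g ** f = 0"
   using p p' assoc[OF p'(1) kd(1) id(1)] assoc[OF p'(1) ik g(1)] gd(2)
    zero_comp[OF p'(1) hom_cod[OF g(1)]] by simp
  then obtain g' where g': "hom g' Q V" "g' ** c = g" using cd(3)[OF g(1)] by blast
  have "g ** i = 0" using g' assoc[OF id(1) cd(1) g'(1)] id(2) comp_zero[OF hom_dom[OF id(1)] g'(1)] by simp
  then obtain s where s: "hom s I K" "i ** k ** s = i" using gd(3)[OF id(1)] by blast
  have ks: "hom (k ** s) I I" using hom_comp[OF s(1) kd(1)] .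
  have "i ** (k ** s) = i ** idt A I" using s assoc[OF s(1) kd(1) id(1)] comp_id[OF id(1)] by simp
  hence "k ** s = idt A I" using mono_cancel[OF im ks hom_id[OF hom_dom[OF v(1)]]] by blast
  hence "v = v ** (k ** s)" using comp_id[OF v(1)] by simp
  also have "\<dots> = 0" using assoc[OF s(1) kd(1) v(1)] kd(2) zero_comp[OF s(1) hom_cod[OF v(1)]] by simp
  finally show "v = 0" .
 qed
 hence "cov p U I" using p(1) by (simp add: cov_def)
 then obtain T' e u where e: "cov e T' T" "hom u T' U" "p ** u = x' ** e"
  using cov_pullback[OF _ x'(1)] by blast
 have "x ** e = f ** u"
  using assoc[OF e(2) p(1) id(1)] assoc[OF cov_hom[OF e(1)] x'(1) id(1)] e(3) p(2) x'(2) by simp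
 thus ?thesis using e by blast
qed

lemma coker_ar_cokernel: "hom f U Y ==> EX Q. is_cokernel A Y f Q (coker_ar A Y f)"
 unfolding coker_ar_def by (rule someI_ex) (use cokernel_ex in blast)

lemma coker_ar_hom: "hom f U Y ==> EX Q. hom (coker_ar A Y f) Y Q"
 using coker_ar_cokernel cokernelD(1) hom_cod by blast

lemma coker_ar_zero_iff:
 assumes f: "hom f U Y" and x: "hom x T Y"
 shows "coker_ar A Y f ** x = 0 \<longleftrightarrow> (EX T' e u. cov e T' T & hom u T' U & x ** e = f ** u)"
proof
 obtain Q where Q: "is_cokernel A Y f Q (coker_ar A Y f)" using coker_ar_cokernel[OF f] by blast
 note cd = cokernelD[OF Q hom_cod[OF f]]
 {
  assume "coker_ar A Y f ** x = 0"
  thus "EX T' e u. cov e T' T & hom u T' U & x ** e = f ** u" using image_local[OF f Q x] by blast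
 next
  assume "EX T' e u. cov e T' T & hom u T' U & x ** e = f ** u"
  then obtain T' e u where e: "cov e T' T" "hom u T' U" "x ** e = f ** u" by blast
  have "coker_ar A Y f ** x ** e = 0"
   using assoc[OF cov_hom[OF e(1)] x cd(1)] e(3) assoc[OF e(2) f cd(1)] cd(2)
    zero_comp[OF e(2) hom_cod[OF cd(1)]] by simp
  thus "coker_ar A Y f ** x = 0" using cov_zero[OF e(1) hom_comp[OF x cd(1)]] by blast
 }
qed

lemma mono_coker_zero_iff:
 assumes f: "hom f U Y" and m: "is_mono A U f" and x: "hom x T Y"
 shows "coker_ar A Y f ** x = 0 \<longleftrightarrow> (EX u. hom u T U & f ** u = x)"
proof
 obtain W g where g: "hom g Y W" "is_kernel A Y g U f" using mono_kernel[OF f m] by blast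
 note gd = kernelD[OF g(2) hom_cod[OF f]]
 {
  assume "coker_ar A Y f ** x = 0"
  then obtain T' e u where e: "cov e T' T" "hom u T' U" "x ** e = f ** u"
   using coker_ar_zero_iff[OF f x] by blast
  have "g ** x ** e = 0"
   using assoc[OF cov_hom[OF e(1)] x g(1)] e(3) assoc[OF e(2) f g(1)] gd(2)
    zero_comp[OF e(2) hom_cod[OF g(1)]] by simp
  hence "g ** x = 0" using cov_zero[OF e(1) hom_comp[OF x g(1)]] by blast
  thus "EX u. hom u T U & f ** u = x" using gd(3)[OF x] by blast
 next
  assume "EX u. hom u T U & f ** u = x"
  then obtain u where u: "hom u T U" "f ** u = x" by blast
  thus "coker_ar A Y f ** x = 0"
   unfolding coker_ar_zero_iff[OF f x]
   by (intro exI[of _ T] exI[of _ "idt A T"] exI[of _ u]) (simp add: cov_id[OF hom_dom[OF x]] comp_id[OF x])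
 }
qed

text \<open>A monomorphism is the kernel of some \<open>g\<close>; as \<open>f\<close> is also epi,
  \<open>g\<close> is zero, so the identity of \<open>Y\<close> lifts to a section of
  \<open>f\<close>.\<close>

lemma is_iso_mono_epi:
 assumes f: "hom f X Y" and m: "is_mono A X f" and e: "is_epi A Y f"
 shows "is_iso A X Y f"
proof -
 obtain W g where g: "hom g Y W" "is_kernel A Y g X f" using mono_kernel[OF f m] by blast
 note gd = kernelD[OF g(2) hom_cod[OF f]]
 have "g = 0" using gd(2) g(1) e epi_iff[OF f] by blast
 have iY: "hom (idt A Y) Y Y" using hom_id[OF hom_cod[OF f]] .
 hence "g ** idt A Y = 0" using \<open>g = 0\<close> zero_comp[OF iY hom_cod[OF g(1)]] by simp
 then obtain s where s: "hom s Y X" "f ** s = idt A Y" using gd(3)[OF iY] by blast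
 have "f ** (s ** f) = f ** idt A X"
  using assoc[OF f s(1) f] s(2) id_comp[OF f] comp_id[OF f] by simp
 hence "s ** f = idt A X"
  using mono_cancel[OF m hom_comp[OF f s(1)] hom_id[OF hom_dom[OF f]]] by blast
 thus ?thesis using f s unfolding is_iso_def hom_def by blast
qed

lemma zero_obj_ex: "EX Z. Z : obj A & idt A Z = 0"
 using ab unfolding abelian_category_def by blast

lemma hom_to_zero: "hom f T Z ==> idt A Z = 0 ==> f = 0"
 using id_comp[of f T Z] zero_comp[of f T Z Z] hom_cod[of f T Z] by simp


text \<open>\<open>pres Y Q \<rho>\<close>: the object \<open>Q\<close> is a subquotient of \<open>Y\<close>; \<open>\<rho> T x t\<close> says that the generalised element
 \<open>x : T \<rightarrow> Y\<close> lies in the subobject and has class \<open>t : T \<rightarrow> Q\<close>.\<close>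

definition pres :: "'o => 'o => ('o => 'a => 'a => bool) => bool" where
 "pres Y Q \<rho> \<longleftrightarrow> Y : obj A & Q : obj A &
   (ALL T x t. \<rho> T x t --> hom x T Y & hom t T Q) &
   (ALL T x t T' e. \<rho> T x t & hom e T' T --> \<rho> T' (x ** e) (t ** e)) &
   (ALL T x t y s. \<rho> T x t & \<rho> T y s --> \<rho> T (x - y) (t - s)) &
   (ALL T t. \<rho> T 0 t --> t = 0) &
   (ALL T:obj A. \<rho> T 0 0) &
   (ALL T t. hom t T Q --> (EX T' e x. cov e T' T & \<rho> T' x (t ** e))) &
   (ALL T x T' e t'. hom x T Y & cov e T' T & \<rho> T' (x ** e) t' --> (EX t. \<rho> T x t))"

lemma presD:
 assumes "pres Y Q \<rho>"
 shows pres_ob1: "Y : obj A" and pres_ob2: "Q : obj A"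
  and pres_hom1: "\<rho> T x t ==> hom x T Y" and pres_hom2: "\<rho> T x t ==> hom t T Q"
  and pres_restr: "\<rho> T x t ==> hom e T' T ==> \<rho> T' (x ** e) (t ** e)"
  and pres_diff: "\<rho> T x t ==> \<rho> T y s ==> \<rho> T (x - y) (t - s)"
  and pres_0: "\<rho> T 0 t ==> t = 0"
  and pres_zero: "T : obj A ==> \<rho> T 0 0"
  and pres_surj: "hom t T Q ==> EX T' e x. cov e T' T & \<rho> T' x (t ** e)"
  and pres_dom: "hom x T Y ==> cov e T' T ==> \<rho> T' (x ** e) t' ==> EX t. \<rho> T x t"
proof -
 have 1: "ALL T x t. \<rho> T x t --> hom x T Y & hom t T Q"
  and 2: "ALL T x t T' e. \<rho> T x t & hom e T' T --> \<rho> T' (x ** e) (t ** e)"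
  and 3: "ALL T x t y s. \<rho> T x t & \<rho> T y s --> \<rho> T (x - y) (t - s)"
  and 4: "ALL T t. \<rho> T 0 t --> t = 0" and 5: "ALL T:obj A. \<rho> T 0 0"
  and 6: "ALL T t. hom t T Q --> (EX T' e x. cov e T' T & \<rho> T' x (t ** e))"
  and 7: "ALL T x T' e t'. hom x T Y & cov e T' T & \<rho> T' (x ** e) t' --> (EX t. \<rho> T x t)"
  and 8: "Y : obj A" "Q : obj A"
  using assms unfolding pres_def by - (elim conjE, assumption)+
 show "Y : obj A" "Q : obj A" using 8 .
 show "\<rho> T x t ==> hom x T Y" "\<rho> T x t ==> hom t T Q" using 1 by auto
 show "\<rho> T x t ==> hom e T' T ==> \<rho> T' (x ** e) (t ** e)" using 2 by auto
 show "\<rho> T x t ==> \<rho> T y s ==> \<rho> T (x - y) (t - s)" using 3 by auto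
 show "\<rho> T 0 t ==> t = 0" using 4 by auto
 show "T : obj A ==> \<rho> T 0 0" using 5 by auto
 show "hom t T Q ==> EX T' e x. cov e T' T & \<rho> T' x (t ** e)" using 6 by auto
 show "hom x T Y ==> cov e T' T ==> \<rho> T' (x ** e) t' ==> EX t. \<rho> T x t" using 7[rule_format, of x T e T' t'] by simp
qed

lemma pres_uniq: "pres Y Q \<rho> ==> \<rho> T x t ==> \<rho> T x s ==> t = s"
 using pres_diff[of Y Q \<rho> T x t x s] pres_0[of Y Q \<rho> T "t - s"] by simp

lemma pres_uminus: "pres Y Q \<rho> ==> \<rho> T x t ==> \<rho> T (- x) (- t)"
 using pres_diff[of Y Q \<rho> T 0 0 x t] pres_zero[of Y Q \<rho> T] pres_hom1[of Y Q \<rho> T x t]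
 by (simp add: hom_def)

lemma pres_add: "pres Y Q \<rho> ==> \<rho> T x t ==> \<rho> T y s ==> \<rho> T (x + y) (t + s)"
 using pres_diff[of Y Q \<rho> T x t "- y" "- s"] pres_uminus[of Y Q \<rho> T y s] by simp

lemma pres_ksgn: "pres Y Q \<rho> ==> \<rho> T x t ==> \<rho> T (ksgn k x) (ksgn k t)"
 by (simp add: ksgn_def pres_uminus)

text \<open>Relations glue: a class of \<open>x\<close> exists by \<open>pres_dom\<close>, and
  arrows out of \<open>T\<close> are determined on a covering.\<close>

lemma pres_loc:
 assumes p: "pres Y Q \<rho>" and x: "hom x T Y" and t: "hom t T Q" and e: "cov e T' T"
  and r: "\<rho> T' (x ** e) (t ** e)"
 shows "\<rho> T x t"
proof -
 obtain s where s: "\<rho> T x s" using pres_dom[OF p x e r] by blast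
 have "s ** e = t ** e" using pres_uniq[OF p pres_restr[OF p s cov_hom[OF e]] r] .
 thus ?thesis using cov_cancel[OF e pres_hom2[OF p s] t] s by simp
qed

lemma pres_zero_loc:
 assumes p: "pres Y Q \<rho>" and x: "hom x T Y" and e: "cov e T' T" and r: "\<rho> T' (x ** e) 0"
 shows "\<rho> T x 0"
proof (rule pres_loc[OF p x _ e])
 show "hom 0 T Q" using hom_zero[OF hom_dom[OF x] pres_ob2[OF p]] .
 show "\<rho> T' (x ** e) (0 ** e)" using r zero_comp[OF cov_hom[OF e] pres_ob2[OF p]] by simp
qed

text \<open>It suffices to test the identity of \<open>Q\<close>, which locally is the class of an
  element. Equations between arrows of chosen subquotients are reduced to elements in this way
  throughout.\<close>

lemma pres_eq:
 assumes p: "pres Y Q \<rho>" and ab: "hom \<alpha> Q W" "hom \<beta> Q W"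
  and eq: "\<And>T x t. \<rho> T x t ==> \<alpha> ** t = \<beta> ** t"
 shows "\<alpha> = \<beta>"
proof -
 have i: "hom (idt A Q) Q Q" using hom_id[OF pres_ob2[OF p]] .
 obtain T' e x where e: "cov e T' Q" "\<rho> T' x (idt A Q ** e)" using pres_surj[OF p i] by blast
 hence "\<alpha> ** e = \<beta> ** e" using eq[of T' x e] id_comp[OF cov_hom[OF e(1)]] by simp
 thus ?thesis using cov_cancel[OF e(1) ab] by blast
qed

text \<open>Choose an element \<open>x\<close> whose class is a covering \<open>e\<close> of
  \<open>Q\<close>, a kind of universal element. By \<open>ker\<close>, the class of its image is
  killed by whatever \<open>e\<close> kills, so it descends along \<open>e\<close> to the wanted
  arrow.\<close>

lemma pres_arrow:
 assumes p: "pres Y Q \<rho>" and p': "pres Y' Q' \<rho>'" and \<phi>: "hom \<phi> Y Y'"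
  and dom: "\<And>T x t. \<rho> T x t ==> EX t'. \<rho>' T (\<phi> ** x) t'"
  and ker: "\<And>T x. \<rho> T x 0 ==> \<rho>' T (\<phi> ** x) 0"
 shows "EX \<theta>. hom \<theta> Q Q' & (ALL T x t. \<rho> T x t --> \<rho>' T (\<phi> ** x) (\<theta> ** t))"
proof -
 have i: "hom (idt A Q) Q Q" using hom_id[OF pres_ob2[OF p]] .
 obtain T' e x where "cov e T' Q" "\<rho> T' x (idt A Q ** e)" using pres_surj[OF p i] by blast
 hence e: "cov e T' Q" "\<rho> T' x e" using id_comp[OF cov_hom] by auto
 note x = pres_hom1[OF p e(2)] and he = cov_hom[OF e(1)]
 obtain t' where t': "\<rho>' T' (\<phi> ** x) t'" using dom[OF e(2)] by blast
 note ht' = pres_hom2[OF p' t']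
 have "EX \<theta>. hom \<theta> Q Q' & \<theta> ** e = t'"
 proof (rule cov_descent[OF e(1) ht'])
  fix S k assume k: "hom k S T'" "e ** k = 0"
  have "\<rho>' S (\<phi> ** (x ** k)) 0" using ker pres_restr[OF p e(2) k(1)] k(2) by simp
  moreover have "\<rho>' S (\<phi> ** (x ** k)) (t' ** k)"
   using pres_restr[OF p' t' k(1)] assoc[OF k(1) x \<phi>] by simp
  ultimately show "t' ** k = 0" using pres_uniq[OF p'] by blast
 qed
 then obtain \<theta> where \<theta>: "hom \<theta> Q Q'" "\<theta> ** e = t'" by blast
 have "\<rho>' T (\<phi> ** y) (\<theta> ** t)" if r: "\<rho> T y t" for T y t
 proof -
  note y = pres_hom1[OF p r] and ht = pres_hom2[OF p r]
  obtain S e' h where h: "cov e' S T" "hom h S T'" "e ** h = t ** e'"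
   using cov_pullback[OF e(1) ht] by blast
  note he' = cov_hom[OF h(1)]
  have xh: "hom (x ** h) S Y" and ye: "hom (y ** e') S Y" using hom_comp h(2) x he' y by blast+
  have "\<rho> S (x ** h - y ** e') 0"
   using pres_diff[OF p pres_restr[OF p e(2) h(2)] pres_restr[OF p r he']] h(3) by simp
  hence "\<rho>' S (\<phi> ** (x ** h) - \<phi> ** (y ** e')) 0" using ker comp_diff[OF xh ye \<phi>] by fastforce
  moreover have "\<rho>' S (\<phi> ** (x ** h)) (t' ** h)" using pres_restr[OF p' t' h(2)] assoc[OF h(2) x \<phi>] by simp
  ultimately have "\<rho>' S (\<phi> ** (x ** h) - (\<phi> ** (x ** h) - \<phi> ** (y ** e'))) (t' ** h - 0)"
   using pres_diff[OF p'] by blast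
  hence "\<rho>' S (\<phi> ** (y ** e')) (t' ** h)" by simp
  moreover have "t' ** h = \<theta> ** t ** e'"
   using \<theta>(2) h(3) assoc[OF h(2) he \<theta>(1)] assoc[OF he' ht \<theta>(1)] by simp
  moreover have "\<phi> ** (y ** e') = \<phi> ** y ** e'" using assoc[OF he' y \<phi>] by simp
  ultimately have "\<rho>' S (\<phi> ** y ** e') (\<theta> ** t ** e')" by simp
  thus ?thesis using pres_loc[OF p' hom_comp[OF y \<phi>] hom_comp[OF ht \<theta>(1)] h(1)] by blast
 qed
 thus ?thesis using \<theta>(1) by blast
qed

text \<open>Injectivity makes \<open>\<theta>\<close> mono, and local surjectivity modulo relations
  makes it epi; no inverse has to be written down.\<close>

lemma pres_iso:
 assumes p: "pres Y Q \<rho>" and p': "pres Y' Q' \<rho>'" and \<phi>: "hom \<phi> Y Y'"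
  and \<theta>: "hom \<theta> Q Q'" "\<And>T x t. \<rho> T x t ==> \<rho>' T (\<phi> ** x) (\<theta> ** t)"
  and inj: "\<And>T x t. \<rho> T x t ==> \<rho>' T (\<phi> ** x) 0 ==> \<rho> T x 0"
  and surj: "\<And>T x' t'. \<rho>' T x' t' ==>
   EX T' e x t. cov e T' T & \<rho> T' x t & \<rho>' T' (\<phi> ** x - x' ** e) 0"
 shows "is_iso A Q Q' \<theta>"
proof (rule is_iso_mono_epi[OF \<theta>(1)])
 show "is_mono A Q \<theta>" unfolding mono_iff[OF \<theta>(1)]
 proof (intro allI impI)
  fix T t assume "hom t T Q & \<theta> ** t = 0"
  hence t: "hom t T Q" "\<theta> ** t = 0" by auto
  obtain T' e x where e: "cov e T' T" "\<rho> T' x (t ** e)" using pres_surj[OF p t(1)] by blast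
  have "\<theta> ** (t ** e) = 0"
   using assoc[OF cov_hom[OF e(1)] t(1) \<theta>(1)] t(2) zero_comp[OF cov_hom[OF e(1)] pres_ob2[OF p']] by simp
  hence "\<rho> T' x 0" using inj[OF e(2)] \<theta>(2)[OF e(2)] by simp
  hence "t ** e = 0" using pres_uniq[OF p e(2)] by blast
  thus "t = 0" using cov_zero[OF e(1) t(1)] by blast
 qed
 show "is_epi A Q' \<theta>" unfolding epi_iff[OF \<theta>(1)]
 proof (intro allI impI)
  fix W y assume "hom y Q' W & y ** \<theta> = 0"
  hence y: "hom y Q' W" "y ** \<theta> = 0" by auto
  have "y = 0"
  proof (rule pres_eq[OF p' y(1)])
   show z: "hom 0 Q' W" using hom_zero[OF pres_ob2[OF p'] hom_cod[OF y(1)]] .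
   fix T x' t' assume r: "\<rho>' T x' t'"
   note ht' = pres_hom2[OF p' r]
   obtain T' e x t where e: "cov e T' T" "\<rho> T' x t" "\<rho>' T' (\<phi> ** x - x' ** e) 0"
    using surj[OF r] by blast
   note he = cov_hom[OF e(1)]
   have te: "t' ** e = \<theta> ** t"
    using pres_uniq[OF p' pres_diff[OF p' \<theta>(2)[OF e(2)] pres_restr[OF p' r he]] e(3)] by simp
   have "y ** t' ** e = y ** \<theta> ** t"
    using te assoc[OF he ht' y(1)] assoc[OF pres_hom2[OF p e(2)] \<theta>(1) y(1)] by simp
   also have "\<dots> = 0" using y(2) zero_comp[OF pres_hom2[OF p e(2)] hom_cod[OF y(1)]] by simp
   finally have "y ** t' = 0" using cov_zero[OF e(1) hom_comp[OF ht' y(1)]] by blast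
   thus "y ** t' = 0 ** t'" using zero_comp[OF ht' hom_cod[OF y(1)]] by simp
  qed
  thus "y = 0" .
 qed
qed

lemma is_iso_hom: "is_iso A X Y f ==> X : obj A ==> Y : obj A ==> hom f X Y"
 by (simp add: is_iso_def hom_def)

text \<open>Both objects are subquotients of one \<open>Y\<close>, so the isomorphism is induced by
  the identity of \<open>Y\<close>. Its effect on elements is kept in the conclusion because
  naturality is later read off from it.\<close>

lemma pres_iso_ex:
 assumes p: "pres Y Q \<rho>" and p': "pres Y Q' \<rho>'"
  and dom: "\<And>T x t. \<rho> T x t ==> EX t'. \<rho>' T x t'"
  and ker: "\<And>T x. \<rho> T x 0 ==> \<rho>' T x 0"
  and inj: "\<And>T x t. \<rho> T x t ==> \<rho>' T x 0 ==> \<rho> T x 0"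
  and surj: "\<And>T x' t'. \<rho>' T x' t' ==> EX T' e x t. cov e T' T & \<rho> T' x t & \<rho>' T' (x - x' ** e) 0"
 shows "EX \<theta>. is_iso A Q Q' \<theta> & (ALL T x t. \<rho> T x t --> \<rho>' T x (\<theta> ** t))"
proof -
 have i: "hom (idt A Y) Y Y" using hom_id[OF pres_ob1[OF p]] .
 have ix: "idt A Y ** x = x" if "\<rho> T x t" for T x t using id_comp[OF pres_hom1[OF p that]] .
 have "EX \<theta>. hom \<theta> Q Q' & (ALL T x t. \<rho> T x t --> \<rho>' T (idt A Y ** x) (\<theta> ** t))"
  by (rule pres_arrow[OF p p' i]) (use ix dom ker in auto)
 then obtain \<theta> where \<theta>: "hom \<theta> Q Q'" "\<And>T x t. \<rho> T x t ==> \<rho>' T (idt A Y ** x) (\<theta> ** t)" by blast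
 have "is_iso A Q Q' \<theta>"
 proof (rule pres_iso[OF p p' i \<theta>])
  fix T x t assume "\<rho> T x t" "\<rho>' T (idt A Y ** x) 0"
  thus "\<rho> T x 0" using inj ix by simp
 next
  fix T x' t' assume "\<rho>' T x' t'"
  then obtain T' e x t where "cov e T' T" "\<rho> T' x t" "\<rho>' T' (x - x' ** e) 0" using surj by blast
  thus "EX T' e x t. cov e T' T & \<rho> T' x t & \<rho>' T' (idt A Y ** x - x' ** e) 0" using ix by metis
 qed
 thus ?thesis using \<theta>(2) ix by (auto intro!: exI[of _ \<theta>])
qed

text \<open>A subquotient of a subquotient as a subquotient of the original object. Cohomology of
  pages and of truncated total complexes is expressed in this way by elements of one fixed
  complex.\<close>

definition rcomp :: "('o => 'a => 'a => bool) => ('o => 'a => 'a => bool) => 'o => 'a => 'a => bool" where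
 "rcomp \<rho> \<sigma> T x r \<longleftrightarrow> (EX q. \<rho> T x q & \<sigma> T q r)"

lemma pres_rcomp:
 assumes p: "pres Y Q \<rho>" and s: "pres Q R \<sigma>"
 shows "pres Y R (rcomp \<rho> \<sigma>)"
 unfolding pres_def rcomp_def
proof (intro conjI allI impI ballI)
 show "Y : obj A" "R : obj A" using pres_ob1[OF p] pres_ob2[OF s] .
next
 fix T x t assume "EX q. \<rho> T x q & \<sigma> T q t"
 thus "hom x T Y" "hom t T R" using pres_hom1[OF p] pres_hom2[OF s] by blast+
next
 fix T x t T' e assume "(EX q. \<rho> T x q & \<sigma> T q t) & hom e T' T"
 thus "EX q. \<rho> T' (x ** e) q & \<sigma> T' q (t ** e)" using pres_restr[OF p] pres_restr[OF s] by blast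
next
 fix T x t y u assume "(EX q. \<rho> T x q & \<sigma> T q t) & (EX q. \<rho> T y q & \<sigma> T q u)"
 thus "EX q. \<rho> T (x - y) q & \<sigma> T q (t - u)" using pres_diff[OF p] pres_diff[OF s] by blast
next
 fix T t assume "EX q. \<rho> T 0 q & \<sigma> T q t"
 thus "t = 0" using pres_0[OF p] pres_0[OF s] by blast
next
 fix T assume "T : obj A"
 thus "EX q. \<rho> T 0 q & \<sigma> T q 0" using pres_zero[OF p] pres_zero[OF s] by blast
next
 fix T t assume "hom t T R"
 then obtain T1 e q where 1: "cov e T1 T" "\<sigma> T1 q (t ** e)" using pres_surj[OF s] by blast
 then obtain T2 f x where 2: "cov f T2 T1" "\<rho> T2 x (q ** f)" using pres_surj[OF p pres_hom1[OF s]] by blast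
 have "\<sigma> T2 (q ** f) (t ** (e ** f))"
  using pres_restr[OF s 1(2) cov_hom[OF 2(1)]] assoc[OF cov_hom[OF 2(1)] cov_hom[OF 1(1)] \<open>hom t T R\<close>] by simp
 thus "EX T' e x. cov e T' T & (EX q. \<rho> T' x q & \<sigma> T' q (t ** e))"
  using cov_comp[OF 1(1) 2(1)] 2(2) by blast
next
 fix T x T' e t' assume "hom x T Y & cov e T' T & (EX q. \<rho> T' (x ** e) q & \<sigma> T' q t')"
 then obtain q' where h: "hom x T Y" "cov e T' T" "\<rho> T' (x ** e) q'" "\<sigma> T' q' t'" by blast
 obtain q where q: "\<rho> T x q" using pres_dom[OF p h(1,2,3)] by blast
 have "q ** e = q'" using pres_uniq[OF p pres_restr[OF p q cov_hom[OF h(2)]] h(3)] .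
 then obtain t where "\<sigma> T q t" using pres_dom[OF s pres_hom2[OF p q] h(2)] h(4) by blast
 thus "EX t q. \<rho> T x q & \<sigma> T q t" using q by blast
qed

subsection \<open>Chosen subquotients\<close>

definition sqr :: "('o, 'a) subq => 'o => 'a => 'a => bool" where
 "sqr s T x t \<longleftrightarrow> (EX w. hom w T (sub_ob s) & sub_ar s ** w = x & quo_ar s ** w = t)"

text \<open>What is retained of a chosen \<open>subq\<close>. Membership in its numerator is always
  phrased as \<open>EX t. sqr s T x t\<close>, membership in its denominator as
  \<open>sqr s T x 0\<close>.\<close>

definition SQ :: "'o => ('o, 'a) subq => bool" where
 "SQ Y s \<longleftrightarrow> hom (sub_ar s) (sub_ob s) Y & is_mono A (sub_ob s) (sub_ar s) &
   cov (quo_ar s) (sub_ob s) (quo_ob s) & pres Y (quo_ob s) (sqr s)"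

abbreviation (input) "sH Y n \<equiv> sqr (coh A Y n)"
abbreviation (input) "qH Y n \<equiv> quo_ob (coh A Y n)"
abbreviation (input) "sE D r j n \<equiv> sqr (fil_E A D r j n)"
abbreviation (input) "qE D r j n \<equiv> quo_ob (fil_E A D r j n)"
abbreviation (input) "dfil C F X \<equiv> descent_fil A C F X"

lemma SQ_pres: "SQ Y s ==> pres Y (quo_ob s) (sqr s)"
 and SQ_sub: "SQ Y s ==> hom (sub_ar s) (sub_ob s) Y"
 and SQ_mono: "SQ Y s ==> is_mono A (sub_ob s) (sub_ar s)"
 and SQ_cov: "SQ Y s ==> cov (quo_ar s) (sub_ob s) (quo_ob s)"
 by (simp_all add: SQ_def)

lemma SQ_quo: "SQ Y s ==> hom (quo_ar s) (sub_ob s) (quo_ob s)"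
 by (simp add: SQ_cov cov_hom)

lemma SQ_generic: "SQ Y s ==> sqr s (sub_ob s) (sub_ar s) (quo_ar s)"
 unfolding sqr_def
 using hom_id[OF hom_dom[OF SQ_sub]] comp_id[OF SQ_sub] comp_id[OF SQ_quo] by blast

text \<open>The \<open>THE\<close> in \<open>sq_map\<close> is well defined because
  \<open>sub_ar\<close> is mono and \<open>quo_ar\<close> is epi; the relation for the universal
  element \<open>sub_ar s\<close> already determines the arrow.\<close>

lemma sq_map_eqI:
 assumes s: "SQ Y s" and s': "SQ Y' s'" and \<phi>: "hom \<phi> Y Y'"
  and \<theta>: "hom \<theta> (quo_ob s) (quo_ob s')" and rel: "sqr s' (sub_ob s) (\<phi> ** sub_ar s) (\<theta> ** quo_ar s)"
 shows "sq_map A s s' \<phi> = \<theta>"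
 unfolding sq_map_def
proof (rule the_equality)
 obtain w where w: "hom w (sub_ob s) (sub_ob s')" "sub_ar s' ** w = \<phi> ** sub_ar s"
  "quo_ar s' ** w = \<theta> ** quo_ar s" using rel unfolding sqr_def by blast
 thus "\<theta> : arr A (quo_ob s) (quo_ob s') &
   (EX w:arr A (sub_ob s) (sub_ob s'). sub_ar s' ** w = \<phi> ** sub_ar s & \<theta> ** quo_ar s = quo_ar s' ** w)"
  using hom_arr[OF \<theta>] hom_arr[OF w(1)] by metis
 fix t assume "t : arr A (quo_ob s) (quo_ob s') &
   (EX w:arr A (sub_ob s) (sub_ob s'). sub_ar s' ** w = \<phi> ** sub_ar s & t ** quo_ar s = quo_ar s' ** w)"
 then obtain v where v: "t : arr A (quo_ob s) (quo_ob s')" "v : arr A (sub_ob s) (sub_ob s')"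
  "sub_ar s' ** v = \<phi> ** sub_ar s" "t ** quo_ar s = quo_ar s' ** v" by blast
 have hv: "hom v (sub_ob s) (sub_ob s')" and ht: "hom t (quo_ob s) (quo_ob s')"
  using v(1,2) w(1) \<theta> by (auto simp: hom_def)
 have "v = w" using mono_cancel[OF SQ_mono[OF s'] hv w(1)] v(3) w(2) by simp
 thus "t = \<theta>" using cov_cancel[OF SQ_cov[OF s] ht \<theta>] v(4) w(3) by simp
qed

lemma sq_map_spec:
 assumes s: "SQ Y s" and s': "SQ Y' s'" and \<phi>: "hom \<phi> Y Y'"
  and dom: "\<And>T x t. sqr s T x t ==> EX t'. sqr s' T (\<phi> ** x) t'"
  and ker: "\<And>T x. sqr s T x 0 ==> sqr s' T (\<phi> ** x) 0"
 shows "hom (sq_map A s s' \<phi>) (quo_ob s) (quo_ob s')"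
  and "sqr s T x t ==> sqr s' T (\<phi> ** x) (sq_map A s s' \<phi> ** t)"
proof -
 have "EX \<theta>. hom \<theta> (quo_ob s) (quo_ob s') & (ALL T x t. sqr s T x t --> sqr s' T (\<phi> ** x) (\<theta> ** t))"
  by (rule pres_arrow[OF SQ_pres[OF s] SQ_pres[OF s'] \<phi>]) (use dom ker in auto)
 then obtain \<theta> where \<theta>: "hom \<theta> (quo_ob s) (quo_ob s')"
  "ALL T x t. sqr s T x t --> sqr s' T (\<phi> ** x) (\<theta> ** t)" by blast
 have "sq_map A s s' \<phi> = \<theta>"
  by (rule sq_map_eqI[OF s s' \<phi> \<theta>(1)]) (use \<theta>(2) SQ_generic[OF s] in blast)
 thus "hom (sq_map A s s' \<phi>) (quo_ob s) (quo_ob s')"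
  and "sqr s T x t ==> sqr s' T (\<phi> ** x) (sq_map A s s' \<phi> ** t)" using \<theta> by auto
qed

lemma is_subquot_sub_unique:
 assumes s: "is_subquot A Y G B s" and Y: "Y : obj A"
  and g: "\<And>g. g : G ==> EX Z. hom g Y Z"
 shows "hom (sub_ar s) (sub_ob s) Y" "is_mono A (sub_ob s) (sub_ar s)"
  "hom (quo_ar s) (sub_ob s) (quo_ob s)"
  "hom x T Y ==> (EX w. hom w T (sub_ob s) & sub_ar s ** w = x) \<longleftrightarrow> (ALL g:G. g ** x = 0)"
proof -
 show h: "hom (sub_ar s) (sub_ob s) Y" "hom (quo_ar s) (sub_ob s) (quo_ob s)"
  using s Y by (auto simp: is_subquot_def hom_def)
 have z: "g ** (sub_ar s ** w) = 0" if gG: "g : G" and w: "hom w T (sub_ob s)" for g w T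
 proof -
  obtain Z where Z: "hom g Y Z" using g[OF gG] by blast
  have "g ** sub_ar s = 0" using s gG by (simp add: is_subquot_def)
  thus ?thesis using assoc[OF w h(1) Z] zero_comp[OF w hom_cod[OF Z]] by simp
 qed
 have u: "EX! w. w : arr A T (sub_ob s) & sub_ar s ** w = x" if "hom x T Y" "ALL g:G. g ** x = 0" for T x
  using s that unfolding is_subquot_def hom_def by blast
 show "is_mono A (sub_ob s) (sub_ar s)" unfolding mono_iff[OF h(1)]
 proof (intro allI impI)
  fix T x assume x: "hom x T (sub_ob s) & sub_ar s ** x = 0"
  hence T: "T : obj A" by (simp add: hom_def)
  have "ALL g:G. g ** 0 = 0" using comp_zero[OF T] g by blast
  from u[OF hom_zero[OF T Y] this] have "EX! w. w : arr A T (sub_ob s) & sub_ar s ** w = 0" .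
  moreover have "0 : arr A T (sub_ob s)" "sub_ar s ** 0 = 0"
   using hom_zero[OF T hom_dom[OF h(1)]] comp_zero[OF T h(1)] by (auto simp: hom_def)
  ultimately show "x = 0" using x hom_arr by blast
 qed
 show "hom x T Y ==> (EX w. hom w T (sub_ob s) & sub_ar s ** w = x) \<longleftrightarrow> (ALL g:G. g ** x = 0)"
  using u[of x T] z hom_dom[OF h(1)] unfolding hom_def by blast
qed

lemma common_kernel_ex:
 assumes "finite G" "Y : obj A" "\<And>g. g : G ==> EX Z. hom g Y Z"
 shows "EX K k. hom k K Y & is_mono A K k & (ALL g:G. g ** k = 0) &
  (ALL T x. hom x T Y & (ALL g:G. g ** x = 0) --> (EX w. hom w T K & k ** w = x))"
 using assms(1,3)
proof (induction G rule: finite_induct)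
 case empty
 have i: "hom (idt A Y) Y Y" using hom_id[OF assms(2)] .
 moreover have "is_mono A Y (idt A Y)" unfolding mono_iff[OF i] using id_comp by auto
 moreover have "EX w. hom w T Y & idt A Y ** w = x" if "hom x T Y" for T x using id_comp[OF that] that by blast
 ultimately show ?case by (intro exI[of _ Y] exI[of _ "idt A Y"]) simp
next
 case (insert g G)
 have "EX K k. hom k K Y & is_mono A K k & (ALL g:G. g ** k = 0) &
  (ALL T x. hom x T Y & (ALL g:G. g ** x = 0) --> (EX w. hom w T K & k ** w = x))"
  by (rule insert.IH) (use insert.prems in blast)
 then obtain K k where k: "hom k K Y" "is_mono A K k" "ALL g:G. g ** k = 0"
  and ku: "ALL T x. hom x T Y & (ALL g:G. g ** x = 0) --> (EX w. hom w T K & k ** w = x)" by (elim exE conjE)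
 obtain Z where g: "hom g Y Z" using insert.prems by blast
 have gk: "hom (g ** k) K Z" using hom_comp[OF k(1) g] .
 obtain L l where l: "is_kernel A K (g ** k) L l" using kernel_ex[OF gk] by blast
 note ld = kernelD[OF l hom_dom[OF k(1)]] and lm = kernel_mono[OF l gk]
 have kl: "hom (k ** l) L Y" using hom_comp[OF ld(1) k(1)] .
 have 1: "is_mono A L (k ** l)" unfolding mono_iff[OF kl]
 proof (intro allI impI)
  fix T x assume "hom x T L & k ** l ** x = 0"
  hence x: "hom x T L" "k ** l ** x = 0" by auto
  have "k ** (l ** x) = 0" using assoc[OF x(1) ld(1) k(1)] x(2) by simp
  hence "l ** x = 0" using mono_zero[OF k(2,1) hom_comp[OF x(1) ld(1)]] by blast
  thus "x = 0" using mono_zero[OF lm ld(1) x(1)] by blast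
 qed
 have 2: "ALL h:insert g G. h ** (k ** l) = 0"
 proof
  fix h assume "h : insert g G"
  show "h ** (k ** l) = 0"
  proof (cases "h = g")
   case True
   thus ?thesis using assoc[OF ld(1) k(1) g] ld(2) by simp
  next
   case False
   then obtain W where W: "hom h Y W" "h : G" using insert.prems \<open>h : insert g G\<close> by blast
   hence "h ** k = 0" using k(3) by blast
   thus ?thesis using assoc[OF ld(1) k(1) W(1)] zero_comp[OF ld(1) hom_cod[OF W(1)]] by simp
  qed
 qed
 have 3: "ALL T x. hom x T Y & (ALL h:insert g G. h ** x = 0) --> (EX w. hom w T L & k ** l ** w = x)"
 proof (intro allI impI)
  fix T x assume "hom x T Y & (ALL h:insert g G. h ** x = 0)"
  hence x: "hom x T Y" "g ** x = 0" "ALL h:G. h ** x = 0" by auto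
  obtain v where v: "hom v T K" "k ** v = x" using ku x(1,3) by blast
  have "g ** k ** v = 0" using assoc[OF v(1) k(1) g] v(2) x(2) by simp
  then obtain w where w: "hom w T L" "l ** w = v" using ld(3)[OF v(1)] by blast
  hence "k ** l ** w = x" using v assoc[OF w(1) ld(1) k(1)] by simp
  thus "EX w. hom w T L & k ** l ** w = x" using w(1) by blast
 qed
 show ?case using kl 1 2 3 by (intro exI[of _ L] exI[of _ "k ** l"]) simp
qed

text \<open>A sum of two images is the image of a single arrow from the biproduct; this turns a
  subquotient with two relations, as in \<open>fil_E\<close>, into one cokernel.\<close>

lemma biprod_copair:
 assumes f: "hom f U Y" and g: "hom g V Y"
 shows "EX W h. hom h W Y &
  (ALL T y. hom y Y T --> (y ** h = 0 \<longleftrightarrow> y ** f = 0 & y ** g = 0)) &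
  (ALL T x. hom x T Y --> (EX w. hom w T W & h ** w = x) \<longleftrightarrow>
    (EX u v. hom u T U & hom v T V & x = f ** u + g ** v))"
proof -
 obtain W i j p q where B: "hom i U W" "hom j V W" "hom p W U" "hom q W V"
  "p ** i = idt A U" "q ** j = idt A V" "p ** j = 0" "q ** i = 0"
  using biprod2_ex[OF hom_dom[OF f] hom_dom[OF g]] by blast
 have fp: "hom (f ** p) W Y" and gq: "hom (g ** q) W Y" using hom_comp B f g by blast+
 have h: "hom (f ** p + g ** q) W Y" using hom_add[OF fp gq] .
 have act: "(f ** p + g ** q) ** w = f ** (p ** w) + g ** (q ** w)" if "hom w T W" for w T
  using add_comp[OF that fp gq] assoc[OF that B(3) f] assoc[OF that B(4) g] by simp
 have hi: "(f ** p + g ** q) ** i = f" "(f ** p + g ** q) ** j = g"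
  unfolding act[OF B(1)] act[OF B(2)]
  using B(5-8) comp_id[OF f] comp_id[OF g] comp_zero[OF hom_dom[OF f] g] comp_zero[OF hom_dom[OF g] f] by auto
 have "y ** (f ** p + g ** q) = 0 \<longleftrightarrow> y ** f = 0 & y ** g = 0" if y: "hom y Y T" for T y
 proof
  assume "y ** (f ** p + g ** q) = 0"
  thus "y ** f = 0 & y ** g = 0"
   using assoc[OF B(1) h y] assoc[OF B(2) h y] hi zero_comp[OF B(1) hom_cod[OF y]]
    zero_comp[OF B(2) hom_cod[OF y]] by simp
 next
  assume "y ** f = 0 & y ** g = 0"
  thus "y ** (f ** p + g ** q) = 0"
   using comp_add[OF fp gq y] assoc[OF B(3) f y] assoc[OF B(4) g y]
    zero_comp[OF B(3) hom_cod[OF y]] zero_comp[OF B(4) hom_cod[OF y]] by simp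
 qed
 moreover have "(EX w. hom w T W & (f ** p + g ** q) ** w = x) \<longleftrightarrow>
    (EX u v. hom u T U & hom v T V & x = f ** u + g ** v)" if x: "hom x T Y" for T x
 proof
  assume "EX w. hom w T W & (f ** p + g ** q) ** w = x"
  then obtain w where w: "hom w T W" "(f ** p + g ** q) ** w = x" by blast
  thus "EX u v. hom u T U & hom v T V & x = f ** u + g ** v"
   using act[OF w(1)] hom_comp[OF w(1) B(3)] hom_comp[OF w(1) B(4)] by (intro exI[of _ "p ** w"] exI[of _ "q ** w"]) simp
 next
  assume "EX u v. hom u T U & hom v T V & x = f ** u + g ** v"
  then obtain u v where uv: "hom u T U" "hom v T V" "x = f ** u + g ** v" by blast
  have iu: "hom (i ** u) T W" and jv: "hom (j ** v) T W" using hom_comp uv B by blast+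
  have "(f ** p + g ** q) ** (i ** u + j ** v) = x"
   using comp_add[OF iu jv h] assoc[OF uv(1) B(1) h] assoc[OF uv(2) B(2) h] hi uv(3) by simp
  thus "EX w. hom w T W & (f ** p + g ** q) ** w = x" using hom_add[OF iu jv] by blast
 qed
 ultimately show ?thesis using h by blast
qed

text \<open>\<open>subquot\<close> is a \<open>SOME\<close> choice: a subquotient is first built
  from a common kernel and a cokernel, and then everything is derived afresh for the chosen one from
  its universal properties.\<close>

lemma subquot2:
 assumes Y: "Y : obj A" and G: "finite G" "\<And>g. g : G ==> EX Z. hom g Y Z"
  and b: "hom b U Y" "\<And>g. g : G ==> g ** b = 0" and c: "hom c V Y" "\<And>g. g : G ==> g ** c = 0"
 defines "s \<equiv> subquot A Y G {(U, b), (V, c)}"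
 shows "SQ Y s" and "(EX t. sqr s T x t) \<longleftrightarrow> hom x T Y & (ALL g:G. g ** x = 0)"
  and "sqr s T x 0 \<longleftrightarrow> hom x T Y &
   (EX T' e u v. cov e T' T & hom u T' U & hom v T' V & x ** e = b ** u + c ** v)"
proof -
 obtain K k where k: "hom k K Y" "is_mono A K k" "ALL g:G. g ** k = 0"
  "\<And>T x. hom x T Y ==> ALL g:G. g ** x = 0 ==> EX w. hom w T K & k ** w = x"
  using common_kernel_ex[OF G(1) Y G(2)] by blast
 obtain b' where b': "hom b' U K" "k ** b' = b" using k(4)[OF b(1)] b(2) by blast
 obtain c' where c': "hom c' V K" "k ** c' = c" using k(4)[OF c(1)] c(2) by blast
 \<comment> \<open>As \<open>k\<close> is mono, \<open>b'\<close> and \<open>c'\<close> are the only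
   lifts, so the quantifier over lifts in \<open>is_subquot\<close> collapses.\<close>
 have cond: "(ALL (U', b0):{(U, b), (V, c)}. ALL w:arr A U' K. k ** w = b0 --> y ** w = 0) \<longleftrightarrow> y ** b' = 0 & y ** c' = 0" for y
 proof -
  have "w = b'" if "w : arr A U K" "k ** w = b" for w
   using that b' mono_cancel[OF k(2) _ b'(1), of w] by (simp add: hom_def)
  moreover have "w = c'" if "w : arr A V K" "k ** w = c" for w
   using that c' mono_cancel[OF k(2) _ c'(1), of w] by (simp add: hom_def)
  ultimately show ?thesis using b' c' by (auto simp: hom_def)
 qed
 obtain W h where h: "hom h W K" "\<And>T y. hom y K T ==> y ** h = 0 \<longleftrightarrow> y ** b' = 0 & y ** c' = 0"
  "\<And>T x. hom x T K ==> (EX w. hom w T W & h ** w = x) \<longleftrightarrow>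
    (EX u v. hom u T U & hom v T V & x = b' ** u + c' ** v)"
  using biprod_copair[OF b'(1) c'(1)] by blast
 obtain Q q where q: "is_cokernel A K h Q q" using cokernel_ex[OF h(1)] by blast
 note qd = cokernelD[OF q hom_cod[OF h(1)]]
 have "is_subquot A Y G {(U, b), (V, c)} \<lparr>sub_ob = K, sub_ar = k, quo_ob = Q, quo_ar = q\<rparr>"
 proof -
  have 1: "EX! w. w : arr A T K & k ** w = x" if x: "T : obj A" "x : arr A T Y" "ALL g:G. g ** x = 0" for T x
  proof -
   have "hom x T Y" using x Y by (simp add: hom_def)
   then obtain w where w: "hom w T K" "k ** w = x" using k(4) x(3) by blast
   show ?thesis
   proof (rule ex1I[of _ w])
    show "w : arr A T K & k ** w = x" using w by (simp add: hom_def)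
    fix v assume v: "v : arr A T K & k ** v = x"
    hence "hom v T K" using w by (simp add: hom_def)
    thus "v = w" using mono_cancel[OF k(2) _ w(1)] v w(2) by simp
   qed
  qed
  have 2: "EX! t. t : arr A Q T & t ** q = y"
   if y: "T : obj A" "y : arr A K T" "ALL (U', b0):{(U, b), (V, c)}. ALL w:arr A U' K. k ** w = b0 --> y ** w = 0" for T y
  proof -
   have hy: "hom y K T" using y(1,2) k(1) by (simp add: hom_def)
   have "y ** b' = 0 & y ** c' = 0" using y(3) unfolding cond .
   hence "y ** h = 0" using h(2)[OF hy] by simp
   thus ?thesis using q y(1,2) by (simp add: is_cokernel_def)
  qed
  have "q ** b' = 0 & q ** c' = 0" using h(2)[OF qd(1)] qd(2) by blast
  hence 3: "ALL (U', b0):{(U, b), (V, c)}. ALL w:arr A U' K. k ** w = b0 --> q ** w = 0" unfolding cond .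
  show ?thesis unfolding is_subquot_def select_convs subq.simps
   using 1 2 3 k(1,3) qd(1) unfolding hom_def by blast
 qed
 hence s: "is_subquot A Y G {(U, b), (V, c)} s" unfolding s_def subquot_def by (rule someI)
 note su = is_subquot_sub_unique[OF s Y G(2), simplified]
 show dom: "(EX t. sqr s T x t) \<longleftrightarrow> hom x T Y & (ALL g:G. g ** x = 0)" for T x
  using su(4)[of x T] hom_comp[OF _ su(1), of _ T] unfolding sqr_def by blast
 obtain b1 where b1: "hom b1 U (sub_ob s)" "sub_ar s ** b1 = b" using su(4)[OF b(1)] b(2) by blast
 obtain c1 where c1: "hom c1 V (sub_ob s)" "sub_ar s ** c1 = c" using su(4)[OF c(1)] c(2) by blast
 have cond1: "(ALL (U', b0):{(U, b), (V, c)}. ALL w:arr A U' (sub_ob s). sub_ar s ** w = b0 --> y ** w = 0) \<longleftrightarrow> y ** b1 = 0 & y ** c1 = 0" for y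
 proof -
  have "w = b1" if "w : arr A U (sub_ob s)" "sub_ar s ** w = b" for w
   using that b1 mono_cancel[OF su(2) _ b1(1), of w] by (simp add: hom_def)
  moreover have "w = c1" if "w : arr A V (sub_ob s)" "sub_ar s ** w = c" for w
   using that c1 mono_cancel[OF su(2) _ c1(1), of w] by (simp add: hom_def)
  ultimately show ?thesis using b1 c1 by (auto simp: hom_def)
 qed
 obtain W1 h1 where h1: "hom h1 W1 (sub_ob s)"
  "\<And>T y. hom y (sub_ob s) T ==> y ** h1 = 0 \<longleftrightarrow> y ** b1 = 0 & y ** c1 = 0"
  "\<And>T x. hom x T (sub_ob s) ==> (EX w. hom w T W1 & h1 ** w = x) \<longleftrightarrow>
    (EX u v. hom u T U & hom v T V & x = b1 ** u + c1 ** v)"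
  using biprod_copair[OF b1(1) c1(1)] by blast
 have q0: "quo_ar s ** h1 = 0" using h1(2)[OF su(3)] s unfolding is_subquot_def cond1 by blast
 have qu: "EX! t. t : arr A (quo_ob s) T & t ** quo_ar s = y" if "T : obj A" "y : arr A (sub_ob s) T" "y ** h1 = 0" for T y
 proof -
  have "y ** b1 = 0 & y ** c1 = 0" using h1(2)[of y T] that su(1) by (simp add: hom_def)
  thus ?thesis using s that(1,2) unfolding is_subquot_def cond1 by blast
 qed
 have ck: "is_cokernel A (sub_ob s) h1 (quo_ob s) (quo_ar s)"
  unfolding is_cokernel_def using su(3) q0 qu unfolding hom_def by blast
 have "is_epi A (quo_ob s) (quo_ar s)" unfolding epi_iff[OF su(3)]
 proof (intro allI impI)
  fix T y assume y: "hom y (quo_ob s) T & y ** quo_ar s = 0"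
  hence T: "T : obj A" by (simp add: hom_def)
  have "EX! t. t : arr A (quo_ob s) T & t ** quo_ar s = 0"
   using qu[OF T hom_arr[OF hom_zero[OF hom_dom[OF su(3)] T]]] zero_comp[OF h1(1) T] by simp
  moreover have "0 : arr A (quo_ob s) T" "0 ** quo_ar s = 0"
   using hom_zero[OF hom_cod[OF su(3)] T] zero_comp[OF su(3) T] by (auto simp: hom_def)
  ultimately show "y = 0" using y hom_arr by blast
 qed
 hence cv: "cov (quo_ar s) (sub_ob s) (quo_ob s)" using su(3) by (simp add: cov_def)
 have zero: "quo_ar s ** w = 0 \<longleftrightarrow>
  (EX T' e u v. cov e T' T & hom u T' U & hom v T' V & sub_ar s ** w ** e = b ** u + c ** v)"
  if w: "hom w T (sub_ob s)" for w T
 proof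
  assume "quo_ar s ** w = 0"
  then obtain T' e u where e: "cov e T' T" "hom u T' W1" "w ** e = h1 ** u"
   using image_local[OF h1(1) ck w] by blast
  have we: "hom (w ** e) T' (sub_ob s)" using hom_comp[OF cov_hom[OF e(1)] w] .
  obtain u v where uv: "hom u T' U" "hom v T' V" "w ** e = b1 ** u + c1 ** v" using h1(3)[OF we] e by metis
  have "sub_ar s ** w ** e = b ** u + c ** v"
   using assoc[OF cov_hom[OF e(1)] w su(1)] uv(3) comp_add[OF hom_comp[OF uv(1) b1(1)] hom_comp[OF uv(2) c1(1)] su(1)]
    assoc[OF uv(1) b1(1) su(1)] assoc[OF uv(2) c1(1) su(1)] b1(2) c1(2) by simp
  thus "EX T' e u v. cov e T' T & hom u T' U & hom v T' V & sub_ar s ** w ** e = b ** u + c ** v"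
   using e uv by blast
 next
  assume "EX T' e u v. cov e T' T & hom u T' U & hom v T' V & sub_ar s ** w ** e = b ** u + c ** v"
  then obtain T' e u v where e: "cov e T' T" "hom u T' U" "hom v T' V" "sub_ar s ** w ** e = b ** u + c ** v" by blast
  note he = cov_hom[OF e(1)]
  have bu: "hom (b1 ** u) T' (sub_ob s)" and cv': "hom (c1 ** v) T' (sub_ob s)" using hom_comp e b1 c1 by blast+
  have "sub_ar s ** (w ** e) = sub_ar s ** (b1 ** u + c1 ** v)"
   using assoc[OF he w su(1)] e(4) comp_add[OF bu cv' su(1)]
    assoc[OF e(2) b1(1) su(1)] assoc[OF e(3) c1(1) su(1)] b1(2) c1(2) by simp
  hence we: "w ** e = b1 ** u + c1 ** v"
   using mono_cancel[OF su(2) hom_comp[OF he w] hom_add[OF bu cv']] by blast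
  have "quo_ar s ** b1 = 0 & quo_ar s ** c1 = 0" using h1(2)[OF su(3)] q0 by blast
  hence "quo_ar s ** w ** e = 0"
   using assoc[OF he w su(3)] we comp_add[OF bu cv' su(3)] assoc[OF e(2) b1(1) su(3)]
    assoc[OF e(3) c1(1) su(3)] zero_comp[OF e(2) hom_cod[OF su(3)]] zero_comp[OF e(3) hom_cod[OF su(3)]] by simp
  thus "quo_ar s ** w = 0" using cov_zero[OF e(1) hom_comp[OF w su(3)]] by blast
 qed
 show "sqr s T x 0 \<longleftrightarrow> hom x T Y &
   (EX T' e u v. cov e T' T & hom u T' U & hom v T' V & x ** e = b ** u + c ** v)"
 proof
  assume "sqr s T x 0"
  thus "hom x T Y & (EX T' e u v. cov e T' T & hom u T' U & hom v T' V & x ** e = b ** u + c ** v)"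
   unfolding sqr_def using zero hom_comp[OF _ su(1)] by blast
 next
  assume r: "hom x T Y & (EX T' e u v. cov e T' T & hom u T' U & hom v T' V & x ** e = b ** u + c ** v)"
  then obtain T' e u v where e: "cov e T' T" "hom u T' U" "hom v T' V" "x ** e = b ** u + c ** v" and x: "hom x T Y" by blast
  have "g ** x = 0" if gG: "g : G" for g
  proof -
   obtain Z where Z: "hom g Y Z" using G(2)[OF gG] by blast
   have "g ** x ** e = 0"
    using assoc[OF cov_hom[OF e(1)] x Z] e(4) comp_add[OF hom_comp[OF e(2) b(1)] hom_comp[OF e(3) c(1)] Z]
     assoc[OF e(2) b(1) Z] assoc[OF e(3) c(1) Z] b(2)[OF gG] c(2)[OF gG]
     zero_comp[OF e(2) hom_cod[OF Z]] zero_comp[OF e(3) hom_cod[OF Z]] by simp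
   thus ?thesis using cov_zero[OF e(1) hom_comp[OF x Z]] by blast
  qed
  then obtain w where "hom w T (sub_ob s)" "sub_ar s ** w = x" using su(4)[OF x] by blast
  thus "sqr s T x 0" unfolding sqr_def using zero r by blast
 qed
 have "pres Y (quo_ob s) (sqr s)" unfolding pres_def
 proof (intro conjI allI impI ballI)
  show "Y : obj A" "quo_ob s : obj A" using Y hom_cod[OF su(3)] .
 next
  fix T x t assume "sqr s T x t"
  thus "hom x T Y" "hom t T (quo_ob s)" unfolding sqr_def using hom_comp su by blast+
 next
  fix T x t T' e assume "sqr s T x t & hom e T' T"
  then obtain w where w: "hom w T (sub_ob s)" "sub_ar s ** w = x" "quo_ar s ** w = t" "hom e T' T"
   unfolding sqr_def by blast
  thus "sqr s T' (x ** e) (t ** e)"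
   unfolding sqr_def using hom_comp[OF w(4,1)] assoc[OF w(4,1) su(1)] assoc[OF w(4,1) su(3)] by auto
 next
  fix T x t y u assume "sqr s T x t & sqr s T y u"
  then obtain w v where w: "hom w T (sub_ob s)" "sub_ar s ** w = x" "quo_ar s ** w = t"
   and v: "hom v T (sub_ob s)" "sub_ar s ** v = y" "quo_ar s ** v = u"
   unfolding sqr_def by blast
  show "sqr s T (x - y) (t - u)"
   unfolding sqr_def using hom_diff[OF w(1) v(1)] comp_diff[OF w(1) v(1) su(1)] comp_diff[OF w(1) v(1) su(3)] w v by auto
 next
  fix T t assume "sqr s T 0 t"
  then obtain w where w: "hom w T (sub_ob s)" "sub_ar s ** w = 0" "quo_ar s ** w = t" unfolding sqr_def by blast
  hence "w = 0" using su(2) mono_iff[OF su(1)] by blast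
  thus "t = 0" using w comp_zero[OF hom_dom[OF w(1)] su(3)] by simp
 next
  fix T assume T: "T : obj A"
  show "sqr s T 0 0" unfolding sqr_def
   using hom_zero[OF T hom_dom[OF su(1)]] comp_zero[OF T su(1)] comp_zero[OF T su(3)] by blast
 next
  fix T t assume "hom t T (quo_ob s)"
  then obtain T' e w where "cov e T' T" "hom w T' (sub_ob s)" "quo_ar s ** w = t ** e" using cov_pullback[OF cv] by blast
  thus "EX T' e x. cov e T' T & sqr s T' x (t ** e)" unfolding sqr_def by blast
 next
  fix T x T' e t' assume a: "hom x T Y & cov e T' T & sqr s T' (x ** e) t'"
  hence x: "hom x T Y" "cov e T' T" by auto
  have "ALL g:G. g ** x = 0"
  proof
   fix g assume g: "g : G"
   obtain Z where Z: "hom g Y Z" using G(2) g by blast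
   have "g ** (x ** e) = 0" using dom a g by blast
   hence "g ** x ** e = 0" using assoc[OF cov_hom[OF x(2)] x(1) Z] by simp
   thus "g ** x = 0" using cov_zero[OF x(2) hom_comp[OF x(1) Z]] by blast
  qed
  thus "EX t. sqr s T x t" using dom x(1) by blast
 qed
 thus "SQ Y s" using su cv by (simp add: SQ_def)
qed

text \<open>Two equal relations collapse to one element of the set, and
  \<open>b ** u + b ** v\<close> is \<open>b ** (u + v)\<close>.\<close>

lemma subquot1:
 assumes Y: "Y : obj A" and G: "finite G" "\<And>g. g : G ==> EX Z. hom g Y Z"
  and b: "hom b U Y" "\<And>g. g : G ==> g ** b = 0"
 defines "s \<equiv> subquot A Y G {(U, b)}"
 shows "SQ Y s" and "(EX t. sqr s T x t) \<longleftrightarrow> hom x T Y & (ALL g:G. g ** x = 0)"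
  and "sqr s T x 0 \<longleftrightarrow> hom x T Y & (EX T' e u. cov e T' T & hom u T' U & x ** e = b ** u)"
proof -
 note s2 = subquot2[OF Y G b b, simplified insert_absorb2, folded s_def]
 show "SQ Y s" "(EX t. sqr s T x t) \<longleftrightarrow> hom x T Y & (ALL g:G. g ** x = 0)" using s2(1,2) by auto
 show "sqr s T x 0 \<longleftrightarrow> hom x T Y & (EX T' e u. cov e T' T & hom u T' U & x ** e = b ** u)"
 proof
  assume "sqr s T x 0"
  then obtain T' e u v where "hom x T Y" and e: "cov e T' T" "hom u T' U" "hom v T' U" "x ** e = b ** u + b ** v"
   using s2(3) by blast
  thus "hom x T Y & (EX T' e u. cov e T' T & hom u T' U & x ** e = b ** u)"
   using comp_add[OF e(2,3) b(1)] hom_add[OF e(2,3)]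
   by (intro conjI exI[of _ T'] exI[of _ e] exI[of _ "u + v"]) simp_all
 next
  assume "hom x T Y & (EX T' e u. cov e T' T & hom u T' U & x ** e = b ** u)"
  then obtain T' e u where "hom x T Y" and e: "cov e T' T" "hom u T' U" "x ** e = b ** u" by blast
  moreover have "hom 0 T' U" "b ** 0 = 0" using hom_zero[OF hom_dom[OF e(2)] hom_cod[OF e(2)]] comp_zero[OF hom_dom[OF e(2)] b(1)] by auto
  ultimately show "sqr s T x 0" using e
   by (intro s2(3)[THEN iffD2] conjI exI[of _ T'] exI[of _ e] exI[of _ u] exI[of _ 0]) simp_all
 qed
qed

text \<open>A pair \<open>(U, b)\<close> enters \<open>is_subquot\<close> only through lifts of
  \<open>b\<close>. If \<open>b\<close> is zero, or if the subobject is zero because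
  \<open>idt A Y\<close> is imposed, such a lift is zero by uniqueness, so the predicate and with it
  the \<open>SOME\<close> choice do not change. The second case occurs for truncations in degrees
  where the relations are not contained in the subobject.\<close>

lemma subquot_drop:
 assumes Y: "Y : obj A" and G: "\<And>g. g : G ==> EX Z. hom g Y Z"
  and B: "\<And>U b. (U, b) : B ==> U : obj A & (b = 0 \<or> idt A Y : G)"
 shows "subquot A Y G B = subquot A Y G {}"
proof -
 have triv: "(ALL (U, b):B. ALL w:arr A U (sub_ob s). sub_ar s ** w = b --> y ** w = 0)"
  if ex: "sub_ob s : obj A" "sub_ar s : arr A (sub_ob s) Y" "ALL g:G. g ** sub_ar s = 0" "ALL T:obj A. ALL x:arr A T Y. (ALL g:G. g ** x = 0) -->
    (EX! w. w : arr A T (sub_ob s) & sub_ar s ** w = x)" and y: "T : obj A" "y : arr A (sub_ob s) T" for s y T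
 proof clarify
  fix U b w assume b: "(U, sub_ar s ** w) : B" and w: "w : arr A U (sub_ob s)"
  have U: "U : obj A" using B[OF b] by blast
  have h: "hom (sub_ar s) (sub_ob s) Y" "hom y (sub_ob s) T" "hom w U (sub_ob s)"
   using ex(1,2) Y y U w by (auto simp: hom_def)
  have w0: "sub_ar s ** w = 0"
  proof (cases "idt A Y : G")
   case True
   hence "sub_ar s = 0" using ex(3) id_comp[OF h(1)] by auto
   thus ?thesis using zero_comp[OF h(3) Y] by simp
  qed (use B[OF b] in blast)
  have "ALL g:G. g ** 0 = 0" using comp_zero[OF U] G by blast
  hence "EX! w. w : arr A U (sub_ob s) & sub_ar s ** w = 0"
   using ex(4) U hom_arr[OF hom_zero[OF U Y]] by blast
  moreover have "0 : arr A U (sub_ob s)" "sub_ar s ** 0 = 0"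
   using hom_arr[OF hom_zero[OF U ex(1)]] comp_zero[OF U h(1)] by auto
  ultimately have "w = 0" using w w0 by blast
  thus "y ** w = 0" using comp_zero[OF U h(2)] by simp
 qed
 have "is_subquot A Y G B s \<longleftrightarrow> is_subquot A Y G {} s" for s
 proof
  assume s: "is_subquot A Y G {} s"
  show "is_subquot A Y G B s" unfolding is_subquot_def
   using s triv[of s "quo_ob s" "quo_ar s"] unfolding is_subquot_def by auto
 next
  assume s: "is_subquot A Y G B s"
  hence *: "ALL T:obj A. ALL y:arr A (sub_ob s) T. (ALL (U, b):B. ALL w:arr A U (sub_ob s). sub_ar s ** w = b --> y ** w = 0)"
   using triv unfolding is_subquot_def by (elim conjE) blast
  show "is_subquot A Y G {} s" using s * unfolding is_subquot_def by simp
 qed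
 thus ?thesis by (simp add: subquot_def)
qed

lemma subquot0:
 assumes Y: "Y : obj A" and G: "finite G" "\<And>g. g : G ==> EX Z. hom g Y Z"
 defines "s \<equiv> subquot A Y G {}"
 shows "SQ Y s" and "(EX t. sqr s T x t) \<longleftrightarrow> hom x T Y & (ALL g:G. g ** x = 0)"
  and "sqr s T x 0 \<longleftrightarrow> hom x T Y & x = 0"
proof -
 have z: "hom 0 Y Y" using hom_zero[OF Y Y] .
 have gz: "g ** 0 = 0" if "g : G" for g using comp_zero[OF Y] G(2)[OF that] by blast
 have s: "s = subquot A Y G {(Y, 0)}" unfolding s_def by (rule subquot_drop[OF Y, symmetric]) (use Y G(2) in auto)
 note s1 = subquot1[OF Y G z gz, folded s]
 show "SQ Y s" "(EX t. sqr s T x t) \<longleftrightarrow> hom x T Y & (ALL g:G. g ** x = 0)" using s1(1,2) by auto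
 show "sqr s T x 0 \<longleftrightarrow> hom x T Y & x = 0"
 proof
  assume "sqr s T x 0"
  then obtain T' e u where x: "hom x T Y" and e: "cov e T' T" "hom u T' Y" "x ** e = 0 ** u" using s1(3) by blast
  thus "hom x T Y & x = 0" using cov_zero[OF e(1) x] zero_comp[OF e(2) Y] by simp
 next
  assume "hom x T Y & x = 0"
  thus "sqr s T x 0" using pres_zero[OF SQ_pres[OF s1(1)]] hom_dom by blast
 qed
qed

lemma sqr_whole: "Y : obj A ==> sqr (whole A Y) T x t \<longleftrightarrow> hom x T Y & t = x"
 unfolding sqr_def whole_def using id_comp by auto

lemma SQ_whole:
 assumes Y: "Y : obj A"
 shows "SQ Y (whole A Y)"
proof -
 have i: "hom (idt A Y) Y Y" using hom_id[OF Y] .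
 have "is_mono A Y (idt A Y)" unfolding mono_iff[OF i] using id_comp by auto
 moreover have "pres Y Y (sqr (whole A Y))"
  unfolding pres_def sqr_whole[OF Y]
 proof (intro conjI allI impI ballI)
  show "Y : obj A" "Y : obj A" using Y by auto
 next
  fix T x t assume "hom x T Y & t = x"
  thus "hom x T Y" and "hom t T Y" by auto
 next
  fix T x t T' e assume "(hom x T Y & t = x) & hom e T' T"
  thus "hom (x ** e) T' Y" "t ** e = x ** e" using hom_comp[of e T' T x Y] by auto
 next
  fix T x t y u assume "(hom x T Y & t = x) & hom y T Y & u = y"
  thus "hom (x - y) T Y" "t - u = x - y" using hom_diff[of x T Y y] by auto
 next
  fix T t assume "hom 0 T Y & t = 0" thus "t = 0" by simp
 next
  fix T assume "T : obj A"
  thus "hom 0 T Y" "0 = 0" using hom_zero Y by auto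
 next
  fix T t assume t: "hom t T Y"
  show "EX T' e x. cov e T' T & hom x T' Y & t ** e = x"
   using cov_id[OF hom_dom[OF t]] hom_comp[OF hom_id[OF hom_dom[OF t]] t] by blast
 next
  fix T x T' e t' assume "hom x T Y & cov e T' T & hom (x ** e) T' Y & t' = x ** e"
  thus "EX t. hom x T Y & t = x" by simp
 qed
 ultimately show ?thesis using i cov_id[OF Y] unfolding SQ_def by (simp add: whole_def)
qed


subsection \<open>Finite biproducts\<close>

definition bip :: "'i set => ('i => 'o) => 'o \<times> ('i => 'a) \<times> ('i => 'a) => bool" where
 "bip S X s \<longleftrightarrow> finite S & (ALL i:S. X i : obj A) & is_biproduct A S X s"

lemma bip_finite: "bip S X s ==> finite S"
 by (simp add: bip_def)

lemma bip_obj: "bip S X s ==> fst s : obj A"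
 by (cases s) (simp add: bip_def is_biproduct_def)

lemma bip_in: "bip S X s ==> i : S ==> hom (fst (snd s) i) (X i) (fst s)"
 by (cases s) (simp add: bip_def is_biproduct_def hom_def)

lemma bip_pr: "bip S X s ==> i : S ==> hom (snd (snd s) i) (fst s) (X i)"
 by (cases s) (simp add: bip_def is_biproduct_def hom_def)

lemma bip_comp: "bip S X s ==> i : S ==> j : S ==>
 snd (snd s) i ** fst (snd s) j = (if i = j then idt A (X i) else 0)"
 by (cases s) (simp add: bip_def is_biproduct_def)

lemma bip_sum: "bip S X s ==> (\<Sum>i\<in>S. fst (snd s) i ** snd (snd s) i) = idt A (fst s)"
 by (cases s) (simp add: bip_def is_biproduct_def)

lemma bip_ext:
 assumes s: "bip S X s" and x: "hom x T (fst s)" and y: "hom y T (fst s)"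
  and eq: "\<And>i. i : S ==> snd (snd s) i ** x = snd (snd s) i ** y"
 shows "x = y"
proof -
 have "z = (\<Sum>i\<in>S. fst (snd s) i ** (snd (snd s) i ** z))" if z: "hom z T (fst s)" for z
 proof -
  have "z = (\<Sum>i\<in>S. fst (snd s) i ** snd (snd s) i) ** z" using bip_sum[OF s] id_comp[OF z] by simp
  also have "\<dots> = (\<Sum>i\<in>S. fst (snd s) i ** snd (snd s) i ** z)"
   by (rule sum_comp[OF z hom_cod[OF z]]) (rule hom_comp[OF bip_pr[OF s] bip_in[OF s]])
  also have "\<dots> = (\<Sum>i\<in>S. fst (snd s) i ** (snd (snd s) i ** z))"
   by (rule sum.cong[OF refl]) (rule assoc[OF z bip_pr[OF s] bip_in[OF s]])
  finally show ?thesis .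
 qed
 from this[OF x] this[OF y] show ?thesis using eq by simp
qed

lemma bip_tuple:
 assumes s: "bip S X s" and T: "T : obj A" and x: "\<And>i. i : S ==> hom (x i) T (X i)"
 shows "hom (\<Sum>i\<in>S. fst (snd s) i ** x i) T (fst s)"
  and "j : S ==> snd (snd s) j ** (\<Sum>i\<in>S. fst (snd s) i ** x i) = x j"
proof -
 have h: "hom (fst (snd s) i ** x i) T (fst s)" if "i : S" for i
  using hom_comp[OF x[OF that] bip_in[OF s that]] .
 thus "hom (\<Sum>i\<in>S. fst (snd s) i ** x i) T (fst s)" by (intro hom_sum[OF T bip_obj[OF s]])
 assume j: "j : S"
 have "snd (snd s) j ** (\<Sum>i\<in>S. fst (snd s) i ** x i) = (\<Sum>i\<in>S. snd (snd s) j ** (fst (snd s) i ** x i))"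
  by (rule comp_sum[OF bip_pr[OF s j] T h])
 also have "\<dots> = (\<Sum>i\<in>S. if j = i then x i else 0)"
 proof (rule sum.cong[OF refl])
  fix i assume i: "i : S"
  have "snd (snd s) j ** (fst (snd s) i ** x i) = snd (snd s) j ** fst (snd s) i ** x i"
   using assoc[OF x[OF i] bip_in[OF s i] bip_pr[OF s j]] by simp
  thus "snd (snd s) j ** (fst (snd s) i ** x i) = (if j = i then x i else 0)"
   using bip_comp[OF s j i] id_comp[OF x[OF i]] zero_comp[OF x[OF i] hom_cod[OF x[OF j]]] by simp
 qed
 also have "\<dots> = x j" using j bip_finite[OF s] by simp
 finally show "snd (snd s) j ** (\<Sum>i\<in>S. fst (snd s) i ** x i) = x j" .
qed

lemma bip_matrix:
 assumes s: "bip S X s" and s': "bip S' X' s'"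
  and a: "\<And>i j. i : S ==> j : S' ==> hom (a i j) (X' j) (X i)"
 defines "\<alpha> \<equiv> \<Sum>i\<in>S. \<Sum>j\<in>S'. fst (snd s) i ** (a i j ** snd (snd s') j)"
 shows "hom \<alpha> (fst s') (fst s)"
  and "hom x T (fst s') ==> i : S ==> snd (snd s) i ** (\<alpha> ** x) = (\<Sum>j\<in>S'. a i j ** (snd (snd s') j ** x))"
proof -
 note ob = bip_obj[OF s] and ob' = bip_obj[OF s']
 have h1: "hom (a i j ** snd (snd s') j) (fst s') (X i)" if "i : S" "j : S'" for i j
  using hom_comp[OF bip_pr[OF s' that(2)] a[OF that]] .
 have h2: "hom (fst (snd s) i ** (a i j ** snd (snd s') j)) (fst s') (fst s)" if "i : S" "j : S'" for i j
  using hom_comp[OF h1[OF that] bip_in[OF s that(1)]] .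
 have h3: "hom (\<Sum>j\<in>S'. a i j ** snd (snd s') j) (fst s') (X i)" if "i : S" for i
  by (rule hom_sum[OF ob' hom_dom[OF bip_in[OF s that]] h1[OF that]])
 have \<alpha>: "\<alpha> = (\<Sum>i\<in>S. fst (snd s) i ** (\<Sum>j\<in>S'. a i j ** snd (snd s') j))"
  unfolding \<alpha>_def
  by (rule sum.cong[OF refl]) (rule comp_sum[OF bip_in[OF s] ob' h1, symmetric])
 show ha: "hom \<alpha> (fst s') (fst s)"
  unfolding \<alpha> by (intro hom_sum[OF ob' ob] hom_comp[OF h3] bip_in[OF s])
 assume x: "hom x T (fst s')" and i: "i : S"
 have "snd (snd s) i ** (\<alpha> ** x) = snd (snd s) i ** \<alpha> ** x" using assoc[OF x ha bip_pr[OF s i]] by simp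
 also have "snd (snd s) i ** \<alpha> = (\<Sum>j\<in>S'. a i j ** snd (snd s') j)"
  unfolding \<alpha> by (rule bip_tuple(2)[OF s ob' h3 i])
 also have "\<dots> ** x = (\<Sum>j\<in>S'. a i j ** snd (snd s') j ** x)"
  by (rule sum_comp[OF x hom_dom[OF bip_in[OF s i]] h1[OF i]])
 also have "\<dots> = (\<Sum>j\<in>S'. a i j ** (snd (snd s') j ** x))"
  by (rule sum.cong[OF refl]) (rule assoc[OF x bip_pr[OF s'] a[OF i]])
 finally show "snd (snd s) i ** (\<alpha> ** x) = (\<Sum>j\<in>S'. a i j ** (snd (snd s') j ** x))" .
qed

text \<open>\<open>abelian_category\<close> provides only a zero object and binary biproducts,
  whereas the \<open>SOME\<close> in \<open>tot_sum\<close> ranges over finite families.\<close>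

lemma bip_ex:
 assumes "finite S" "\<And>i. i : S ==> X i : obj A"
 shows "EX s. bip S X s"
 using assms
proof (induction S rule: finite_induct)
 case empty
 obtain Z where "Z : obj A" "idt A Z = 0" using zero_obj_ex by blast
 hence "bip {} X (Z, (\<lambda>_. 0), (\<lambda>_. 0))" by (simp add: bip_def is_biproduct_def)
 thus ?case by blast
next
 case (insert k S)
 then obtain s where s: "bip S X s" by blast
 obtain W i j p q where B: "hom i (X k) W" "hom j (fst s) W" "hom p W (X k)" "hom q W (fst s)"
  "p ** i = idt A (X k)" "q ** j = idt A (fst s)" "p ** j = 0" "q ** i = 0" "i ** p + j ** q = idt A W"
  using biprod2_ex[OF insert.prems[of k] bip_obj[OF s]] by blast
 define \<iota> where "\<iota> l = (if l = k then i else j ** fst (snd s) l)" for l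
 define \<pi> where "\<pi> l = (if l = k then p else snd (snd s) l ** q)" for l
 have h: "hom (\<iota> l) (X l) W" "hom (\<pi> l) W (X l)" if "l : insert k S" for l
  using that B(1,3) hom_comp[OF bip_in[OF s] B(2)] hom_comp[OF B(4) bip_pr[OF s]]
  unfolding \<iota>_def \<pi>_def by auto
 have c: "\<pi> l ** \<iota> m = (if l = m then idt A (X l) else 0)" if l: "l : insert k S" and m: "m : insert k S" for l m
 proof (cases "l = k"; cases "m = k")
  assume "l = k" "m = k" thus ?thesis unfolding \<iota>_def \<pi>_def using B(5) by simp
 next
  assume *: "l = k" "m \<noteq> k"
  hence m': "m : S" using m by simp
  have "p ** (j ** fst (snd s) m) = 0"
   using assoc[OF bip_in[OF s m'] B(2,3)] B(7) zero_comp[OF bip_in[OF s m'] hom_cod[OF B(3)]] by simp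
  thus ?thesis unfolding \<iota>_def \<pi>_def using * by simp
 next
  assume *: "l \<noteq> k" "m = k"
  hence l': "l : S" using l by simp
  have "snd (snd s) l ** q ** i = 0"
   using assoc[OF B(1,4) bip_pr[OF s l']] B(8) comp_zero[OF hom_dom[OF B(1)] bip_pr[OF s l']] by simp
  thus ?thesis unfolding \<iota>_def \<pi>_def using * by simp
 next
  assume *: "l \<noteq> k" "m \<noteq> k"
  hence l': "l : S" and m': "m : S" using l m by auto
  have "snd (snd s) l ** q ** (j ** fst (snd s) m) = snd (snd s) l ** fst (snd s) m"
   using assoc[OF hom_comp[OF bip_in[OF s m'] B(2)] B(4) bip_pr[OF s l']]
    assoc[OF bip_in[OF s m'] B(2,4)] B(6) id_comp[OF bip_in[OF s m']] by simp
  thus ?thesis unfolding \<iota>_def \<pi>_def using * bip_comp[OF s l' m'] by simp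
 qed
 have "(\<Sum>l\<in>S. \<iota> l ** \<pi> l) = (\<Sum>l\<in>S. j ** (fst (snd s) l ** (snd (snd s) l ** q)))"
 proof (rule sum.cong[OF refl])
  fix l assume l: "l : S"
  hence "l \<noteq> k" using insert.hyps by blast
  thus "\<iota> l ** \<pi> l = j ** (fst (snd s) l ** (snd (snd s) l ** q))"
   unfolding \<iota>_def \<pi>_def using assoc[OF hom_comp[OF B(4) bip_pr[OF s l]] bip_in[OF s l] B(2)] by simp
 qed
 also have "\<dots> = j ** (\<Sum>l\<in>S. fst (snd s) l ** (snd (snd s) l ** q))"
  by (rule comp_sum[OF B(2) hom_dom[OF B(4)], symmetric]) (rule hom_comp[OF hom_comp[OF B(4) bip_pr[OF s]] bip_in[OF s]])
 also have "(\<Sum>l\<in>S. fst (snd s) l ** (snd (snd s) l ** q)) = q"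
  by (rule bip_ext[OF s bip_tuple(1)[OF s hom_dom[OF B(4)]] B(4)])
   (use hom_comp[OF B(4) bip_pr[OF s]] bip_tuple(2)[OF s hom_dom[OF B(4)], of "\<lambda>l. snd (snd s) l ** q"] in auto)
 finally have "(\<Sum>l\<in>S. \<iota> l ** \<pi> l) = j ** q" .
 hence "(\<Sum>l\<in>insert k S. \<iota> l ** \<pi> l) = idt A W"
  using insert.hyps B(9) unfolding \<iota>_def \<pi>_def by simp
 hence "bip (insert k S) X (W, \<iota>, \<pi>)"
  unfolding bip_def is_biproduct_def using h c insert.hyps(1) insert.prems hom_cod[OF B(1)] by (simp add: hom_def)
 thus ?case by blast
qed

definition brel :: "'i set => ('i => 'o => 'a => 'a => bool) => 'o \<times> ('i => 'a) \<times> ('i => 'a) =>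
  'o \<times> ('i => 'a) \<times> ('i => 'a) => 'o => 'a => 'a => bool" where
 "brel S \<rho> s s' T x t \<longleftrightarrow> hom x T (fst s) & hom t T (fst s') &
   (ALL i:S. \<rho> i T (snd (snd s) i ** x) (snd (snd s') i ** t))"

lemma brel_dom:
 assumes s: "bip S X s" and s': "bip S X' s'" and p: "\<And>i. i : S ==> pres (X i) (X' i) (\<rho> i)"
 shows "(EX t. brel S \<rho> s s' T x t) \<longleftrightarrow> hom x T (fst s) & (ALL i:S. EX t. \<rho> i T (snd (snd s) i ** x) t)"
proof
 assume r: "hom x T (fst s) & (ALL i:S. EX t. \<rho> i T (snd (snd s) i ** x) t)"
 hence T: "T : obj A" by (simp add: hom_def)
 have "ALL i:S. EX t. \<rho> i T (snd (snd s) i ** x) t" using r by blast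
 from bchoice[OF this] obtain t where t: "ALL i:S. \<rho> i T (snd (snd s) i ** x) (t i)" by blast
 have h: "\<And>i. i : S ==> hom (t i) T (X' i)" using t pres_hom2[OF p] by blast
 show "EX t. brel S \<rho> s s' T x t" unfolding brel_def
  using r t bip_tuple[OF s' T h] by (intro exI[of _ "\<Sum>i\<in>S. fst (snd s') i ** t i"]) simp
qed (auto simp: brel_def)

text \<open>Finiteness of \<open>S\<close> enters in the surjectivity: the components lift over
  different coverings, which \<open>finite_cov\<close> refines to one.\<close>

lemma pres_brel:
 assumes s: "bip S X s" and s': "bip S X' s'" and p: "\<And>i. i : S ==> pres (X i) (X' i) (\<rho> i)"
 shows "pres (fst s) (fst s') (brel S \<rho> s s')"
 unfolding pres_def
proof (intro conjI allI impI ballI)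
 show "fst s : obj A" "fst s' : obj A" using bip_obj s s' by blast+
next
 fix T x t assume "brel S \<rho> s s' T x t"
 thus "hom x T (fst s)" and "hom t T (fst s')" unfolding brel_def by auto
next
 fix T x t T' e assume r: "brel S \<rho> s s' T x t & hom e T' T"
 hence h: "hom x T (fst s)" "hom t T (fst s')" "hom e T' T" unfolding brel_def by auto
 have "\<rho> i T' (snd (snd s) i ** (x ** e)) (snd (snd s') i ** (t ** e))" if i: "i : S" for i
 proof -
  have "\<rho> i T (snd (snd s) i ** x) (snd (snd s') i ** t)" using r i unfolding brel_def by blast
  from pres_restr[OF p[OF i] this h(3)] show ?thesis
   using assoc[OF h(3,1) bip_pr[OF s i]] assoc[OF h(3,2) bip_pr[OF s' i]] by simp
 qed
 thus "brel S \<rho> s s' T' (x ** e) (t ** e)"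
  unfolding brel_def using hom_comp[OF h(3,1)] hom_comp[OF h(3,2)] by blast
next
 fix T x t y u assume r: "brel S \<rho> s s' T x t & brel S \<rho> s s' T y u"
 hence h: "hom x T (fst s)" "hom t T (fst s')" "hom y T (fst s)" "hom u T (fst s')" unfolding brel_def by auto
 have "\<rho> i T (snd (snd s) i ** (x - y)) (snd (snd s') i ** (t - u))" if i: "i : S" for i
  using pres_diff[OF p[OF i], of T] r i comp_diff[OF h(1,3) bip_pr[OF s i]] comp_diff[OF h(2,4) bip_pr[OF s' i]]
  unfolding brel_def by auto
 thus "brel S \<rho> s s' T (x - y) (t - u)"
  unfolding brel_def using hom_diff[OF h(1,3)] hom_diff[OF h(2,4)] by blast
next
 fix T t assume r: "brel S \<rho> s s' T 0 t"
 hence h: "hom t T (fst s')" unfolding brel_def by auto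
 have T: "T : obj A" using hom_dom[OF h] .
 show "t = 0"
 proof (rule bip_ext[OF s' h hom_zero[OF T bip_obj[OF s']]])
  fix i assume i: "i : S"
  have "\<rho> i T 0 (snd (snd s') i ** t)" using r i comp_zero[OF T bip_pr[OF s i]] unfolding brel_def by auto
  thus "snd (snd s') i ** t = snd (snd s') i ** 0"
   using pres_0[OF p[OF i]] comp_zero[OF T bip_pr[OF s' i]] by simp
 qed
next
 fix T assume T: "T : obj A"
 show "brel S \<rho> s s' T 0 0"
  unfolding brel_def using hom_zero[OF T bip_obj[OF s]] hom_zero[OF T bip_obj[OF s']]
   comp_zero[OF T bip_pr[OF s]] comp_zero[OF T bip_pr[OF s']] pres_zero[OF p T] by auto
next
 fix T t assume t: "hom t T (fst s')"
 have T: "T : obj A" using hom_dom[OF t] .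
 have "EX T' e. cov e T' T & (ALL i:S. EX x. \<rho> i T' x (snd (snd s') i ** t ** e))"
 proof (rule finite_cov[OF bip_finite[OF s] T])
  fix i assume i: "i : S"
  show "EX T' e. cov e T' T & (EX x. \<rho> i T' x (snd (snd s') i ** t ** e))"
   using pres_surj[OF p[OF i] hom_comp[OF t bip_pr[OF s' i]]] by blast
 next
  fix i T' e T'' g assume i: "i : S" and "EX x. \<rho> i T' x (snd (snd s') i ** t ** e)" and h: "hom e T' T" "hom g T'' T'"
  then obtain x where "\<rho> i T' x (snd (snd s') i ** t ** e)" by blast
  from pres_restr[OF p[OF i] this h(2)]
  show "EX x. \<rho> i T'' x (snd (snd s') i ** t ** (e ** g))"
   using assoc[OF h(2,1) hom_comp[OF t bip_pr[OF s' i]]] by auto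
 qed
 then obtain T' e where e: "cov e T' T" "ALL i:S. EX x. \<rho> i T' x (snd (snd s') i ** t ** e)" by blast
 obtain x where x: "ALL i:S. \<rho> i T' (x i) (snd (snd s') i ** t ** e)" using bchoice[OF e(2)] by blast
 note he = cov_hom[OF e(1)]
 have h: "\<And>i. i : S ==> hom (x i) T' (X i)" using x pres_hom1[OF p] by blast
 have "brel S \<rho> s s' T' (\<Sum>i\<in>S. fst (snd s) i ** x i) (t ** e)"
  unfolding brel_def using hom_comp[OF he t] bip_tuple[OF s hom_dom[OF he] h] x assoc[OF he t bip_pr[OF s']] by simp
 thus "EX T' e x. cov e T' T & brel S \<rho> s s' T' x (t ** e)" using e(1) by blast
next
 fix T x T' e t' assume r: "hom x T (fst s) & cov e T' T & brel S \<rho> s s' T' (x ** e) t'"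
 hence x: "hom x T (fst s)" "cov e T' T" by auto
 have "EX t. \<rho> i T (snd (snd s) i ** x) t" if i: "i : S" for i
 proof -
  have "\<rho> i T' (snd (snd s) i ** x ** e) (snd (snd s') i ** t')"
   using r i assoc[OF cov_hom[OF x(2)] x(1) bip_pr[OF s i]] unfolding brel_def by simp
  thus ?thesis using pres_dom[OF p[OF i] hom_comp[OF x(1) bip_pr[OF s i]] x(2)] by blast
 qed
 thus "EX t. brel S \<rho> s s' T x t" using brel_dom[OF s s' p] x(1) by blast
qed

lemma brel_zero:
 assumes s: "bip S X s" and s': "bip S X' s'"
 shows "brel S \<rho> s s' T x 0 \<longleftrightarrow> hom x T (fst s) & (ALL i:S. \<rho> i T (snd (snd s) i ** x) 0)"
proof (cases "hom x T (fst s)")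
 case True
 hence T: "T : obj A" by (simp add: hom_def)
 show ?thesis unfolding brel_def using True hom_zero[OF T bip_obj[OF s']] comp_zero[OF T bip_pr[OF s']] by auto
qed (auto simp: brel_def)

subsection \<open>Cohomology of complexes\<close>

lemma cpx_hom_d: "is_complex A Y ==> hom (cdf Y n) (cob Y n) (cob Y (n + 1))"
 unfolding is_complex_def hom_def by blast

lemma cpx_hom_d': "is_complex A Y ==> hom (cdf Y (n - 1)) (cob Y (n - 1)) (cob Y n)"
 using cpx_hom_d[of Y "n - 1"] by simp

lemma cpx_ob: "is_complex A Y ==> cob Y n : obj A"
 unfolding is_complex_def by blast

lemma cpx_dd: "is_complex A Y ==> cdf Y (n + 1) ** cdf Y n = 0"
 unfolding is_complex_def by blast

lemma cpx_ddx:
 assumes "is_complex A Y" "hom x T (cob Y n)"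
 shows "cdf Y (n + 1) ** (cdf Y n ** x) = 0"
 using assoc[OF assms(2) cpx_hom_d[OF assms(1)] cpx_hom_d[OF assms(1)]] cpx_dd[OF assms(1)]
  zero_comp[OF assms(2) cpx_ob[OF assms(1), of "n + 1 + 1"]] by simp

lemma cpx_ddx':
 assumes "is_complex A Y" "hom x T (cob Y (n - 1))"
 shows "cdf Y n ** (cdf Y (n - 1) ** x) = 0"
 using cpx_ddx[OF assms] by simp

lemma coh_SQ:
 assumes Y: "is_complex A Y"
 shows "SQ (cob Y n) (coh A Y n)"
  and "(EX t. sH Y n T x t) \<longleftrightarrow> hom x T (cob Y n) & cdf Y n ** x = 0"
  and "sH Y n T x 0 \<longleftrightarrow> hom x T (cob Y n) &
   (EX T' e u. cov e T' T & hom u T' (cob Y (n - 1)) & x ** e = cdf Y (n - 1) ** u)"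
proof -
 have 1: "cob Y n : obj A" "finite {cdf Y n}" "\<And>g. g : {cdf Y n} ==> EX Z. hom g (cob Y n) Z"
  "hom (cdf Y (n - 1)) (cob Y (n - 1)) (cob Y n)" "\<And>g. g : {cdf Y n} ==> g ** cdf Y (n - 1) = 0"
  using cpx_ob[OF Y] cpx_hom_d[OF Y] cpx_hom_d'[OF Y] cpx_dd[OF Y, of "n - 1"] by auto
 show "SQ (cob Y n) (coh A Y n)"
  "(EX t. sH Y n T x t) \<longleftrightarrow> hom x T (cob Y n) & cdf Y n ** x = 0"
  "sH Y n T x 0 \<longleftrightarrow> hom x T (cob Y n) &
   (EX T' e u. cov e T' T & hom u T' (cob Y (n - 1)) & x ** e = cdf Y (n - 1) ** u)"
  using subquot1[OF 1] unfolding coh_def by auto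
qed

lemma chain_map_hom: "chain_map A Y Y' \<phi> ==> is_complex A Y ==> is_complex A Y' ==> hom (\<phi> n) (cob Y n) (cob Y' n)"
 unfolding chain_map_def cpx_hom_def using cpx_ob by (simp add: hom_def)

lemma chain_map_d: "chain_map A Y Y' \<phi> ==> cdf Y' n ** \<phi> n = \<phi> (n + 1) ** cdf Y n"
 unfolding chain_map_def cpx_diff_def by (auto simp: ksgn_def)

lemma chain_mapI:
 assumes "\<And>n. hom (\<phi> n) (cob Y n) (cob Y' n)" "\<And>n. cdf Y' n ** \<phi> n = \<phi> (n + 1) ** cdf Y n"
 shows "chain_map A Y Y' \<phi>"
 using assms unfolding chain_map_def cpx_hom_def cpx_diff_def by (auto simp: ksgn_def hom_def)

lemma chain_map_dx:
 assumes \<phi>: "chain_map A Y Y' \<phi>" and Y: "is_complex A Y" "is_complex A Y'" and x: "hom x T (cob Y n)"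
 shows "cdf Y' n ** (\<phi> n ** x) = \<phi> (n + 1) ** (cdf Y n ** x)"
 using assoc[OF x chain_map_hom[OF \<phi> Y] cpx_hom_d[OF Y(2)]] chain_map_d[OF \<phi>, of n]
  assoc[OF x cpx_hom_d[OF Y(1)] chain_map_hom[OF \<phi> Y]] by simp

lemma coh_map_spec:
 assumes \<phi>: "chain_map A Y Y' \<phi>" and Y: "is_complex A Y" "is_complex A Y'"
 shows "hom (coh_map A Y Y' \<phi> n) (qH Y n) (qH Y' n)"
  and "sH Y n T x h ==> sH Y' n T (\<phi> n ** x) (coh_map A Y Y' \<phi> n ** h)"
proof -
 note hp = chain_map_hom[OF \<phi> Y]
 have dom: "EX t'. sH Y' n T (\<phi> n ** x) t'" if r: "sH Y n T x t" for T x t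
 proof -
  have x: "hom x T (cob Y n)" "cdf Y n ** x = 0" using coh_SQ(2)[OF Y(1)] r by blast+
  thus ?thesis using coh_SQ(2)[OF Y(2)] chain_map_dx[OF \<phi> Y x(1)]
   hom_comp[OF x(1) hp] comp_zero[OF hom_dom[OF x(1)] hp] by simp
 qed
 have ker: "sH Y' n T (\<phi> n ** x) 0" if r: "sH Y n T x 0" for T x
 proof -
  obtain T' e u where x: "hom x T (cob Y n)" and e: "cov e T' T" "hom u T' (cob Y (n - 1))"
   "x ** e = cdf Y (n - 1) ** u" using r coh_SQ(3)[OF Y(1)] by blast
  have "\<phi> n ** x ** e = cdf Y' (n - 1) ** (\<phi> (n - 1) ** u)"
   using assoc[OF cov_hom[OF e(1)] x hp] e(3) chain_map_dx[OF \<phi> Y e(2)] by simp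
  thus ?thesis using coh_SQ(3)[OF Y(2)] hom_comp[OF x hp] hom_comp[OF e(2) hp] e(1) by blast
 qed
 show "hom (coh_map A Y Y' \<phi> n) (qH Y n) (qH Y' n)"
  and "sH Y n T x h ==> sH Y' n T (\<phi> n ** x) (coh_map A Y Y' \<phi> n ** h)"
  unfolding coh_map_def
  by (rule sq_map_spec[OF coh_SQ(1)[OF Y(1)] coh_SQ(1)[OF Y(2)] hp]; use dom ker in blast)+
qed

lemma coh_map_eqI:
 assumes \<phi>: "chain_map A Y Y' \<phi>" and Y: "is_complex A Y" "is_complex A Y'"
  and \<theta>: "hom \<theta> (qH Y n) (qH Y' n)"
  and eq: "\<And>T x h. sH Y n T x h ==> sH Y' n T (\<phi> n ** x) (\<theta> ** h)"
 shows "coh_map A Y Y' \<phi> n = \<theta>"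
proof (rule pres_eq[OF SQ_pres[OF coh_SQ(1)[OF Y(1)]] coh_map_spec(1)[OF \<phi> Y] \<theta>])
 fix T x t assume r: "sH Y n T x t"
 show "coh_map A Y Y' \<phi> n ** t = \<theta> ** t"
  using pres_uniq[OF SQ_pres[OF coh_SQ(1)[OF Y(2)]] coh_map_spec(2)[OF \<phi> Y r] eq[OF r]] .
qed

lemma chain_map_id: "is_complex A Y ==> chain_map A Y Y (\<lambda>n. idt A (cob Y n))"
 by (rule chain_mapI) (simp_all add: hom_id cpx_ob comp_id[OF cpx_hom_d] id_comp[OF cpx_hom_d])

lemma coh_map_id:
 assumes Y: "is_complex A Y" and \<phi>: "\<phi> n = idt A (cob Y n)" "chain_map A Y Y \<phi>"
 shows "coh_map A Y Y \<phi> n = idt A (qH Y n)"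
proof (rule coh_map_eqI[OF \<phi>(2) Y Y])
 note p = SQ_pres[OF coh_SQ(1)[OF Y]]
 show "hom (idt A (qH Y n)) (qH Y n) (qH Y n)"
  using hom_id[OF pres_ob2[OF p]] .
 fix T x h assume r: "sH Y n T x h"
 thus "sH Y n T (\<phi> n ** x) (idt A (qH Y n) ** h)"
  using id_comp[OF pres_hom1[OF p r]] id_comp[OF pres_hom2[OF p r]] \<phi>(1) by simp
qed

lemma chain_map_comp:
 assumes \<phi>: "chain_map A Y Y' \<phi>" and \<psi>: "chain_map A Y' Y'' \<psi>"
  and Y: "is_complex A Y" "is_complex A Y'" "is_complex A Y''"
 shows "chain_map A Y Y'' (\<lambda>n. \<psi> n ** \<phi> n)"
proof (rule chain_mapI)
 note h1 = chain_map_hom[OF \<phi> Y(1,2)] and h2 = chain_map_hom[OF \<psi> Y(2,3)]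
 show "hom (\<psi> n ** \<phi> n) (cob Y n) (cob Y'' n)" for n using hom_comp[OF h1 h2] .
 show "cdf Y'' n ** (\<psi> n ** \<phi> n) = \<psi> (n + 1) ** \<phi> (n + 1) ** cdf Y n" for n
  using assoc[OF h1 h2 cpx_hom_d[OF Y(3)], of n] chain_map_d[OF \<psi>, of n] chain_map_d[OF \<phi>, of n]
   assoc[OF h1 cpx_hom_d[OF Y(2)] h2, of n] assoc[OF cpx_hom_d[OF Y(1)] h1 h2, of n] by simp
qed

lemma coh_map_comp:
 assumes \<phi>: "chain_map A Y Y' \<phi>" and \<psi>: "chain_map A Y' Y'' \<psi>"
  and Y: "is_complex A Y" "is_complex A Y'" "is_complex A Y''"
  and \<chi>: "\<chi> n = \<psi> n ** \<phi> n" "chain_map A Y Y'' \<chi>"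
 shows "coh_map A Y Y'' \<chi> n = coh_map A Y' Y'' \<psi> n ** coh_map A Y Y' \<phi> n"
proof (rule coh_map_eqI[OF \<chi>(2) Y(1,3)])
 note h1 = chain_map_hom[OF \<phi> Y(1,2)] and h2 = chain_map_hom[OF \<psi> Y(2,3)]
 note c1 = coh_map_spec[OF \<phi> Y(1,2)] and c2 = coh_map_spec[OF \<psi> Y(2,3)]
 show "hom (coh_map A Y' Y'' \<psi> n ** coh_map A Y Y' \<phi> n) (qH Y n) (qH Y'' n)"
  using hom_comp[OF c1(1) c2(1)] .
 fix T x h assume r: "sH Y n T x h"
 note x = pres_hom1[OF SQ_pres[OF coh_SQ(1)[OF Y(1)]] r] and t = pres_hom2[OF SQ_pres[OF coh_SQ(1)[OF Y(1)]] r]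
 show "sH Y'' n T (\<chi> n ** x) (coh_map A Y' Y'' \<psi> n ** coh_map A Y Y' \<phi> n ** h)"
  using c2(2)[OF c1(2)[OF r]] assoc[OF x h1 h2] assoc[OF t c1(1) c2(1)] \<chi>(1) by simp
qed

lemma coh_map_homotopic:
 assumes \<phi>: "chain_map A Y Y' \<phi>" and \<psi>: "chain_map A Y Y' \<psi>" and Y: "is_complex A Y" "is_complex A Y'"
  and h: "homotopic A Y Y' \<phi> \<psi>"
 shows "coh_map A Y Y' \<phi> n = coh_map A Y Y' \<psi> n"
proof (rule coh_map_eqI[OF \<phi> Y coh_map_spec(1)[OF \<psi> Y]])
 note p = SQ_pres[OF coh_SQ(1)[OF Y(1)]] and p' = SQ_pres[OF coh_SQ(1)[OF Y(2)]]
 obtain k where k: "k : cpx_hom A (- 1) Y Y'" "\<And>n. \<phi> n - \<psi> n = cpx_diff A (- 1) Y Y' k n"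
  using h unfolding homotopic_def by blast
 have hk: "hom (k m) (cob Y m) (cob Y' (m - 1))" for m
  using k(1) cpx_ob[OF Y(1)] cpx_ob[OF Y(2)] unfolding cpx_hom_def hom_def by auto
 have hk': "hom (k (m + 1)) (cob Y (m + 1)) (cob Y' m)" for m using hk[of "m + 1"] by simp
 have eq: "\<phi> n - \<psi> n = cdf Y' (n - 1) ** k n + k (n + 1) ** cdf Y n" for n
  using k(2)[of n] unfolding cpx_diff_def by (simp add: ksgn_def)
 fix T x t assume r: "sH Y n T x t"
 have x: "hom x T (cob Y n)" "cdf Y n ** x = 0" using coh_SQ(2)[OF Y(1)] r by blast+
 note hp = chain_map_hom[OF \<phi> Y] and hq = chain_map_hom[OF \<psi> Y]
 note hd = cpx_hom_d'[OF Y(2), of n] and d0 = cpx_hom_d[OF Y(1), of n]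
 have "\<phi> n ** x - \<psi> n ** x = cdf Y' (n - 1) ** (k n ** x)"
  using diff_comp[OF x(1) hp hq] eq[of n] add_comp[OF x(1) hom_comp[OF hk hd] hom_comp[OF d0 hk']]
   assoc[OF x(1) hk hd] assoc[OF x(1) d0 hk'] x(2) comp_zero[OF hom_dom[OF x(1)] hk'] by simp
 hence "(\<phi> n ** x - \<psi> n ** x) ** idt A T = cdf Y' (n - 1) ** (k n ** x)"
  using comp_id[OF hom_diff[OF hom_comp[OF x(1) hp] hom_comp[OF x(1) hq]]] by simp
 hence "sH Y' n T (\<phi> n ** x - \<psi> n ** x) 0"
  using coh_SQ(3)[OF Y(2)] hom_diff[OF hom_comp[OF x(1) hp] hom_comp[OF x(1) hq]]
   cov_id[OF hom_dom[OF x(1)]] hom_comp[OF x(1) hk] by blast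
 from pres_add[OF p' this coh_map_spec(2)[OF \<psi> Y r]]
 show "sH Y' n T (\<phi> n ** x) (coh_map A Y Y' \<psi> n ** t)" by simp
qed

text \<open>If \<open>Z\<close> is degreewise a subquotient of a complex \<open>Y\<close> (compatibly with the differentials up to sign),
 then its cohomology is a subquotient of \<open>Y\<close>.\<close>

lemma coh_pres:
 assumes Y: "is_complex A Y" and p: "\<And>n. pres (cob Y n) (cob Z n) (\<rho> n)"
  and d: "\<And>n. hom (cdf Z n) (cob Z n) (cob Z (n + 1))"
  and compat: "\<And>n T x t. \<rho> n T x t ==> EX k. \<rho> (n + 1) T (cdf Y n ** x) (ksgn k (cdf Z n ** t))"
 shows "is_complex A Z"
  and "pres (cob Y n) (qH Z n) (rcomp (\<rho> n) (sH Z n))"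
  and "(EX h. rcomp (\<rho> n) (sH Z n) T x h) \<longleftrightarrow> (EX t. \<rho> n T x t) & \<rho> (n + 1) T (cdf Y n ** x) 0"
  and "rcomp (\<rho> n) (sH Z n) T x 0 \<longleftrightarrow> (EX t. \<rho> n T x t) &
   (EX T' e y u. cov e T' T & \<rho> (n - 1) T' y u & \<rho> n T' (x ** e - cdf Y (n - 1) ** y) 0)"
proof -
 have comm: "\<rho> (n + 1) T (cdf Y n ** x) 0 \<longleftrightarrow> cdf Z n ** t = 0" if r: "\<rho> n T x t" for n T x t
 proof -
  obtain k where k: "\<rho> (n + 1) T (cdf Y n ** x) (ksgn k (cdf Z n ** t))" using compat[OF r] by blast
  show ?thesis
  proof
   assume "\<rho> (n + 1) T (cdf Y n ** x) 0"
   from pres_uniq[OF p k this] show "cdf Z n ** t = 0" by simp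
  next
   assume "cdf Z n ** t = 0"
   thus "\<rho> (n + 1) T (cdf Y n ** x) 0" using k by simp
  qed
 qed
 show Z: "is_complex A Z" unfolding is_complex_def
 proof (intro allI conjI)
  fix n
  show "cob Z n : obj A" "cdf Z n : arr A (cob Z n) (cob Z (n + 1))" using d[of n] by (auto simp: hom_def)
  show "cdf Z (n + 1) ** cdf Z n = 0"
  proof (rule pres_eq[OF p hom_comp[OF d d] hom_zero])
   show "cob Z n : obj A" and "cob Z (n + 1 + 1) : obj A" using hom_dom[OF d] by blast+
   fix T x t assume r: "\<rho> n T x t"
   note x = pres_hom1[OF p r] and t = pres_hom2[OF p r]
   obtain k where k: "\<rho> (n + 1) T (cdf Y n ** x) (ksgn k (cdf Z n ** t))" using compat[OF r] by blast
   have "\<rho> (n + 1 + 1) T (cdf Y (n + 1) ** (cdf Y n ** x)) 0"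
    using cpx_ddx[OF Y x] pres_zero[OF p hom_dom[OF x]] by simp
   hence "cdf Z (n + 1) ** ksgn k (cdf Z n ** t) = 0" using comm[OF k] by blast
   hence "cdf Z (n + 1) ** (cdf Z n ** t) = 0" using comp_ksgn[OF hom_comp[OF t d] d] by simp
   thus "cdf Z (n + 1) ** cdf Z n ** t = 0 ** t"
    using assoc[OF t d d] zero_comp[OF t hom_dom[OF d]] by simp
  qed
 qed
 note c = coh_SQ[OF Z]
 show "pres (cob Y n) (qH Z n) (rcomp (\<rho> n) (sH Z n))"
  using pres_rcomp[OF p SQ_pres[OF c(1)]] .
 show "(EX h. rcomp (\<rho> n) (sH Z n) T x h) \<longleftrightarrow> (EX t. \<rho> n T x t) & \<rho> (n + 1) T (cdf Y n ** x) 0"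
 proof
  assume "EX h. rcomp (\<rho> n) (sH Z n) T x h"
  then obtain t h where t: "\<rho> n T x t" "sH Z n T t h" unfolding rcomp_def by blast
  hence "cdf Z n ** t = 0" using c(2)[of n T t] by blast
  thus "(EX t. \<rho> n T x t) & \<rho> (n + 1) T (cdf Y n ** x) 0" using comm[OF t(1)] t by blast
 next
  assume r: "(EX t. \<rho> n T x t) & \<rho> (n + 1) T (cdf Y n ** x) 0"
  then obtain t where t: "\<rho> n T x t" by blast
  hence "cdf Z n ** t = 0" using comm r by blast
  hence "EX h. sH Z n T t h" using c(2)[of n T t] pres_hom2[OF p t] by blast
  thus "EX h. rcomp (\<rho> n) (sH Z n) T x h" unfolding rcomp_def using t by blast
 qed
 show "rcomp (\<rho> n) (sH Z n) T x 0 \<longleftrightarrow> (EX t. \<rho> n T x t) &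
   (EX T' e y u. cov e T' T & \<rho> (n - 1) T' y u & \<rho> n T' (x ** e - cdf Y (n - 1) ** y) 0)"
 proof
  assume "rcomp (\<rho> n) (sH Z n) T x 0"
  then obtain t where t: "\<rho> n T x t" "sH Z n T t 0" unfolding rcomp_def by blast
  obtain T1 e u where e: "cov e T1 T" "hom u T1 (cob Z (n - 1))" "t ** e = cdf Z (n - 1) ** u"
   using t(2) c(3) by blast
  obtain T2 f y where f: "cov f T2 T1" "\<rho> (n - 1) T2 y (u ** f)" using pres_surj[OF p e(2)] by blast
  obtain k where "\<rho> (n - 1 + 1) T2 (cdf Y (n - 1) ** y) (ksgn k (cdf Z (n - 1) ** (u ** f)))" using compat[OF f(2)] by blast
  hence k: "\<rho> n T2 (cdf Y (n - 1) ** y) (ksgn k (cdf Z (n - 1) ** (u ** f)))" by simp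
  note he = cov_hom[OF e(1)] and hf = cov_hom[OF f(1)] and hy = pres_hom1[OF p f(2)]
  have hd: "hom (cdf Z (n - 1)) (cob Z (n - 1)) (cob Z n)" using d[of "n - 1"] by simp
  have te: "t ** (e ** f) = cdf Z (n - 1) ** (u ** f)"
   using assoc[OF hf he pres_hom2[OF p t(1)]] e(3) assoc[OF hf e(2) hd] by simp
  have "\<rho> n T2 (x ** (e ** f)) (t ** (e ** f))" using pres_restr[OF p t(1) hom_comp[OF hf he]] .
  \<comment> \<open>The unknown sign is absorbed into the lift: \<open>y\<close> and
    \<open>u\<close> are replaced by their images under \<open>ksgn k\<close>.\<close>
  from pres_diff[OF p this pres_ksgn[OF p k, of k]]
  have "\<rho> n T2 (x ** (e ** f) - ksgn k (cdf Y (n - 1) ** y)) 0" unfolding te by (simp add: ksgn_ksgn ksgn_even)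
  hence "\<rho> n T2 (x ** (e ** f) - cdf Y (n - 1) ** ksgn k y) 0" using comp_ksgn[OF hy cpx_hom_d[OF Y]] by simp
  moreover have "\<rho> (n - 1) T2 (ksgn k y) (ksgn k (u ** f))" using pres_ksgn[OF p f(2)] .
  ultimately show "(EX t. \<rho> n T x t) &
   (EX T' e y u. cov e T' T & \<rho> (n - 1) T' y u & \<rho> n T' (x ** e - cdf Y (n - 1) ** y) 0)"
   using t(1) cov_comp[OF e(1) f(1)] by blast
 next
  assume "(EX t. \<rho> n T x t) &
   (EX T' e y u. cov e T' T & \<rho> (n - 1) T' y u & \<rho> n T' (x ** e - cdf Y (n - 1) ** y) 0)"
  then obtain t T' e y u where t: "\<rho> n T x t" and e: "cov e T' T" "\<rho> (n - 1) T' y u"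
   "\<rho> n T' (x ** e - cdf Y (n - 1) ** y) 0" by blast
  obtain k where "\<rho> (n - 1 + 1) T' (cdf Y (n - 1) ** y) (ksgn k (cdf Z (n - 1) ** u))" using compat[OF e(2)] by blast
  hence k: "\<rho> n T' (cdf Y (n - 1) ** y) (ksgn k (cdf Z (n - 1) ** u))" by simp
  have "\<rho> n T' (x ** e) (ksgn k (cdf Z (n - 1) ** u))" using pres_add[OF p e(3) k] by simp
  hence "t ** e = ksgn k (cdf Z (n - 1) ** u)" using pres_uniq[OF p pres_restr[OF p t cov_hom[OF e(1)]]] by blast
  hence "t ** e = cdf Z (n - 1) ** ksgn k u" using comp_ksgn[OF pres_hom2[OF p e(2)] d] by simp
  hence "sH Z n T t 0"
   using c(3)[of n T t] pres_hom2[OF p t] e(1) hom_ksgn[OF pres_hom2[OF p e(2)]] by blast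
  thus "rcomp (\<rho> n) (sH Z n) T x 0" unfolding rcomp_def using t by blast
 qed
qed


lemma sqr_ex: "SQ Y s ==> (EX t. sqr s T x t) \<longleftrightarrow> (EX w. hom w T (sub_ob s) & sub_ar s ** w = x)"
 unfolding sqr_def by blast

text \<open>The hypotheses speak of elements of \<open>Y\<close>, where the computations take place,
  while \<open>sq_map_spec\<close> wants elements of \<open>Q\<close>; these are lifted along a
  covering.\<close>

lemma rcomp_sq_map:
 assumes p: "pres Y Q \<rho>" and p': "pres Y' Q' \<rho>'" and s: "SQ Q s" and s': "SQ Q' s'"
  and \<psi>: "hom \<psi> Q Q'" and compat: "\<And>T x q. \<rho> T x q ==> \<rho>' T (\<phi> ** x) (\<psi> ** q)"
  and dom: "\<And>T x t. rcomp \<rho> (sqr s) T x t ==> EX t'. rcomp \<rho>' (sqr s') T (\<phi> ** x) t'"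
  and ker: "\<And>T x. rcomp \<rho> (sqr s) T x 0 ==> rcomp \<rho>' (sqr s') T (\<phi> ** x) 0"
 shows "hom (sq_map A s s' \<psi>) (quo_ob s) (quo_ob s')"
  and "sqr s T q t ==> sqr s' T (\<psi> ** q) (sq_map A s s' \<psi> ** t)"
  and "rcomp \<rho> (sqr s) T x t ==> rcomp \<rho>' (sqr s') T (\<phi> ** x) (sq_map A s s' \<psi> ** t)"
proof -
 note ps = SQ_pres[OF s] and ps' = SQ_pres[OF s']
 have 1: "EX t'. sqr s' T (\<psi> ** q) t'" if r: "sqr s T q t" for T q t
 proof -
  note q = pres_hom1[OF ps r]
  obtain T' e x where e: "cov e T' T" "\<rho> T' x (q ** e)" using pres_surj[OF p q] by blast
  note he = cov_hom[OF e(1)]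
  have "rcomp \<rho> (sqr s) T' x (t ** e)" unfolding rcomp_def using e(2) pres_restr[OF ps r he] by blast
  then obtain q' t' where q': "\<rho>' T' (\<phi> ** x) q'" "sqr s' T' q' t'" using dom unfolding rcomp_def by blast
  have "q' = \<psi> ** q ** e" using pres_uniq[OF p' q'(1) compat[OF e(2)]] assoc[OF he q \<psi>] by simp
  thus ?thesis using pres_dom[OF ps' hom_comp[OF q \<psi>] e(1)] q'(2) by blast
 qed
 have 2: "sqr s' T (\<psi> ** q) 0" if r: "sqr s T q 0" for T q
 proof -
  note q = pres_hom1[OF ps r]
  obtain T' e x where e: "cov e T' T" "\<rho> T' x (q ** e)" using pres_surj[OF p q] by blast
  note he = cov_hom[OF e(1)]
  have "sqr s T' (q ** e) 0" using pres_restr[OF ps r he] zero_comp[OF he pres_ob2[OF ps]] by simp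
  hence "rcomp \<rho> (sqr s) T' x 0" unfolding rcomp_def using e(2) by blast
  then obtain q' where q': "\<rho>' T' (\<phi> ** x) q'" "sqr s' T' q' 0" using ker unfolding rcomp_def by blast
  have "q' = \<psi> ** q ** e" using pres_uniq[OF p' q'(1) compat[OF e(2)]] assoc[OF he q \<psi>] by simp
  thus ?thesis using pres_zero_loc[OF ps' hom_comp[OF q \<psi>] e(1)] q'(2) by blast
 qed
 show "hom (sq_map A s s' \<psi>) (quo_ob s) (quo_ob s')"
  by (rule sq_map_spec(1)[OF s s' \<psi>]) (use 1 2 in blast)+
 have 3: "sqr s' T (\<psi> ** q) (sq_map A s s' \<psi> ** t)" if "sqr s T q t" for T q t
  by (rule sq_map_spec(2)[OF s s' \<psi> _ _ that]) (use 1 2 in blast)+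
 thus "sqr s T q t ==> sqr s' T (\<psi> ** q) (sq_map A s s' \<psi> ** t)" .
 show "rcomp \<rho>' (sqr s') T (\<phi> ** x) (sq_map A s s' \<psi> ** t)" if "rcomp \<rho> (sqr s) T x t"
  using that compat 3 unfolding rcomp_def by blast
qed

section \<open>The spectral sequence of a filtered complex\<close>

definition fG :: "('o, 'a) fcpx => int => int => 'o => 'a => bool" where
 "fG Fi p n T x \<longleftrightarrow> (EX u. hom u T (cob (stage Fi p) n) & incl Fi p n ** u = x)"

text \<open>Unlike in \<open>fil_conds\<close>, \<open>r\<close> is an integer, so that
  \<open>r - 1\<close> is exact; the passage between the two costs the assumption
  \<open>r \<ge> 1\<close>.\<close>

definition fZ :: "('o, 'a) fcpx => int => int => int => 'o => 'a => bool" where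
 "fZ Fi r p n T x \<longleftrightarrow> fG Fi p n T x & fG Fi (p - r) (n + 1) T (Md Fi n ** x)"

text \<open>The denominator of \<open>fil_E\<close>. A sum of two subobjects is an image, so the
  decomposition of an element exists only locally.\<close>

definition fB :: "('o, 'a) fcpx => int => int => int => 'o => 'a => bool" where
 "fB Fi r p n T x \<longleftrightarrow> hom x T (Mo Fi n) & (EX T' e y z. cov e T' T & fZ Fi (r - 1) (p - 1) n T' y &
   fZ Fi (r - 1) (p + r - 1) (n - 1) T' z & x ** e = y + Md Fi (n - 1) ** z)"

lemma filD:
 assumes "is_filtered A Fi"
 shows fil_amb: "is_complex A (amb Fi)" and fil_stage: "is_complex A (stage Fi p)"
  and fil_chain: "chain_map A (stage Fi p) (amb Fi) (incl Fi p)"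
  and fil_mono: "is_mono A (cob (stage Fi p) n) (incl Fi p n)"
 using assms unfolding is_filtered_def by blast+

lemma fil_incl: "is_filtered A Fi ==> hom (incl Fi p n) (cob (stage Fi p) n) (Mo Fi n)"
 using chain_map_hom[OF fil_chain fil_stage fil_amb] by blast

context
 fixes Fi :: "('o, 'a) fcpx"
 assumes F: "is_filtered A Fi"
begin

private abbreviation "M \<equiv> amb Fi"

lemma fG_hom: "fG Fi p n T x ==> hom x T (cob M n)"
 unfolding fG_def using hom_comp[OF _ fil_incl[OF F]] by blast

lemma fG_restr:
 assumes "fG Fi p n T x" and e: "hom e T' T"
 shows "fG Fi p n T' (x ** e)"
proof -
 obtain u where u: "hom u T (cob (stage Fi p) n)" "incl Fi p n ** u = x" using assms(1) unfolding fG_def by blast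
 thus ?thesis unfolding fG_def using assoc[OF e u(1) fil_incl[OF F]] hom_comp[OF e u(1)] by auto
qed

lemma fG_diff:
 assumes "fG Fi p n T x" "fG Fi p n T y"
 shows "fG Fi p n T (x - y)"
proof -
 obtain u v where u: "hom u T (cob (stage Fi p) n)" "incl Fi p n ** u = x"
  and v: "hom v T (cob (stage Fi p) n)" "incl Fi p n ** v = y" using assms unfolding fG_def by blast
 thus ?thesis unfolding fG_def using comp_diff[OF u(1) v(1) fil_incl[OF F]] hom_diff[OF u(1) v(1)] by auto
qed

lemma fG_zero: "T : obj A ==> fG Fi p n T 0"
 unfolding fG_def using hom_zero[OF _ hom_dom[OF fil_incl[OF F]]] comp_zero[OF _ fil_incl[OF F]] by blast

lemma fG_add: "fG Fi p n T x ==> fG Fi p n T y ==> fG Fi p n T (x + y)"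
 using fG_diff[of p n T x "0 - y"] fG_diff[of p n T 0 y] fG_zero[of T p n] hom_dom[OF fG_hom] by fastforce

lemma fG_coker: "hom x T (cob M n) ==> coker_ar A (cob M n) (incl Fi p n) ** x = 0 \<longleftrightarrow> fG Fi p n T x"
 unfolding fG_def using mono_coker_zero_iff[OF fil_incl[OF F] fil_mono[OF F]] by blast

lemma fG_Suc: "fG Fi p n T x ==> fG Fi (p + 1) n T x"
proof -
 assume "fG Fi p n T x"
 then obtain u where u: "hom u T (cob (stage Fi p) n)" "incl Fi p n ** u = x" unfolding fG_def by blast
 have "EX v:arr A (cob (stage Fi p) n) (cob (stage Fi (p + 1)) n). incl Fi (p + 1) n ** v = incl Fi p n"
  using F unfolding is_filtered_def by blast
 then obtain v where v: "v : arr A (cob (stage Fi p) n) (cob (stage Fi (p + 1)) n)" "incl Fi (p + 1) n ** v = incl Fi p n" by blast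
 hence hv: "hom v (cob (stage Fi p) n) (cob (stage Fi (p + 1)) n)" using fil_incl[OF F] by (simp add: hom_def)
 show "fG Fi (p + 1) n T x" unfolding fG_def
  using hom_comp[OF u(1) hv] assoc[OF u(1) hv fil_incl[OF F]] v(2) u(2) by auto
qed

lemma fG_mono: "p \<le> q ==> fG Fi p n T x ==> fG Fi q n T x"
 by (induction q rule: int_ge_induct) (auto intro: fG_Suc)

lemma fG_d:
 assumes "fG Fi p n T x"
 shows "fG Fi p (n + 1) T (cdf M n ** x)"
proof -
 obtain u where u: "hom u T (cob (stage Fi p) n)" "incl Fi p n ** u = x" using assms unfolding fG_def by blast
 show ?thesis unfolding fG_def
  using chain_map_dx[OF fil_chain[OF F] fil_stage[OF F] fil_amb[OF F] u(1)] u
   hom_comp[OF u(1) cpx_hom_d[OF fil_stage[OF F]]] by auto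
qed

lemma fG_d': "fG Fi p (n - 1) T x ==> fG Fi p n T (cdf M (n - 1) ** x)"
 using fG_d[of p "n - 1"] by simp

lemma fZ_hom: "fZ Fi r p n T x ==> hom x T (cob M n)"
 unfolding fZ_def by (blast intro: fG_hom)

lemma fZ_restr:
 assumes "fZ Fi r p n T x" and e: "hom e T' T"
 shows "fZ Fi r p n T' (x ** e)"
 using assms fG_restr[OF _ e] assoc[OF e fZ_hom[OF assms(1)] cpx_hom_d[OF fil_amb[OF F]]]
 unfolding fZ_def by fastforce

lemma fZ_diff:
 assumes "fZ Fi r p n T x" "fZ Fi r p n T y"
 shows "fZ Fi r p n T (x - y)"
 using assms fG_diff comp_diff[OF fZ_hom[OF assms(1)] fZ_hom[OF assms(2)] cpx_hom_d[OF fil_amb[OF F]]]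
 unfolding fZ_def by simp

lemma fZ_zero: "T : obj A ==> fZ Fi r p n T 0"
 unfolding fZ_def using fG_zero comp_zero[OF _ cpx_hom_d[OF fil_amb[OF F]]] by simp

lemma fZ_add:
 assumes "fZ Fi r p n T x" "fZ Fi r p n T y"
 shows "fZ Fi r p n T (x + y)"
 using assms fG_add comp_add[OF fZ_hom[OF assms(1)] fZ_hom[OF assms(2)] cpx_hom_d[OF fil_amb[OF F]]]
 unfolding fZ_def by simp

lemma fZ_mono: "p \<le> q ==> p - r \<le> q - s ==> fZ Fi r p n T x ==> fZ Fi s q n T x"
 unfolding fZ_def using fG_mono by blast

lemma fZ_dz:
 assumes "fZ Fi r q (n - 1) T z" and "q - r \<le> p"
 shows "fZ Fi s p n T (cdf M (n - 1) ** z)"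
proof -
 have "fG Fi p n T (cdf M (n - 1) ** z)" using assms fG_mono[of "q - r" p n] unfolding fZ_def by simp
 moreover have "cdf M n ** (cdf M (n - 1) ** z) = 0" using cpx_ddx'[OF fil_amb[OF F] fZ_hom[OF assms(1)]] .
 ultimately show ?thesis unfolding fZ_def using fG_zero hom_dom[OF fZ_hom[OF assms(1)]] by simp
qed

lemma fBI:
 assumes y: "fZ Fi (r - 1) (p - 1) n T y" and z: "fZ Fi (r - 1) (p + r - 1) (n - 1) T z"
 shows "fB Fi r p n T (y + cdf M (n - 1) ** z)"
proof -
 have h: "hom (y + cdf M (n - 1) ** z) T (cob M n)"
  using hom_add[OF fZ_hom[OF y] hom_comp[OF fZ_hom[OF z] cpx_hom_d'[OF fil_amb[OF F]]]] .
 thus ?thesis unfolding fB_def using y z cov_id[OF hom_dom[OF h]] comp_id[OF h] by blast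
qed

lemma fBI_z:
 assumes z: "fZ Fi (r - 1) (p + r - 1) (n - 1) T z"
 shows "fB Fi r p n T (cdf M (n - 1) ** z)"
 using fBI[OF fZ_zero[OF hom_dom[OF fZ_hom[OF z]]] z] by simp

lemma fBI_y:
 assumes y: "fZ Fi (r - 1) (p - 1) n T y"
 shows "fB Fi r p n T y"
 using fBI[OF y fZ_zero[OF hom_dom[OF fZ_hom[OF y]]]]
  comp_zero[OF hom_dom[OF fZ_hom[OF y]] cpx_hom_d'[OF fil_amb[OF F]], of n] by simp

lemma fB_loc:
 assumes x: "hom x T (cob M n)" and e: "cov e T' T" and b: "fB Fi r p n T' (x ** e)"
 shows "fB Fi r p n T x"
proof -
 obtain T2 f y z where f: "cov f T2 T'" "fZ Fi (r - 1) (p - 1) n T2 y"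
   "fZ Fi (r - 1) (p + r - 1) (n - 1) T2 z" "x ** e ** f = y + cdf M (n - 1) ** z"
  using b unfolding fB_def by blast
 have "x ** (e ** f) = y + cdf M (n - 1) ** z" using assoc[OF cov_hom[OF f(1)] cov_hom[OF e] x] f(4) by simp
 thus ?thesis unfolding fB_def using x cov_comp[OF e f(1)] f(2,3) by blast
qed

lemma fil_Z_SQ:
 shows "SQ (cob M n) (fil_Z A Fi r p n)"
  and "(EX w. hom w T (sub_ob (fil_Z A Fi r p n)) & sub_ar (fil_Z A Fi r p n) ** w = x) \<longleftrightarrow> fZ Fi (int r) p n T x"
  and "EX Z. g : fil_conds A Fi r p n --> hom g (cob M n) Z"
  and "hom x T (cob M n) ==> (ALL g:fil_conds A Fi r p n. g ** x = 0) \<longleftrightarrow> fZ Fi (int r) p n T x"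
proof -
 note d = cpx_hom_d[OF fil_amb[OF F], of n]
 obtain Q where Q: "hom (coker_ar A (cob M n) (incl Fi p n)) (cob M n) Q"
  using coker_ar_hom[OF fil_incl[OF F]] by blast
 obtain R where R: "hom (coker_ar A (cob M (n + 1)) (incl Fi (p - int r) (n + 1))) (cob M (n + 1)) R"
  using coker_ar_hom[OF fil_incl[OF F]] by blast
 have G: "EX Z. hom g (cob M n) Z" if "g : fil_conds A Fi r p n" for g
  using that Q hom_comp[OF d R] unfolding fil_conds_def by blast
 thus "EX Z. g : fil_conds A Fi r p n --> hom g (cob M n) Z" by blast
 have c: "(ALL g:fil_conds A Fi r p n. g ** x = 0) \<longleftrightarrow> fZ Fi (int r) p n T x" if x: "hom x T (cob M n)" for x T
  unfolding fil_conds_def fZ_def using fG_coker[OF x] fG_coker[OF hom_comp[OF x d]] assoc[OF x d R] by auto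
 thus "hom x T (cob M n) ==> (ALL g:fil_conds A Fi r p n. g ** x = 0) \<longleftrightarrow> fZ Fi (int r) p n T x" .
 have fin: "finite (fil_conds A Fi r p n)" unfolding fil_conds_def by simp
 note s = subquot0[OF cpx_ob[OF fil_amb[OF F]] fin G, folded fil_Z_def]
 show "SQ (cob M n) (fil_Z A Fi r p n)" using s(1) by blast
 have "(EX t. sqr (fil_Z A Fi r p n) T x t) \<longleftrightarrow> fZ Fi (int r) p n T x"
  using s(2)[of T x] c[of x T] fZ_hom by blast
 thus "(EX w. hom w T (sub_ob (fil_Z A Fi r p n)) & sub_ar (fil_Z A Fi r p n) ** w = x) \<longleftrightarrow> fZ Fi (int r) p n T x"
  using sqr_ex[OF s(1)] by blast
qed

lemma fil_E_SQ:
 assumes r: "r \<ge> 1"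
 shows "SQ (cob M n) (fil_E A Fi r p n)"
  and "(EX t. sE Fi r p n T x t) \<longleftrightarrow> fZ Fi (int r) p n T x"
  and "sE Fi r p n T x 0 \<longleftrightarrow> fB Fi (int r) p n T x"
proof -
 define U where "U = fil_Z A Fi (r - 1) (p - 1) n"
 define V where "V = fil_Z A Fi (r - 1) (p + int r - 1) (n - 1)"
 have ir: "int (r - 1) = int r - 1" using r by simp
 note d = cpx_hom_d'[OF fil_amb[OF F], of n]
 have U: "hom (sub_ar U) (sub_ob U) (cob M n)" unfolding U_def by (rule SQ_sub[OF fil_Z_SQ(1)])
 have V: "hom (sub_ar V) (sub_ob V) (cob M (n - 1))" unfolding V_def by (rule SQ_sub[OF fil_Z_SQ(1)])
 have Ux: "(EX w. hom w T (sub_ob U) & sub_ar U ** w = x) \<longleftrightarrow> fZ Fi (int r - 1) (p - 1) n T x" for T x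
  unfolding U_def fil_Z_SQ(2) ir ..
 have Vx: "(EX w. hom w T (sub_ob V) & sub_ar V ** w = x) \<longleftrightarrow> fZ Fi (int r - 1) (p + int r - 1) (n - 1) T x" for T x
  unfolding V_def fil_Z_SQ(2) ir ..
 have UZ: "fZ Fi (int r - 1) (p - 1) n (sub_ob U) (sub_ar U)"
  using Ux[of "sub_ob U"] hom_id[OF hom_dom[OF U]] comp_id[OF U] by blast
 have VZ: "fZ Fi (int r - 1) (p + int r - 1) (n - 1) (sub_ob V) (sub_ar V)"
  using Vx[of "sub_ob V"] hom_id[OF hom_dom[OF V]] comp_id[OF V] by blast
 have U0: "g ** sub_ar U = 0" if "g : fil_conds A Fi r p n" for g
  using fil_Z_SQ(4)[OF U, of r p] fZ_mono[OF _ _ UZ, of p "int r"] that by simp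
 have dV: "hom (cdf M (n - 1) ** sub_ar V) (sub_ob V) (cob M n)" using hom_comp[OF V d] .
 have V0: "g ** (cdf M (n - 1) ** sub_ar V) = 0" if "g : fil_conds A Fi r p n" for g
  using fil_Z_SQ(4)[OF dV, of r p] fZ_dz[OF VZ, of p "int r"] that by simp
 have fin: "finite (fil_conds A Fi r p n)" unfolding fil_conds_def by simp
 have G: "EX Z. hom g (cob M n) Z" if "g : fil_conds A Fi r p n" for g using fil_Z_SQ(3) that by blast
 have E: "fil_E A Fi r p n = subquot A (cob M n) (fil_conds A Fi r p n)
  {(sub_ob U, sub_ar U), (sub_ob V, cdf M (n - 1) ** sub_ar V)}"
  unfolding fil_E_def U_def V_def Let_def ..
 note s = subquot2[OF cpx_ob[OF fil_amb[OF F]] fin G U U0 dV V0, folded E]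
 show "SQ (cob M n) (fil_E A Fi r p n)" using s(1) by blast
 show "(EX t. sE Fi r p n T x t) \<longleftrightarrow> fZ Fi (int r) p n T x"
  using s(2)[of T x] fil_Z_SQ(4)[of x T n r p] fZ_hom by blast
 show "sE Fi r p n T x 0 \<longleftrightarrow> fB Fi (int r) p n T x"
 proof
  assume "sE Fi r p n T x 0"
  then obtain T' e u v where x: "hom x T (cob M n)" and e: "cov e T' T" "hom u T' (sub_ob U)"
   "hom v T' (sub_ob V)" "x ** e = sub_ar U ** u + cdf M (n - 1) ** sub_ar V ** v" using s(3) by blast
  have "x ** e = sub_ar U ** u + cdf M (n - 1) ** (sub_ar V ** v)" using e(4) assoc[OF e(3) V d] by simp
  moreover have "fZ Fi (int r - 1) (p - 1) n T' (sub_ar U ** u)" using Ux e(2) by blast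
  moreover have "fZ Fi (int r - 1) (p + int r - 1) (n - 1) T' (sub_ar V ** v)" using Vx e(3) by blast
  ultimately show "fB Fi (int r) p n T x" unfolding fB_def using x e(1) by blast
 next
  assume "fB Fi (int r) p n T x"
  then obtain T' e y z where x: "hom x T (cob M n)" and e: "cov e T' T" "fZ Fi (int r - 1) (p - 1) n T' y"
   "fZ Fi (int r - 1) (p + int r - 1) (n - 1) T' z" "x ** e = y + cdf M (n - 1) ** z" unfolding fB_def by blast
  obtain u where u: "hom u T' (sub_ob U)" "sub_ar U ** u = y" using e(2) Ux by blast
  obtain v where v: "hom v T' (sub_ob V)" "sub_ar V ** v = z" using e(3) Vx by blast
  have "x ** e = sub_ar U ** u + cdf M (n - 1) ** sub_ar V ** v" using e(4) u(2) v(2) assoc[OF v(1) V d] by simp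
  thus "sE Fi r p n T x 0" using s(3) x e(1) u(1) v(1) by blast
 qed
qed

lemma fil_E_pres: "r \<ge> 1 ==> pres (cob M n) (qE Fi r p n) (sE Fi r p n)"
 using SQ_pres[OF fil_E_SQ(1)] .

section \<open>The differentials and the passage to the next page\<close>

definition fdE :: "nat => int => int => 'a" where
 "fdE r p n = sq_map A (fil_E A Fi r p n) (fil_E A Fi r (p - int r) (n + 1)) (cdf M n)"

text \<open>If y lies in Z_(r-1) of stage p - 1, then d y is one of the boundaries divided out in
  stage p - r, because p - 1 = (p - r) + r - 1. The second summand of an element of
  \<open>fB\<close> is itself a differential and is killed by d.\<close>

lemma fdE_spec:
 assumes r: "r \<ge> 1"
 shows "hom (fdE r p n) (qE Fi r p n) (qE Fi r (p - int r) (n + 1))"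
  and "sE Fi r p n T x t ==> sE Fi r (p - int r) (n + 1) T (cdf M n ** x) (fdE r p n ** t)"
proof -
 note d = cpx_hom_d[OF fil_amb[OF F], of n]
 have dom: "EX t'. sE Fi r (p - int r) (n + 1) T (cdf M n ** x) t'"
  if s: "sE Fi r p n T x t" for T x t
 proof -
  have "fZ Fi (int r) p n T x" using fil_E_SQ(2)[OF r] s by blast
  hence "fZ Fi (int r) (p - int r) (n + 1) T (cdf M n ** x)" using fZ_dz[of "int r" p "n + 1" T x] by simp
  thus ?thesis using fil_E_SQ(2)[OF r] by blast
 qed
 have ker: "sE Fi r (p - int r) (n + 1) T (cdf M n ** x) 0"
  if s: "sE Fi r p n T x 0" for T x
 proof -
  have "fB Fi (int r) p n T x" using fil_E_SQ(3)[OF r] s by blast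
  then obtain T' e y z where x: "hom x T (cob M n)" and e: "cov e T' T" "fZ Fi (int r - 1) (p - 1) n T' y"
   "fZ Fi (int r - 1) (p + int r - 1) (n - 1) T' z" "x ** e = y + cdf M (n - 1) ** z" unfolding fB_def by blast
  have "cdf M n ** (x ** e) = cdf M n ** y"
   using e(4) comp_add[OF fZ_hom[OF e(2)] hom_comp[OF fZ_hom[OF e(3)] cpx_hom_d'[OF fil_amb[OF F]]] d]
    cpx_ddx'[OF fil_amb[OF F] fZ_hom[OF e(3)]] by simp
  moreover have "fB Fi (int r) (p - int r) (n + 1) T' (cdf M n ** y)"
   using fBI_z[of "int r" "p - int r" "n + 1" T' y] e(2) by simp
  ultimately have "fB Fi (int r) (p - int r) (n + 1) T (cdf M n ** x)"
   using fB_loc[OF hom_comp[OF x d] e(1)] assoc[OF cov_hom[OF e(1)] x d] by simp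
  thus ?thesis using fil_E_SQ(3)[OF r] by blast
 qed
 show "hom (fdE r p n) (qE Fi r p n) (qE Fi r (p - int r) (n + 1))"
  unfolding fdE_def
  by (rule sq_map_spec(1)[OF fil_E_SQ(1)[OF r] fil_E_SQ(1)[OF r] d]) (use dom ker in blast)+
 show "sE Fi r (p - int r) (n + 1) T (cdf M n ** x) (fdE r p n ** t)" if "sE Fi r p n T x t"
  unfolding fdE_def
  by (rule sq_map_spec(2)[OF fil_E_SQ(1)[OF r] fil_E_SQ(1)[OF r] d _ _ that]) (use dom ker in blast)+
qed

lemma fdE_spec':
 assumes r: "r \<ge> 1"
 shows "hom (fdE r (p + int r) (n - 1)) (qE Fi r (p + int r) (n - 1)) (qE Fi r p n)"
  and "sE Fi r (p + int r) (n - 1) T x t ==>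
   sE Fi r p n T (cdf M (n - 1) ** x) (fdE r (p + int r) (n - 1) ** t)"
 using fdE_spec[OF r, of "p + int r" "n - 1"] by simp_all

definition fH :: "nat => int => int => ('o, 'a) subq" where
 "fH r p n = subquot A (qE Fi r p n) {fdE r p n}
   {(qE Fi r (p + int r) (n - 1), fdE r (p + int r) (n - 1))}"

lemma fdE_comp:
 assumes r: "r \<ge> 1"
 shows "fdE r p n ** fdE r (p + int r) (n - 1) = 0"
proof (rule pres_eq[OF fil_E_pres[OF r] hom_comp[OF fdE_spec'(1)[OF r] fdE_spec(1)[OF r]] hom_zero])
 show o: "qE Fi r (p + int r) (n - 1) : obj A" "qE Fi r (p - int r) (n + 1) : obj A"
  using pres_ob2[OF fil_E_pres[OF r]] by blast+
 fix T x t assume s: "sE Fi r (p + int r) (n - 1) T x t"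
 note x = pres_hom1[OF fil_E_pres[OF r] s] and t = pres_hom2[OF fil_E_pres[OF r] s]
 have "sE Fi r (p - int r) (n + 1) T 0 (fdE r p n ** (fdE r (p + int r) (n - 1) ** t))"
  using fdE_spec(2)[OF r fdE_spec'(2)[OF r s]] cpx_ddx'[OF fil_amb[OF F] x] by simp
 hence "fdE r p n ** (fdE r (p + int r) (n - 1) ** t) = 0" using pres_0[OF fil_E_pres[OF r]] by blast
 thus "fdE r p n ** fdE r (p + int r) (n - 1) ** t = 0 ** t"
  using assoc[OF t fdE_spec'(1)[OF r] fdE_spec(1)[OF r]] zero_comp[OF t o(2)] by simp
qed

text \<open>Cohomology of a page in terms of the underlying complex, so that it can be compared with
  the next page element by element.\<close>

lemma fH_SQ:
 assumes r: "r \<ge> 1"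
 shows "SQ (qE Fi r p n) (fH r p n)"
  and "(EX h. rcomp (sE Fi r p n) (sqr (fH r p n)) T x h) \<longleftrightarrow>
   fZ Fi (int r) p n T x & fB Fi (int r) (p - int r) (n + 1) T (cdf M n ** x)"
  and "rcomp (sE Fi r p n) (sqr (fH r p n)) T x 0 \<longleftrightarrow> fZ Fi (int r) p n T x &
   (EX T' e z. cov e T' T & fZ Fi (int r) (p + int r) (n - 1) T' z &
     fB Fi (int r) p n T' (x ** e - cdf M (n - 1) ** z))"
proof -
 let ?E = "fil_E A Fi r p n" and ?E' = "fil_E A Fi r (p + int r) (n - 1)"
 note p = fil_E_pres[OF r] and dE = fdE_spec[OF r, of p n] and dE' = fdE_spec'[OF r, of p n]
 have c: "quo_ob ?E : obj A" "finite {fdE r p n}" "\<And>g. g : {fdE r p n} ==> EX Z. hom g (quo_ob ?E) Z"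
  "hom (fdE r (p + int r) (n - 1)) (quo_ob ?E') (quo_ob ?E)"
  "\<And>g. g : {fdE r p n} ==> g ** fdE r (p + int r) (n - 1) = 0"
  using pres_ob2[OF p] dE(1) dE'(1) fdE_comp[OF r] by blast+
 note s = subquot1[OF c, folded fH_def]
 show "SQ (quo_ob ?E) (fH r p n)" using s(1) by blast
 show "(EX h. rcomp (sqr ?E) (sqr (fH r p n)) T x h) \<longleftrightarrow>
   fZ Fi (int r) p n T x & fB Fi (int r) (p - int r) (n + 1) T (cdf M n ** x)"
 proof
  assume "EX h. rcomp (sqr ?E) (sqr (fH r p n)) T x h"
  then obtain t h where t: "sqr ?E T x t" "sqr (fH r p n) T t h" unfolding rcomp_def by blast
  hence "fdE r p n ** t = 0" using s(2)[of T t] by blast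
  thus "fZ Fi (int r) p n T x & fB Fi (int r) (p - int r) (n + 1) T (cdf M n ** x)"
   using dE(2)[OF t(1)] fil_E_SQ[OF r] t(1) by metis
 next
  assume a: "fZ Fi (int r) p n T x & fB Fi (int r) (p - int r) (n + 1) T (cdf M n ** x)"
  then obtain t where t: "sqr ?E T x t" using fil_E_SQ(2)[OF r] by blast
  have "fdE r p n ** t = 0" using pres_uniq[OF p dE(2)[OF t]] fil_E_SQ(3)[OF r] a by blast
  then obtain h where "sqr (fH r p n) T t h" using s(2)[of T t] pres_hom2[OF p t] by blast
  thus "EX h. rcomp (sqr ?E) (sqr (fH r p n)) T x h" unfolding rcomp_def using t by blast
 qed
 show "rcomp (sqr ?E) (sqr (fH r p n)) T x 0 \<longleftrightarrow> fZ Fi (int r) p n T x &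
   (EX T' e z. cov e T' T & fZ Fi (int r) (p + int r) (n - 1) T' z &
     fB Fi (int r) p n T' (x ** e - cdf M (n - 1) ** z))"
 proof
  assume "rcomp (sqr ?E) (sqr (fH r p n)) T x 0"
  then obtain t where t: "sqr ?E T x t" "sqr (fH r p n) T t 0" unfolding rcomp_def by blast
  obtain T1 e u where e: "cov e T1 T" "hom u T1 (quo_ob ?E')" "t ** e = fdE r (p + int r) (n - 1) ** u"
   using t(2) s(3) by blast
  obtain T2 f z where f: "cov f T2 T1" "sqr ?E' T2 z (u ** f)" using pres_surj[OF p e(2)] by blast
  note he = cov_hom[OF e(1)] and hf = cov_hom[OF f(1)]
  have te: "t ** (e ** f) = fdE r (p + int r) (n - 1) ** (u ** f)"
   using assoc[OF hf he pres_hom2[OF p t(1)]] e(3) assoc[OF hf e(2) dE'(1)] by simp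
  have "sqr ?E T2 (x ** (e ** f) - cdf M (n - 1) ** z) (t ** (e ** f) - fdE r (p + int r) (n - 1) ** (u ** f))"
   using pres_diff[OF p pres_restr[OF p t(1) hom_comp[OF hf he]] dE'(2)[OF f(2)]] .
  hence "fB Fi (int r) p n T2 (x ** (e ** f) - cdf M (n - 1) ** z)" unfolding te using fil_E_SQ(3)[OF r] by simp
  moreover have "fZ Fi (int r) (p + int r) (n - 1) T2 z" using f(2) fil_E_SQ(2)[OF r] by blast
  moreover have "fZ Fi (int r) p n T x" using t(1) fil_E_SQ(2)[OF r] by blast
  ultimately show "fZ Fi (int r) p n T x & (EX T' e z. cov e T' T & fZ Fi (int r) (p + int r) (n - 1) T' z &
     fB Fi (int r) p n T' (x ** e - cdf M (n - 1) ** z))" using cov_comp[OF e(1) f(1)] by blast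
 next
  assume "fZ Fi (int r) p n T x & (EX T' e z. cov e T' T & fZ Fi (int r) (p + int r) (n - 1) T' z &
     fB Fi (int r) p n T' (x ** e - cdf M (n - 1) ** z))"
  then obtain T' e z where x: "fZ Fi (int r) p n T x" and e: "cov e T' T"
   "fZ Fi (int r) (p + int r) (n - 1) T' z" "fB Fi (int r) p n T' (x ** e - cdf M (n - 1) ** z)" by blast
  obtain t where t: "sqr ?E T x t" using x fil_E_SQ(2)[OF r] by blast
  obtain u where u: "sqr ?E' T' z u" using e(2) fil_E_SQ(2)[OF r] by blast
  have "sqr ?E T' (x ** e - cdf M (n - 1) ** z) 0" using e(3) fil_E_SQ(3)[OF r] by blast
  hence "t ** e - fdE r (p + int r) (n - 1) ** u = 0"
   using pres_uniq[OF p pres_diff[OF p pres_restr[OF p t cov_hom[OF e(1)]] dE'(2)[OF u]]] by blast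
  hence "sqr (fH r p n) T t 0"
   using s(3)[of T t] pres_hom2[OF p t] e(1) pres_hom2[OF p u] by auto
  thus "rcomp (sqr ?E) (sqr (fH r p n)) T x 0" unfolding rcomp_def using t by blast
 qed
qed

definition fnext :: "nat => int => int => 'a" where
 "fnext r p n = (let e' = fil_E A Fi (Suc r) p n; e = fil_E A Fi r p n; h = fH r p n
   in THE t. t : arr A (quo_ob e') (quo_ob h) &
    (EX w:arr A (sub_ob e') (sub_ob e). EX s:arr A (sub_ob e') (sub_ob h).
     sub_ar e ** w = sub_ar e' & sub_ar h ** s = quo_ar e ** w & t ** quo_ar e' = quo_ar h ** s))"

lemma the_next_eqI:
 assumes e': "SQ Y e'" and e: "SQ Y e" and h: "SQ (quo_ob e) h" and \<theta>: "hom \<theta> (quo_ob e') (quo_ob h)"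
  and rel: "rcomp (sqr e) (sqr h) (sub_ob e') (sub_ar e') (\<theta> ** quo_ar e')"
 shows "(THE t. t : arr A (quo_ob e') (quo_ob h) &
    (EX w:arr A (sub_ob e') (sub_ob e). EX s:arr A (sub_ob e') (sub_ob h).
     sub_ar e ** w = sub_ar e' & sub_ar h ** s = quo_ar e ** w & t ** quo_ar e' = quo_ar h ** s)) = \<theta>"
proof (rule the_equality)
 obtain w s where w: "hom w (sub_ob e') (sub_ob e)" "sub_ar e ** w = sub_ar e'"
  and s: "hom s (sub_ob e') (sub_ob h)" "sub_ar h ** s = quo_ar e ** w" "quo_ar h ** s = \<theta> ** quo_ar e'"
  using rel unfolding rcomp_def sqr_def by blast
 thus "\<theta> : arr A (quo_ob e') (quo_ob h) &
    (EX w:arr A (sub_ob e') (sub_ob e). EX s:arr A (sub_ob e') (sub_ob h).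
     sub_ar e ** w = sub_ar e' & sub_ar h ** s = quo_ar e ** w & \<theta> ** quo_ar e' = quo_ar h ** s)"
  using hom_arr[OF \<theta>] hom_arr[OF w(1)] hom_arr[OF s(1)] by force
 fix t assume "t : arr A (quo_ob e') (quo_ob h) &
    (EX w:arr A (sub_ob e') (sub_ob e). EX s:arr A (sub_ob e') (sub_ob h).
     sub_ar e ** w = sub_ar e' & sub_ar h ** s = quo_ar e ** w & t ** quo_ar e' = quo_ar h ** s)"
 then obtain v u where *: "t : arr A (quo_ob e') (quo_ob h)" "v : arr A (sub_ob e') (sub_ob e)"
  "u : arr A (sub_ob e') (sub_ob h)" "sub_ar e ** v = sub_ar e'" "sub_ar h ** u = quo_ar e ** v"
  "t ** quo_ar e' = quo_ar h ** u" by blast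
 have v: "hom v (sub_ob e') (sub_ob e)" and u: "hom u (sub_ob e') (sub_ob h)" and t: "hom t (quo_ob e') (quo_ob h)"
  using * w(1) s(1) \<theta> by (auto simp: hom_def)
 have "v = w" using mono_cancel[OF SQ_mono[OF e] v w(1)] *(4) w(2) by simp
 hence "u = s" using mono_cancel[OF SQ_mono[OF h] u s(1)] *(5) s(2) by simp
 thus "t = \<theta>" using cov_cancel[OF SQ_cov[OF e'] t \<theta>] *(6) s(3) by simp
qed

text \<open>Both objects are subquotients of the same term of the complex, so
  \<open>pres_iso_ex\<close> reduces the isomorphism to inclusions between the Z and B of
  consecutive pages.\<close>

lemma fnext_spec:
 assumes r: "r \<ge> 1"
 shows "is_iso A (qE Fi (Suc r) p n) (quo_ob (fH r p n)) (fnext r p n)"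
  and "sE Fi (Suc r) p n T x t ==>
   rcomp (sE Fi r p n) (sqr (fH r p n)) T x (fnext r p n ** t)"
proof -
 let ?E' = "fil_E A Fi (Suc r) p n" and ?E = "fil_E A Fi r p n"
 have r': "Suc r \<ge> 1" by simp
 note C = fil_amb[OF F] and EH = fil_E_SQ[OF r] and E'H = fil_E_SQ[OF r'] and H = fH_SQ[OF r, of p n]
 note pH = pres_rcomp[OF fil_E_pres[OF r] SQ_pres[OF H(1)]]
 have i: "int (Suc r) = int r + 1" by simp
 have dom: "EX t'. rcomp (sqr ?E) (sqr (fH r p n)) T x t'" if "sqr ?E' T x t" for T x t
 proof -
  have z: "fZ Fi (int r + 1) p n T x" using that E'H(2)[of p n T x] unfolding i by blast
  have "fZ Fi (int r) p n T x" using fZ_mono[OF _ _ z] by simp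
  moreover have "fZ Fi (int r - 1) (p - int r - 1) (n + 1) T (cdf M n ** x)"
   using fZ_dz[of "int r + 1" p "n + 1" T x] z by simp
  ultimately show ?thesis using H(2) fBI_y by blast
 qed
 have ker: "rcomp (sqr ?E) (sqr (fH r p n)) T x 0" if "sqr ?E' T x 0" for T x
 proof -
  have "fB Fi (int r + 1) p n T x" using that E'H(3)[of p n T x] unfolding i by blast
  then obtain T' e y z where x: "hom x T (cob M n)" and e: "cov e T' T" "fZ Fi (int r) (p - 1) n T' y"
   "fZ Fi (int r) (p + int r) (n - 1) T' z" "x ** e = y + cdf M (n - 1) ** z"
   unfolding fB_def by (auto simp: algebra_simps)
  have "fB Fi (int r) p n T' y" using fBI_y[OF fZ_mono[OF _ _ e(2)]] by simp
  hence "fB Fi (int r) p n T' (x ** e - cdf M (n - 1) ** z)" using e(4) by simp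
  moreover have "fZ Fi (int r + 1) p n T x"
   using E'H(2)[of p n T x] that unfolding i by blast
  hence "fZ Fi (int r) p n T x" by (rule fZ_mono[rotated 2]) simp_all
  ultimately show ?thesis using H(3) e(1,3) by blast
 qed
 have inj: "sqr ?E' T x 0" if s1: "sqr ?E' T x t" and s2: "rcomp (sqr ?E) (sqr (fH r p n)) T x 0" for T x t
 proof -
  have x: "fZ Fi (int r + 1) p n T x" using s1 E'H(2)[of p n T x] unfolding i by blast
  obtain T1 e z where e: "cov e T1 T" "fZ Fi (int r) (p + int r) (n - 1) T1 z"
   "fB Fi (int r) p n T1 (x ** e - cdf M (n - 1) ** z)" using s2 H(3) by blast
  obtain T2 f y z' where f: "cov f T2 T1" "fZ Fi (int r - 1) (p - 1) n T2 y"
   "fZ Fi (int r - 1) (p + int r - 1) (n - 1) T2 z'"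
   "(x ** e - cdf M (n - 1) ** z) ** f = y + cdf M (n - 1) ** z'" using e(3) unfolding fB_def by blast
  note he = cov_hom[OF e(1)] and hf = cov_hom[OF f(1)] and hx = fZ_hom[OF x]
  note d' = cpx_hom_d'[OF C, of n]
  have zf: "fZ Fi (int r) (p + int r) (n - 1) T2 (z ** f)" using fZ_restr[OF e(2) hf] .
  \<comment> \<open>Z_(r-1) of stage p + r - 1 is contained in Z_r of stage p + r: both require the
    differential to lie in stage p.\<close>
  have z'2: "fZ Fi (int r) (p + int r) (n - 1) T2 z'" using fZ_mono[OF _ _ f(3)] by simp
  have zz: "fZ Fi (int r) (p + int r) (n - 1) T2 (z ** f + z')" using fZ_add[OF zf z'2] .
  have eq: "x ** (e ** f) = y + cdf M (n - 1) ** (z ** f + z')"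
   using f(4) diff_comp[OF hf hom_comp[OF he hx] hom_comp[OF fZ_hom[OF e(2)] d']] assoc[OF hf he hx]
    assoc[OF hf fZ_hom[OF e(2)] d'] comp_add[OF fZ_hom[OF zf] fZ_hom[OF z'2] d'] by (simp add: algebra_simps)
  have xef: "fZ Fi (int r + 1) p n T2 (x ** (e ** f))" using fZ_restr[OF x hom_comp[OF hf he]] .
  have "cdf M n ** y = cdf M n ** (x ** (e ** f))"
   using eq comp_add[OF fZ_hom[OF f(2)] hom_comp[OF fZ_hom[OF zz] d'] cpx_hom_d[OF C]]
    cpx_ddx'[OF C fZ_hom[OF zz]] by simp
  \<comment> \<open>\<open>y\<close> has the same differential as \<open>x ** (e ** f)\<close>,
    which lies in stage p - r - 1; this gains the one step needed for the next page.\<close>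
  hence "fZ Fi (int r) (p - 1) n T2 y" using f(2) xef unfolding fZ_def by (simp add: algebra_simps)
  hence "fB Fi (int r + 1) p n T x"
   unfolding fB_def using hx cov_comp[OF e(1) f(1)] zz eq by (auto simp: algebra_simps)
  thus ?thesis using E'H(3)[of p n T x] unfolding i by blast
 qed
 have surj: "EX T' e y s. cov e T' T & sqr ?E' T' y s & rcomp (sqr ?E) (sqr (fH r p n)) T' (y - x ** e) 0"
  if "rcomp (sqr ?E) (sqr (fH r p n)) T x t" for T x t
 proof -
  have x: "fZ Fi (int r) p n T x" and b: "fB Fi (int r) (p - int r) (n + 1) T (cdf M n ** x)"
   using that H(2) by blast+
  obtain T' e y z where e: "cov e T' T" "fZ Fi (int r - 1) (p - int r - 1) (n + 1) T' y"
   "fZ Fi (int r - 1) (p - 1) n T' z" "cdf M n ** x ** e = y + cdf M n ** z"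
   using b unfolding fB_def by auto
  note he = cov_hom[OF e(1)] and hx = fZ_hom[OF x] and hz = fZ_hom[OF e(3)]
  have xe: "hom (x ** e) T' (cob M n)" using hom_comp[OF he hx] .
  have "cdf M n ** (x ** e - z) = y"
   using comp_diff[OF xe hz cpx_hom_d[OF C]] assoc[OF he hx cpx_hom_d[OF C]] e(4) by (metis add_diff_cancel_right')
  moreover have "fG Fi p n T' (x ** e - z)"
   using fG_diff[of p n T' "x ** e" z] fZ_restr[OF x he] e(3) fG_mono[of "p - 1" p] unfolding fZ_def by auto
  \<comment> \<open>After subtraction of \<open>z\<close> only \<open>y\<close> is left in the
    differential, one stage deeper than before; \<open>z\<close> itself has class zero in
    E_r.\<close>
  ultimately have "fZ Fi (int r + 1) p n T' (x ** e - z)" using e(2) unfolding fZ_def by (simp add: algebra_simps)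
  then obtain s where s: "sqr ?E' T' (x ** e - z) s" using E'H(2)[of p n T'] unfolding i by blast
  have T': "T' : obj A" using hom_dom[OF he] .
  have b: "fB Fi (int r) p n T' z" using fBI_y[OF e(3)] .
  hence "sqr ?E T' z 0" using EH(3) by blast
  hence "rcomp (sqr ?E) (sqr (fH r p n)) T' z 0"
   unfolding rcomp_def using pres_zero[OF SQ_pres[OF H(1)] T'] by blast
  hence "rcomp (sqr ?E) (sqr (fH r p n)) T' (- z) (- 0)" using pres_uminus[OF pH] by blast
  hence "rcomp (sqr ?E) (sqr (fH r p n)) T' (x ** e - z - x ** e) 0" by simp
  thus ?thesis using e(1) s by blast
 qed
 have "EX \<theta>. is_iso A (quo_ob ?E') (quo_ob (fH r p n)) \<theta> &
  (ALL T x t. sqr ?E' T x t --> rcomp (sqr ?E) (sqr (fH r p n)) T x (\<theta> ** t))"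
  by (rule pres_iso_ex[OF fil_E_pres[OF r'] pH]) (fact dom ker inj surj)+
 then obtain \<theta> where \<theta>: "is_iso A (quo_ob ?E') (quo_ob (fH r p n)) \<theta>"
  "ALL T x t. sqr ?E' T x t --> rcomp (sqr ?E) (sqr (fH r p n)) T x (\<theta> ** t)" by blast
 have h\<theta>: "hom \<theta> (quo_ob ?E') (quo_ob (fH r p n))"
  using is_iso_hom[OF \<theta>(1) pres_ob2[OF fil_E_pres[OF r']] pres_ob2[OF pH]] .
 have "fnext r p n = \<theta>" unfolding fnext_def Let_def
  by (rule the_next_eqI[OF E'H(1) EH(1) H(1) h\<theta>]) (use \<theta>(2) SQ_generic[OF E'H(1)] in blast)
 thus "is_iso A (quo_ob ?E') (quo_ob (fH r p n)) (fnext r p n)"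
  "sqr ?E' T x t ==> rcomp (sqr ?E) (sqr (fH r p n)) T x (fnext r p n ** t)" using \<theta> by auto
qed

lemma ss_of_simps:
 shows "page (ss_of A Fi) r i j = qE Fi r j (i + j)"
  and "sdiff (ss_of A Fi) r i j = fdE r j (i + j)"
  and "page_coh A (ss_of A Fi) r i j = fH r j (i + j)"
  and "snext (ss_of A Fi) r i j = fnext r j (i + j)"
proof -
 show 1: "page (ss_of A Fi) r i j = qE Fi r j (i + j)" for r i j
  by (simp add: ss_of_def ss_pre_def)
 show 2: "sdiff (ss_of A Fi) r i j = fdE r j (i + j)" for r i j
  by (simp add: ss_of_def ss_pre_def fdE_def)
 have idx: "i - int r - 1 + (j + int r) = i + j - 1" by simp
 show 4: "page_coh A (ss_of A Fi) r i j = fH r j (i + j)"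
  unfolding page_coh_def fH_def 1 2 idx ..
 \<comment> \<open>\<open>page_coh\<close> does not look at \<open>snext\<close>, so it is the same
   for \<open>ss_pre\<close> and \<open>ss_of\<close>.\<close>
 have 3: "page_coh A (ss_pre A Fi) r i j = fH r j (i + j)"
  unfolding 4[symmetric] page_coh_def by (simp add: ss_of_def)
 show "snext (ss_of A Fi) r i j = fnext r j (i + j)"
  unfolding fnext_def 3[symmetric] by (simp add: ss_of_def Let_def)
qed

lemma ss_of_spectral_sequence: "is_spectral_sequence A (ss_of A Fi)"
 unfolding is_spectral_sequence_def ss_of_simps
proof (intro allI impI conjI)
 fix r :: nat and i j :: int assume r: "1 \<le> r"
 have idx: "i + int r + 1 + (j - int r) = i + j + 1" by simp
 show "qE Fi r j (i + j) : obj A" using pres_ob2[OF fil_E_pres[OF r]] .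
 show "fdE r j (i + j) : arr A (qE Fi r j (i + j)) (qE Fi r (j - int r) (i + int r + 1 + (j - int r)))"
  unfolding idx using hom_arr[OF fdE_spec(1)[OF r]] .
 show "fdE r (j - int r) (i + int r + 1 + (j - int r)) ** fdE r j (i + j) = 0"
  using fdE_comp[OF r, of "j - int r" "i + j + 1"] unfolding idx by simp
 show "is_iso A (qE Fi (Suc r) j (i + j)) (quo_ob (fH r j (i + j))) (fnext r j (i + j))"
  using fnext_spec(1)[OF r] .
qed

end


section \<open>Maps of filtered complexes and the induced maps of spectral sequences\<close>

definition fmap :: "('o, 'a) fcpx => ('o, 'a) fcpx => (int => 'a) => bool" where
 "fmap Fi Fi' \<phi> \<longleftrightarrow> is_filtered A Fi & is_filtered A Fi' & chain_map A (amb Fi) (amb Fi') \<phi> &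
   (ALL p n T x. fG Fi p n T x --> fG Fi' p n T (\<phi> n ** x))"

context
 fixes Fi Fi' \<phi>
 assumes f: "fmap Fi Fi' \<phi>"
begin

lemma fmapD:
 shows "is_filtered A Fi" "is_filtered A Fi'" "chain_map A (amb Fi) (amb Fi') \<phi>"
  "is_complex A (amb Fi)" "is_complex A (amb Fi')" "hom (\<phi> n) (Mo Fi n) (Mo Fi' n)"
  "fG Fi p n T x ==> fG Fi' p n T (\<phi> n ** x)"
proof -
 show 1: "is_filtered A Fi" "is_filtered A Fi'" "chain_map A (amb Fi) (amb Fi') \<phi>"
  and "fG Fi p n T x ==> fG Fi' p n T (\<phi> n ** x)" using f unfolding fmap_def by blast+
 show 2: "is_complex A (amb Fi)" "is_complex A (amb Fi')" using fil_amb 1 by blast+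
 show "hom (\<phi> n) (Mo Fi n) (Mo Fi' n)" using chain_map_hom[OF 1(3) 2] .
qed

lemma fmap_dx: "hom x T (Mo Fi n) ==> Md Fi' n ** (\<phi> n ** x) = \<phi> (n + 1) ** (Md Fi n ** x)"
 using chain_map_dx[OF fmapD(3-5)] .

lemma fmap_dx': "hom x T (Mo Fi (n - 1)) ==> Md Fi' (n - 1) ** (\<phi> (n - 1) ** x) = \<phi> n ** (Md Fi (n - 1) ** x)"
 using fmap_dx[of x T "n - 1"] by simp

lemma fmap_fZ: "fZ Fi r p n T x ==> fZ Fi' r p n T (\<phi> n ** x)"
 using fmap_dx[OF fZ_hom[OF fmapD(1)], of r p n T x] fmapD(7) unfolding fZ_def by simp

lemma fmap_fB:
 assumes "fB Fi r p n T x"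
 shows "fB Fi' r p n T (\<phi> n ** x)"
proof -
 obtain T' e y z where x: "hom x T (Mo Fi n)" and e: "cov e T' T" "fZ Fi (r - 1) (p - 1) n T' y"
   "fZ Fi (r - 1) (p + r - 1) (n - 1) T' z" "x ** e = y + Md Fi (n - 1) ** z"
  using assms unfolding fB_def by blast
 note z = fZ_hom[OF fmapD(1) e(3)] and y = fZ_hom[OF fmapD(1) e(2)]
 have "\<phi> n ** x ** e = \<phi> n ** y + Md Fi' (n - 1) ** (\<phi> (n - 1) ** z)"
  using assoc[OF cov_hom[OF e(1)] x fmapD(6)] e(4)
   comp_add[OF y hom_comp[OF z cpx_hom_d'[OF fmapD(4)]] fmapD(6)] fmap_dx'[OF z] by simp
 thus ?thesis unfolding fB_def using hom_comp[OF x fmapD(6)] e(1) fmap_fZ[OF e(2)] fmap_fZ[OF e(3)] by blast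
qed

definition fEm :: "nat => int => int => 'a" where
 "fEm r p n = sq_map A (fil_E A Fi r p n) (fil_E A Fi' r p n) (\<phi> n)"

lemma ss_map_fEm: "ss_map A Fi Fi' \<phi> r i j = fEm r j (i + j)"
 unfolding ss_map_def fEm_def ..

lemma fEm_spec:
 assumes r: "r \<ge> 1"
 shows "hom (fEm r p n) (qE Fi r p n) (qE Fi' r p n)"
  and "sE Fi r p n T x t ==> sE Fi' r p n T (\<phi> n ** x) (fEm r p n ** t)"
proof -
 note E = fil_E_SQ[OF fmapD(1) r, where p = p and n = n] and E' = fil_E_SQ[OF fmapD(2) r, where p = p and n = n]
 have dom: "EX t'. sE Fi' r p n T (\<phi> n ** x) t'" if "sE Fi r p n T x t" for T x t
  using that E(2) E'(2) fmap_fZ by blast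
 have ker: "sE Fi' r p n T (\<phi> n ** x) 0" if "sE Fi r p n T x 0" for T x
  using that E(3) E'(3) fmap_fB by blast
 show "hom (fEm r p n) (qE Fi r p n) (qE Fi' r p n)" unfolding fEm_def
  by (rule sq_map_spec(1)[OF E(1) E'(1) fmapD(6)]) (use dom ker in blast)+
 show "sE Fi' r p n T (\<phi> n ** x) (fEm r p n ** t)" if "sE Fi r p n T x t" unfolding fEm_def
  by (rule sq_map_spec(2)[OF E(1) E'(1) fmapD(6) _ _ that]) (use dom ker in blast)+
qed

lemma fEm_fdE:
 assumes r: "r \<ge> 1"
 shows "fEm r (p - int r) (n + 1) ** fdE Fi r p n = fdE Fi' r p n ** fEm r p n"
proof (rule pres_eq[OF fil_E_pres[OF fmapD(1) r]])
 note d = fdE_spec[OF fmapD(1) r] and d' = fdE_spec[OF fmapD(2) r] and m = fEm_spec[OF r]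
 show "hom (fEm r (p - int r) (n + 1) ** fdE Fi r p n) (qE Fi r p n) (qE Fi' r (p - int r) (n + 1))"
  using hom_comp[OF d(1) m(1)] .
 show "hom (fdE Fi' r p n ** fEm r p n) (qE Fi r p n) (qE Fi' r (p - int r) (n + 1))"
  using hom_comp[OF m(1) d'(1)] .
 fix T x t assume s: "sE Fi r p n T x t"
 note x = pres_hom1[OF fil_E_pres[OF fmapD(1) r] s] and t = pres_hom2[OF fil_E_pres[OF fmapD(1) r] s]
 have "fEm r (p - int r) (n + 1) ** (fdE Fi r p n ** t) = fdE Fi' r p n ** (fEm r p n ** t)"
  using pres_uniq[OF fil_E_pres[OF fmapD(2) r] m(2)[OF d(2)[OF s]], of "fdE Fi' r p n ** (fEm r p n ** t)"]
   d'(2)[OF m(2)[OF s]] fmap_dx[OF x] by simp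
 thus "fEm r (p - int r) (n + 1) ** fdE Fi r p n ** t = fdE Fi' r p n ** fEm r p n ** t"
  using assoc[OF t d(1) m(1)] assoc[OF t m(1) d'(1)] by simp
qed

lemma fHm_spec:
 fixes p n
 assumes r: "r \<ge> 1"
 defines "\<eta> \<equiv> sq_map A (fH Fi r p n) (fH Fi' r p n) (fEm r p n)"
 shows "hom \<eta> (quo_ob (fH Fi r p n)) (quo_ob (fH Fi' r p n))"
  and "rcomp (sE Fi r p n) (sqr (fH Fi r p n)) T x t ==>
   rcomp (sE Fi' r p n) (sqr (fH Fi' r p n)) T (\<phi> n ** x) (\<eta> ** t)"
proof -
 note H = fH_SQ[OF fmapD(1) r, of p n] and H' = fH_SQ[OF fmapD(2) r, of p n]
 have dom: "EX t'. rcomp (sE Fi' r p n) (sqr (fH Fi' r p n)) T (\<phi> n ** x) t'"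
  if "rcomp (sE Fi r p n) (sqr (fH Fi r p n)) T x t" for T x t
 proof -
  have "fZ Fi (int r) p n T x" "fB Fi (int r) (p - int r) (n + 1) T (Md Fi n ** x)" using that H(2) by blast+
  hence "fZ Fi' (int r) p n T (\<phi> n ** x)" "fB Fi' (int r) (p - int r) (n + 1) T (Md Fi' n ** (\<phi> n ** x))"
   using fmap_fZ fmap_fB fmap_dx[OF fZ_hom[OF fmapD(1)]] by auto
  thus ?thesis using H'(2) by blast
 qed
 have ker: "rcomp (sE Fi' r p n) (sqr (fH Fi' r p n)) T (\<phi> n ** x) 0"
  if a: "rcomp (sE Fi r p n) (sqr (fH Fi r p n)) T x 0" for T x
 proof -
  obtain T' e z where x: "fZ Fi (int r) p n T x" and e: "cov e T' T" "fZ Fi (int r) (p + int r) (n - 1) T' z"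
   "fB Fi (int r) p n T' (x ** e - Md Fi (n - 1) ** z)" using a H(3) by blast
  note hx = fZ_hom[OF fmapD(1) x] and hz = fZ_hom[OF fmapD(1) e(2)] and he = cov_hom[OF e(1)]
  have "\<phi> n ** (x ** e - Md Fi (n - 1) ** z) = \<phi> n ** x ** e - Md Fi' (n - 1) ** (\<phi> (n - 1) ** z)"
   using comp_diff[OF hom_comp[OF he hx] hom_comp[OF hz cpx_hom_d'[OF fmapD(4)]] fmapD(6)]
    assoc[OF he hx fmapD(6)] fmap_dx'[OF hz] by simp
  thus ?thesis using H'(3) fmap_fZ[OF x] fmap_fZ[OF e(2)] fmap_fB[OF e(3)] e(1) by auto
 qed
 note R = rcomp_sq_map[OF fil_E_pres[OF fmapD(1) r] fil_E_pres[OF fmapD(2) r] H(1) H'(1) fEm_spec(1)[OF r], of "\<phi> n"]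
 show "hom \<eta> (quo_ob (fH Fi r p n)) (quo_ob (fH Fi' r p n))" unfolding \<eta>_def
  by (rule R(1)) (fact fEm_spec(2)[OF r] dom ker)+
 show "rcomp (sE Fi' r p n) (sqr (fH Fi' r p n)) T (\<phi> n ** x) (\<eta> ** t)"
  if "rcomp (sE Fi r p n) (sqr (fH Fi r p n)) T x t" unfolding \<eta>_def
  by (rule R(3)[OF _ _ _ that]) (fact fEm_spec(2)[OF r] dom ker)+
qed

lemma fEm_fnext:
 assumes r: "r \<ge> 1"
 shows "fnext Fi' r p n ** fEm (Suc r) p n =
  sq_map A (fH Fi r p n) (fH Fi' r p n) (fEm r p n) ** fnext Fi r p n"
proof -
 have r': "Suc r \<ge> 1" by simp
 note p1 = fil_E_pres[OF fmapD(1) r', where p = p and n = n] and p2 = fil_E_pres[OF fmapD(2) r', where p = p and n = n]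
 note H = fH_SQ[OF fmapD(1) r, of p n] and H' = fH_SQ[OF fmapD(2) r, of p n]
 note pH' = pres_rcomp[OF fil_E_pres[OF fmapD(2) r] SQ_pres[OF H'(1)]]
 note k = fnext_spec[OF fmapD(1) r, of p n] and k' = fnext_spec[OF fmapD(2) r, of p n]
 have hk: "hom (fnext Fi r p n) (qE Fi (Suc r) p n) (quo_ob (fH Fi r p n))"
  using is_iso_hom[OF k(1) pres_ob2[OF p1] pres_ob2[OF SQ_pres[OF H(1)]]] .
 have hk': "hom (fnext Fi' r p n) (qE Fi' (Suc r) p n) (quo_ob (fH Fi' r p n))"
  using is_iso_hom[OF k'(1) pres_ob2[OF p2] pres_ob2[OF SQ_pres[OF H'(1)]]] .
 note m = fEm_spec[OF r'] and q = fHm_spec[OF r, of p n]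
 show ?thesis
 proof (rule pres_eq[OF p1 hom_comp[OF m(1) hk'] hom_comp[OF hk q(1)]])
  fix T x t assume s: "sE Fi (Suc r) p n T x t"
  note t = pres_hom2[OF p1 s]
  show "fnext Fi' r p n ** fEm (Suc r) p n ** t =
   sq_map A (fH Fi r p n) (fH Fi' r p n) (fEm r p n) ** fnext Fi r p n ** t"
   using pres_uniq[OF pH' k'(2)[OF m(2)[OF s]] q(2)[OF k(2)[OF s]]] assoc[OF t m(1) hk'] assoc[OF t hk q(1)] by simp
 qed
qed

lemma ss_map_morphism: "is_ss_morphism A (ss_of A Fi) (ss_of A Fi') (ss_map A Fi Fi' \<phi>)"
 unfolding is_ss_morphism_def ss_of_simps[OF fmapD(1)] ss_of_simps[OF fmapD(2)] ss_map_fEm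
proof (intro allI impI conjI)
 fix r :: nat and i j :: int assume r: "1 \<le> r"
 have idx: "i + int r + 1 + (j - int r) = i + j + 1" by simp
 show "fEm r j (i + j) : arr A (qE Fi r j (i + j)) (qE Fi' r j (i + j))"
  using hom_arr[OF fEm_spec(1)[OF r]] .
 show "fEm r (j - int r) (i + int r + 1 + (j - int r)) ** fdE Fi r j (i + j) = fdE Fi' r j (i + j) ** fEm r j (i + j)"
  unfolding idx using fEm_fdE[OF r] .
 show "fnext Fi' r j (i + j) ** fEm (Suc r) j (i + j) =
  sq_map A (fH Fi r j (i + j)) (fH Fi' r j (i + j)) (fEm r j (i + j)) ** fnext Fi r j (i + j)" using fEm_fnext[OF r] .
qed

end

text \<open>The criterion behind both kinds of homotopy invariance: the difference of the two maps
  only has to send Z_r into B_r.\<close>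

lemma ss_map_eq:
 assumes f: "fmap Fi Fi' \<phi>" and g: "fmap Fi Fi' \<psi>" and r: "r \<ge> 1"
  and eq: "\<And>T x. fZ Fi (int r) j (i + j) T x ==> fB Fi' (int r) j (i + j) T (\<phi> (i + j) ** x - \<psi> (i + j) ** x)"
 shows "ss_map A Fi Fi' \<phi> r i j = ss_map A Fi Fi' \<psi> r i j"
 unfolding ss_map_fEm[OF f] ss_map_fEm[OF g]
proof (rule pres_eq[OF fil_E_pres[OF fmapD(1)[OF f] r] fEm_spec(1)[OF f r] fEm_spec(1)[OF g r]])
 note p = fil_E_pres[OF fmapD(2)[OF f] r]
 fix T x t assume s: "sE Fi r j (i + j) T x t"
 hence "fB Fi' (int r) j (i + j) T (\<phi> (i + j) ** x - \<psi> (i + j) ** x)"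
  using eq fil_E_SQ(2)[OF fmapD(1)[OF f] r] by blast
 hence "sE Fi' r j (i + j) T (\<phi> (i + j) ** x - \<psi> (i + j) ** x) 0"
  using fil_E_SQ(3)[OF fmapD(2)[OF f] r] by blast
 hence "fEm Fi Fi' \<phi> r j (i + j) ** t - fEm Fi Fi' \<psi> r j (i + j) ** t = 0"
  using pres_uniq[OF p pres_diff[OF p fEm_spec(2)[OF f r s] fEm_spec(2)[OF g r s]]] by blast
 thus "fEm Fi Fi' \<phi> r j (i + j) ** t = fEm Fi Fi' \<psi> r j (i + j) ** t" by simp
qed

lemma ss_map_comp:
 assumes f: "fmap Fi Fi' \<phi>" and g: "fmap Fi' Fi'' \<psi>" and h: "fmap Fi Fi'' \<chi>"
  and \<chi>: "\<chi> (i + j) = \<psi> (i + j) ** \<phi> (i + j)" and r: "r \<ge> 1"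
 shows "ss_map A Fi Fi'' \<chi> r i j = ss_map A Fi' Fi'' \<psi> r i j ** ss_map A Fi Fi' \<phi> r i j"
 unfolding ss_map_fEm[OF f] ss_map_fEm[OF g] ss_map_fEm[OF h]
proof (rule pres_eq[OF fil_E_pres[OF fmapD(1)[OF f] r] fEm_spec(1)[OF h r] hom_comp[OF fEm_spec(1)[OF f r] fEm_spec(1)[OF g r]]])
 note p = fil_E_pres[OF fmapD(1)[OF f] r]
 fix T x t assume s: "sE Fi r j (i + j) T x t"
 have "\<chi> (i + j) ** x = \<psi> (i + j) ** (\<phi> (i + j) ** x)"
  using assoc[OF pres_hom1[OF p s] fmapD(6)[OF f] fmapD(6)[OF g]] \<chi> by simp
 thus "fEm Fi Fi'' \<chi> r j (i + j) ** t = fEm Fi' Fi'' \<psi> r j (i + j) ** fEm Fi Fi' \<phi> r j (i + j) ** t"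
  using pres_uniq[OF fil_E_pres[OF fmapD(2)[OF h] r] fEm_spec(2)[OF h r s], of "fEm Fi' Fi'' \<psi> r j (i + j) ** (fEm Fi Fi' \<phi> r j (i + j) ** t)"]
   fEm_spec(2)[OF g r fEm_spec(2)[OF f r s]] assoc[OF pres_hom2[OF p s] fEm_spec(1)[OF f r] fEm_spec(1)[OF g r]] by simp
qed

lemma ss_map_id:
 assumes f: "fmap Fi Fi \<phi>" and \<phi>: "\<phi> (i + j) = idt A (Mo Fi (i + j))" and r: "r \<ge> 1"
 shows "ss_map A Fi Fi \<phi> r i j = idt A (qE Fi r j (i + j))"
 unfolding ss_map_fEm[OF f]
proof (rule pres_eq[OF fil_E_pres[OF fmapD(1)[OF f] r] fEm_spec(1)[OF f r] hom_id])
 note p = fil_E_pres[OF fmapD(1)[OF f] r]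
 show "qE Fi r j (i + j) : obj A" using pres_ob2[OF p] .
 fix T x t assume s: "sE Fi r j (i + j) T x t"
 have "\<phi> (i + j) ** x = x" using id_comp[OF pres_hom1[OF p s]] \<phi> by simp
 hence "sE Fi r j (i + j) T x (fEm Fi Fi \<phi> r j (i + j) ** t)" using fEm_spec(2)[OF f r s] by simp
 from pres_uniq[OF p s this] show "fEm Fi Fi \<phi> r j (i + j) ** t = idt A (qE Fi r j (i + j)) ** t"
  using id_comp[OF pres_hom2[OF p s]] by simp
qed

subsection \<open>Convergence\<close>

text \<open>Bounded below and exhausted after finitely many steps in each degree \<open>n\<close>;
  the bounds may depend on \<open>n\<close>, as they do for the descent filtration.\<close>

definition fbounded :: "('o, 'a) fcpx => bool" where
 "fbounded Fi \<longleftrightarrow> is_filtered A Fi & (ALL n. (EX p0. ALL p<=p0. ALL T x. fG Fi p n T x --> x = 0) &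
   (EX p1. ALL p>=p1. ALL T x. hom x T (Mo Fi n) --> fG Fi p n T x))"

context
 fixes Fi :: "('o, 'a) fcpx"
 assumes b: "fbounded Fi"
begin

lemma bF: "is_filtered A Fi" using b by (simp add: fbounded_def)

abbreviation (input) "\<alpha>c p n \<equiv> coh_map A (stage Fi p) (amb Fi) (incl Fi p) n"

lemma \<alpha>c_spec:
 shows "hom (\<alpha>c p n) (qH (stage Fi p) n) (qH (amb Fi) n)"
  and "sH (stage Fi p) n T x h ==> sH (amb Fi) n T (incl Fi p n ** x) (\<alpha>c p n ** h)"
 using coh_map_spec[OF fil_chain[OF bF] fil_stage[OF bF] fil_amb[OF bF]] by blast+

text \<open>\<open>incl\<close> is mono, so a cocycle of the ambient complex that lies in a stage is
  a cocycle of that stage.\<close>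

lemma \<alpha>c_image:
 assumes s: "sH (amb Fi) n T x h" and x: "fG Fi p n T x"
 shows "EX k. hom k T (qH (stage Fi p) n) & \<alpha>c p n ** k = h"
proof -
 note C = fil_amb[OF bF] and S = fil_stage[OF bF, of p]
 obtain u where u: "hom u T (cob (stage Fi p) n)" "incl Fi p n ** u = x" using x unfolding fG_def by blast
 have "incl Fi p (n + 1) ** (cdf (stage Fi p) n ** u) = 0"
  using chain_map_dx[OF fil_chain[OF bF] S C u(1)] u(2) coh_SQ(2)[OF C, of n T x] s by auto
 hence "cdf (stage Fi p) n ** u = 0"
  using mono_zero[OF fil_mono[OF bF] fil_incl[OF bF] hom_comp[OF u(1) cpx_hom_d[OF S]]] by blast
 then obtain k where k: "sH (stage Fi p) n T u k" using coh_SQ(2)[OF S] u(1) by blast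
 have "\<alpha>c p n ** k = h"
  using pres_uniq[OF SQ_pres[OF coh_SQ(1)[OF C]] \<alpha>c_spec(2)[OF k]] s u(2) by blast
 thus ?thesis using pres_hom2[OF SQ_pres[OF coh_SQ(1)[OF S]] k] by blast
qed

lemma \<alpha>c_lift:
 assumes k: "hom k T (qH (stage Fi p) n)"
 shows "EX T' e x. cov e T' T & fG Fi p n T' x & sH (amb Fi) n T' x (\<alpha>c p n ** k ** e)"
proof -
 note p = SQ_pres[OF coh_SQ(1)[OF fil_stage[OF bF]]]
 obtain T' e u where e: "cov e T' T" "sH (stage Fi p) n T' u (k ** e)" using pres_surj[OF p k] by blast
 have "sH (amb Fi) n T' (incl Fi p n ** u) (\<alpha>c p n ** k ** e)"
  using \<alpha>c_spec(2)[OF e(2)] assoc[OF cov_hom[OF e(1)] k \<alpha>c_spec(1)] by simp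
 moreover have "fG Fi p n T' (incl Fi p n ** u)" unfolding fG_def using pres_hom1[OF p e(2)] by blast
 ultimately show ?thesis using e(1) by blast
qed

lemma fil_coh_vanish: "EX p0. ALL p<=p0. \<alpha>c p n = 0"
proof -
 obtain p0 where p0: "ALL p<=p0. ALL T x. fG Fi p n T x --> x = 0" using b unfolding fbounded_def by blast
 have "\<alpha>c p n = 0" if "p \<le> p0" for p
 proof (rule pres_eq[OF SQ_pres[OF coh_SQ(1)[OF fil_stage[OF bF]]] \<alpha>c_spec(1) hom_zero])
  note C = fil_amb[OF bF] and S = fil_stage[OF bF, of p]
  show o: "qH (stage Fi p) n : obj A" "qH (amb Fi) n : obj A"
   using hom_dom[OF \<alpha>c_spec(1)] hom_cod[OF \<alpha>c_spec(1)] .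
  fix T x t assume s: "sH (stage Fi p) n T x t"
  have "fG Fi p n T (incl Fi p n ** x)" unfolding fG_def using pres_hom1[OF SQ_pres[OF coh_SQ(1)[OF S]] s] by blast
  hence "sH (amb Fi) n T 0 (\<alpha>c p n ** t)" using p0 that \<alpha>c_spec(2)[OF s] by metis
  thus "\<alpha>c p n ** t = 0 ** t" using pres_0[OF SQ_pres[OF coh_SQ(1)[OF C]]]
   zero_comp[OF pres_hom2[OF SQ_pres[OF coh_SQ(1)[OF S]] s] o(2)] by simp
 qed
 thus ?thesis by blast
qed

lemma fil_coh_exhaust: "EX p1. ALL p>=p1. is_epi A (qH (amb Fi) n) (\<alpha>c p n)"
proof -
 obtain p1 where p1: "ALL p>=p1. ALL T x. hom x T (Mo Fi n) --> fG Fi p n T x" using b unfolding fbounded_def by blast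
 note P = SQ_pres[OF coh_SQ(1)[OF fil_amb[OF bF]]]
 have "is_epi A (qH (amb Fi) n) (\<alpha>c p n)" if pp: "p \<ge> p1" for p
  unfolding epi_iff[OF \<alpha>c_spec(1)]
 proof (intro allI impI)
  fix W y assume "hom y (qH (amb Fi) n) W & y ** \<alpha>c p n = 0"
  hence y: "hom y (qH (amb Fi) n) W" "y ** \<alpha>c p n = 0" by auto
  show "y = 0"
  proof (rule pres_eq[OF P y(1) hom_zero[OF hom_dom[OF y(1)] hom_cod[OF y(1)]]])
   fix T x t assume s: "sH (amb Fi) n T x t"
   have "fG Fi p n T x" using p1 pp pres_hom1[OF P s] by blast
   then obtain k where k: "hom k T (qH (stage Fi p) n)" "\<alpha>c p n ** k = t" using \<alpha>c_image[OF s] by blast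
   thus "y ** t = 0 ** t"
    using assoc[OF k(1) \<alpha>c_spec(1) y(1)] y(2) zero_comp[OF k(1) hom_cod[OF y(1)]]
     zero_comp[OF pres_hom2[OF P s] hom_cod[OF y(1)]] by simp
  qed
 qed
 thus ?thesis by blast
qed

text \<open>A class comes from stage \<open>q\<close> iff its cocycle is locally an element of the
  stage plus a boundary; that element is then a cocycle automatically.\<close>

lemma coh_gr_SQ:
 shows "SQ (qH (amb Fi) n) (coh_gr A Fi p n)"
  and "(EX t. rcomp (sH (amb Fi) n) (sqr (coh_gr A Fi p n)) T x t) \<longleftrightarrow>
   hom x T (Mo Fi n) & Md Fi n ** x = 0 &
   (EX T' e a v. cov e T' T & fG Fi p n T' a & hom v T' (Mo Fi (n - 1)) & x ** e = a + Md Fi (n - 1) ** v)"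
  and "rcomp (sH (amb Fi) n) (sqr (coh_gr A Fi p n)) T x 0 \<longleftrightarrow>
   hom x T (Mo Fi n) & Md Fi n ** x = 0 &
   (EX T' e a v. cov e T' T & fG Fi (p - 1) n T' a & hom v T' (Mo Fi (n - 1)) & x ** e = a + Md Fi (n - 1) ** v)"
proof -
 let ?H = "coh A (amb Fi) n"
 note C = fil_amb[OF bF] and CH = coh_SQ[OF fil_amb[OF bF], of n] and P = SQ_pres[OF coh_SQ(1)[OF fil_amb[OF bF]], of n]
 note d' = cpx_hom_d'[OF C, of n]
 have image: "(EX T' e u. cov e T' T & hom u T' (qH (stage Fi q) n) & h ** e = \<alpha>c q n ** u) \<longleftrightarrow>
   (EX T' e a v. cov e T' T & fG Fi q n T' a & hom v T' (Mo Fi (n - 1)) & x ** e = a + Md Fi (n - 1) ** v)"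
  if s: "sqr ?H T x h" for T x h q
 proof
  assume "EX T' e u. cov e T' T & hom u T' (qH (stage Fi q) n) & h ** e = \<alpha>c q n ** u"
  then obtain T1 e u where e: "cov e T1 T" "hom u T1 (qH (stage Fi q) n)" "h ** e = \<alpha>c q n ** u" by blast
  obtain T2 f a where f: "cov f T2 T1" "fG Fi q n T2 a" "sqr ?H T2 a (\<alpha>c q n ** u ** f)" using \<alpha>c_lift[OF e(2)] by blast
  note he = cov_hom[OF e(1)] and hf = cov_hom[OF f(1)] and x = pres_hom1[OF P s] and h = pres_hom2[OF P s]
  have "sqr ?H T2 (x ** (e ** f)) (\<alpha>c q n ** u ** f)"
   using pres_restr[OF P s hom_comp[OF hf he]] e(3) assoc[OF hf he h] by simp
  from pres_diff[OF P this f(3)] have "sqr ?H T2 (x ** (e ** f) - a) 0" by simp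
  then obtain T3 g v where g: "cov g T3 T2" "hom v T3 (Mo Fi (n - 1))"
   "(x ** (e ** f) - a) ** g = Md Fi (n - 1) ** v" using CH(3) by blast
  note hg = cov_hom[OF g(1)]
  have "x ** (e ** f ** g) = a ** g + Md Fi (n - 1) ** v"
   using g(3) diff_comp[OF hg hom_comp[OF hom_comp[OF hf he] x] fG_hom[OF bF f(2)]]
    assoc[OF hg hom_comp[OF hf he] x] by (simp add: algebra_simps)
  thus "EX T' e a v. cov e T' T & fG Fi q n T' a & hom v T' (Mo Fi (n - 1)) & x ** e = a + Md Fi (n - 1) ** v"
   using cov_comp[OF cov_comp[OF e(1) f(1)] g(1)] fG_restr[OF bF f(2) hg] g(2) by blast
 next
  assume "EX T' e a v. cov e T' T & fG Fi q n T' a & hom v T' (Mo Fi (n - 1)) & x ** e = a + Md Fi (n - 1) ** v"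
  then obtain T' e a v where e: "cov e T' T" "fG Fi q n T' a" "hom v T' (Mo Fi (n - 1))"
   "x ** e = a + Md Fi (n - 1) ** v" by blast
  note he = cov_hom[OF e(1)]
  have dv: "hom (Md Fi (n - 1) ** v) T' (Mo Fi n)" using hom_comp[OF e(3) d'] .
  have "sqr ?H T' (Md Fi (n - 1) ** v) 0"
   using CH(3) dv cov_id[OF hom_dom[OF dv]] comp_id[OF dv] e(3) by metis
  from pres_diff[OF P pres_restr[OF P s he] this] have "sqr ?H T' a (h ** e)" using e(4) by simp
  then obtain k where "hom k T' (qH (stage Fi q) n)" "\<alpha>c q n ** k = h ** e" using \<alpha>c_image[OF _ e(2)] by blast
  thus "EX T' e u. cov e T' T & hom u T' (qH (stage Fi q) n) & h ** e = \<alpha>c q n ** u"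
   using e(1) by metis
 qed
 obtain Q where Q: "hom (coker_ar A (quo_ob ?H) (\<alpha>c p n)) (quo_ob ?H) Q" using coker_ar_hom[OF \<alpha>c_spec(1)] by blast
 have z: "coker_ar A (quo_ob ?H) (\<alpha>c p n) ** \<alpha>c (p - 1) n = 0"
  unfolding coker_ar_zero_iff[OF \<alpha>c_spec(1) \<alpha>c_spec(1)]
 proof -
  let ?T = "qH (stage Fi (p - 1)) n"
  have i: "hom (idt A ?T) ?T ?T" using hom_id[OF hom_dom[OF \<alpha>c_spec(1)]] .
  obtain T' e x where e: "cov e T' ?T" "fG Fi (p - 1) n T' x" "sqr ?H T' x (\<alpha>c (p - 1) n ** idt A ?T ** e)"
   using \<alpha>c_lift[OF i] by blast
  have "fG Fi p n T' x" using fG_mono[OF bF _ e(2), of p] by simp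
  from \<alpha>c_image[OF e(3) this]
  obtain k where "hom k T' (qH (stage Fi p) n)" "\<alpha>c p n ** k = \<alpha>c (p - 1) n ** e"
   unfolding comp_id[OF \<alpha>c_spec(1)] by blast
  thus "EX T' e u. cov e T' ?T & hom u T' (qH (stage Fi p) n) & \<alpha>c (p - 1) n ** e = \<alpha>c p n ** u"
   using e(1) by metis
 qed
 have c: "quo_ob ?H : obj A" "finite {coker_ar A (quo_ob ?H) (\<alpha>c p n)}"
  "\<And>g. g : {coker_ar A (quo_ob ?H) (\<alpha>c p n)} ==> EX Z. hom g (quo_ob ?H) Z"
  "hom (\<alpha>c (p - 1) n) (qH (stage Fi (p - 1)) n) (quo_ob ?H)"
  "\<And>g. g : {coker_ar A (quo_ob ?H) (\<alpha>c p n)} ==> g ** \<alpha>c (p - 1) n = 0"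
  using hom_dom[OF Q] Q \<alpha>c_spec(1) z by blast+
 have E: "coh_gr A Fi p n = subquot A (quo_ob ?H) {coker_ar A (quo_ob ?H) (\<alpha>c p n)}
  {(qH (stage Fi (p - 1)) n, \<alpha>c (p - 1) n)}" unfolding coh_gr_def im_quot_def ..
 note s = subquot1[OF c, folded E]
 show "SQ (quo_ob ?H) (coh_gr A Fi p n)" using s(1) by blast
 have dx: "hom x T (Mo Fi n) & Md Fi n ** x = 0" if "sqr ?H T x h" for x T h
  using that CH(2) by blast
 have 1: "(EX t. sqr (coh_gr A Fi p n) T h t) \<longleftrightarrow> (EX T' e a v. cov e T' T & fG Fi p n T' a & hom v T' (Mo Fi (n - 1)) & x ** e = a + Md Fi (n - 1) ** v)"
  if "sqr ?H T x h" for x T h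
 proof -
  have "(EX t. sqr (coh_gr A Fi p n) T h t) \<longleftrightarrow> coker_ar A (quo_ob ?H) (\<alpha>c p n) ** h = 0"
   using s(2)[of T h] pres_hom2[OF P that] by blast
  thus ?thesis using coker_ar_zero_iff[OF \<alpha>c_spec(1) pres_hom2[OF P that]] image[OF that] by simp
 qed
 have 2: "sqr (coh_gr A Fi p n) T h 0 \<longleftrightarrow> (EX T' e a v. cov e T' T & fG Fi (p - 1) n T' a & hom v T' (Mo Fi (n - 1)) & x ** e = a + Md Fi (n - 1) ** v)"
  if "sqr ?H T x h" for x T h
  using s(3)[of T h] pres_hom2[OF P that] image[OF that] by simp
 show "(EX t. rcomp (sqr ?H) (sqr (coh_gr A Fi p n)) T x t) \<longleftrightarrow>
   hom x T (Mo Fi n) & Md Fi n ** x = 0 &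
   (EX T' e a v. cov e T' T & fG Fi p n T' a & hom v T' (Mo Fi (n - 1)) & x ** e = a + Md Fi (n - 1) ** v)"
  using 1 CH(2) unfolding rcomp_def by meson
 show "rcomp (sqr ?H) (sqr (coh_gr A Fi p n)) T x 0 \<longleftrightarrow>
   hom x T (Mo Fi n) & Md Fi n ** x = 0 &
   (EX T' e a v. cov e T' T & fG Fi (p - 1) n T' a & hom v T' (Mo Fi (n - 1)) & x ** e = a + Md Fi (n - 1) ** v)"
  using 2 CH(2) unfolding rcomp_def by meson
qed

lemma coh_gr_pres: "pres (Mo Fi n) (quo_ob (coh_gr A Fi p n)) (rcomp (sH (amb Fi) n) (sqr (coh_gr A Fi p n)))"
 using pres_rcomp[OF SQ_pres[OF coh_SQ(1)[OF fil_amb[OF bF]]] SQ_pres[OF coh_gr_SQ(1)]] .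

text \<open>For large \<open>r\<close> the conditions defining \<open>Z\<^sub>r\<close> and \<open>B\<^sub>r\<close> become \<open>r\<close>-independent.\<close>

lemma fil_stable:
 "EX r0>=1. ALL r>=r0. fdE Fi r p n = 0 & fdE Fi r (p + int r) (n - 1) = 0 &
   (ALL T x. fZ Fi (int r) p n T x \<longleftrightarrow> fG Fi p n T x & Md Fi n ** x = 0) &
   (ALL T v. hom v T (Mo Fi (n - 1)) --> fG Fi p n T (Md Fi (n - 1) ** v) -->
    fZ Fi (int r - 1) (p + int r - 1) (n - 1) T v)"
proof -
 note C = fil_amb[OF bF]
 obtain p0 where p0: "\<And>q T x. q \<le> p0 ==> fG Fi q (n + 1) T x ==> x = 0" using b unfolding fbounded_def by blast
 obtain p1 where p1: "\<And>q T x. q \<ge> p1 ==> hom x T (Mo Fi (n - 1)) ==> fG Fi q (n - 1) T x" using b unfolding fbounded_def by blast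
 \<comment> \<open>From here on stage p - r is zero in degree n + 1, and stage p + r - 1 is
   everything in degree n - 1.\<close>
 define r0 where "r0 = nat (max 1 (max (p - p0) (p1 - p + 1)))"
 have "fdE Fi r p n = 0 & fdE Fi r (p + int r) (n - 1) = 0 &
   (ALL T x. fZ Fi (int r) p n T x \<longleftrightarrow> fG Fi p n T x & Md Fi n ** x = 0) &
   (ALL T v. hom v T (Mo Fi (n - 1)) --> fG Fi p n T (Md Fi (n - 1) ** v) -->
    fZ Fi (int r - 1) (p + int r - 1) (n - 1) T v)" if rr: "r \<ge> r0" for r
 proof -
  have r: "r \<ge> 1" "p - int r \<le> p0" "p + int r - 1 \<ge> p1" using rr unfolding r0_def by linarith+
  note P = fil_E_pres[OF bF r(1)] and d = fdE_spec[OF bF r(1), of p n] and d' = fdE_spec'[OF bF r(1), of p n]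
  have Z: "fZ Fi (int r) p n T x \<longleftrightarrow> fG Fi p n T x & Md Fi n ** x = 0" for T x
   unfolding fZ_def using p0[OF r(2)] fG_zero[OF bF hom_dom[OF fG_hom[OF bF]]] by metis
  have V: "fZ Fi (int r - 1) (p + int r - 1) (n - 1) T v"
   if "hom v T (Mo Fi (n - 1))" "fG Fi p n T (Md Fi (n - 1) ** v)" for T v
   unfolding fZ_def using p1[OF r(3)] that by simp
  have 1: "fdE Fi r p n = 0"
  proof (rule pres_eq[OF P d(1) hom_zero[OF hom_dom[OF d(1)] hom_cod[OF d(1)]]])
   fix T x t assume s: "sE Fi r p n T x t"
   hence "Md Fi n ** x = 0" using fil_E_SQ(2)[OF bF r(1)] Z by blast
   hence "fdE Fi r p n ** t = 0" using d(2)[OF s] pres_0[OF P] by simp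
   thus "fdE Fi r p n ** t = 0 ** t" using zero_comp[OF pres_hom2[OF P s] hom_cod[OF d(1)]] by simp
  qed
  have 2: "fdE Fi r (p + int r) (n - 1) = 0"
  proof (rule pres_eq[OF P d'(1) hom_zero[OF hom_dom[OF d'(1)] hom_cod[OF d'(1)]]])
   fix T x t assume s: "sE Fi r (p + int r) (n - 1) T x t"
   have x: "fZ Fi (int r) (p + int r) (n - 1) T x" using s fil_E_SQ(2)[OF bF r(1)] by blast
   hence "fG Fi p n T (Md Fi (n - 1) ** x)" unfolding fZ_def by simp
   hence "fB Fi (int r) p n T (Md Fi (n - 1) ** x)" using fBI_z[OF bF V] fZ_hom[OF bF x] by blast
   hence "sE Fi r p n T (Md Fi (n - 1) ** x) 0" using fil_E_SQ(3)[OF bF r(1)] by blast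
   hence "fdE Fi r (p + int r) (n - 1) ** t = 0" using pres_uniq[OF P d'(2)[OF s]] by blast
   thus "fdE Fi r (p + int r) (n - 1) ** t = 0 ** t" using zero_comp[OF pres_hom2[OF P s] hom_cod[OF d'(1)]] by simp
  qed
  show ?thesis using 1 2 Z V by blast
 qed
 moreover have "r0 \<ge> 1" unfolding r0_def by simp
 ultimately show ?thesis by blast
qed

text \<open>For large \<open>r\<close>, Z_r consists of the cocycles in the stage and B_r of those
  among them that are locally cohomologous to a cocycle of the previous stage. This is the graded
  piece of the cohomology.\<close>

lemma ss_limit_spec:
 "EX r0>=1. ALL r>=r0. fdE Fi r j (i + j) = 0 & fdE Fi r (j + int r) (i + j - 1) = 0 &
   is_iso A (qE Fi r j (i + j)) (quo_ob (coh_gr A Fi j (i + j))) (ss_limit A Fi r i j) &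
   (ALL T x t. sE Fi r j (i + j) T x t -->
    rcomp (sH (amb Fi) (i + j)) (sqr (coh_gr A Fi j (i + j))) T x (ss_limit A Fi r i j ** t))"
proof -
 define n where "n = i + j"
 note C = fil_amb[OF bF] and CH = coh_SQ[OF fil_amb[OF bF], of n] and S = fil_stage[OF bF, of j]
 note d = cpx_hom_d[OF C, of n] and d' = cpx_hom_d'[OF C, of n]
 obtain r0 where r0: "r0 \<ge> 1" and st: "\<And>r. r \<ge> r0 ==> fdE Fi r j n = 0 & fdE Fi r (j + int r) (n - 1) = 0 &
   (ALL T x. fZ Fi (int r) j n T x \<longleftrightarrow> fG Fi j n T x & Md Fi n ** x = 0) &
   (ALL T v. hom v T (Mo Fi (n - 1)) --> fG Fi j n T (Md Fi (n - 1) ** v) -->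
    fZ Fi (int r - 1) (j + int r - 1) (n - 1) T v)" using fil_stable by blast
 have "fdE Fi r j n = 0 & fdE Fi r (j + int r) (n - 1) = 0 &
   is_iso A (qE Fi r j n) (quo_ob (coh_gr A Fi j n)) (ss_limit A Fi r i j) &
   (ALL T x t. sE Fi r j n T x t -->
    rcomp (sH (amb Fi) n) (sqr (coh_gr A Fi j n)) T x (ss_limit A Fi r i j ** t))" if rr: "r \<ge> r0" for r
 proof -
  have r: "r \<ge> 1" using rr r0 by simp
  let ?e = "fil_E A Fi r j n" and ?c = "coh A (stage Fi j) n" and ?g = "coh_gr A Fi j n"
  note Z = st[OF rr, THEN conjunct2, THEN conjunct2, THEN conjunct1, rule_format]
  note V = st[OF rr, THEN conjunct2, THEN conjunct2, THEN conjunct2, rule_format]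
  note E = fil_E_SQ[OF bF r, where p = j and n = n] and G = coh_gr_SQ[of n j] and P = fil_E_pres[OF bF r, where p = j and n = n] and P' = coh_gr_pres[of n j]
  have dom: "EX t'. rcomp (sH (amb Fi) n) (sqr ?g) T x t'" if "sqr ?e T x t" for T x t
  proof -
   have x: "fG Fi j n T x" "Md Fi n ** x = 0" using that E(2) Z by blast+
   note hx = fG_hom[OF bF x(1)]
   have "x ** idt A T = x + Md Fi (n - 1) ** 0"
    using comp_id[OF hx] comp_zero[OF hom_dom[OF hx] d'] by simp
   thus ?thesis unfolding G(2)
    using x hx cov_id[OF hom_dom[OF hx]] hom_zero[OF hom_dom[OF hx] hom_dom[OF d']] by blast
  qed
  have ker: "rcomp (sH (amb Fi) n) (sqr ?g) T x 0" if s: "sqr ?e T x 0" for T x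
  proof -
   obtain T' e y z where x: "hom x T (Mo Fi n)" and e: "cov e T' T" "fZ Fi (int r - 1) (j - 1) n T' y"
    "fZ Fi (int r - 1) (j + int r - 1) (n - 1) T' z" "x ** e = y + Md Fi (n - 1) ** z"
    using s E(3) unfolding fB_def by blast
   have "Md Fi n ** x = 0" using s E(2) Z by blast
   moreover have "fG Fi (j - 1) n T' y" using e(2) unfolding fZ_def by blast
   ultimately show ?thesis unfolding G(3) using x e(1,4) fZ_hom[OF bF e(3)] by blast
  qed
  have inj: "sqr ?e T x 0" if s: "sqr ?e T x t" and s': "rcomp (sH (amb Fi) n) (sqr ?g) T x 0" for T x t
  proof -
   have x: "fZ Fi (int r) j n T x" using s E(2) by blast
   note hx = fZ_hom[OF bF x]
   obtain T' e a v where e: "cov e T' T" "fG Fi (j - 1) n T' a" "hom v T' (Mo Fi (n - 1))"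
    "x ** e = a + Md Fi (n - 1) ** v" and dx0: "Md Fi n ** x = 0" using s' unfolding G(3) by blast
   note he = cov_hom[OF e(1)] and ha = fG_hom[OF bF e(2)] and hdv = hom_comp[OF e(3) d']
   have "Md Fi n ** (x ** e) = 0" using assoc[OF he hx d] dx0 zero_comp[OF he hom_cod[OF d]] by simp
   hence da: "Md Fi n ** a = 0" using e(4) comp_add[OF ha hdv d] cpx_ddx'[OF C e(3)] by simp
   have "fZ Fi (int r - 1) (j - 1) n T' a" unfolding fZ_def using e(2) da fG_zero[OF bF hom_dom[OF ha]] by simp
   moreover have "fG Fi j n T' (Md Fi (n - 1) ** v)"
   proof -
    have "Md Fi (n - 1) ** v = x ** e - a" using e(4) by simp
    moreover have "fG Fi j n T' (x ** e)" using fZ_restr[OF bF x he] unfolding fZ_def by blast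
    moreover have "fG Fi j n T' a" using fG_mono[OF bF _ e(2), of j] by simp
    ultimately show ?thesis using fG_diff[OF bF] by simp
   qed
   hence "fZ Fi (int r - 1) (j + int r - 1) (n - 1) T' v" using V e(3) by blast
   ultimately show ?thesis unfolding E(3) fB_def using hx e(1,4) by blast
  qed
  have surj: "EX T' e y s. cov e T' T & sqr ?e T' y s & rcomp (sH (amb Fi) n) (sqr ?g) T' (y - x ** e) 0"
   if s: "rcomp (sH (amb Fi) n) (sqr ?g) T x t" for T x t
  proof -
   obtain T' e a v where x: "hom x T (Mo Fi n)" "Md Fi n ** x = 0" and e: "cov e T' T" "fG Fi j n T' a"
    "hom v T' (Mo Fi (n - 1))" "x ** e = a + Md Fi (n - 1) ** v" using s G(2) by blast
   note he = cov_hom[OF e(1)] and ha = fG_hom[OF bF e(2)] and hdv = hom_comp[OF e(3) d'] and T' = hom_dom[OF cov_hom[OF e(1)]]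
   have xe0: "Md Fi n ** (x ** e) = 0" using assoc[OF he x(1) d] x(2) zero_comp[OF he hom_cod[OF d]] by simp
   hence "Md Fi n ** a = 0" using e(4) comp_add[OF ha hdv d] cpx_ddx'[OF C e(3)] by simp
   then obtain s where s: "sqr ?e T' a s" using E(2) Z e(2) by blast
   have av: "a - x ** e = Md Fi (n - 1) ** (- v)" using e(4) comp_minus[OF e(3) d'] by simp
   have hav: "hom (a - x ** e) T' (Mo Fi n)" using hom_diff[OF ha hom_comp[OF he x(1)]] .
   have "Md Fi n ** (a - x ** e) = 0" unfolding av using cpx_ddx'[OF C hom_minus[OF e(3)]] .
   moreover have "(a - x ** e) ** idt A T' = 0 + Md Fi (n - 1) ** (- v)" using comp_id[OF hav] av by simp
   ultimately have "rcomp (sH (amb Fi) n) (sqr ?g) T' (a - x ** e) 0"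
    unfolding G(3) using hav cov_id[OF T'] fG_zero[OF bF T'] hom_minus[OF e(3)] by blast
   thus ?thesis using e(1) s by blast
  qed
  have "EX \<theta>. is_iso A (quo_ob ?e) (quo_ob ?g) \<theta> & (ALL T x t. sqr ?e T x t --> rcomp (sH (amb Fi) n) (sqr ?g) T x (\<theta> ** t))"
   by (rule pres_iso_ex[OF P P']) (fact dom ker inj surj)+
  then obtain \<theta> where \<theta>: "is_iso A (quo_ob ?e) (quo_ob ?g) \<theta>"
   "\<And>T x t. sqr ?e T x t ==> rcomp (sH (amb Fi) n) (sqr ?g) T x (\<theta> ** t)" by blast
  have h\<theta>: "hom \<theta> (quo_ob ?e) (quo_ob ?g)" using is_iso_hom[OF \<theta>(1) pres_ob2[OF P] pres_ob2[OF P']] .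
  note SS = coh_SQ[OF S, of n] and inc = fil_incl[OF bF, of j n] and cg = SQ_generic[OF coh_SQ(1)[OF S, of n]]
  note sc = SQ_sub[OF SS(1)] and qc = SQ_quo[OF SS(1)]
  have lim: "(THE t. t : arr A (quo_ob ?e) (quo_ob ?g) &
    (EX w:arr A (sub_ob ?c) (sub_ob ?e). EX s:arr A (sub_ob ?c) (sub_ob ?g).
     sub_ar ?e ** w = incl Fi j n ** sub_ar ?c & sub_ar ?g ** s = \<alpha>c j n ** quo_ar ?c &
     t ** (quo_ar ?e ** w) = quo_ar ?g ** s)) = \<theta>"
  proof (rule the_equality)
   have ic: "fG Fi j n (sub_ob ?c) (incl Fi j n ** sub_ar ?c)" unfolding fG_def using sc by blast
   note a = \<alpha>c_spec(2)[OF cg]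
   have "Md Fi n ** (incl Fi j n ** sub_ar ?c) = 0" using a CH(2) by blast
   then obtain \<tau> where \<tau>: "sqr ?e (sub_ob ?c) (incl Fi j n ** sub_ar ?c) \<tau>" using E(2) Z ic by blast
   then obtain w where w: "hom w (sub_ob ?c) (sub_ob ?e)" "sub_ar ?e ** w = incl Fi j n ** sub_ar ?c" "quo_ar ?e ** w = \<tau>"
    unfolding sqr_def by blast
   obtain q where q: "sH (amb Fi) n (sub_ob ?c) (incl Fi j n ** sub_ar ?c) q" "sqr ?g (sub_ob ?c) q (\<theta> ** \<tau>)"
    using \<theta>(2)[OF \<tau>] unfolding rcomp_def by blast
   have "q = \<alpha>c j n ** quo_ar ?c" using pres_uniq[OF SQ_pres[OF CH(1)] q(1) a] .
   then obtain s where s: "hom s (sub_ob ?c) (sub_ob ?g)" "sub_ar ?g ** s = \<alpha>c j n ** quo_ar ?c" "quo_ar ?g ** s = \<theta> ** \<tau>"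
    using q(2) unfolding sqr_def by blast
   show "\<theta> : arr A (quo_ob ?e) (quo_ob ?g) &
    (EX w:arr A (sub_ob ?c) (sub_ob ?e). EX s:arr A (sub_ob ?c) (sub_ob ?g).
     sub_ar ?e ** w = incl Fi j n ** sub_ar ?c & sub_ar ?g ** s = \<alpha>c j n ** quo_ar ?c &
     \<theta> ** (quo_ar ?e ** w) = quo_ar ?g ** s)"
    using hom_arr[OF h\<theta>] hom_arr[OF w(1)] hom_arr[OF s(1)] w(2,3) s(2,3) by force
   fix t assume "t : arr A (quo_ob ?e) (quo_ob ?g) &
    (EX w:arr A (sub_ob ?c) (sub_ob ?e). EX s:arr A (sub_ob ?c) (sub_ob ?g).
     sub_ar ?e ** w = incl Fi j n ** sub_ar ?c & sub_ar ?g ** s = \<alpha>c j n ** quo_ar ?c &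
     t ** (quo_ar ?e ** w) = quo_ar ?g ** s)"
   then obtain w' s' where *: "t : arr A (quo_ob ?e) (quo_ob ?g)" "w' : arr A (sub_ob ?c) (sub_ob ?e)"
    "s' : arr A (sub_ob ?c) (sub_ob ?g)" "sub_ar ?e ** w' = incl Fi j n ** sub_ar ?c"
    "sub_ar ?g ** s' = \<alpha>c j n ** quo_ar ?c" "t ** (quo_ar ?e ** w') = quo_ar ?g ** s'" by blast
   have w': "hom w' (sub_ob ?c) (sub_ob ?e)" and s'h: "hom s' (sub_ob ?c) (sub_ob ?g)" and t: "hom t (quo_ob ?e) (quo_ob ?g)"
    using * w(1) s(1) h\<theta> by (auto simp: hom_def)
   have "w' = w" using mono_cancel[OF SQ_mono[OF E(1)] w' w(1)] *(4) w(2) by simp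
   moreover have "s' = s" using mono_cancel[OF SQ_mono[OF G(1)] s'h s(1)] *(5) s(2) by simp
   ultimately have t\<tau>: "t ** \<tau> = \<theta> ** \<tau>" using *(6) w(3) s(3) by simp
   \<comment> \<open>The \<open>THE\<close> in \<open>ss_limit\<close> constrains \<open>t\<close>
     only on the universal cocycle of the stage; uniqueness holds since every element of Z_r is a
     restriction of that cocycle.\<close>
   show "t = \<theta>"
   proof (rule pres_eq[OF P t h\<theta>])
    fix T x \<sigma> assume x: "sqr ?e T x \<sigma>"
    hence xg: "fG Fi j n T x" "Md Fi n ** x = 0" using E(2) Z by blast+
    then obtain u where u: "hom u T (cob (stage Fi j) n)" "incl Fi j n ** u = x" unfolding fG_def by blast
    have "incl Fi j (n + 1) ** (cdf (stage Fi j) n ** u) = 0"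
     using chain_map_dx[OF fil_chain[OF bF] S C u(1)] u(2) xg(2) by simp
    hence "cdf (stage Fi j) n ** u = 0"
     using mono_zero[OF fil_mono[OF bF] fil_incl[OF bF] hom_comp[OF u(1) cpx_hom_d[OF S]]] by blast
    then obtain v where v: "hom v T (sub_ob ?c)" "sub_ar ?c ** v = u" using SS(2)[of T u] sqr_ex[OF SS(1)] u(1) by blast
    have "sqr ?e T (incl Fi j n ** sub_ar ?c ** v) (\<tau> ** v)" using pres_restr[OF P \<tau> v(1)] .
    hence "sqr ?e T x (\<tau> ** v)" using assoc[OF v(1) sc inc] v(2) u(2) by simp
    hence "\<sigma> = \<tau> ** v" using pres_uniq[OF P x] by blast
    thus "t ** \<sigma> = \<theta> ** \<sigma>"
     using assoc[OF v(1) pres_hom2[OF P \<tau>] t] assoc[OF v(1) pres_hom2[OF P \<tau>] h\<theta>] t\<tau> by simp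
   qed
  qed
  have "ss_limit A Fi r i j = \<theta>" using lim unfolding ss_limit_def Let_def n_def .
  thus ?thesis using \<theta> st[OF rr] by blast
 qed
 thus ?thesis using r0 unfolding n_def by blast
qed

lemma fbounded_converges: "ss_converges A Fi"
 unfolding ss_converges_def
proof (intro conjI allI)
 fix n show "EX p0. ALL p<=p0. \<alpha>c p n = 0" using fil_coh_vanish .
 show "EX p1. ALL p>=p1. is_epi A (qH (amb Fi) n) (\<alpha>c p n)" using fil_coh_exhaust .
next
 fix i j :: int
 have idx: "i - int r - 1 + (j + int r) = i + j - 1" for r by simp
 show "EX r0>=1. ALL r>=r0. sdiff (ss_of A Fi) r i j = 0 & sdiff (ss_of A Fi) r (i - int r - 1) (j + int r) = 0 &
    is_iso A (page (ss_of A Fi) r i j) (quo_ob (coh_gr A Fi j (i + j))) (ss_limit A Fi r i j)"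
  unfolding ss_of_simps[OF bF] idx using ss_limit_spec[of j i] by blast
qed

end

lemma fmap_abutment_compat:
 assumes f: "fmap Fi Fi' \<phi>" and b: "fbounded Fi" and b': "fbounded Fi'"
 shows "abutment_compat A Fi Fi' \<phi>"
 unfolding abutment_compat_def
proof (intro allI)
 fix i j :: int
 define n where "n = i + j"
 note C = fmapD(4)[OF f] and C' = fmapD(5)[OF f] and ch = fmapD(3)[OF f]
 note P = SQ_pres[OF coh_SQ(1)[OF C]] and P' = SQ_pres[OF coh_SQ(1)[OF C']]
 note G = coh_gr_SQ[OF b, of n j] and G' = coh_gr_SQ[OF b', of n j] and m = coh_map_spec[OF ch C C', of n]
 have tr: "EX T' e a v. cov e T' T & fG Fi' q n T' a & hom v T' (Mo Fi' (n - 1)) & \<phi> n ** x ** e = a + Md Fi' (n - 1) ** v"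
  if x: "hom x T (Mo Fi n)" and ex: "EX T' e a v. cov e T' T & fG Fi q n T' a & hom v T' (Mo Fi (n - 1)) & x ** e = a + Md Fi (n - 1) ** v" for q x T
 proof -
  obtain T' e a v where e: "cov e T' T" "fG Fi q n T' a" "hom v T' (Mo Fi (n - 1))" "x ** e = a + Md Fi (n - 1) ** v"
   using ex by blast
  have "\<phi> n ** x ** e = \<phi> n ** a + Md Fi' (n - 1) ** (\<phi> (n - 1) ** v)"
   using assoc[OF cov_hom[OF e(1)] x fmapD(6)[OF f]] e(4) fmap_dx'[OF f e(3)]
    comp_add[OF fG_hom[OF fmapD(1)[OF f] e(2)] hom_comp[OF e(3) cpx_hom_d'[OF C]] fmapD(6)[OF f]] by simp
  thus ?thesis using e(1) fmapD(7)[OF f e(2)] hom_comp[OF e(3) fmapD(6)[OF f]] by blast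
 qed
 have dom: "EX t'. rcomp (sH (amb Fi') n) (sqr (coh_gr A Fi' j n)) T (\<phi> n ** x) t'"
  if s: "rcomp (sH (amb Fi) n) (sqr (coh_gr A Fi j n)) T x t" for T x t
 proof -
  have x: "hom x T (Mo Fi n)" "Md Fi n ** x = 0" and
   ex: "EX T' e a v. cov e T' T & fG Fi j n T' a & hom v T' (Mo Fi (n - 1)) & x ** e = a + Md Fi (n - 1) ** v"
   using s G(2) by blast+
  thus ?thesis unfolding G'(2)
   using tr[OF x(1) ex] hom_comp[OF x(1) fmapD(6)[OF f]] fmap_dx[OF f x(1)] comp_zero[OF hom_dom[OF x(1)] fmapD(6)[OF f]] by simp
 qed
 have ker: "rcomp (sH (amb Fi') n) (sqr (coh_gr A Fi' j n)) T (\<phi> n ** x) 0"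
  if s: "rcomp (sH (amb Fi) n) (sqr (coh_gr A Fi j n)) T x 0" for T x
 proof -
  have x: "hom x T (Mo Fi n)" "Md Fi n ** x = 0" and
   ex: "EX T' e a v. cov e T' T & fG Fi (j - 1) n T' a & hom v T' (Mo Fi (n - 1)) & x ** e = a + Md Fi (n - 1) ** v"
   using s G(3) by blast+
  thus ?thesis unfolding G'(3)
   using tr[OF x(1) ex] hom_comp[OF x(1) fmapD(6)[OF f]] fmap_dx[OF f x(1)] comp_zero[OF hom_dom[OF x(1)] fmapD(6)[OF f]] by simp
 qed
 note R = rcomp_sq_map[OF P P' G(1) G'(1) m(1), of "\<phi> n"]
 define \<mu> where "\<mu> = sq_map A (coh_gr A Fi j n) (coh_gr A Fi' j n) (coh_map A (amb Fi) (amb Fi') \<phi> n)"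
 have \<mu>1: "hom \<mu> (quo_ob (coh_gr A Fi j n)) (quo_ob (coh_gr A Fi' j n))" unfolding \<mu>_def
  by (rule R(1)) (fact m(2) dom ker)+
 have \<mu>2: "rcomp (sH (amb Fi') n) (sqr (coh_gr A Fi' j n)) T (\<phi> n ** x) (\<mu> ** t)"
  if "rcomp (sH (amb Fi) n) (sqr (coh_gr A Fi j n)) T x t" for T x t unfolding \<mu>_def
  by (rule R(3)[OF _ _ _ that]) (fact m(2) dom ker)+
 obtain r0 where r0: "r0 \<ge> 1" "\<And>r. r \<ge> r0 ==> is_iso A (qE Fi r j n) (quo_ob (coh_gr A Fi j n)) (ss_limit A Fi r i j)"
   "\<And>r T x t. r \<ge> r0 ==> sE Fi r j n T x t ==>
    rcomp (sH (amb Fi) n) (sqr (coh_gr A Fi j n)) T x (ss_limit A Fi r i j ** t)"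
  using ss_limit_spec[OF b, of j i] unfolding n_def by blast
 obtain r1 where r1: "r1 \<ge> 1" "\<And>r. r \<ge> r1 ==> is_iso A (qE Fi' r j n) (quo_ob (coh_gr A Fi' j n)) (ss_limit A Fi' r i j)"
   "\<And>r T x t. r \<ge> r1 ==> sE Fi' r j n T x t ==>
    rcomp (sH (amb Fi') n) (sqr (coh_gr A Fi' j n)) T x (ss_limit A Fi' r i j ** t)"
  using ss_limit_spec[OF b', of j i] unfolding n_def by blast
 have "\<mu> ** ss_limit A Fi r i j = ss_limit A Fi' r i j ** ss_map A Fi Fi' \<phi> r i j" if rr: "r \<ge> max r0 r1" for r
 proof -
  have r: "r \<ge> 1" "r \<ge> r0" "r \<ge> r1" using rr r0(1) by auto
  note p = fil_E_pres[OF fmapD(1)[OF f] r(1), where p = j and n = n] and p' = fil_E_pres[OF fmapD(2)[OF f] r(1), where p = j and n = n]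
  note l = is_iso_hom[OF r0(2)[OF r(2)] pres_ob2[OF p] hom_dom[OF \<mu>1]]
  note l' = is_iso_hom[OF r1(2)[OF r(3)] pres_ob2[OF p'] hom_cod[OF \<mu>1]]
  have M: "ss_map A Fi Fi' \<phi> r i j = fEm Fi Fi' \<phi> r j n" unfolding n_def using ss_map_fEm[OF f] .
  note e = fEm_spec[OF f r(1), of j n]
  show ?thesis unfolding M
  proof (rule pres_eq[OF p hom_comp[OF l \<mu>1] hom_comp[OF e(1) l']])
   fix T x t assume s: "sE Fi r j n T x t"
   note t = pres_hom2[OF p s]
   show "\<mu> ** ss_limit A Fi r i j ** t = ss_limit A Fi' r i j ** fEm Fi Fi' \<phi> r j n ** t"
    using pres_uniq[OF coh_gr_pres[OF b'] \<mu>2[OF r0(3)[OF r(2) s]] r1(3)[OF r(3) e(2)[OF s]]]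
     assoc[OF t l \<mu>1] assoc[OF t e(1) l'] by simp
  qed
 qed
 thus "EX r0>=1. ALL r>=r0. sq_map A (coh_gr A Fi j (i + j)) (coh_gr A Fi' j (i + j))
    (coh_map A (amb Fi) (amb Fi') \<phi> (i + j)) ** ss_limit A Fi r i j =
   ss_limit A Fi' r i j ** ss_map A Fi Fi' \<phi> r i j"
  unfolding \<mu>_def n_def using r0(1) by (intro exI[of _ "max r0 r1"]) simp
qed


section \<open>Filtrations by decalage\<close>

text \<open>The hypothesis \<open>z\<close> expresses that the image of \<open>\<beta>\<close> lies
  in that of \<open>\<alpha>\<close>, as \<open>subquot1\<close> requires of its relations.\<close>

lemma im_quot_SQ:
 assumes \<alpha>: "hom \<alpha> U Y" and \<beta>: "hom \<beta> V Y" and z: "coker_ar A Y \<alpha> ** \<beta> = 0"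
 shows "SQ Y (im_quot A Y \<alpha> V \<beta>)"
  and "(EX t. sqr (im_quot A Y \<alpha> V \<beta>) T x t) \<longleftrightarrow> hom x T Y & (EX T' e u. cov e T' T & hom u T' U & x ** e = \<alpha> ** u)"
  and "sqr (im_quot A Y \<alpha> V \<beta>) T x 0 \<longleftrightarrow> hom x T Y & (EX T' e v. cov e T' T & hom v T' V & x ** e = \<beta> ** v)"
proof -
 obtain Q where Q: "hom (coker_ar A Y \<alpha>) Y Q" using coker_ar_hom[OF \<alpha>] by blast
 have c: "Y : obj A" "finite {coker_ar A Y \<alpha>}" "\<And>g. g : {coker_ar A Y \<alpha>} ==> EX Z. hom g Y Z" "hom \<beta> V Y"
  "\<And>g. g : {coker_ar A Y \<alpha>} ==> g ** \<beta> = 0"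
  using hom_cod[OF \<alpha>] Q \<beta> z by blast+
 note s = subquot1[OF c, folded im_quot_def]
 show "SQ Y (im_quot A Y \<alpha> V \<beta>)" using s(1) by blast
 show "(EX t. sqr (im_quot A Y \<alpha> V \<beta>) T x t) \<longleftrightarrow> hom x T Y & (EX T' e u. cov e T' T & hom u T' U & x ** e = \<alpha> ** u)"
  using s(2)[of T x] coker_ar_zero_iff[OF \<alpha>, of x T] by blast
 show "sqr (im_quot A Y \<alpha> V \<beta>) T x 0 \<longleftrightarrow> hom x T Y & (EX T' e v. cov e T' T & hom v T' V & x ** e = \<beta> ** v)"
  using s(3) .
qed

lemma coker_factor_zero:
 assumes \<alpha>: "hom \<alpha> U Y" and \<gamma>: "hom \<gamma> V U"
 shows "coker_ar A Y \<alpha> ** (\<alpha> ** \<gamma>) = 0"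
 unfolding coker_ar_zero_iff[OF \<alpha> hom_comp[OF \<gamma> \<alpha>]]
 using cov_id[OF hom_dom[OF \<gamma>]] comp_id[OF hom_comp[OF \<gamma> \<alpha>]] \<gamma> by blast

lemma im_quot_map:
 assumes \<alpha>: "hom \<alpha> U Y" and \<beta>: "hom \<beta> V Y" and z: "coker_ar A Y \<alpha> ** \<beta> = 0"
  and \<alpha>': "hom \<alpha>' U' Y'" and \<beta>': "hom \<beta>' V' Y'" and z': "coker_ar A Y' \<alpha>' ** \<beta>' = 0"
  and \<psi>: "hom \<psi> Y Y'" and \<mu>: "hom \<mu> U U'" "\<psi> ** \<alpha> = \<alpha>' ** \<mu>" and \<nu>: "hom \<nu> V V'" "\<psi> ** \<beta> = \<beta>' ** \<nu>"
 defines "\<eta> \<equiv> sq_map A (im_quot A Y \<alpha> V \<beta>) (im_quot A Y' \<alpha>' V' \<beta>') \<psi>"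
 shows "hom \<eta> (quo_ob (im_quot A Y \<alpha> V \<beta>)) (quo_ob (im_quot A Y' \<alpha>' V' \<beta>'))"
  and "sqr (im_quot A Y \<alpha> V \<beta>) T x t ==> sqr (im_quot A Y' \<alpha>' V' \<beta>') T (\<psi> ** x) (\<eta> ** t)"
proof -
 note s = im_quot_SQ[OF \<alpha> \<beta> z] and s' = im_quot_SQ[OF \<alpha>' \<beta>' z']
 have tr: "EX T' e u. cov e T' T & hom u T' W' & \<psi> ** x ** e = \<gamma>' ** u"
  if x: "hom x T Y" and ex: "EX T' e u. cov e T' T & hom u T' W & x ** e = \<gamma> ** u"
   and \<gamma>: "hom \<gamma> W Y" "hom \<gamma>' W' Y'" "hom \<mu> W W'" "\<psi> ** \<gamma> = \<gamma>' ** \<mu>" for x T W W' \<gamma> \<gamma>' \<mu>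
 proof -
  obtain T' e u where e: "cov e T' T" "hom u T' W" "x ** e = \<gamma> ** u" using ex by blast
  have "\<psi> ** x ** e = \<gamma>' ** (\<mu> ** u)"
   using assoc[OF cov_hom[OF e(1)] x \<psi>] e(3) assoc[OF e(2) \<gamma>(1) \<psi>] \<gamma>(4) assoc[OF e(2) \<gamma>(3,2)] by simp
  thus ?thesis using e(1) hom_comp[OF e(2) \<gamma>(3)] by blast
 qed
 have dom: "EX t'. sqr (im_quot A Y' \<alpha>' V' \<beta>') T (\<psi> ** x) t'" if "sqr (im_quot A Y \<alpha> V \<beta>) T x t" for T x t
 proof -
  have x: "hom x T Y" and ex: "EX T' e u. cov e T' T & hom u T' U & x ** e = \<alpha> ** u" using that s(2) by blast+
  show ?thesis unfolding s'(2) using hom_comp[OF x \<psi>] tr[OF x ex \<alpha> \<alpha>' \<mu>] by blast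
 qed
 have ker: "sqr (im_quot A Y' \<alpha>' V' \<beta>') T (\<psi> ** x) 0" if "sqr (im_quot A Y \<alpha> V \<beta>) T x 0" for T x
 proof -
  have x: "hom x T Y" and ex: "EX T' e u. cov e T' T & hom u T' V & x ** e = \<beta> ** u" using that s(3) by blast+
  show ?thesis unfolding s'(3) using hom_comp[OF x \<psi>] tr[OF x ex \<beta> \<beta>' \<nu>] by blast
 qed
 show "hom \<eta> (quo_ob (im_quot A Y \<alpha> V \<beta>)) (quo_ob (im_quot A Y' \<alpha>' V' \<beta>'))"
  unfolding \<eta>_def by (rule sq_map_spec(1)[OF s(1) s'(1) \<psi>]) (fact dom ker)+
 show "sqr (im_quot A Y' \<alpha>' V' \<beta>') T (\<psi> ** x) (\<eta> ** t)" if "sqr (im_quot A Y \<alpha> V \<beta>) T x t"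
  unfolding \<eta>_def by (rule sq_map_spec(2)[OF s(1) s'(1) \<psi> _ _ that]) (fact dom ker)+
qed

text \<open>The filtration \<open>G\<close> of a complex is the decalage of a filtration \<open>W\<close> that is not stable under the
 differential: \<open>d W\<^sub>p \<subseteq> W\<^sub>p\<^sub>+\<^sub>1\<close> and \<open>G\<^sub>p = W\<^sub>p \<inter> d\<^sup>-\<^sup>1 W\<^sub>p\<close>.\<close>

definition Wfil :: "('o, 'a) fcpx => (int => int => 'o => 'a => bool) => bool" where
 "Wfil Fi W \<longleftrightarrow> is_filtered A Fi &
   (ALL p n T x. W p n T x --> hom x T (Mo Fi n)) &
   (ALL p n T x T' e. W p n T x & hom e T' T --> W p n T' (x ** e)) &
   (ALL p n T x y. W p n T x & W p n T y --> W p n T (x - y)) &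
   (ALL p n. ALL T:obj A. W p n T 0) &
   (ALL p q n T x. p \<le> q & W p n T x --> W q n T x) &
   (ALL p n T x. W p n T x --> W (p + 1) (n + 1) T (Md Fi n ** x)) &
   (ALL p n T x. fG Fi p n T x \<longleftrightarrow> W p n T x & W p (n + 1) T (Md Fi n ** x))"

text \<open>W_p is not stable under d; this is the subcomplex generated by it.\<close>

definition Kfil :: "('o, 'a) fcpx => (int => int => 'o => 'a => bool) => int => int => 'o => 'a => bool" where
 "Kfil Fi W p n T x \<longleftrightarrow> hom x T (Mo Fi n) &
   (EX T' e w w'. cov e T' T & W p n T' w & W p (n - 1) T' w' & x ** e = w + Md Fi (n - 1) ** w')"

lemma WfilD:
 assumes "Wfil Fi W"
 shows Wfil_fil: "is_filtered A Fi" and W_hom: "W p n T x ==> hom x T (Mo Fi n)"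
  and W_restr: "W p n T x ==> hom e T' T ==> W p n T' (x ** e)"
  and W_diff: "W p n T x ==> W p n T y ==> W p n T (x - y)"
  and W_zero: "T : obj A ==> W p n T 0"
  and W_mono: "p \<le> q ==> W p n T x ==> W q n T x"
  and W_d: "W p n T x ==> W (p + 1) (n + 1) T (Md Fi n ** x)"
  and W_G: "fG Fi p n T x \<longleftrightarrow> W p n T x & W p (n + 1) T (Md Fi n ** x)"
proof -
 have 1: "is_filtered A Fi" and 2: "ALL p n T x. W p n T x --> hom x T (Mo Fi n)"
  and 3: "ALL p n T x T' e. W p n T x & hom e T' T --> W p n T' (x ** e)"
  and 4: "ALL p n T x y. W p n T x & W p n T y --> W p n T (x - y)"
  and 5: "ALL p n. ALL T:obj A. W p n T 0" and 6: "ALL p q n T x. p \<le> q & W p n T x --> W q n T x"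
  and 7: "ALL p n T x. W p n T x --> W (p + 1) (n + 1) T (Md Fi n ** x)"
  and 8: "ALL p n T x. fG Fi p n T x \<longleftrightarrow> W p n T x & W p (n + 1) T (Md Fi n ** x)"
  using assms unfolding Wfil_def by - (elim conjE, assumption)+
 show "is_filtered A Fi" using 1 .
 show "W p n T x ==> hom x T (Mo Fi n)" using 2 by simp
 show "W p n T x ==> hom e T' T ==> W p n T' (x ** e)" using 3 by simp
 show "W p n T x ==> W p n T y ==> W p n T (x - y)" using 4 by simp
 show "T : obj A ==> W p n T 0" using 5 by simp
 show "p \<le> q ==> W p n T x ==> W q n T x" using 6 by blast
 show "W p n T x ==> W (p + 1) (n + 1) T (Md Fi n ** x)" using 7 by simp
 show "fG Fi p n T x \<longleftrightarrow> W p n T x & W p (n + 1) T (Md Fi n ** x)" using 8 by blast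
qed

context
 fixes Fi :: "('o, 'a) fcpx" and W :: "int => int => 'o => 'a => bool"
 assumes w: "Wfil Fi W"
begin

lemma wF: "is_filtered A Fi" and wC: "is_complex A (amb Fi)"
 using Wfil_fil[OF w] fil_amb by blast+

lemma G_of_cycle:
 assumes "W p n T x" "Md Fi n ** x = 0"
 shows "fG Fi p n T x"
 using assms W_G[OF w] W_zero[OF w hom_dom[OF W_hom[OF w assms(1)]]] by simp

text \<open>Since d maps W_p into W_(p+1). Together with \<open>G_W\<close> it interleaves the two
  filtrations: G_p is contained in W_p, and W_p in G_(p+1).\<close>

lemma G_Suc:
 assumes "W p n T x"
 shows "fG Fi (p + 1) n T x"
 using W_G[OF w] W_mono[OF w _ assms, of "p + 1"] W_d[OF w assms] by simp

lemma G_dW: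
 assumes "W p (n - 1) T x"
 shows "fG Fi (p + 1) n T (Md Fi (n - 1) ** x)"
 using fG_d'[OF wF, of "p + 1" n T x] G_Suc[OF assms] by simp

lemma G_W: "fG Fi p n T x ==> W p n T x"
 using W_G[OF w] by blast

lemma Kfil_W: "W p n T x ==> Kfil Fi W p n T x"
proof -
 assume x: "W p n T x"
 note hx = W_hom[OF w x]
 have T: "T : obj A" using hom_dom[OF hx] .
 have "x ** idt A T = x + Md Fi (n - 1) ** 0" using comp_id[OF hx] comp_zero[OF T cpx_hom_d'[OF wC, of n]] by simp
 thus ?thesis unfolding Kfil_def using hx cov_id[OF T] x W_zero[OF w T] by blast
qed

text \<open>Locally x = y + d z with y and z in W_(p-1). Since d y = d x lies in stage p - r, y
  belongs to G_(p-1), and z lies in G_p by \<open>G_Suc\<close>; so both summands are divided out on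
  page r. This permits W_(p-1) + d W_(p-1) to replace G_(p-1).\<close>

lemma Kfil_fB:
 assumes r: "r \<ge> 1" and x: "fZ Fi r p n T x" and K: "Kfil Fi W (p - 1) n T x"
 shows "fB Fi r p n T x"
proof -
 obtain T' e y z where e: "cov e T' T" "W (p - 1) n T' y" "W (p - 1) (n - 1) T' z" "x ** e = y + Md Fi (n - 1) ** z"
  using K unfolding Kfil_def by blast
 note he = cov_hom[OF e(1)] and hx = fZ_hom[OF wF x] and hy = W_hom[OF w e(2)] and hz = W_hom[OF w e(3)]
 note xe = fZ_restr[OF wF x he]
 have "Md Fi n ** (x ** e) = Md Fi n ** y"
  using e(4) comp_add[OF hy hom_comp[OF hz cpx_hom_d'[OF wC]] cpx_hom_d[OF wC]] cpx_ddx'[OF wC hz] by simp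
 hence dy: "fG Fi (p - r) (n + 1) T' (Md Fi n ** y)" using xe unfolding fZ_def by simp
 hence "W (p - 1) (n + 1) T' (Md Fi n ** y)" using W_mono[OF w _ G_W[OF dy], of "p - 1"] r by simp
 hence "fG Fi (p - 1) n T' y" using W_G[OF w] e(2) by blast
 hence y: "fZ Fi (r - 1) (p - 1) n T' y" unfolding fZ_def using dy by simp
 have "fG Fi p (n - 1) T' z" using G_Suc[OF e(3)] by simp
 hence "fG Fi (p + r - 1) (n - 1) T' z" using fG_mono[OF wF, of p "p + r - 1"] r by simp
 moreover have "fG Fi p n T' (Md Fi (n - 1) ** z)" using G_dW[OF e(3)] by simp
 ultimately have z: "fZ Fi (r - 1) (p + r - 1) (n - 1) T' z" unfolding fZ_def by simp
 have "fB Fi r p n T' (x ** e)" unfolding e(4) using fBI[OF wF y z] .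
 thus ?thesis using fB_loc[OF wF hx e(1)] by blast
qed

end

text \<open>Compatibility of \<open>k\<close> is assumed with W only. As \<open>\<phi>\<close> and
  \<open>\<psi>\<close> respect the filtration, the homotopy equation puts d (k x) and d (k (d x))
  back into the same steps of W, so k x lies in G_j and k (d x) in G_(j-r). This gives the two
  summands of an element of B_r.\<close>

lemma ss_map_homotopy:
 assumes f: "fmap Fi Fi' \<phi>" and g: "fmap Fi Fi' \<psi>" and w: "Wfil Fi W" and w': "Wfil Fi' W'"
  and k: "\<And>n. hom (k n) (Mo Fi n) (Mo Fi' (n - 1))" "\<And>p n T x. W p n T x ==> W' p (n - 1) T (k n ** x)"
  and eq: "\<And>n. \<phi> n - \<psi> n = Md Fi' (n - 1) ** k n + k (n + 1) ** Md Fi n" and r: "r \<ge> 1"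
 shows "ss_map A Fi Fi' \<phi> r i j = ss_map A Fi Fi' \<psi> r i j"
proof (rule ss_map_eq[OF f g r])
 fix T x assume x: "fZ Fi (int r) j (i + j) T x"
 define n where "n = i + j"
 have x: "fZ Fi (int r) j n T x" using x unfolding n_def .
 note F = fmapD(1)[OF f] and F' = fmapD(2)[OF f] and C = fmapD(4)[OF f] and C' = fmapD(5)[OF f]
 note h\<phi> = fmapD(6)[OF f] and h\<psi> = fmapD(6)[OF g] and hx = fZ_hom[OF F x]
 have k': "hom (k (n + 1)) (Mo Fi (n + 1)) (Mo Fi' n)" for n using k(1)[of "n + 1"] by simp
 have dif: "\<phi> n ** y - \<psi> n ** y = Md Fi' (n - 1) ** (k n ** y) + k (n + 1) ** (Md Fi n ** y)"
  if y: "hom y T (Mo Fi n)" for y n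
  using diff_comp[OF y h\<phi> h\<psi>] eq[of n] add_comp[OF y hom_comp[OF k(1) cpx_hom_d'[OF C']] hom_comp[OF cpx_hom_d[OF C] k']]
   assoc[OF y k(1) cpx_hom_d'[OF C']] assoc[OF y cpx_hom_d[OF C] k'] by simp
 define u where "u = Md Fi n ** x"
 have u: "fG Fi (j - int r) (n + 1) T u" using x unfolding fZ_def u_def by blast
 note hu = fG_hom[OF F u]
 have ku: "hom (k (n + 1) ** u) T (Mo Fi' n)" using hom_comp[OF hu k'] .
 have kx: "hom (k n ** x) T (Mo Fi' (n - 1))" using hom_comp[OF hx k(1)] .
 have Wku: "W' (j - int r) n T (k (n + 1) ** u)" using k(2)[OF G_W[OF w u]] by simp
 have du: "Md Fi (n + 1) ** u = 0" unfolding u_def using cpx_ddx[OF C hx] .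
 have "Md Fi' n ** (k (n + 1) ** u) = \<phi> (n + 1) ** u - \<psi> (n + 1) ** u"
  using dif[OF hu] du comp_zero[OF hom_dom[OF hu] k(1)] by simp
 moreover have "W' (j - int r) (n + 1) T (\<phi> (n + 1) ** u - \<psi> (n + 1) ** u)"
  using W_diff[OF w' G_W[OF w' fmapD(7)[OF f u]] G_W[OF w' fmapD(7)[OF g u]]] .
 ultimately have Gku: "fG Fi' (j - int r) n T (k (n + 1) ** u)" using W_G[OF w'] Wku by simp
 have "fG Fi' (j - 1) n T (k (n + 1) ** u)" using fG_mono[OF F' _ Gku, of "j - 1"] r by simp
 hence y: "fZ Fi' (int r - 1) (j - 1) n T (k (n + 1) ** u)"
  unfolding fZ_def using fG_d[OF F' Gku] by simp
 have xG: "fG Fi j n T x" using x unfolding fZ_def by blast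
 have Wkx: "W' j (n - 1) T (k n ** x)" using k(2)[OF G_W[OF w xG]] .
 have e1: "Md Fi' (n - 1) ** (k n ** x) = (\<phi> n ** x - \<psi> n ** x) - k (n + 1) ** u"
  using dif[OF hx] unfolding u_def by simp
 have "W' j n T (\<phi> n ** x - \<psi> n ** x)" using W_diff[OF w' G_W[OF w' fmapD(7)[OF f xG]] G_W[OF w' fmapD(7)[OF g xG]]] .
 hence Wd: "W' j n T (Md Fi' (n - 1) ** (k n ** x))"
  unfolding e1 using W_diff[OF w' _ W_mono[OF w' _ Wku]] r by simp
 hence "fG Fi' j (n - 1) T (k n ** x)" using W_G[OF w', of j "n - 1"] Wkx by simp
 hence "fG Fi' (j + int r - 1) (n - 1) T (k n ** x)" using fG_mono[OF F', of j "j + int r - 1"] r by simp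
 moreover have "fG Fi' j n T (Md Fi' (n - 1) ** (k n ** x))" using G_of_cycle[OF w' Wd cpx_ddx'[OF C' kx]] .
 ultimately have z: "fZ Fi' (int r - 1) (j + int r - 1) (n - 1) T (k n ** x)" unfolding fZ_def by simp
 have "\<phi> n ** x - \<psi> n ** x = k (n + 1) ** u + Md Fi' (n - 1) ** (k n ** x)" using e1 by simp
 hence "fB Fi' (int r) j n T (\<phi> n ** x - \<psi> n ** x)" using fBI[OF F' y z] by simp
 thus "fB Fi' (int r) j (i + j) T (\<phi> (i + j) ** x - \<psi> (i + j) ** x)" unfolding n_def .
qed

text \<open>\<open>TP Fi W b c Z \<rho>\<close>: the complex \<open>Z\<close> is \<open>G\<^sub>b / (W\<^sub>c + d W\<^sub>c)\<close>, and zero if \<open>b \<le> c\<close>.\<close>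

definition TP :: "('o, 'a) fcpx => (int => int => 'o => 'a => bool) => int => int => ('o, 'a) cpx =>
  (int => 'o => 'a => 'a => bool) => bool" where
 "TP Fi W b c Z \<rho> \<longleftrightarrow> Wfil Fi W & (ALL n. pres (Mo Fi n) (cob Z n) (\<rho> n)) &
   (ALL n. hom (cdf Z n) (cob Z n) (cob Z (n + 1))) &
   (ALL n T x t. \<rho> n T x t --> (EX k. \<rho> (n + 1) T (Md Fi n ** x) (ksgn k (cdf Z n ** t)))) &
   (ALL n T x. (EX t. \<rho> n T x t) \<longleftrightarrow> (if c < b then fG Fi b n T x else T : obj A & x = 0)) &
   (ALL n T x. c < b --> \<rho> n T x 0 \<longleftrightarrow> Kfil Fi W c n T x)"

abbreviation (input) "\<sigma>c Z \<rho> n \<equiv> rcomp (\<rho> n) (sH Z n)"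

lemma TP_coh:
 assumes "TP Fi W b c Z \<rho>"
 shows "is_complex A Z" and "pres (Mo Fi n) (qH Z n) (\<sigma>c Z \<rho> n)"
  and "c < b ==> (EX h. \<sigma>c Z \<rho> n T x h) \<longleftrightarrow> fG Fi b n T x & Kfil Fi W c (n + 1) T (Md Fi n ** x)"
  and "c < b ==> \<sigma>c Z \<rho> n T x 0 \<longleftrightarrow> fG Fi b n T x &
   (EX T' e y. cov e T' T & fG Fi b (n - 1) T' y & Kfil Fi W c n T' (x ** e - Md Fi (n - 1) ** y))"
  and "\<not> c < b ==> \<sigma>c Z \<rho> n T x h ==> x = 0"
proof -
 have 1: "Wfil Fi W" and 2: "\<And>n. pres (Mo Fi n) (cob Z n) (\<rho> n)"
  and 3: "\<And>n. hom (cdf Z n) (cob Z n) (cob Z (n + 1))"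
  and 4: "\<And>n T x t. \<rho> n T x t ==> EX k. \<rho> (n + 1) T (Md Fi n ** x) (ksgn k (cdf Z n ** t))"
  and 5: "\<And>n T x. (EX t. \<rho> n T x t) \<longleftrightarrow> (if c < b then fG Fi b n T x else T : obj A & x = 0)"
  and 6: "\<And>n T x. c < b ==> \<rho> n T x 0 \<longleftrightarrow> Kfil Fi W c n T x"
  using assms unfolding TP_def by simp_all
 note cp = coh_pres[OF fil_amb[OF Wfil_fil[OF 1]] 2 3 4]
 show "is_complex A Z" by (rule cp(1))
 show "pres (Mo Fi n) (qH Z n) (\<sigma>c Z \<rho> n)" by (rule cp(2))
 show "(EX h. \<sigma>c Z \<rho> n T x h) \<longleftrightarrow> fG Fi b n T x & Kfil Fi W c (n + 1) T (Md Fi n ** x)" if cb: "c < b"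
  using cp(3)[of n T x] unfolding 5 6[OF cb] using cb by simp
 show "\<sigma>c Z \<rho> n T x 0 \<longleftrightarrow> fG Fi b n T x &
   (EX T' e y. cov e T' T & fG Fi b (n - 1) T' y & Kfil Fi W c n T' (x ** e - Md Fi (n - 1) ** y))" if cb: "c < b"
 proof -
  have "(EX t. \<rho> n T x t) \<longleftrightarrow> fG Fi b n T x" for n T x using 5 cb by simp
  thus ?thesis using cp(4)[of n T x] unfolding 6[OF cb] by blast
 qed
 show "x = 0" if "\<not> c < b" "\<sigma>c Z \<rho> n T x h"
 proof -
  have "EX t. \<rho> n T x t" using that(2) unfolding rcomp_def by blast
  thus ?thesis using 5[of n T x] that(1) by simp
 qed
qed

text \<open>The surjective half of the comparison between G_b / G_c and G_b / (W_c + d W_c): a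
  relative cocycle is corrected by an element of W_c, and what remains of its differential is a
  cocycle in W_c, hence in G_c.\<close>

lemma TP_cycle:
 assumes w: "Wfil Fi W" and cb: "c < b" and x: "fG Fi b n T x" and K: "Kfil Fi W c (n + 1) T (Md Fi n ** x)"
 shows "EX T' e y. cov e T' T & W c n T' y & fG Fi b n T' (x ** e - y) & fG Fi b n T' y &
  fG Fi c (n + 1) T' (Md Fi n ** (x ** e - y))"
proof -
 note F = wF[OF w] and C = wC[OF w]
 obtain T' e a y where e: "cov e T' T" "W c (n + 1) T' a" "W c n T' y" "Md Fi n ** x ** e = a + Md Fi n ** y"
  using K unfolding Kfil_def by auto
 note he = cov_hom[OF e(1)] and hx = fG_hom[OF F x] and hy = W_hom[OF w e(3)]
 have xe: "hom (x ** e) T' (Mo Fi n)" using hom_comp[OF he hx] .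
 have ea: "Md Fi n ** (x ** e - y) = a"
  using comp_diff[OF xe hy cpx_hom_d[OF C]] assoc[OF he hx cpx_hom_d[OF C]] e(4) by (metis add_diff_cancel_right')
 hence "Md Fi (n + 1) ** a = 0" using cpx_ddx[OF C hom_diff[OF xe hy]] by simp
 hence ga: "fG Fi c (n + 1) T' a" using G_of_cycle[OF w e(2)] by blast
 have gy: "fG Fi b n T' y" using fG_mono[OF F _ G_Suc[OF w e(3)], of b] cb by simp
 thus ?thesis using e(1,3) ga ea fG_diff[OF F fG_restr[OF F x he] gy] by auto
qed

text \<open>E_1 is the cohomology of G_j / G_(j-1); \<open>TP_cycle\<close> and
  \<open>Kfil_fB\<close> allow G_(j-1) to be replaced by W_(j-1) + d W_(j-1).\<close>

lemma TP_E1_iso: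
 assumes t: "TP Fi W j (j - 1) Z \<rho>"
 shows "EX \<theta>. is_iso A (qE Fi 1 j n) (qH Z n) \<theta> &
  (ALL T x t. sE Fi 1 j n T x t --> \<sigma>c Z \<rho> n T x (\<theta> ** t))"
proof -
 have w: "Wfil Fi W" using t unfolding TP_def by blast
 note F = wF[OF w] and C = wC[OF w]
 have 1: "(1::nat) \<le> 1" by simp
 have cb: "j - 1 < j" by simp
 note E = fil_E_SQ[OF F 1, unfolded of_nat_1] and P = fil_E_pres[OF F 1] and D = TP_coh[OF t] and d' = cpx_hom_d'[OF C, of n]
 note D3 = D(3)[OF cb] and D4 = D(4)[OF cb]
 show ?thesis
 proof (rule pres_iso_ex[OF P D(2)])
  fix T x t assume "sE Fi 1 j n T x t"
  hence "fZ Fi 1 j n T x" using E(2) by blast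
  thus "EX t'. \<sigma>c Z \<rho> n T x t'" unfolding D3 fZ_def using Kfil_W[OF w G_W[OF w]] by blast
 next
  fix T x assume s: "sE Fi 1 j n T x 0"
  hence x: "fG Fi j n T x" using E(2) unfolding fZ_def by blast
  obtain T' e y z where e: "cov e T' T" "fZ Fi 0 (j - 1) n T' y" "fZ Fi 0 j (n - 1) T' z" "x ** e = y + Md Fi (n - 1) ** z"
   using s unfolding E(3) fB_def by auto
  have "x ** e - Md Fi (n - 1) ** z = y" using e(4) by simp
  moreover have "Kfil Fi W (j - 1) n T' y" using e(2) Kfil_W[OF w G_W[OF w]] unfolding fZ_def by blast
  moreover have "fG Fi j (n - 1) T' z" using e(3) unfolding fZ_def by blast
  ultimately show "\<sigma>c Z \<rho> n T x 0" unfolding D4 using x e(1)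
   by (intro conjI exI[of _ T'] exI[of _ e] exI[of _ z]) simp_all
 next
  fix T x t assume s: "sE Fi 1 j n T x t" "\<sigma>c Z \<rho> n T x 0"
  have x: "fZ Fi 1 j n T x" using s(1) E(2) by blast
  obtain T' e y where e: "cov e T' T" "fG Fi j (n - 1) T' y" "Kfil Fi W (j - 1) n T' (x ** e - Md Fi (n - 1) ** y)"
   using s(2) unfolding D4 by blast
  note he = cov_hom[OF e(1)]
  have y: "fZ Fi 0 j (n - 1) T' y" unfolding fZ_def using e(2) fG_d'[OF F e(2)] by simp
  have dy: "fZ Fi 1 j n T' (Md Fi (n - 1) ** y)" using fZ_dz[OF F y] by simp
  have "fB Fi 1 j n T' (x ** e - Md Fi (n - 1) ** y)"
   using Kfil_fB[OF w _ fZ_diff[OF F fZ_restr[OF F x he] dy] e(3)] by simp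
  hence "sE Fi 1 j n T' (x ** e - Md Fi (n - 1) ** y) 0" using E(3) by blast
  moreover have "sE Fi 1 j n T' (Md Fi (n - 1) ** y) 0" using E(3) fBI_z[OF F, of 1 j n T' y] y by simp
  ultimately have "sE Fi 1 j n T' (x ** e) 0" using pres_add[OF P] by fastforce
  thus "sE Fi 1 j n T x 0" using pres_zero_loc[OF P fZ_hom[OF F x] e(1)] by blast
 next
  fix T x t assume "\<sigma>c Z \<rho> n T x t"
  hence x: "fG Fi j n T x" and K: "Kfil Fi W (j - 1) (n + 1) T (Md Fi n ** x)" using D3 by blast+
  obtain T' e y where e: "cov e T' T" "W (j - 1) n T' y" "fG Fi j n T' (x ** e - y)" "fG Fi j n T' y"
   "fG Fi (j - 1) (n + 1) T' (Md Fi n ** (x ** e - y))" using TP_cycle[OF w cb x K] by blast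
  have "fZ Fi 1 j n T' (x ** e - y)" unfolding fZ_def using e(3,5) by simp
  then obtain s where s: "sE Fi 1 j n T' (x ** e - y) s" using E(2) by blast
  have T': "T' : obj A" using hom_dom[OF cov_hom[OF e(1)]] .
  have hy: "hom y T' (Mo Fi n)" using W_hom[OF w e(2)] .
  have "y ** idt A T' - Md Fi (n - 1) ** 0 = y" using comp_id[OF hy] comp_zero[OF T' d'] by simp
  hence "\<sigma>c Z \<rho> n T' y 0" unfolding D4 using e(4) cov_id[OF T'] fG_zero[OF F T'] Kfil_W[OF w e(2)]
   by (intro conjI exI[of _ T'] exI[of _ "idt A T'"] exI[of _ 0]) simp_all
  hence "\<sigma>c Z \<rho> n T' (- y) (- 0)" using pres_uminus[OF D(2)] by blast
  hence "\<sigma>c Z \<rho> n T' (x ** e - y - x ** e) 0" by simp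
  thus "EX T' e y s. cov e T' T & sE Fi 1 j n T' y s & \<sigma>c Z \<rho> n T' (y - x ** e) 0" using e(1) s by blast
 qed
qed

text \<open>Put b = j + r - 1 and c = j - r. Up to W_c, the elements of Z_r are the cocycles of G_j
  modulo W_c + d W_c, that is, of \<open>U\<close>. Passing to the cohomology of G_b / (W_c + d W_c)
  divides out the boundaries coming from G_b, and the image of \<open>V\<close> removes stage j -
  1.\<close>

lemma TP_En_iso:
 assumes r: "r \<ge> (1::nat)" and T: "TP Fi W (j + int r - 1) (j - int r) Z \<rho>" and U: "TP Fi W j (j - int r) U \<rho>U"
  and V: "TP Fi W (j - 1) (j - int r) V \<rho>V"
  and \<alpha>: "hom \<alpha> (qH U n) (qH Z n)" "\<And>T x h. \<sigma>c U \<rho>U n T x h ==> \<sigma>c Z \<rho> n T x (\<alpha> ** h)"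
  and \<beta>: "hom \<beta> (qH V n) (qH Z n)" "\<And>T x h. \<sigma>c V \<rho>V n T x h ==> \<sigma>c Z \<rho> n T x (\<beta> ** h)"
  and z: "coker_ar A (qH Z n) \<alpha> ** \<beta> = 0"
 defines "D \<equiv> im_quot A (qH Z n) \<alpha> (qH V n) \<beta>"
 shows "EX \<theta>. is_iso A (qE Fi r j n) (quo_ob D) \<theta> &
  (ALL T x t. sE Fi r j n T x t --> rcomp (\<sigma>c Z \<rho> n) (sqr D) T x (\<theta> ** t))"
proof -
 have w: "Wfil Fi W" using T unfolding TP_def by blast
 note F = wF[OF w] and C = wC[OF w]
 have cbT: "j - int r < j + int r - 1" and cbU: "j - int r < j" using r by auto
 note E = fil_E_SQ[OF F r] and P = fil_E_pres[OF F r] and HT = TP_coh[OF T] and HU = TP_coh[OF U] and HV = TP_coh[OF V]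
 note d = cpx_hom_d[OF C, of n] and d' = cpx_hom_d'[OF C, of n]
 note DS = im_quot_SQ[OF \<alpha>(1) \<beta>(1) z, folded D_def]
 note PD = pres_rcomp[OF HT(2) SQ_pres[OF DS(1)]]
 note T3 = HT(3)[OF cbT] and T4 = HT(4)[OF cbT] and U3 = HU(3)[OF cbU]
 have kerT: "rcomp (\<sigma>c Z \<rho> n) (sqr D) T x 0" if "\<sigma>c Z \<rho> n T x 0" for T x
  unfolding rcomp_def[of "\<sigma>c Z \<rho> n"] using that pres_zero[OF SQ_pres[OF DS(1)] hom_dom[OF pres_hom1[OF HT(2) that]]] by blast
 have TW: "\<sigma>c Z \<rho> n T y 0" if y: "W (j - int r) n T y" for T y
 proof -
  note hy = W_hom[OF w y]
  have T': "T : obj A" using hom_dom[OF hy] .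
  have "y ** idt A T - Md Fi (n - 1) ** 0 = y" using comp_id[OF hy] comp_zero[OF T' d'] by simp
  moreover have "fG Fi (j + int r - 1) n T y" using fG_mono[OF F _ G_Suc[OF w y], of "j + int r - 1"] r by simp
  ultimately show ?thesis unfolding T4 using cov_id[OF T'] fG_zero[OF F T'] Kfil_W[OF w y]
   by (intro conjI exI[of _ T] exI[of _ "idt A T"] exI[of _ 0]) simp_all
 qed
 have TD: "\<sigma>c Z \<rho> n T (Md Fi (n - 1) ** y) 0" if y: "fG Fi (j + int r - 1) (n - 1) T y" for T y
 proof -
  note hy = hom_comp[OF fG_hom[OF F y] d']
  have T': "T : obj A" using hom_dom[OF hy] .
  have "Md Fi (n - 1) ** y ** idt A T - Md Fi (n - 1) ** y = 0" using comp_id[OF hy] by simp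
  thus ?thesis unfolding T4
   using fG_d'[OF F y] cov_id[OF T'] y Kfil_W[OF w W_zero[OF w T']]
   by (intro conjI exI[of _ T] exI[of _ "idt A T"] exI[of _ y]) simp_all
 qed
 have domU: "EX h. \<sigma>c U \<rho>U n T x h" if x: "fZ Fi (int r) j n T x" for T x
  unfolding U3 using x Kfil_W[OF w G_W[OF w]] unfolding fZ_def by blast
 have dom: "EX t'. rcomp (\<sigma>c Z \<rho> n) (sqr D) T x t'" if s: "sE Fi r j n T x t" for T x t
 proof -
  have "fZ Fi (int r) j n T x" using s E(2) by blast
  then obtain h where h: "\<sigma>c U \<rho>U n T x h" using domU by blast
  note hh = pres_hom2[OF HU(2) h]
  have "\<alpha> ** h ** idt A T = \<alpha> ** h" using comp_id[OF hom_comp[OF hh \<alpha>(1)]] .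
  hence "EX t. sqr D T (\<alpha> ** h) t" unfolding DS(2) using hom_comp[OF hh \<alpha>(1)] cov_id[OF hom_dom[OF hh]] hh by blast
  thus ?thesis unfolding rcomp_def[of "\<sigma>c Z \<rho> n"] using \<alpha>(2)[OF h] by blast
 qed
 have fromV: "rcomp (\<sigma>c Z \<rho> n) (sqr D) T v 0" if v: "\<sigma>c V \<rho>V n T v h" for T v h
 proof -
  note hh = pres_hom2[OF HV(2) v]
  have "\<beta> ** h ** idt A T = \<beta> ** h" using comp_id[OF hom_comp[OF hh \<beta>(1)]] .
  hence "sqr D T (\<beta> ** h) 0" unfolding DS(3) using hom_comp[OF hh \<beta>(1)] cov_id[OF hom_dom[OF hh]] hh by blast
  thus ?thesis unfolding rcomp_def[of "\<sigma>c Z \<rho> n"] using \<beta>(2)[OF v] by blast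
 qed
 have ker: "rcomp (\<sigma>c Z \<rho> n) (sqr D) T x 0" if s: "sE Fi r j n T x 0" for T x
 proof -
  obtain T' e y z where x: "hom x T (Mo Fi n)" and e: "cov e T' T" "fZ Fi (int r - 1) (j - 1) n T' y"
   "fZ Fi (int r - 1) (j + int r - 1) (n - 1) T' z" "x ** e = y + Md Fi (n - 1) ** z"
   using s unfolding E(3) fB_def by blast
  have y: "fG Fi (j - 1) n T' y" "fG Fi (j - int r) (n + 1) T' (Md Fi n ** y)" using e(2) unfolding fZ_def by auto
  have "rcomp (\<sigma>c Z \<rho> n) (sqr D) T' y 0"
  \<comment> \<open>For \<open>r = 1\<close> the interval of \<open>V\<close> is empty and
    \<open>V\<close> is zero; then stage j - 1 is already contained in W_c.\<close>
  proof (cases "r = 1")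
   case True
   hence "W (j - int r) n T' y" using G_W[OF w y(1)] by simp
   thus ?thesis using kerT TW by blast
  next
   case False
   hence "j - int r < j - 1" using r by simp
   then obtain h where "\<sigma>c V \<rho>V n T' y h" using HV(3) y Kfil_W[OF w G_W[OF w y(2)]] by blast
   thus ?thesis using fromV by blast
  qed
  moreover have "rcomp (\<sigma>c Z \<rho> n) (sqr D) T' (Md Fi (n - 1) ** z) 0" using kerT TD e(3) unfolding fZ_def by blast
  ultimately have "rcomp (\<sigma>c Z \<rho> n) (sqr D) T' (x ** e) 0" using pres_add[OF PD] e(4) by fastforce
  thus ?thesis using pres_zero_loc[OF PD x e(1)] by blast
 qed
 have jr: "j - int r \<le> j - 1" using r by simp
 \<comment> \<open>The core of injectivity. Such a \<open>z\<close> is locally a + d u with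
   \<open>a\<close> in W_c and u in G_b; d a = d z lies in stage c, so \<open>a\<close> lies in G_c,
   and then d u = z - a lies in G_j, as B_r demands.\<close>
 have KB: "fB Fi (int r) j n T z" if z: "fZ Fi (int r) j n T z" and s: "\<sigma>c Z \<rho> n T z 0" for T z
 proof -
  obtain T1 e1 y where e1: "cov e1 T1 T" and y: "fG Fi (j + int r - 1) (n - 1) T1 y"
   and K: "Kfil Fi W (j - int r) n T1 (z ** e1 - Md Fi (n - 1) ** y)" using s unfolding T4 by blast
  obtain T2 e2 a b where e2: "cov e2 T2 T1" and a: "W (j - int r) n T2 a" and b: "W (j - int r) (n - 1) T2 b"
   and eq: "(z ** e1 - Md Fi (n - 1) ** y) ** e2 = a + Md Fi (n - 1) ** b" using K unfolding Kfil_def by blast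
  note h1 = cov_hom[OF e1] and h2 = cov_hom[OF e2]
  note z2 = fZ_restr[OF F z hom_comp[OF h2 h1]] and y2 = fG_restr[OF F y h2]
  note ha = W_hom[OF w a] and hb = W_hom[OF w b] and hy = fG_hom[OF F y] and hy2 = fG_hom[OF F y2]
  note hu = hom_add[OF hy2 hb]
  have zu: "z ** (e1 ** e2) = a + Md Fi (n - 1) ** (y ** e2 + b)"
   using eq diff_comp[OF h2 hom_comp[OF h1 fZ_hom[OF F z]] hom_comp[OF hy d']] assoc[OF h2 h1 fZ_hom[OF F z]] assoc[OF h2 hy d']
    comp_add[OF hy2 hb d'] by (simp add: algebra_simps)
  have "Md Fi n ** (z ** (e1 ** e2)) = Md Fi n ** a"
   unfolding zu using comp_add[OF ha hom_comp[OF hu d'] d] cpx_ddx'[OF C hu] by simp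
  hence Ga: "fG Fi (j - int r) n T2 a" using a z2 G_W[OF w] unfolding W_G[OF w] fZ_def by metis
  have Za: "fZ Fi (int r - 1) (j - 1) n T2 a" unfolding fZ_def using fG_mono[OF F jr Ga] fG_d[OF F Ga] by simp
  have "fG Fi (j + int r - 1) (n - 1) T2 b" using fG_mono[OF F _ G_Suc[OF w b], of "j + int r - 1"] r by simp
  hence Gu: "fG Fi (j + int r - 1) (n - 1) T2 (y ** e2 + b)" using fG_add[OF F y2] by blast
  have "Md Fi (n - 1) ** (y ** e2 + b) = z ** (e1 ** e2) - a" unfolding zu by simp
  hence "fG Fi j n T2 (Md Fi (n - 1) ** (y ** e2 + b))"
   using fG_diff[OF F _ fG_mono[OF F _ Ga]] z2 unfolding fZ_def by simp
  hence "fZ Fi (int r - 1) (j + int r - 1) (n - 1) T2 (y ** e2 + b)" unfolding fZ_def using Gu by simp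
  thus ?thesis using fB_loc[OF F fZ_hom[OF F z] cov_comp[OF e1 e2]] fBI[OF F Za] unfolding zu by blast
 qed
 have inj: "sE Fi r j n T x 0"
  if s: "sE Fi r j n T x t" and s': "rcomp (\<sigma>c Z \<rho> n) (sqr D) T x 0" for T x t
 proof -
  have x: "fZ Fi (int r) j n T x" using s E(2) by blast
  note hx = fZ_hom[OF F x]
  obtain q where q: "\<sigma>c Z \<rho> n T x q" "sqr D T q 0" using s' unfolding rcomp_def[of "\<sigma>c Z \<rho> n"] by blast
  obtain T1 e1 k where e1: "cov e1 T1 T" "hom k T1 (qH V n)" "q ** e1 = \<beta> ** k" using q(2) unfolding DS(3) by blast
  obtain T2 e2 v where e2: "cov e2 T2 T1" "\<sigma>c V \<rho>V n T2 v (k ** e2)" using pres_surj[OF HV(2) e1(2)] by blast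
  note h1 = cov_hom[OF e1(1)] and h2 = cov_hom[OF e2(1)]
  have "q ** (e1 ** e2) = \<beta> ** (k ** e2)"
   using assoc[OF h2 h1 pres_hom2[OF HT(2) q(1)]] e1(3) assoc[OF h2 e1(2) \<beta>(1)] by simp
  hence xv: "\<sigma>c Z \<rho> n T2 (x ** (e1 ** e2) - v) 0"
   using pres_diff[OF HT(2) pres_restr[OF HT(2) q(1) hom_comp[OF h2 h1]] \<beta>(2)[OF e2(2)]] by simp
  have T2: "T2 : obj A" using hom_dom[OF h2] .
  \<comment> \<open>\<open>TP_cycle\<close> corrects the element from \<open>V\<close> to one in
    Z_(r-1) of stage j - 1, which is divided out in E_r. For \<open>r = 1\<close> there is nothing
    to correct, because \<open>V\<close> is zero.\<close>
  have "EX T' e y. cov e T' T2 & W (j - int r) n T' y & fZ Fi (int r - 1) (j - 1) n T' (v ** e - y)"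
  proof (cases "j - int r < j - 1")
   case True
   hence "fG Fi (j - 1) n T2 v" "Kfil Fi W (j - int r) (n + 1) T2 (Md Fi n ** v)" using HV(3) e2(2) by blast+
   from TP_cycle[OF w True this] show ?thesis unfolding fZ_def by auto
  next
   case False
   hence "v = 0" using HV(5) e2(2) by blast
   hence "v ** idt A T2 - 0 = 0" using zero_comp[OF hom_id[OF T2] cpx_ob[OF C]] by simp
   thus ?thesis using cov_id[OF T2] W_zero[OF w T2] fZ_zero[OF F T2] by metis
  qed
  then obtain T3 e3 y where e3: "cov e3 T3 T2" and y: "W (j - int r) n T3 y" and vy: "fZ Fi (int r - 1) (j - 1) n T3 (v ** e3 - y)" by blast
  note h3 = cov_hom[OF e3]
  let ?e = "e1 ** e2 ** e3"
  have ce: "cov ?e T3 T" using cov_comp[OF cov_comp[OF e1(1) e2(1)] e3] .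
  have hv: "hom v T2 (Mo Fi n)" using pres_hom1[OF HV(2) e2(2)] .
  note xe = fZ_restr[OF F x cov_hom[OF ce]]
  have "\<sigma>c Z \<rho> n T3 ((x ** (e1 ** e2) - v) ** e3 + y) 0"
   using pres_add[OF HT(2) pres_restr[OF HT(2) xv h3] TW[OF y]] zero_comp[OF h3 pres_ob2[OF HT(2)]] by simp
  moreover have "(x ** (e1 ** e2) - v) ** e3 + y = x ** ?e - (v ** e3 - y)"
   using diff_comp[OF h3 hom_comp[OF hom_comp[OF h2 h1] hx] hv] assoc[OF h3 hom_comp[OF h2 h1] hx] by simp
  moreover have "fZ Fi (int r) j n T3 (x ** ?e - (v ** e3 - y))" using fZ_diff[OF F xe fZ_mono[OF F _ _ vy]] by simp
  ultimately have "fB Fi (int r) j n T3 (x ** ?e - (v ** e3 - y))" using KB by simp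
  hence "sE Fi r j n T3 (x ** ?e - (v ** e3 - y) + (v ** e3 - y)) (0 + 0)"
   using pres_add[OF P] fBI_y[OF F vy] unfolding E(3)[symmetric] by blast
  hence "sE Fi r j n T3 (x ** ?e) 0" by simp
  thus ?thesis using pres_zero_loc[OF P hx ce] by blast
 qed
 have surj: "EX T' e y s. cov e T' T & sE Fi r j n T' y s & rcomp (\<sigma>c Z \<rho> n) (sqr D) T' (y - x ** e) 0"
  if s: "rcomp (\<sigma>c Z \<rho> n) (sqr D) T x t" for T x t
 proof -
  obtain q where q: "\<sigma>c Z \<rho> n T x q" "sqr D T q t" using s unfolding rcomp_def[of "\<sigma>c Z \<rho> n"] by blast
  obtain T1 e1 k where e1: "cov e1 T1 T" "hom k T1 (qH U n)" "q ** e1 = \<alpha> ** k" using q(2) DS(2) by blast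
  obtain T2 e2 u where e2: "cov e2 T2 T1" "\<sigma>c U \<rho>U n T2 u (k ** e2)" using pres_surj[OF HU(2) e1(2)] by blast
  note h1 = cov_hom[OF e1(1)] and h2 = cov_hom[OF e2(1)] and hx = pres_hom1[OF HT(2) q(1)]
  have "q ** (e1 ** e2) = \<alpha> ** (k ** e2)"
   using assoc[OF h2 h1 pres_hom2[OF HT(2) q(1)]] e1(3) assoc[OF h2 e1(2) \<alpha>(1)] by simp
  hence ux: "\<sigma>c Z \<rho> n T2 (u - x ** (e1 ** e2)) 0"
   using pres_diff[OF HT(2) \<alpha>(2)[OF e2(2)] pres_restr[OF HT(2) q(1) hom_comp[OF h2 h1]]] by simp
  have u: "fG Fi j n T2 u" and K: "Kfil Fi W (j - int r) (n + 1) T2 (Md Fi n ** u)" using e2(2) U3 by blast+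
  obtain T3 e3 y where e3: "cov e3 T3 T2" "W (j - int r) n T3 y" "fG Fi j n T3 (u ** e3 - y)" "fG Fi j n T3 y"
   "fG Fi (j - int r) (n + 1) T3 (Md Fi n ** (u ** e3 - y))" using TP_cycle[OF w cbU u K] by blast
  note h3 = cov_hom[OF e3(1)]
  have "fZ Fi (int r) j n T3 (u ** e3 - y)" unfolding fZ_def using e3(3,5) by blast
  then obtain s where s: "sE Fi r j n T3 (u ** e3 - y) s" using E(2) by blast
  have T3: "T3 : obj A" using hom_dom[OF h3] .
  have "\<sigma>c Z \<rho> n T3 ((u - x ** (e1 ** e2)) ** e3) 0"
   using pres_restr[OF HT(2) ux h3] zero_comp[OF h3 pres_ob2[OF HT(2)]] by simp
  from pres_diff[OF HT(2) this TW[OF e3(2)]]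
  have "\<sigma>c Z \<rho> n T3 ((u - x ** (e1 ** e2)) ** e3 - y) 0" by simp
  moreover have "(u - x ** (e1 ** e2)) ** e3 - y = u ** e3 - y - x ** (e1 ** e2 ** e3)"
   using diff_comp[OF h3 fG_hom[OF F u] hom_comp[OF hom_comp[OF h2 h1] hx]] assoc[OF h3 hom_comp[OF h2 h1] hx]
   by (simp add: algebra_simps)
  ultimately have "rcomp (\<sigma>c Z \<rho> n) (sqr D) T3 (u ** e3 - y - x ** (e1 ** e2 ** e3)) 0" using kerT by simp
  thus ?thesis using cov_comp[OF cov_comp[OF e1(1) e2(1)] e3(1)] s by blast
 qed
 show ?thesis by (rule pres_iso_ex[OF P PD]) (fact dom ker inj surj)+
qed

end

section \<open>Total complexes of twisted complexes\<close>

definition neg_dg :: "('p, 'm::ab_group_add) dgcat => bool" where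
 "neg_dg C \<longleftrightarrow> (ALL i>0. ALL P:dobj C. ALL Q:dobj C. dhom C i P Q = {0})"

text \<open>\<open>S\<close> is a finite set of indices outside which the objects of the twisted complex \<open>X\<close> over \<open>C/I\<close> vanish.\<close>

definition twok :: "('p, 'm::ab_group_add) dgcat => ('p, 'm) dgideal => int set => ('p, 'm) tw => bool" where
 "twok C I S X \<longleftrightarrow> X : tw_obj C I & finite S & tw_supp C I X \<subseteq> S"

lemma dg_catD:
 assumes "dg_category C"
 shows dg_subgrp: "P : dobj C ==> Q : dobj C ==> subgrp (dhom C i P Q)"
  and dg_diff: "P : dobj C ==> Q : dobj C ==> f : dhom C i P Q ==> ddiff C i P Q f : dhom C (i + 1) P Q"
  and dg_did: "P : dobj C ==> did C P : dhom C 0 P P"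
  and dg_comp: "P : dobj C ==> Q : dobj C ==> R : dobj C ==> f : dhom C i P Q ==> g : dhom C j Q R ==>
   dcmp C P Q R i j g f : dhom C (i + j) P R"
 using assms unfolding dg_category_def by blast+

context abcat begin

text \<open>\<open>F\<close> is a functor on the quotient of \<open>C\<close> by \<open>I\<close>.
  For zero \<open>I\<close> this is any functor on \<open>C\<close>; for \<open>trunc_ideal\<close>
  it gives sense to total complexes of twisted complexes whose Maurer-Cartan equation holds only
  modulo \<open>I\<close>.\<close>

definition kills :: "('p, 'm::ab_group_add) dgcat => ('p, 'm) dgideal => ('p, 'm, 'o, 'a) cfun => bool" where
 "kills C I F \<longleftrightarrow> contra_dg_functor C A F &
   (ALL i n. ALL P:dobj C. ALL Q:dobj C. ALL f:dhom C i P Q. f : I i P Q --> fmor F i P Q f n = 0)"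

text \<open>The \<open>SOME\<close> term of \<open>tot_sum\<close> with the index set as a
  parameter, so that \<open>tot_ttot\<close> is an identity of terms. Modulo an ideal the support
  can become smaller than the set over which the sums are formed.\<close>

definition tS :: "('p, 'm::ab_group_add, 'o, 'a) cfun => int set => ('p, 'm) tw => int => 'o \<times> (int => 'a) \<times> (int => 'a)" where
 "tS F S X n = (SOME s. is_biproduct A S (\<lambda>i. Fo F (fst X i) (n + i)) s)"

abbreviation (input) "tI F S X n \<equiv> fst (snd (tS F S X n))"
abbreviation (input) "tP F S X n \<equiv> snd (snd (tS F S X n))"

definition ttot :: "('p, 'm::ab_group_add, 'o, 'a) cfun => int set => ('p, 'm) tw => ('o, 'a) cpx" where
 "ttot F S X = \<lparr>cob = (\<lambda>n. fst (tS F S X n)),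
   cdf = (\<lambda>n. \<Sum>i\<in>S. \<Sum>j\<in>S. tI F S X (n + 1) i **
     (ksgn i ((if i = j then Fd F (fst X i) (n + i) else 0) -
      fmor F (i - j + 1) (fst X i) (fst X j) (snd X i j) (n + j)) ** tP F S X n j))\<rparr>"

definition tmap :: "('p, 'm::ab_group_add, 'o, 'a) cfun => int set => int set => ('p, 'm) tw => ('p, 'm) tw =>
  (int => int => 'm) => int => 'a" where
 "tmap F S S' X X' f n = (\<Sum>i\<in>S. \<Sum>j\<in>S'. tI F S X n i **
   (fmor F (i - j) (fst X i) (fst X' j) (f i j) (n + j) ** tP F S' X' n j))"

text \<open>Components of degree \<open>L\<close> with the sign (-1)^(i L). The case
  \<open>L = 0\<close> gives the maps of total complexes and \<open>L = -1\<close> their homotopies,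
  so one computation serves both.\<close>

definition tmL :: "int => ('p, 'm::ab_group_add, 'o, 'a) cfun => int set => int set => ('p, 'm) tw => ('p, 'm) tw =>
  (int => int => 'm) => int => 'a" where
 "tmL L F S S' X X' f n = (\<Sum>i\<in>S. \<Sum>j\<in>S'. tI F S X (n + L) i **
   (ksgn (i * L) (fmor F (L + i - j) (fst X i) (fst X' j) (f i j) (n + j)) ** tP F S' X' n j))"

lemma tmap_tmL: "tmap F S S' X X' f n = tmL 0 F S S' X X' f n"
 unfolding tmap_def tmL_def by (simp add: ksgn_even)

definition tnat :: "('p, 'm::ab_group_add, 'o, 'a) cfun => ('p, 'm, 'o, 'a) cfun => ('p => int => 'a) => int set =>
  ('p, 'm) tw => int => 'a" where
 "tnat F F' \<eta> S X n = (\<Sum>i\<in>S. tI F' S X n i ** (\<eta> (fst X i) (n + i) ** tP F S X n i))"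

lemma sum_ksgn_comp:
 assumes x: "hom x T Y" and Z: "Z : obj A" and g: "\<And>i. hom (g i) Y Z"
 shows "(\<Sum>i\<in>L. ksgn (k i) (g i)) ** x = (\<Sum>i\<in>L. ksgn (k i) (g i ** x))"
proof -
 have "(\<Sum>i\<in>L. ksgn (k i) (g i)) ** x = (\<Sum>i\<in>L. ksgn (k i) (g i) ** x)"
  by (rule sum_comp[OF x Z hom_ksgn[OF g]])
 thus ?thesis using ksgn_comp[OF x g] by simp
qed

lemma tot_ttot: "tot A C F X = ttot F (supp0 C X) X"
 unfolding tot_def ttot_def tS_def tot_sum_def ..

lemma tot_map_tmap: "tot_map A C F X X' f = tmap F (supp0 C X) (supp0 C X') X X' f"
 unfolding tot_map_def tmap_def tS_def tot_sum_def by (rule ext) (rule refl)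

lemma tot_nat_tnat: "tot_nat A C F F' \<eta> X = tnat F F' \<eta> (supp0 C X) X"
 unfolding tot_nat_def tnat_def tS_def tot_sum_def by (rule ext) (rule refl)

lemma killsD:
 assumes "kills C I F"
 shows kills_fun: "contra_dg_functor C A F" and kills_cat: "dg_category C"
  and kills_0: "P : dobj C ==> Q : dobj C ==> f : dhom C i P Q ==> f : I i P Q ==> fmor F i P Q f n = 0"
 using assms unfolding kills_def contra_dg_functor_def by blast+

context
 fixes C :: "('p, 'm::ab_group_add) dgcat" and F :: "('p, 'm, 'o, 'a) cfun"
 assumes cf: "contra_dg_functor C A F"
begin

lemma cf_cat: "dg_category C" and cf_cpx: "P : dobj C ==> is_complex A (fob F P)"
 and cf_id: "P : dobj C ==> fmor F 0 P P (did C P) n = idt A (Fo F P n)"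
 using cf unfolding contra_dg_functor_def by blast+

context
 fixes P Q
 assumes PQ: "P : dobj C" "Q : dobj C"
begin

lemma cf_hom:
 assumes "f : dhom C i P Q"
 shows "hom (fmor F i P Q f n) (Fo F Q n) (Fo F P (n + i))"
proof -
 have "fmor F i P Q f : cpx_hom A i (fob F Q) (fob F P)" using cf PQ assms unfolding contra_dg_functor_def by blast
 thus ?thesis unfolding cpx_hom_def hom_def using cpx_ob[OF cf_cpx] PQ by blast
qed

lemma cf_add:
 assumes "f : dhom C i P Q" "g : dhom C i P Q"
 shows "fmor F i P Q (f + g) n = fmor F i P Q f n + fmor F i P Q g n"
 using cf PQ assms unfolding contra_dg_functor_def by blast

lemma cf_diff:
 assumes f: "f : dhom C i P Q"
 shows "fmor F (i + 1) P Q (ddiff C i P Q f) n =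
  Fd F P (n + i) ** fmor F i P Q f n - ksgn i (fmor F i P Q f (n + 1) ** Fd F Q n)"
proof -
 have "ALL n. fmor F (i + 1) P Q (ddiff C i P Q f) n = cpx_diff A i (fob F Q) (fob F P) (fmor F i P Q f) n"
  using cf PQ f unfolding contra_dg_functor_def by blast
 thus ?thesis unfolding cpx_diff_def by blast
qed

lemma cf_cmp:
 assumes "R : dobj C" "f : dhom C i P Q" "g : dhom C j Q R"
 shows "fmor F (i + j) P R (dcmp C P Q R i j g f) n = fmor F i P Q f (n + j) ** fmor F j Q R g n"
proof -
 have "ALL j. ALL R:dobj C. ALL g:dhom C j Q R. ALL n. fmor F (i + j) P R (dcmp C P Q R i j g f) n =
      cmp A (fmor F i P Q f (n + j)) (fmor F j Q R g n)"
  using cf PQ assms(2) unfolding contra_dg_functor_def by blast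
 thus ?thesis using assms by blast
qed

lemma cf_zero: "fmor F i P Q 0 n = 0"
 using cf_add[of 0 i 0 n] subgrp_zero[OF dg_subgrp[OF cf_cat PQ]] by simp

lemma cf_minus:
 assumes f: "f : dhom C i P Q"
 shows "fmor F i P Q (- f) n = - fmor F i P Q f n"
 using cf_add[OF f subgrp_minus[OF dg_subgrp[OF cf_cat PQ] f], of n] cf_zero[of i n] by (simp add: eq_neg_iff_add_eq_0 add.commute)

lemma cf_minus': "f : dhom C i P Q ==> g : dhom C i P Q ==> fmor F i P Q (f - g) n = fmor F i P Q f n - fmor F i P Q g n"
 using cf_add[of f i "- g" n] cf_minus[of g i n] subgrp_minus[OF dg_subgrp[OF cf_cat PQ], of g] by simp

lemma cf_ksgn: "f : dhom C i P Q ==> fmor F i P Q (ksgn k f) n = ksgn k (fmor F i P Q f n)"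
 by (simp add: ksgn_def cf_minus)

lemma cf_sum: "(\<And>l. l : L ==> f l : dhom C i P Q) ==> fmor F i P Q (sum f L) n = (\<Sum>l\<in>L. fmor F i P Q (f l) n)"
proof (induction L rule: infinite_finite_induct)
 case (insert l L)
 thus ?case using cf_add[of "f l" i "sum f L" n] subgrp_sum[OF dg_subgrp[OF cf_cat PQ], of L f] by simp
qed (simp_all add: cf_zero)

end

end

context
 fixes C :: "('p, 'm::ab_group_add) dgcat" and F :: "('p, 'm, 'o, 'a) cfun" and I
 assumes kF: "kills C I F"
begin

lemmas kF_f = kills_fun[OF kF]
lemmas kF_c = kills_cat[OF kF]

abbreviation (input) "Yo X i n \<equiv> Fo F (fst X i) (n + i)"

definition dd :: "('p, 'm) tw => int => int => 'a" where
 "dd X i n = Fd F (fst X i) (n + i)"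

definition qq :: "('p, 'm) tw => int => int => int => 'a" where
 "qq X i j n = fmor F (i - j + 1) (fst X i) (fst X j) (snd X i j) (n + j)"

definition ff :: "('p, 'm) tw => ('p, 'm) tw => (int => int => 'm) => int => int => int => 'a" where
 "ff X X' f i j n = fmor F (i - j) (fst X i) (fst X' j) (f i j) (n + j)"

definition fL :: "int => ('p, 'm) tw => ('p, 'm) tw => (int => int => 'm) => int => int => int => 'a" where
 "fL L X X' f i j n = fmor F (L + i - j) (fst X i) (fst X' j) (f i j) (n + j)"

lemma ff_fL: "ff X X' f i j n = fL 0 X X' f i j n"
 unfolding ff_def fL_def by simp

lemma twok_simps:
 assumes "twok C I S X"
 shows "finite S" "fst X i : dobj C" "snd X i j : dhom C (i - j + 1) (fst X i) (fst X j)"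
 using assms unfolding twok_def tw_obj_def by blast+

lemma twok_outside:
 assumes X: "twok C I S X" and i: "i \<notin> tw_supp C I X"
 shows "idt A (Fo F (fst X i) n) = 0"
proof -
 have "did C (fst X i) : I 0 (fst X i) (fst X i)" using i unfolding tw_supp_def by simp
 hence "fmor F 0 (fst X i) (fst X i) (did C (fst X i)) n = 0"
  using kills_0[OF kF] dg_did[OF kF_c] twok_simps(2)[OF X] by blast
 thus ?thesis using cf_id[OF kF_f twok_simps(2)[OF X]] by simp
qed

text \<open>The index sets differ by objects that \<open>F\<close> sends to zero. Sums in
  \<open>tw_obj\<close> and \<open>tw_diff\<close> run over the support modulo \<open>I\<close>,
  those in \<open>ttot\<close> over \<open>S\<close>.\<close>

lemma twok_sum:
 assumes X: "twok C I S X" and a: "\<And>l. hom (a l) Z (Fo F (fst X l) (n l))" and b: "\<And>l. hom (b l) (Fo F (fst X l) (n l)) Z'"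
 shows "(\<Sum>l\<in>tw_supp C I X. ksgn (k l) (b l ** a l)) = (\<Sum>l\<in>S. ksgn (k l) (b l ** a l))"
proof (rule sum.mono_neutral_left)
 show "finite S" "tw_supp C I X \<subseteq> S" using X unfolding twok_def by blast+
 show "ALL l:S - tw_supp C I X. ksgn (k l) (b l ** a l) = 0"
 proof
  fix l assume "l : S - tw_supp C I X"
  hence "idt A (Fo F (fst X l) (n l)) = 0" using twok_outside[OF X] by blast
  hence "a l = 0" using hom_to_zero[OF a] by blast
  thus "ksgn (k l) (b l ** a l) = 0" using comp_zero[OF hom_dom[OF a] b] by simp
 qed
qed

lemma tS_bip:
 assumes X: "twok C I S X"
 shows "bip S (\<lambda>i. Yo X i n) (tS F S X n)"
proof -
 have ob: "\<And>i. i : S ==> Yo X i n : obj A" using cpx_ob[OF cf_cpx[OF kF_f twok_simps(2)[OF X]]] by blast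
 obtain s where "bip S (\<lambda>i. Yo X i n) s" using bip_ex[of S "\<lambda>i. Yo X i n"] ob twok_simps(1)[OF X] by blast
 hence "is_biproduct A S (\<lambda>i. Yo X i n) s" unfolding bip_def by blast
 hence "is_biproduct A S (\<lambda>i. Yo X i n) (tS F S X n)" unfolding tS_def by (rule someI)
 thus ?thesis unfolding bip_def using twok_simps(1)[OF X] ob by blast
qed

lemma cob_ttot: "cob (ttot F S X) n = fst (tS F S X n)"
 by (simp add: ttot_def)

lemma tP_hom: "twok C I S X ==> i : S ==> hom (tP F S X n i) (cob (ttot F S X) n) (Yo X i n)"
 unfolding cob_ttot using bip_pr[OF tS_bip] .

lemma tI_hom: "twok C I S X ==> i : S ==> hom (tI F S X n i) (Yo X i n) (cob (ttot F S X) n)"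
 unfolding cob_ttot using bip_in[OF tS_bip] .

lemma ttot_ext:
 "twok C I S X ==> hom x T (cob (ttot F S X) n) ==> hom y T (cob (ttot F S X) n) ==>
  (\<And>i. i : S ==> tP F S X n i ** x = tP F S X n i ** y) ==> x = y"
 unfolding cob_ttot using bip_ext[OF tS_bip] by blast

lemma dd_hom: "twok C I S X ==> hom (dd X i n) (Yo X i n) (Yo X i (n + 1))"
 unfolding dd_def using cpx_hom_d[OF cf_cpx[OF kF_f twok_simps(2)], of S X i "n + i"] by (simp add: algebra_simps)

lemma dd_dd:
 assumes X: "twok C I S X" and x: "hom x T (Yo X i n)"
 shows "dd X i (n + 1) ** (dd X i n ** x) = 0"
proof -
 have e: "n + 1 + i = n + i + 1" by simp
 show ?thesis unfolding dd_def e using cpx_ddx[OF cf_cpx[OF kF_f twok_simps(2)[OF X]] x] .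
qed

lemma qq_hom:
 assumes X: "twok C I S X"
 shows "hom (qq X i j n) (Yo X j n) (Yo X i (n + 1))"
proof -
 have e: "n + j + (i - j + 1) = n + 1 + i" by simp
 show ?thesis unfolding qq_def
  using cf_hom[OF kF_f twok_simps(2)[OF X] twok_simps(2)[OF X] twok_simps(3)[OF X], of i j "n + j"] unfolding e .
qed

lemma fL_hom:
 assumes X: "twok C I S X" and X': "twok C I S' X'" and f: "f : tw_hom C L X X'"
 shows "hom (fL L X X' f i j n) (Yo X' j n) (Yo X i (n + L))"
proof -
 have "f i j : dhom C (L + i - j) (fst X i) (fst X' j)" using f unfolding tw_hom_def by simp
 moreover have e: "n + j + (L + i - j) = n + L + i" by simp
 ultimately show ?thesis unfolding fL_def
  using cf_hom[OF kF_f twok_simps(2)[OF X] twok_simps(2)[OF X'], of "f i j" "L + i - j" i j "n + j"] unfolding e by blast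
qed

lemma ff_hom:
 assumes X: "twok C I S X" and X': "twok C I S' X'" and f: "f : tw_hom C 0 X X'"
 shows "hom (ff X X' f i j n) (Yo X' j n) (Yo X i n)"
 unfolding ff_fL using fL_hom[OF X X' f, of i j n] by simp

lemma ttot_entry:
 assumes X: "twok C I S X"
 shows "hom (ksgn i ((if i = j then Fd F (fst X i) (n + i) else 0) -
      fmor F (i - j + 1) (fst X i) (fst X j) (snd X i j) (n + j))) (Yo X j n) (Yo X i (n + 1))"
proof (rule hom_ksgn, rule hom_diff)
 show "hom (if i = j then Fd F (fst X i) (n + i) else 0) (Yo X j n) (Yo X i (n + 1))"
  using dd_hom[OF X, of j n] hom_zero[OF hom_dom[OF dd_hom[OF X, of j n]] hom_cod[OF dd_hom[OF X, of i n]]]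
  unfolding dd_def by simp
 show "hom (fmor F (i - j + 1) (fst X i) (fst X j) (snd X i j) (n + j)) (Yo X j n) (Yo X i (n + 1))"
  using qq_hom[OF X] unfolding qq_def .
qed

lemma ttot_d:
 assumes X: "twok C I S X"
 shows "hom (cdf (ttot F S X) n) (cob (ttot F S X) n) (cob (ttot F S X) (n + 1))"
  and "hom x T (cob (ttot F S X) n) ==> i : S ==> tP F S X (n + 1) i ** (cdf (ttot F S X) n ** x) =
   ksgn i (dd X i n ** (tP F S X n i ** x) - (\<Sum>j\<in>S. qq X i j n ** (tP F S X n j ** x)))"
proof -
 note m = bip_matrix[OF tS_bip[OF X] tS_bip[OF X] ttot_entry[OF X]]
 have cdf: "cdf (ttot F S X) n = (\<Sum>i\<in>S. \<Sum>j\<in>S. tI F S X (n + 1) i **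
     (ksgn i ((if i = j then Fd F (fst X i) (n + i) else 0) -
      fmor F (i - j + 1) (fst X i) (fst X j) (snd X i j) (n + j)) ** tP F S X n j))" unfolding ttot_def by simp
 show "hom (cdf (ttot F S X) n) (cob (ttot F S X) n) (cob (ttot F S X) (n + 1))"
  unfolding cdf cob_ttot by (rule m(1))
 assume x: "hom x T (cob (ttot F S X) n)" and i: "i : S"
 have px: "hom (tP F S X n j ** x) T (Yo X j n)" if "j : S" for j using hom_comp[OF x tP_hom[OF X that]] .
 have "tP F S X (n + 1) i ** (cdf (ttot F S X) n ** x) = (\<Sum>j\<in>S. ksgn i ((if i = j then Fd F (fst X i) (n + i) else 0) -
      fmor F (i - j + 1) (fst X i) (fst X j) (snd X i j) (n + j)) ** (tP F S X n j ** x))"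
  unfolding cdf by (rule m(2)[OF x[unfolded cob_ttot] i])
 also have "\<dots> = (\<Sum>j\<in>S. ksgn i ((if i = j then dd X i n ** (tP F S X n i ** x) else 0) - qq X i j n ** (tP F S X n j ** x)))"
 proof (rule sum.cong[OF refl])
  fix j assume j: "j : S"
  let ?a = "if i = j then Fd F (fst X i) (n + i) else 0"
  have a: "hom ?a (Yo X j n) (Yo X i (n + 1))"
   using dd_hom[OF X, of j n] hom_zero[OF hom_dom[OF dd_hom[OF X, of j n]] hom_cod[OF dd_hom[OF X, of i n]]]
   unfolding dd_def by simp
  have "ksgn i (?a - fmor F (i - j + 1) (fst X i) (fst X j) (snd X i j) (n + j)) ** (tP F S X n j ** x) =
   ksgn i (?a ** (tP F S X n j ** x) - qq X i j n ** (tP F S X n j ** x))"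
   using ksgn_comp[OF px[OF j] hom_diff[OF a qq_hom[OF X]]] diff_comp[OF px[OF j] a qq_hom[OF X]] unfolding qq_def by simp
  moreover have "?a ** (tP F S X n j ** x) = (if i = j then dd X i n ** (tP F S X n i ** x) else 0)"
   using zero_comp[OF px[OF j] hom_cod[OF a]] unfolding dd_def by simp
  ultimately show "ksgn i (?a - fmor F (i - j + 1) (fst X i) (fst X j) (snd X i j) (n + j)) ** (tP F S X n j ** x) =
   ksgn i ((if i = j then dd X i n ** (tP F S X n i ** x) else 0) - qq X i j n ** (tP F S X n j ** x))" by simp
 qed
 also have "\<dots> = ksgn i (dd X i n ** (tP F S X n i ** x) - (\<Sum>j\<in>S. qq X i j n ** (tP F S X n j ** x)))"
  unfolding ksgn_sum[symmetric] sum_subtractf using i twok_simps(1)[OF X] by simp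
 finally show "tP F S X (n + 1) i ** (cdf (ttot F S X) n ** x) =
   ksgn i (dd X i n ** (tP F S X n i ** x) - (\<Sum>j\<in>S. qq X i j n ** (tP F S X n j ** x)))" .
qed

lemma tmL_spec:
 assumes X: "twok C I S X" and X': "twok C I S' X'" and f: "f : tw_hom C L X X'"
 shows "hom (tmL L F S S' X X' f n) (cob (ttot F S' X') n) (cob (ttot F S X) (n + L))"
  and "hom x T (cob (ttot F S' X') n) ==> i : S ==> tP F S X (n + L) i ** (tmL L F S S' X X' f n ** x) =
   ksgn (i * L) (\<Sum>j\<in>S'. fL L X X' f i j n ** (tP F S' X' n j ** x))"
proof -
 note h = fL_hom[OF X X' f]
 have hk: "hom (ksgn (i * L) (fL L X X' f i j n)) (Yo X' j n) (Yo X i (n + L))" for i j by (rule hom_ksgn[OF h])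
 note m = bip_matrix[OF tS_bip[OF X] tS_bip[OF X'] hk]
 show "hom (tmL L F S S' X X' f n) (cob (ttot F S' X') n) (cob (ttot F S X) (n + L))"
  unfolding tmL_def fL_def[symmetric] cob_ttot by (rule m(1))
 assume x: "hom x T (cob (ttot F S' X') n)" and i: "i : S"
 have "tP F S X (n + L) i ** (tmL L F S S' X X' f n ** x) = (\<Sum>j\<in>S'. ksgn (i * L) (fL L X X' f i j n) ** (tP F S' X' n j ** x))"
  unfolding tmL_def fL_def[symmetric] by (rule m(2)[OF x[unfolded cob_ttot] i])
 also have "\<dots> = (\<Sum>j\<in>S'. ksgn (i * L) (fL L X X' f i j n ** (tP F S' X' n j ** x)))"
  by (rule sum.cong[OF refl]) (use ksgn_comp[OF hom_comp[OF x tP_hom[OF X']] h] in simp)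
 finally show "tP F S X (n + L) i ** (tmL L F S S' X X' f n ** x) =
   ksgn (i * L) (\<Sum>j\<in>S'. fL L X X' f i j n ** (tP F S' X' n j ** x))" unfolding ksgn_sum .
qed

lemma tmap_spec:
 assumes X: "twok C I S X" and X': "twok C I S' X'" and f: "f : tw_hom C 0 X X'"
 shows "hom (tmap F S S' X X' f n) (cob (ttot F S' X') n) (cob (ttot F S X) n)"
  and "hom x T (cob (ttot F S' X') n) ==> i : S ==> tP F S X n i ** (tmap F S S' X X' f n ** x) =
   (\<Sum>j\<in>S'. ff X X' f i j n ** (tP F S' X' n j ** x))"
 unfolding tmap_tmL ff_fL using tmL_spec[OF X X' f, where n = n] by (simp_all add: ksgn_even)

text \<open>\<open>F\<close> applied to the Maurer-Cartan expression of \<open>X\<close>, which lies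
  in \<open>I\<close> and is therefore killed. The order of the factors is reversed because
  \<open>F\<close> is contravariant.\<close>

lemma qq_MC:
 assumes X: "twok C I S X" and x: "hom x T (Yo X k n)"
 shows "dd X i (n + 1) ** (qq X i k n ** x) - ksgn (i - k + 1) (qq X i k (n + 1) ** (dd X k n ** x)) +
  (\<Sum>l\<in>S. ksgn (i - l + 1) (qq X i l (n + 1) ** (qq X l k n ** x))) = 0"
proof -
 note o = twok_simps(2)[OF X] and s = twok_simps(3)[OF X]
 let ?c = "\<lambda>l. dcmp C (fst X i) (fst X l) (fst X k) (i - l + 1) (l - k + 1) (snd X l k) (snd X i l)"
 have mc: "ddiff C (i - k + 1) (fst X i) (fst X k) (snd X i k) + (\<Sum>l\<in>tw_supp C I X. ksgn (i - l + 1) (?c l))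
  : I (i - k + 2) (fst X i) (fst X k)"
  using X unfolding twok_def tw_obj_def by blast
 have e2: "i - k + 1 + 1 = i - k + 2" by simp
 have d: "ddiff C (i - k + 1) (fst X i) (fst X k) (snd X i k) : dhom C (i - k + 2) (fst X i) (fst X k)"
  using dg_diff[OF kF_c o o s, of i k] unfolding e2 .
 have e3: "i - l + 1 + (l - k + 1) = i - k + 2" for l by simp
 have c: "?c l : dhom C (i - k + 2) (fst X i) (fst X k)" for l
  using dg_comp[OF kF_c o o o s s, of i l k] unfolding e3 .
 have sg: "subgrp (dhom C (i - k + 2) (fst X i) (fst X k))" using dg_subgrp[OF kF_c o o] .
 have ks: "ksgn (i - l + 1) (?c l) : dhom C (i - k + 2) (fst X i) (fst X k)" for l using subgrp_ksgn[OF sg c] .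
 have "fmor F (i - k + 2) (fst X i) (fst X k) (\<Sum>l\<in>tw_supp C I X. ksgn (i - l + 1) (?c l)) (n + k) =
  (\<Sum>l\<in>tw_supp C I X. fmor F (i - k + 2) (fst X i) (fst X k) (ksgn (i - l + 1) (?c l)) (n + k))"
  by (rule cf_sum[OF kF_f o o]) (rule ks)
 also have "\<dots> = (\<Sum>l\<in>tw_supp C I X. ksgn (i - l + 1) (fmor F (i - k + 2) (fst X i) (fst X k) (?c l) (n + k)))"
  by (rule sum.cong[OF refl]) (rule cf_ksgn[OF kF_f o o c])
 finally have sm: "fmor F (i - k + 2) (fst X i) (fst X k) (\<Sum>l\<in>tw_supp C I X. ksgn (i - l + 1) (?c l)) (n + k) =
  (\<Sum>l\<in>tw_supp C I X. ksgn (i - l + 1) (fmor F (i - k + 2) (fst X i) (fst X k) (?c l) (n + k)))" .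
 have "fmor F (i - k + 2) (fst X i) (fst X k) (ddiff C (i - k + 1) (fst X i) (fst X k) (snd X i k) +
  (\<Sum>l\<in>tw_supp C I X. ksgn (i - l + 1) (?c l))) (n + k) = 0"
  using kills_0[OF kF o o subgrp_add[OF sg d subgrp_sum[OF sg ks]] mc] .
 hence "fmor F (i - k + 2) (fst X i) (fst X k) (ddiff C (i - k + 1) (fst X i) (fst X k) (snd X i k)) (n + k) +
  (\<Sum>l\<in>tw_supp C I X. ksgn (i - l + 1) (fmor F (i - k + 2) (fst X i) (fst X k) (?c l) (n + k))) = 0"
  using cf_add[OF kF_f o o d subgrp_sum[OF sg ks, of "\<lambda>l. l" "tw_supp C I X"], of "n + k"] sm by simp
 moreover have "fmor F (i - k + 2) (fst X i) (fst X k) (ddiff C (i - k + 1) (fst X i) (fst X k) (snd X i k)) (n + k) =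
  dd X i (n + 1) ** qq X i k n - ksgn (i - k + 1) (qq X i k (n + 1) ** dd X k n)"
 proof -
  have e: "n + k + (i - k + 1) = n + 1 + i" "n + k + 1 = n + 1 + k" by auto
  show ?thesis using cf_diff[OF kF_f o o s, of i k "n + k"] unfolding e2 dd_def qq_def e .
 qed
 moreover have "fmor F (i - k + 2) (fst X i) (fst X k) (?c l) (n + k) = qq X i l (n + 1) ** qq X l k n" for l
 proof -
  have e: "n + k + (l - k + 1) = n + 1 + l" by simp
  show ?thesis using cf_cmp[OF kF_f o o o s s, of i l k "n + k"] unfolding e3 qq_def e .
 qed
 moreover have "(\<Sum>l\<in>tw_supp C I X. ksgn (i - l + 1) (qq X i l (n + 1) ** qq X l k n)) =
   (\<Sum>l\<in>S. ksgn (i - l + 1) (qq X i l (n + 1) ** qq X l k n))"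
  by (rule twok_sum[OF X qq_hom[OF X] qq_hom[OF X]])
 ultimately have eq: "dd X i (n + 1) ** qq X i k n - ksgn (i - k + 1) (qq X i k (n + 1) ** dd X k n) +
  (\<Sum>l\<in>S. ksgn (i - l + 1) (qq X i l (n + 1) ** qq X l k n)) = 0" by simp
 note hd = dd_hom[OF X] and hq = qq_hom[OF X]
 have h1: "hom (dd X i (n + 1) ** qq X i k n) (Yo X k n) (Yo X i (n + 1 + 1))" using hom_comp[OF hq hd] .
 have h2: "hom (qq X i k (n + 1) ** dd X k n) (Yo X k n) (Yo X i (n + 1 + 1))" using hom_comp[OF hd hq] .
 have h3: "hom (qq X i l (n + 1) ** qq X l k n) (Yo X k n) (Yo X i (n + 1 + 1))" for l using hom_comp[OF hq hq] .
 have h4: "hom (\<Sum>l\<in>S. ksgn (i - l + 1) (qq X i l (n + 1) ** qq X l k n)) (Yo X k n) (Yo X i (n + 1 + 1))"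
  by (rule hom_sum[OF hom_cod[OF x] hom_cod[OF h1] hom_ksgn[OF h3]])
 have "0 = (dd X i (n + 1) ** qq X i k n - ksgn (i - k + 1) (qq X i k (n + 1) ** dd X k n) +
  (\<Sum>l\<in>S. ksgn (i - l + 1) (qq X i l (n + 1) ** qq X l k n))) ** x"
  unfolding eq using zero_comp[OF x hom_cod[OF h1]] by simp
 also have "\<dots> = dd X i (n + 1) ** qq X i k n ** x - ksgn (i - k + 1) (qq X i k (n + 1) ** dd X k n ** x) +
  (\<Sum>l\<in>S. ksgn (i - l + 1) (qq X i l (n + 1) ** qq X l k n ** x))"
  using add_comp[OF x hom_diff[OF h1 hom_ksgn[OF h2]] h4] diff_comp[OF x h1 hom_ksgn[OF h2]] ksgn_comp[OF x h2]
   sum_comp[OF x hom_cod[OF h1] hom_ksgn[OF h3]] ksgn_comp[OF x h3] by simp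
 finally show ?thesis using assoc[OF x hq hd] assoc[OF x hd hq] assoc[OF x hq hq] by simp
qed

text \<open>In each component the square of the inner differential vanishes, and
  \<open>qq_MC\<close> trades d q for q d and q q. The resulting terms arise once from the inner
  differential and once from the twisting, and cancel after exchanging the order of
  summation.\<close>

lemma ttot_complex:
 assumes X: "twok C I S X"
 shows "is_complex A (ttot F S X)"
 unfolding is_complex_def
proof (intro allI conjI)
 fix n
 let ?M = "ttot F S X"
 note h = ttot_d(1)[OF X]
 show "cob ?M n : obj A" "cdf ?M n : arr A (cob ?M n) (cob ?M (n + 1))" using h[of n] by (auto simp: hom_def)
 let ?T = "cob ?M n"
 define x where "x = idt A ?T"
 have x: "hom x ?T (cob ?M n)" unfolding x_def using hom_id[OF hom_dom[OF h]] .
 define y where "y = cdf ?M n ** x"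
 have y: "hom y ?T (cob ?M (n + 1))" unfolding y_def using hom_comp[OF x h] .
 have "cdf ?M (n + 1) ** y = 0"
 proof (rule ttot_ext[OF X hom_comp[OF y h] hom_zero[OF hom_dom[OF y] hom_cod[OF h]]])
  fix i assume i: "i : S"
  let ?x = "\<lambda>j. tP F S X n j ** x" and ?y = "\<lambda>j. tP F S X (n + 1) j ** y"
  have px: "hom (?x j) ?T (Yo X j n)" if "j : S" for j using hom_comp[OF x tP_hom[OF X that]] .
  note hd = dd_hom[OF X] and hq = qq_hom[OF X]
  have qx: "hom (qq X j k n ** ?x k) ?T (Yo X j (n + 1))" if "k : S" for j k using hom_comp[OF px[OF that] hq] .
  have dx: "hom (dd X j n ** ?x j) ?T (Yo X j (n + 1))" if "j : S" for j using hom_comp[OF px[OF that] hd] .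
  have sx: "hom (\<Sum>k\<in>S. qq X j k n ** ?x k) ?T (Yo X j (n + 1))" for j
   by (rule hom_sum[OF hom_dom[OF x] hom_cod[OF hd] qx])
  have yj: "?y j = ksgn j (dd X j n ** ?x j - (\<Sum>k\<in>S. qq X j k n ** ?x k))" if "j : S" for j
   unfolding y_def using ttot_d(2)[OF X x that] .
  define a where "a k = qq X i k (n + 1) ** (dd X k n ** ?x k)" for k
  define b where "b l k = qq X i l (n + 1) ** (qq X l k n ** ?x k)" for l k
  have dq: "dd X i (n + 1) ** (qq X i k n ** ?x k) = ksgn (i - k + 1) (a k) - (\<Sum>l\<in>S. ksgn (i - l + 1) (b l k))"
   if "k : S" for k
   using qq_MC[OF X px[OF that], of i] unfolding a_def b_def by (simp add: algebra_simps eq_neg_iff_add_eq_0 add_eq_0_iff)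
  have c1: "dd X i (n + 1) ** (\<Sum>k\<in>S. qq X i k n ** ?x k) = (\<Sum>k\<in>S. dd X i (n + 1) ** (qq X i k n ** ?x k))"
   by (rule comp_sum[OF hd hom_dom[OF x] qx])
  have c2: "qq X i l (n + 1) ** (\<Sum>k\<in>S. qq X l k n ** ?x k) = (\<Sum>k\<in>S. qq X i l (n + 1) ** (qq X l k n ** ?x k))" for l
   by (rule comp_sum[OF hq hom_dom[OF x] qx])
  have D: "dd X i (n + 1) ** ?y i = (\<Sum>k\<in>S. ksgn k (a k)) - (\<Sum>k\<in>S. \<Sum>l\<in>S. ksgn l (b l k))"
  proof -
   have "dd X i (n + 1) ** ?y i = ksgn i (dd X i (n + 1) ** (dd X i n ** ?x i) - (\<Sum>k\<in>S. dd X i (n + 1) ** (qq X i k n ** ?x k)))"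
    unfolding yj[OF i]
    using comp_ksgn[OF hom_diff[OF dx[OF i] sx] hd] comp_diff[OF dx[OF i] sx hd] c1 by simp
   also have "\<dots> = - ksgn i (\<Sum>k\<in>S. ksgn (i - k + 1) (a k) - (\<Sum>l\<in>S. ksgn (i - l + 1) (b l k)))"
    using dd_dd[OF X px[OF i]] dq by (simp add: ksgn_uminus)
   also have "\<dots> = (\<Sum>k\<in>S. - ksgn i (ksgn (i - k + 1) (a k)) - (\<Sum>l\<in>S. - ksgn i (ksgn (i - l + 1) (b l k))))"
    by (simp add: ksgn_sum ksgn_diff sum_negf sum_subtractf)
   also have "\<dots> = (\<Sum>k\<in>S. ksgn k (a k) - (\<Sum>l\<in>S. ksgn l (b l k)))"
   proof -
    have "- ksgn i (ksgn (i - m + 1) z) = ksgn m z" for m and z :: 'a unfolding ksgn_def by auto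
    thus ?thesis by simp
   qed
   finally show ?thesis by (simp add: sum_subtractf)
  qed
  have "qq X i l (n + 1) ** ?y l = ksgn l (a l) - (\<Sum>k\<in>S. ksgn l (b l k))" if l: "l : S" for l
   unfolding yj[OF l] a_def b_def
   using comp_ksgn[OF hom_diff[OF dx[OF l] sx] hq] comp_diff[OF dx[OF l] sx hq] c2 by (simp add: ksgn_diff[symmetric] ksgn_sum[symmetric])
  hence "(\<Sum>l\<in>S. qq X i l (n + 1) ** ?y l) = (\<Sum>l\<in>S. ksgn l (a l)) - (\<Sum>l\<in>S. \<Sum>k\<in>S. ksgn l (b l k))"
   by (simp add: sum_subtractf)
  also have "(\<Sum>l\<in>S. \<Sum>k\<in>S. ksgn l (b l k)) = (\<Sum>k\<in>S. \<Sum>l\<in>S. ksgn l (b l k))" by (rule sum.swap)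
  finally have "tP F S X (n + 1 + 1) i ** (cdf ?M (n + 1) ** y) = 0" using ttot_d(2)[OF X y i] D by simp
  thus "tP F S X (n + 1 + 1) i ** (cdf ?M (n + 1) ** y) = tP F S X (n + 1 + 1) i ** 0"
   using comp_zero[OF hom_dom[OF x] tP_hom[OF X i]] by simp
 qed
 thus "cdf ?M (n + 1) ** cdf ?M n = 0" unfolding y_def x_def using comp_id[OF h] by simp
qed

lemma tw_diff_F:
 assumes X: "twok C I S X" and X': "twok C I S' X'" and f: "f : tw_hom C L X X'"
 shows "tw_diff C I L X X' f i j : dhom C (L + i - j + 1) (fst X i) (fst X' j)"
  and "fL (L + 1) X X' (tw_diff C I L X X' f) i j n = dd X i (n + L) ** fL L X X' f i j n
   - ksgn (L + i - j) (fL L X X' f i j (n + 1) ** dd X' j n) + (\<Sum>m\<in>S'. ksgn (L + i - m) (fL L X X' f i m (n + 1) ** qq X' m j n))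
   - (\<Sum>m\<in>S. ksgn ((m - i) * L) (qq X i m (n + L) ** fL L X X' f m j n))"
proof -
 note o = twok_simps(2)[OF X] and s = twok_simps(3)[OF X] and o' = twok_simps(2)[OF X'] and s' = twok_simps(3)[OF X']
 have fd: "f i j : dhom C (L + i - j) (fst X i) (fst X' j)" for i j using f unfolding tw_hom_def by blast
 let ?c = "\<lambda>m. dcmp C (fst X i) (fst X' m) (fst X' j) (L + i - m) (m - j + 1) (snd X' m j) (f i m)"
 let ?e = "\<lambda>m. dcmp C (fst X i) (fst X m) (fst X' j) (i - m + 1) (L + m - j) (f m j) (snd X i m)"
 let ?D = "dhom C (L + i - j + 1) (fst X i) (fst X' j)"
 have sg: "subgrp ?D" using dg_subgrp[OF kF_c o o'] .
 have d: "ddiff C (L + i - j) (fst X i) (fst X' j) (f i j) : ?D" using dg_diff[OF kF_c o o' fd] .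
 have e1: "L + i - m + (m - j + 1) = L + i - j + 1" for m by simp
 have c: "?c m : ?D" for m using dg_comp[OF kF_c o o' o' fd s', of i m j] unfolding e1 .
 have e2: "i - m + 1 + (L + m - j) = L + i - j + 1" for m by simp
 have e: "?e m : ?D" for m using dg_comp[OF kF_c o o o' s fd, of i m j] unfolding e2 .
 have c': "ksgn (L + i - m) (?c m) : ?D" for m using subgrp_ksgn[OF sg c] .
 have e': "ksgn ((m - i) * L) (?e m) : ?D" for m using subgrp_ksgn[OF sg e] .
 have td: "tw_diff C I L X X' f i j = ddiff C (L + i - j) (fst X i) (fst X' j) (f i j) +
   (\<Sum>m\<in>tw_supp C I X'. ksgn (L + i - m) (?c m)) - (\<Sum>m\<in>tw_supp C I X. ksgn ((m - i) * L) (?e m))"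
  unfolding tw_diff_def ..
 have m1: "ddiff C (L + i - j) (fst X i) (fst X' j) (f i j) + (\<Sum>m\<in>tw_supp C I X'. ksgn (L + i - m) (?c m)) : ?D"
  using subgrp_add[OF sg d subgrp_sum[OF sg c']] .
 have m2: "(\<Sum>m\<in>tw_supp C I X. ksgn ((m - i) * L) (?e m)) : ?D" using subgrp_sum[OF sg e'] .
 show "tw_diff C I L X X' f i j : ?D" unfolding td using subgrp_diff[OF sg m1 m2] .
 let ?G = "\<lambda>z. fmor F (L + i - j + 1) (fst X i) (fst X' j) z (n + j)"
 have "?G (\<Sum>m\<in>tw_supp C I X'. ksgn (L + i - m) (?c m)) = (\<Sum>m\<in>tw_supp C I X'. ?G (ksgn (L + i - m) (?c m)))"
  by (rule cf_sum[OF kF_f o o']) (rule c')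
 also have "\<dots> = (\<Sum>m\<in>tw_supp C I X'. ksgn (L + i - m) (?G (?c m)))"
  by (rule sum.cong[OF refl]) (rule cf_ksgn[OF kF_f o o' c])
 finally have s1: "?G (\<Sum>m\<in>tw_supp C I X'. ksgn (L + i - m) (?c m)) = (\<Sum>m\<in>tw_supp C I X'. ksgn (L + i - m) (?G (?c m)))" .
 have "?G (\<Sum>m\<in>tw_supp C I X. ksgn ((m - i) * L) (?e m)) = (\<Sum>m\<in>tw_supp C I X. ?G (ksgn ((m - i) * L) (?e m)))"
  by (rule cf_sum[OF kF_f o o']) (rule e')
 also have "\<dots> = (\<Sum>m\<in>tw_supp C I X. ksgn ((m - i) * L) (?G (?e m)))"
  by (rule sum.cong[OF refl]) (rule cf_ksgn[OF kF_f o o' e])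
 finally have s2: "?G (\<Sum>m\<in>tw_supp C I X. ksgn ((m - i) * L) (?e m)) = (\<Sum>m\<in>tw_supp C I X. ksgn ((m - i) * L) (?G (?e m)))" .
 have G1: "?G (tw_diff C I L X X' f i j) = ?G (ddiff C (L + i - j) (fst X i) (fst X' j) (f i j)) +
   (\<Sum>m\<in>tw_supp C I X'. ksgn (L + i - m) (?G (?c m))) - (\<Sum>m\<in>tw_supp C I X. ksgn ((m - i) * L) (?G (?e m)))"
  unfolding td
  unfolding cf_minus'[OF kF_f o o' m1 m2] using cf_add[OF kF_f o o' d subgrp_sum[OF sg c', of "\<lambda>m. m"]] s1 s2 by simp
 have e: "n + j + (L + i - j) = n + L + i" "n + j + 1 = n + 1 + j" "n + j + (m - j + 1) = n + 1 + m" "n + j + (L + m - j) = n + L + m"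
   "L + 1 + i - j = L + i - j + 1" for m by auto
 have G2: "?G (ddiff C (L + i - j) (fst X i) (fst X' j) (f i j)) =
  dd X i (n + L) ** fL L X X' f i j n - ksgn (L + i - j) (fL L X X' f i j (n + 1) ** dd X' j n)"
  using cf_diff[OF kF_f o o' fd, of i j "n + j"] unfolding dd_def fL_def e .
 have G3: "?G (?c m) = fL L X X' f i m (n + 1) ** qq X' m j n" for m
  using cf_cmp[OF kF_f o o' o' fd s', of i m j "n + j"] unfolding e1 qq_def fL_def e .
 have G4: "?G (?e m) = qq X i m (n + L) ** fL L X X' f m j n" for m
  using cf_cmp[OF kF_f o o o' s fd, of i m j "n + j"] unfolding e2 qq_def fL_def e .
 note h = fL_hom[OF X X' f]
 show "fL (L + 1) X X' (tw_diff C I L X X' f) i j n = dd X i (n + L) ** fL L X X' f i j n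
   - ksgn (L + i - j) (fL L X X' f i j (n + 1) ** dd X' j n) + (\<Sum>m\<in>S'. ksgn (L + i - m) (fL L X X' f i m (n + 1) ** qq X' m j n))
   - (\<Sum>m\<in>S. ksgn ((m - i) * L) (qq X i m (n + L) ** fL L X X' f m j n))"
  unfolding fL_def[of "L + 1"] e G1 G2 G3 G4 twok_sum[OF X' qq_hom[OF X'] h] twok_sum[OF X h qq_hom[OF X]] ..
qed

lemma tw_diff_hom:
 assumes "twok C I S X" "twok C I S' X'" "f : tw_hom C L X X'"
 shows "tw_diff C I L X X' f : tw_hom C (L + 1) X X'"
 using tw_diff_F(1)[OF assms] unfolding tw_hom_def by (simp add: algebra_simps)

text \<open>Forming total complexes is a contravariant dg functor on twisted complexes. For
  \<open>L = 0\<close> and \<open>L = -1\<close> this yields chain maps and homotopies.\<close>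

lemma tmL_diff:
 assumes X: "twok C I S X" and X': "twok C I S' X'" and f: "f : tw_hom C L X X'"
 shows "tmL (L + 1) F S S' X X' (tw_diff C I L X X' f) n =
  cdf (ttot F S X) (n + L) ** tmL L F S S' X X' f n - ksgn L (tmL L F S S' X X' f (n + 1) ** cdf (ttot F S' X') n)"
proof -
 have en: "n + (L + 1) = n + L + 1" "n + 1 + L = n + L + 1" by auto
 note Dh = tw_diff_hom[OF X X' f]
 note k = tmL_spec[OF X X' f] and d = ttot_d[OF X] and d' = ttot_d[OF X'] and hd = dd_hom[OF X] and hd' = dd_hom[OF X']
  and hq = qq_hom[OF X] and hq' = qq_hom[OF X'] and hk = fL_hom[OF X X' f]
 note D = tmL_spec[OF X X' Dh, where n = n, unfolded en] and hD = fL_hom[OF X X' Dh, of _ _ n, unfolded en]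
 note k1 = k[where n = "n + 1", unfolded en] and hk1 = hk[of _ _ "n + 1", unfolded en]
 let ?M' = "ttot F S' X'" and ?M = "ttot F S X" and ?f = "tmL L F S S' X X' f" and ?D = "tmL (L + 1) F S S' X X' (tw_diff C I L X X' f) n"
 let ?T = "cob ?M' n"
 define x where "x = idt A ?T"
 have T: "?T : obj A" using hom_dom[OF d'(1)] .
 have x: "hom x ?T ?T" unfolding x_def using hom_id[OF T] .
 have px: "hom (tP F S' X' n j ** x) ?T (Yo X' j n)" if "j : S'" for j using hom_comp[OF x tP_hom[OF X' that]] .
 note h1 = hom_comp[OF hom_comp[OF x k(1)] d(1)] and h2 = hom_comp[OF hom_comp[OF x d'(1)] k1(1)]
 have "?D ** x = cdf ?M (n + L) ** (?f n ** x) - ksgn L (?f (n + 1) ** (cdf ?M' n ** x))"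
 proof (rule ttot_ext[OF X hom_comp[OF x D(1)] hom_diff[OF h1 hom_ksgn[OF h2]]])
  fix i assume i: "i : S"
  let ?x = "\<lambda>j. tP F S' X' n j ** x" and ?h = "\<lambda>i j n. fL L X X' f i j n"
  have kx: "hom (?h m j n ** ?x j) ?T (Yo X m (n + L))" if "j : S'" for m j using hom_comp[OF px[OF that] hk] .
  have dx: "hom (dd X' j n ** ?x j) ?T (Yo X' j (n + 1))" if "j : S'" for j using hom_comp[OF px[OF that] hd'] .
  have qx: "hom (qq X' m j n ** ?x j) ?T (Yo X' m (n + 1))" if "j : S'" for m j using hom_comp[OF px[OF that] hq'] .
  have sx: "hom (\<Sum>j\<in>S'. qq X' m j n ** ?x j) ?T (Yo X' m (n + 1))" for m by (rule hom_sum[OF T hom_cod[OF hd'] qx])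
  have sk: "hom (\<Sum>j\<in>S'. ?h m j n ** ?x j) ?T (Yo X m (n + L))" for m by (rule hom_sum[OF T hom_dom[OF hd] kx])
  let ?A = "\<lambda>j. dd X i (n + L) ** (?h i j n ** ?x j)" and ?B = "\<lambda>j. ?h i j (n + 1) ** (dd X' j n ** ?x j)"
   and ?C = "\<lambda>m j. ?h i m (n + 1) ** (qq X' m j n ** ?x j)" and ?D' = "\<lambda>m j. qq X i m (n + L) ** (?h m j n ** ?x j)"
  have rel: "fL (L + 1) X X' (tw_diff C I L X X' f) i j n ** ?x j = ?A j - ksgn (L + i - j) (?B j)
   + (\<Sum>m\<in>S'. ksgn (L + i - m) (?C m j)) - (\<Sum>m\<in>S. ksgn ((m - i) * L) (?D' m j))" if j: "j : S'" for j
  proof -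
   note p = px[OF j]
   have a: "hom (dd X i (n + L) ** ?h i j n) (Yo X' j n) (Yo X i (n + L + 1))" by (rule hom_comp[OF hk hd])
   have b: "hom (?h i j (n + 1) ** dd X' j n) (Yo X' j n) (Yo X i (n + L + 1))" by (rule hom_comp[OF hd' hk1])
   have c: "hom (?h i m (n + 1) ** qq X' m j n) (Yo X' j n) (Yo X i (n + L + 1))" for m by (rule hom_comp[OF hq' hk1])
   have e: "hom (qq X i m (n + L) ** ?h m j n) (Yo X' j n) (Yo X i (n + L + 1))" for m by (rule hom_comp[OF hk hq])
   note o = hom_dom[OF a] hom_cod[OF a]
   have c': "hom (\<Sum>m\<in>S'. ksgn (L + i - m) (?h i m (n + 1) ** qq X' m j n)) (Yo X' j n) (Yo X i (n + L + 1))" by (rule hom_sum[OF o hom_ksgn[OF c]])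
   have e': "hom (\<Sum>m\<in>S. ksgn ((m - i) * L) (qq X i m (n + L) ** ?h m j n)) (Yo X' j n) (Yo X i (n + L + 1))" by (rule hom_sum[OF o hom_ksgn[OF e]])
   note ab = hom_diff[OF a hom_ksgn[OF b]]
   show ?thesis unfolding tw_diff_F(2)[OF X X' f] diff_comp[OF p hom_add[OF ab c'] e'] add_comp[OF p ab c'] diff_comp[OF p a hom_ksgn[OF b]]
     ksgn_comp[OF p b] sum_ksgn_comp[OF p o(2) c] sum_ksgn_comp[OF p o(2) e]
     assoc[OF p hk hd] assoc[OF p hd' hk1] assoc[OF p hq' hk1] assoc[OF p hk hq] ..
  qed
  have R1: "tP F S X (n + L + 1) i ** (cdf ?M (n + L) ** (?f n ** x)) =
   (\<Sum>j\<in>S'. ksgn (i + i * L) (?A j)) - (\<Sum>m\<in>S. \<Sum>j\<in>S'. ksgn (i + m * L) (?D' m j))"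
  proof -
   have "dd X i (n + L) ** (tP F S X (n + L) i ** (?f n ** x)) = ksgn (i * L) (\<Sum>j\<in>S'. ?A j)"
    unfolding k(2)[OF x i] comp_ksgn[OF sk hd] by (subst comp_sum[OF hd T kx]) simp_all
   moreover have "qq X i m (n + L) ** (tP F S X (n + L) m ** (?f n ** x)) = (\<Sum>j\<in>S'. ksgn (m * L) (?D' m j))" if m: "m : S" for m
    unfolding k(2)[OF x m] comp_ksgn[OF sk hq] ksgn_sum[symmetric] by (subst comp_sum[OF hq T kx]) simp_all
   ultimately show ?thesis unfolding d(2)[OF hom_comp[OF x k(1)] i] by (simp add: ksgn_diff ksgn_ksgn ksgn_sum)
  qed
  have R2: "tP F S X (n + L + 1) i ** (?f (n + 1) ** (cdf ?M' n ** x)) =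
   (\<Sum>j\<in>S'. ksgn (i * L + j) (?B j)) - (\<Sum>m\<in>S'. \<Sum>j\<in>S'. ksgn (i * L + m) (?C m j))"
  proof -
   have "?h i m (n + 1) ** (tP F S' X' (n + 1) m ** (cdf ?M' n ** x)) = ksgn m (?B m) - (\<Sum>j\<in>S'. ksgn m (?C m j))" if m: "m : S'" for m
   proof -
    have cs: "?h i m (n + 1) ** (\<Sum>j\<in>S'. qq X' m j n ** ?x j) = (\<Sum>j\<in>S'. ?C m j)" by (rule comp_sum[OF hk1 T qx])
    show ?thesis unfolding d'(2)[OF x m] using comp_ksgn[OF hom_diff[OF dx[OF m] sx] hk1] comp_diff[OF dx[OF m] sx hk1] cs
     by (simp add: ksgn_diff[symmetric] ksgn_sum[symmetric])
   qed
   thus ?thesis unfolding k1(2)[OF hom_comp[OF x d'(1)] i] by (simp add: sum_subtractf ksgn_diff ksgn_sum ksgn_ksgn)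
  qed
  \<comment> \<open>Parity identities matching the sign (-1)^(i L) of \<open>tmL\<close> with the
    signs in \<open>tw_diff\<close> and the (-1)^i of the total differential.\<close>
  have s1: "ksgn (i * (L + 1)) z = ksgn (i + i * L) z" and s2: "ksgn (i + i * L) (ksgn (L + i - m) z) = ksgn L (ksgn (i * L + m) z)"
   and s3: "ksgn (i + i * L) (ksgn ((m - i) * L) z) = ksgn (i + m * L) z" for m and z :: 'a unfolding ksgn_def by auto
  have "tP F S X (n + L + 1) i ** (?D ** x) = (\<Sum>j\<in>S'. ksgn (i + i * L) (?A j) - ksgn L (ksgn (i * L + j) (?B j))
   + (\<Sum>m\<in>S'. ksgn L (ksgn (i * L + m) (?C m j))) - (\<Sum>m\<in>S. ksgn (i + m * L) (?D' m j)))"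
   unfolding D(2)[OF x i] ksgn_sum by (rule sum.cong[OF refl]) (simp add: rel ksgn_diff ksgn_add ksgn_sum s1 s2 s3)
  also have "\<dots> = (\<Sum>j\<in>S'. ksgn (i + i * L) (?A j)) - (\<Sum>j\<in>S'. ksgn L (ksgn (i * L + j) (?B j)))
   + (\<Sum>j\<in>S'. \<Sum>m\<in>S'. ksgn L (ksgn (i * L + m) (?C m j))) - (\<Sum>j\<in>S'. \<Sum>m\<in>S. ksgn (i + m * L) (?D' m j))"
   by (simp only: sum_subtractf sum.distrib)
  also have "(\<Sum>j\<in>S'. \<Sum>m\<in>S'. ksgn L (ksgn (i * L + m) (?C m j))) = (\<Sum>m\<in>S'. \<Sum>j\<in>S'. ksgn L (ksgn (i * L + m) (?C m j)))" by (rule sum.swap)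
  also have "(\<Sum>j\<in>S'. \<Sum>m\<in>S. ksgn (i + m * L) (?D' m j)) = (\<Sum>m\<in>S. \<Sum>j\<in>S'. ksgn (i + m * L) (?D' m j))" by (rule sum.swap)
  finally show "tP F S X (n + L + 1) i ** (?D ** x) = tP F S X (n + L + 1) i ** (cdf ?M (n + L) ** (?f n ** x) - ksgn L (?f (n + 1) ** (cdf ?M' n ** x)))"
   unfolding comp_diff[OF h1 hom_ksgn[OF h2] tP_hom[OF X i]] comp_ksgn[OF h2 tP_hom[OF X i]] R1 R2 by (simp add: ksgn_diff ksgn_sum)
 qed
 thus ?thesis unfolding x_def using comp_id[OF D(1)] comp_id[OF k(1)] comp_id[OF d'(1)] by simp
qed

lemma tmL_zero:
 assumes X: "twok C I S X" and X': "twok C I S' X'" and f: "f : tw_hom C L X X'" and z: "\<And>i j n. fL L X X' f i j n = 0"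
 shows "tmL L F S S' X X' f n = 0"
 unfolding tmL_def fL_def[symmetric] z
 using zero_comp[OF tP_hom[OF X'] hom_cod[OF fL_hom[OF X X' f]]] comp_zero[OF hom_dom[OF tP_hom[OF X']] tI_hom[OF X]] by simp

text \<open>The differential of \<open>f\<close> only lies in \<open>I\<close>, but \<open>F\<close>
  kills it, so the degree 0 case of \<open>tmL_diff\<close> has zero left side.\<close>

lemma tmap_chain:
 assumes X: "twok C I S X" and X': "twok C I S' X'" and f: "f : Tr_mor C I X X'"
 shows "chain_map A (ttot F S' X') (ttot F S X) (tmap F S S' X X' f)"
proof (rule chain_mapI)
 have f0: "f : tw_hom C 0 X X'" and fI: "\<And>i j. tw_diff C I 0 X X' f i j : I (i - j + 1) (fst X i) (fst X' j)"
  using f unfolding Tr_mor_def by auto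
 show "hom (tmap F S S' X X' f n) (cob (ttot F S' X') n) (cob (ttot F S X) n)" for n using tmap_spec(1)[OF X X' f0] .
 have e: "0 + 1 + i - j = i - j + 1" "(0::int) + i - j + 1 = i - j + 1" for i j :: int by auto
 have "fL (0 + 1) X X' (tw_diff C I 0 X X' f) i j n = 0" for i j n
  unfolding fL_def e using kills_0[OF kF twok_simps(2)[OF X] twok_simps(2)[OF X'] tw_diff_F(1)[OF X X' f0, unfolded e] fI] .
 from tmL_zero[OF X X' tw_diff_hom[OF X X' f0] this]
 show "cdf (ttot F S X) n ** tmap F S S' X X' f n = tmap F S S' X X' f (n + 1) ** cdf (ttot F S' X') n" for n
  unfolding tmL_diff[OF X X' f0] tmap_tmL by (simp add: ksgn_even)
qed

lemma tmap_homotopic: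
 assumes X: "twok C I S X" and X': "twok C I S' X'" and f: "f : tw_hom C 0 X X'" and g: "g : tw_hom C 0 X X'"
  and h: "h : tw_hom C (- 1) X X'"
  and eqI: "\<And>i j. f i j - g i j - tw_diff C I (- 1) X X' h i j : I (i - j) (fst X i) (fst X' j)"
 shows "tmap F S S' X X' f n - tmap F S S' X X' g n =
  cdf (ttot F S X) (n - 1) ** tmL (- 1) F S S' X X' h n + tmL (- 1) F S S' X X' h (n + 1) ** cdf (ttot F S' X') n"
proof -
 note o = twok_simps(2)[OF X] and o' = twok_simps(2)[OF X']
 let ?t = "tw_diff C I (- 1) X X' h"
 have t: "?t : tw_hom C 0 X X'" using tw_diff_hom[OF X X' h] by simp
 have m: "u i j : dhom C (i - j) (fst X i) (fst X' j)" if "u : tw_hom C 0 X X'" for u i j using that unfolding tw_hom_def by simp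
 have eq: "ff X X' f i j n = ff X X' g i j n + ff X X' ?t i j n" for i j
 proof -
  note sg = dg_subgrp[OF kF_c o o', of "i - j" i j]
  have "fmor F (i - j) (fst X i) (fst X' j) (f i j - g i j - ?t i j) (n + j) = 0"
   using kills_0[OF kF o o' subgrp_diff[OF sg subgrp_diff[OF sg m[OF f] m[OF g]] m[OF t]] eqI] .
  thus ?thesis unfolding ff_def cf_minus'[OF kF_f o o' subgrp_diff[OF sg m[OF f] m[OF g]] m[OF t]] cf_minus'[OF kF_f o o' m[OF f] m[OF g]]
   by (simp add: algebra_simps)
 qed
 note F = tmap_spec[OF X X' f] and G = tmap_spec[OF X X' g] and T = tmap_spec[OF X X' t]
 have i: "hom (idt A (cob (ttot F S' X') n)) (cob (ttot F S' X') n) (cob (ttot F S' X') n)" using hom_id[OF hom_dom[OF F(1)]] .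
 have "tmap F S S' X X' f n = tmap F S S' X X' g n + tmap F S S' X X' ?t n"
 proof (rule ttot_ext[OF X F(1) hom_add[OF G(1) T(1)]])
  fix l assume l: "l : S"
  have c: "tP F S X n l ** tmap F S S' X X' u n = (\<Sum>j\<in>S'. ff X X' u l j n ** tP F S' X' n j)" if u: "u : tw_hom C 0 X X'" for u
   using tmap_spec(2)[OF X X' u i l] comp_id[OF tmap_spec(1)[OF X X' u]] comp_id[OF tP_hom[OF X']] by simp
  show "tP F S X n l ** tmap F S S' X X' f n = tP F S X n l ** (tmap F S S' X X' g n + tmap F S S' X X' ?t n)"
   unfolding comp_add[OF G(1) T(1) tP_hom[OF X l]] c[OF f] c[OF g] c[OF t] eq
   using add_comp[OF tP_hom[OF X'] ff_hom[OF X X' g] ff_hom[OF X X' t]] by (simp add: sum.distrib)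
 qed
 thus ?thesis using tmL_diff[OF X X' h, of n] unfolding tmap_tmL by (simp add: ksgn_def)
qed

lemma tmL_hom1:
 assumes "twok C I S X" "twok C I S' X'" "h : tw_hom C (- 1) X X'"
 shows "hom (tmL (- 1) F S S' X X' h n) (cob (ttot F S' X') n) (cob (ttot F S X) (n - 1))"
 using tmL_spec(1)[OF assms, of n] by simp

lemma tmap_comp:
 assumes X: "twok C I S X" and Y: "twok C I S' Y" and Z: "twok C I S'' Z"
  and f: "f : tw_hom C 0 X Y" and g: "g : tw_hom C 0 Y Z"
 shows "Tr_comp C I X Y Z g f : tw_hom C 0 X Z"
  and "tmap F S S'' X Z (Tr_comp C I X Y Z g f) n = tmap F S S' X Y f n ** tmap F S' S'' Y Z g n"
proof -
 note oX = twok_simps(2)[OF X] and oY = twok_simps(2)[OF Y] and oZ = twok_simps(2)[OF Z]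
 have fd: "f i j : dhom C (i - j) (fst X i) (fst Y j)" and gd: "g i j : dhom C (i - j) (fst Y i) (fst Z j)" for i j
  using f g unfolding tw_hom_def by auto
 have e: "i - j + (j - k) = i - k" for i j k :: int by simp
 have cd: "dcmp C (fst X i) (fst Y j) (fst Z k) (i - j) (j - k) (g j k) (f i j) : dhom C (i - k) (fst X i) (fst Z k)" for i j k
  using dg_comp[OF kF_c oX oY oZ fd gd, of i j k] unfolding e .
 show gf: "Tr_comp C I X Y Z g f : tw_hom C 0 X Z"
  unfolding tw_hom_def Tr_comp_def by (simp, intro allI subgrp_sum[OF dg_subgrp[OF kF_c oX oZ]] cd)
 note tf = tmap_spec[OF X Y f] and tg = tmap_spec[OF Y Z g] and tgf = tmap_spec[OF X Z gf]
 let ?T = "cob (ttot F S'' Z) n"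
 define x where "x = idt A ?T"
 have T: "?T : obj A" using hom_dom[OF tg(1)] .
 have x: "hom x ?T ?T" unfolding x_def using hom_id[OF T] .
 have px: "hom (tP F S'' Z n k ** x) ?T (Yo Z k n)" if "k : S''" for k using hom_comp[OF x tP_hom[OF Z that]] .
 note hf = ff_hom[OF X Y f] and hg = ff_hom[OF Y Z g]
 have cmp: "ff X Z (Tr_comp C I X Y Z g f) i k n = (\<Sum>j\<in>S'. ff X Y f i j n ** ff Y Z g j k n)" for i k
 proof -
  have "ff X Z (Tr_comp C I X Y Z g f) i k n = (\<Sum>j\<in>tw_supp C I Y. ff X Y f i j n ** ff Y Z g j k n)"
   unfolding ff_def Tr_comp_def cf_sum[OF kF_f oX oZ cd]
  proof (rule sum.cong[OF refl])
   fix j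
   have "n + k + (j - k) = n + j" by simp
   thus "fmor F (i - k) (fst X i) (fst Z k) (dcmp C (fst X i) (fst Y j) (fst Z k) (i - j) (j - k) (g j k) (f i j)) (n + k) =
    fmor F (i - j) (fst X i) (fst Y j) (f i j) (n + j) ** fmor F (j - k) (fst Y j) (fst Z k) (g j k) (n + k)"
    using cf_cmp[OF kF_f oX oY oZ fd gd, of i j k "n + k"] unfolding e by simp
  qed
  also have "\<dots> = (\<Sum>j\<in>S'. ff X Y f i j n ** ff Y Z g j k n)"
   using twok_sum[OF Y hg hf, of "\<lambda>_. 0" i n k] by (simp add: ksgn_even)
  finally show ?thesis .
 qed
 have "tmap F S S'' X Z (Tr_comp C I X Y Z g f) n ** x = tmap F S S' X Y f n ** (tmap F S' S'' Y Z g n ** x)"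
 proof (rule ttot_ext[OF X hom_comp[OF x tgf(1)] hom_comp[OF hom_comp[OF x tg(1)] tf(1)]])
  fix i assume i: "i : S"
  have gx: "hom (ff Y Z g j k n ** (tP F S'' Z n k ** x)) ?T (Yo Y j n)" if "k : S''" for j k using hom_comp[OF px[OF that] hg] .
  have o: "Yo X i n : obj A" using hom_cod[OF hf] .
  have "tP F S X n i ** (tmap F S S'' X Z (Tr_comp C I X Y Z g f) n ** x) =
   (\<Sum>k\<in>S''. (\<Sum>j\<in>S'. ff X Y f i j n ** ff Y Z g j k n) ** (tP F S'' Z n k ** x))" unfolding tgf(2)[OF x i] cmp ..
  also have "\<dots> = (\<Sum>k\<in>S''. \<Sum>j\<in>S'. ff X Y f i j n ** (ff Y Z g j k n ** (tP F S'' Z n k ** x)))"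
   by (rule sum.cong[OF refl]) (simp add: sum_comp[OF px o hom_comp[OF hg hf]] assoc[OF px hg hf])
  also have "\<dots> = (\<Sum>j\<in>S'. \<Sum>k\<in>S''. ff X Y f i j n ** (ff Y Z g j k n ** (tP F S'' Z n k ** x)))" by (rule sum.swap)
  also have "\<dots> = (\<Sum>j\<in>S'. ff X Y f i j n ** (tP F S' Y n j ** (tmap F S' S'' Y Z g n ** x)))"
   by (rule sum.cong[OF refl]) (simp add: tg(2)[OF x] comp_sum[OF hf T gx])
  also have "\<dots> = tP F S X n i ** (tmap F S S' X Y f n ** (tmap F S' S'' Y Z g n ** x))"
   using tf(2)[OF hom_comp[OF x tg(1)] i] by simp
  finally show "tP F S X n i ** (tmap F S S'' X Z (Tr_comp C I X Y Z g f) n ** x) =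
   tP F S X n i ** (tmap F S S' X Y f n ** (tmap F S' S'' Y Z g n ** x))" .
 qed
 thus "tmap F S S'' X Z (Tr_comp C I X Y Z g f) n = tmap F S S' X Y f n ** tmap F S' S'' Y Z g n"
  unfolding x_def using comp_id[OF tgf(1)] comp_id[OF tg(1)] by simp
qed

lemma tmap_id:
 assumes X: "twok C I S X"
 shows "tmap F S S X X (Tr_id C X) n = idt A (cob (ttot F S X) n)"
proof -
 note o = twok_simps(2)[OF X]
 have f: "Tr_id C X : tw_hom C 0 X X"
  unfolding tw_hom_def Tr_id_def using dg_did[OF kF_c o] subgrp_zero[OF dg_subgrp[OF kF_c o o]] by simp
 note t = tmap_spec[OF X X f]
 let ?T = "cob (ttot F S X) n"
 have T: "?T : obj A" using hom_dom[OF t(1)] .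
 have x: "hom (idt A ?T) ?T ?T" using hom_id[OF T] .
 have "tmap F S S X X (Tr_id C X) n ** idt A ?T = idt A ?T"
 proof (rule ttot_ext[OF X hom_comp[OF x t(1)] x])
  fix i assume i: "i : S"
  have px: "hom (tP F S X n k ** idt A ?T) ?T (Yo X k n)" if "k : S" for k using hom_comp[OF x tP_hom[OF X that]] .
  have ob: "Yo X i n : obj A" using hom_cod[OF px[OF i]] .
  have "(\<Sum>j\<in>S. ff X X (Tr_id C X) i j n ** (tP F S X n j ** idt A ?T)) = (\<Sum>j\<in>S. if i = j then tP F S X n j ** idt A ?T else 0)"
  proof (rule sum.cong[OF refl])
   fix j assume j: "j : S"
   show "ff X X (Tr_id C X) i j n ** (tP F S X n j ** idt A ?T) = (if i = j then tP F S X n j ** idt A ?T else 0)"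
    unfolding ff_def Tr_id_def
    using cf_id[OF kF_f o] id_comp[OF px[OF j]] cf_zero[OF kF_f o o] zero_comp[OF px[OF j] ob] by simp
  qed
  thus "tP F S X n i ** (tmap F S S X X (Tr_id C X) n ** idt A ?T) = tP F S X n i ** idt A ?T"
   unfolding t(2)[OF x i] using i twok_simps(1)[OF X] by simp
 qed
 thus ?thesis using comp_id[OF t(1)] by simp
qed

end

section \<open>Transformations of functors on total complexes\<close>

lemma tnat_spec:
 assumes kF: "kills C I F" and kF': "kills C I F'" and X: "twok C I S X"
  and \<eta>: "\<And>P n. P : dobj C ==> hom (\<eta> P n) (Fo F P n) (Fo F' P n)"
 shows "hom (tnat F F' \<eta> S X n) (cob (ttot F S X) n) (cob (ttot F' S X) n)"
  and "hom x T (cob (ttot F S X) n) ==> i : S ==> tP F' S X n i ** (tnat F F' \<eta> S X n ** x) = \<eta> (fst X i) (n + i) ** (tP F S X n i ** x)"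
proof -
 note P = tP_hom[OF kF X] and o = twok_simps(2)[OF kF X] and tb = tS_bip[OF kF X] and tb' = tS_bip[OF kF' X]
 have h: "hom (\<eta> (fst X i) (n + i) ** tP F S X n i) (cob (ttot F S X) n) (Fo F' (fst X i) (n + i))" if "i : S" for i
  using hom_comp[OF P[OF that] \<eta>[OF o]] .
 have T: "cob (ttot F S X) n : obj A" using bip_obj[OF tb] unfolding cob_ttot[OF kF] .
 note b = bip_tuple[OF tb' T h]
 show th: "hom (tnat F F' \<eta> S X n) (cob (ttot F S X) n) (cob (ttot F' S X) n)"
  unfolding tnat_def cob_ttot[OF kF'] using b(1) .
 assume x: "hom x T (cob (ttot F S X) n)" and i: "i : S"
 have "tP F' S X n i ** (tnat F F' \<eta> S X n ** x) = tP F' S X n i ** tnat F F' \<eta> S X n ** x"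
  using assoc[OF x th tP_hom[OF kF' X i]] by simp
 also have "tP F' S X n i ** tnat F F' \<eta> S X n = \<eta> (fst X i) (n + i) ** tP F S X n i"
  unfolding tnat_def using b(2)[OF _ i] by blast
 also have "\<dots> ** x = \<eta> (fst X i) (n + i) ** (tP F S X n i ** x)" using assoc[OF x P[OF i] \<eta>[OF o]] .
 finally show "tP F' S X n i ** (tnat F F' \<eta> S X n ** x) = \<eta> (fst X i) (n + i) ** (tP F S X n i ** x)" .
qed

lemma dg_trD:
 assumes t: "dg_transformation C A F F' \<eta>" and kF: "kills C I F" and kF': "kills C I F'"
 shows "P : dobj C ==> hom (\<eta> P n) (Fo F P n) (Fo F' P n)"
  and "P : dobj C ==> hom x T (Fo F P n) ==> Fd F' P n ** (\<eta> P n ** x) = \<eta> P (n + 1) ** (Fd F P n ** x)"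
  and "P : dobj C ==> Q : dobj C ==> f : dhom C i P Q ==> \<eta> P (n + i) ** fmor F i P Q f n = fmor F' i P Q f n ** \<eta> Q n"
proof -
 have 1: "\<And>P. P : dobj C ==> chain_map A (fob F P) (fob F' P) (\<eta> P)" using t unfolding dg_transformation_def by blast
 note c = cf_cpx[OF kills_fun[OF kF]] and c' = cf_cpx[OF kills_fun[OF kF']]
 show "P : dobj C ==> hom (\<eta> P n) (Fo F P n) (Fo F' P n)" using chain_map_hom[OF 1 c c'] .
 show "P : dobj C ==> hom x T (Fo F P n) ==> Fd F' P n ** (\<eta> P n ** x) = \<eta> P (n + 1) ** (Fd F P n ** x)"
  using chain_map_dx[OF 1 c c'] .
 show "P : dobj C ==> Q : dobj C ==> f : dhom C i P Q ==> \<eta> P (n + i) ** fmor F i P Q f n = fmor F' i P Q f n ** \<eta> Q n"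
  using t unfolding dg_transformation_def by blast
qed

lemma tnat_chain:
 assumes kF: "kills C I F" and kF': "kills C I F'" and X: "twok C I S X" and t: "dg_transformation C A F F' \<eta>"
 shows "chain_map A (ttot F S X) (ttot F' S X) (tnat F F' \<eta> S X)"
proof (rule chain_mapI)
 note \<eta> = dg_trD[OF t kF kF'] and o = twok_simps(2)[OF kF X]
 note s = tnat_spec[OF kF kF' X \<eta>(1)] and d = ttot_d[OF kF X] and d' = ttot_d[OF kF' X]
 show "hom (tnat F F' \<eta> S X n) (cob (ttot F S X) n) (cob (ttot F' S X) n)" for n using s(1) by blast
 fix n
 let ?M = "ttot F S X" and ?M' = "ttot F' S X" and ?N = "tnat F F' \<eta> S X"
 define x where "x = idt A (cob ?M n)"
 have T: "cob ?M n : obj A" using hom_dom[OF d(1)] .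
 have x: "hom x (cob ?M n) (cob ?M n)" unfolding x_def using hom_id[OF T] .
 have h1: "hom (?N n ** x) (cob ?M n) (cob ?M' n)" and h2: "hom (cdf ?M n ** x) (cob ?M n) (cob ?M (n + 1))"
  using hom_comp[OF x s(1)] hom_comp[OF x d(1)] by blast+
 have "cdf ?M' n ** (?N n ** x) = ?N (n + 1) ** (cdf ?M n ** x)"
 proof (rule ttot_ext[OF kF' X hom_comp[OF h1 d'(1)] hom_comp[OF h2 s(1)]])
  fix i assume i: "i : S"
  let ?x = "\<lambda>j. tP F S X n j ** x"
  have px: "hom (?x j) (cob ?M n) (Fo F (fst X j) (n + j))" if "j : S" for j using hom_comp[OF x tP_hom[OF kF X that]] .
  have e: "n + 1 + i = n + i + 1" by simp
  have D: "dd F' X i n ** (\<eta> (fst X i) (n + i) ** ?x i) = \<eta> (fst X i) (n + 1 + i) ** (dd F X i n ** ?x i)"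
   unfolding dd_def[OF kF] dd_def[OF kF'] e using \<eta>(2)[OF o px[OF i]] .
  have Q: "qq F' X i j n ** (\<eta> (fst X j) (n + j) ** ?x j) = \<eta> (fst X i) (n + 1 + i) ** (qq F X i j n ** ?x j)" if j: "j : S" for j
  proof -
   have e: "n + j + (i - j + 1) = n + 1 + i" by simp
   have "\<eta> (fst X i) (n + 1 + i) ** qq F X i j n = qq F' X i j n ** \<eta> (fst X j) (n + j)"
    using \<eta>(3)[OF o o twok_simps(3)[OF kF X], of i "n + j" j] unfolding qq_def[OF kF] qq_def[OF kF'] e .
   thus ?thesis
    using assoc[OF px[OF j] \<eta>(1)[OF o] qq_hom[OF kF' X], of i] assoc[OF px[OF j] qq_hom[OF kF X] \<eta>(1)[OF o], of i] by simp
  qed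
  have qx: "hom (qq F X i j n ** ?x j) (cob ?M n) (Fo F (fst X i) (n + 1 + i))" if "j : S" for j
   using hom_comp[OF px[OF that] qq_hom[OF kF X]] .
  have dx: "hom (dd F X i n ** ?x i) (cob ?M n) (Fo F (fst X i) (n + 1 + i))" using hom_comp[OF px[OF i] dd_hom[OF kF X]] .
  have sx: "hom (\<Sum>j\<in>S. qq F X i j n ** ?x j) (cob ?M n) (Fo F (fst X i) (n + 1 + i))" by (rule hom_sum[OF T hom_cod[OF dx] qx])
  have "tP F' S X (n + 1) i ** (cdf ?M' n ** (?N n ** x)) = ksgn i (\<eta> (fst X i) (n + 1 + i) ** (dd F X i n ** ?x i) -
   (\<Sum>j\<in>S. \<eta> (fst X i) (n + 1 + i) ** (qq F X i j n ** ?x j)))"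
   unfolding d'(2)[OF h1 i] using s(2)[OF _ x] D Q i by simp
  also have "\<dots> = \<eta> (fst X i) (n + 1 + i) ** ksgn i (dd F X i n ** ?x i - (\<Sum>j\<in>S. qq F X i j n ** ?x j))"
   unfolding comp_ksgn[OF hom_diff[OF dx sx] \<eta>(1)[OF o]] comp_diff[OF dx sx \<eta>(1)[OF o]]
   by (subst comp_sum[OF \<eta>(1)[OF o] T qx]) simp_all
  also have "\<dots> = \<eta> (fst X i) (n + 1 + i) ** (tP F S X (n + 1) i ** (cdf ?M n ** x))" using d(2)[OF x i] by simp
  also have "\<dots> = tP F' S X (n + 1) i ** (?N (n + 1) ** (cdf ?M n ** x))" using s(2)[OF _ h2 i] by simp
  finally show "tP F' S X (n + 1) i ** (cdf ?M' n ** (?N n ** x)) = tP F' S X (n + 1) i ** (?N (n + 1) ** (cdf ?M n ** x))" .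
 qed
 thus "cdf ?M' n ** ?N n = ?N (n + 1) ** cdf ?M n" unfolding x_def using comp_id[OF s(1)] comp_id[OF d(1)] by simp
qed

lemma tnat_tmap:
 assumes kF: "kills C I F" and kF': "kills C I F'" and X: "twok C I S X" and X': "twok C I S' X'"
  and t: "dg_transformation C A F F' \<eta>" and f: "f : tw_hom C 0 X X'"
 shows "tnat F F' \<eta> S X n ** tmap F S S' X X' f n = tmap F' S S' X X' f n ** tnat F F' \<eta> S' X' n"
proof -
 note \<eta> = dg_trD[OF t kF kF'] and o = twok_simps(2)[OF kF X] and o' = twok_simps(2)[OF kF X']
 note s = tnat_spec[OF kF kF' X \<eta>(1)] and s' = tnat_spec[OF kF kF' X' \<eta>(1)]
 note m = tmap_spec[OF kF X X' f] and m' = tmap_spec[OF kF' X X' f]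
 let ?T = "cob (ttot F S' X') n"
 define x where "x = idt A ?T"
 have T: "?T : obj A" using hom_dom[OF m(1)] .
 have x: "hom x ?T ?T" unfolding x_def using hom_id[OF T] .
 have h1: "hom (tmap F S S' X X' f n ** x) ?T (cob (ttot F S X) n)" and h2: "hom (tnat F F' \<eta> S' X' n ** x) ?T (cob (ttot F' S' X') n)"
  using hom_comp[OF x m(1)] hom_comp[OF x s'(1)] by blast+
 have "tnat F F' \<eta> S X n ** (tmap F S S' X X' f n ** x) = tmap F' S S' X X' f n ** (tnat F F' \<eta> S' X' n ** x)"
 proof (rule ttot_ext[OF kF' X hom_comp[OF h1 s(1)] hom_comp[OF h2 m'(1)]])
  fix i assume i: "i : S"
  let ?x = "\<lambda>j. tP F S' X' n j ** x"
  have px: "hom (?x j) ?T (Fo F (fst X' j) (n + j))" if "j : S'" for j using hom_comp[OF x tP_hom[OF kF X' that]] .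
  have fx: "hom (ff F X X' f i j n ** ?x j) ?T (Fo F (fst X i) (n + i))" if "j : S'" for j
   using hom_comp[OF px[OF that] ff_hom[OF kF X X' f]] .
  have Q: "ff F' X X' f i j n ** (\<eta> (fst X' j) (n + j) ** ?x j) = \<eta> (fst X i) (n + i) ** (ff F X X' f i j n ** ?x j)" if j: "j : S'" for j
  proof -
   have fd: "f i j : dhom C (i - j) (fst X i) (fst X' j)" using f unfolding tw_hom_def by simp
   have e: "n + j + (i - j) = n + i" by simp
   have "\<eta> (fst X i) (n + i) ** ff F X X' f i j n = ff F' X X' f i j n ** \<eta> (fst X' j) (n + j)"
    using \<eta>(3)[OF o o' fd, of "n + j"] unfolding ff_def[OF kF] ff_def[OF kF'] e .
   thus ?thesis using assoc[OF px[OF j] \<eta>(1)[OF o'] ff_hom[OF kF' X X' f], of i] assoc[OF px[OF j] ff_hom[OF kF X X' f] \<eta>(1)[OF o], of i] by simp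
  qed
  have "tP F' S X n i ** (tnat F F' \<eta> S X n ** (tmap F S S' X X' f n ** x)) = \<eta> (fst X i) (n + i) ** (\<Sum>j\<in>S'. ff F X X' f i j n ** ?x j)"
   using s(2)[OF _ h1 i] m(2)[OF x i] by simp
  also have "\<dots> = (\<Sum>j\<in>S'. \<eta> (fst X i) (n + i) ** (ff F X X' f i j n ** ?x j))" by (rule comp_sum[OF \<eta>(1)[OF o] T fx])
  also have "\<dots> = (\<Sum>j\<in>S'. ff F' X X' f i j n ** (\<eta> (fst X' j) (n + j) ** ?x j))" using Q by simp
  also have "\<dots> = tP F' S X n i ** (tmap F' S S' X X' f n ** (tnat F F' \<eta> S' X' n ** x))"
   using m'(2)[OF h2 i] s'(2)[OF _ x] by simp
  finally show "tP F' S X n i ** (tnat F F' \<eta> S X n ** (tmap F S S' X X' f n ** x)) =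
   tP F' S X n i ** (tmap F' S S' X X' f n ** (tnat F F' \<eta> S' X' n ** x))" .
 qed
 thus ?thesis unfolding x_def using comp_id[OF m(1)] comp_id[OF s'(1)] by simp
qed


section \<open>Truncations\<close>

definition tz :: "int option => int => ('o, 'a) cpx => int => 'o => 'a => bool" where
 "tz lo b Y n T x \<longleftrightarrow> hom x T (cob Y n) & (n > b \<or> (EX a. lo = Some a & b < a) --> x = 0) &
   (n = b --> cdf Y n ** x = 0)"

definition bdry :: "('o, 'a) cpx => int => 'o => 'a => bool" where
 "bdry Y n T x \<longleftrightarrow> (EX T' e u. cov e T' T & hom u T' (cob Y (n - 1)) & x ** e = cdf Y (n - 1) ** u)"

text \<open>To be read inside \<open>tz\<close>. Below degree \<open>a\<close> no condition is left,
  since everything is divided out there.\<close>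

definition tb :: "int option => ('o, 'a) cpx => int => 'o => 'a => bool" where
 "tb lo Y n T x \<longleftrightarrow> hom x T (cob Y n) &
   (case lo of None => x = 0 | Some a => (n > a --> x = 0) & (n = a --> bdry Y n T x))"

lemma bdry_zero:
 assumes Y: "is_complex A Y" and T: "T : obj A"
 shows "bdry Y n T 0"
proof -
 have "0 ** idt A T = cdf Y (n - 1) ** 0" using zero_comp[OF hom_id[OF T] cpx_ob[OF Y]] comp_zero[OF T cpx_hom_d[OF Y]] by simp
 thus ?thesis unfolding bdry_def using cov_id[OF T] hom_zero[OF T cpx_ob[OF Y]] by blast
qed

lemma bdry_cycle:
 assumes Y: "is_complex A Y" and x: "hom x T (cob Y n)" and b: "bdry Y n T x"
 shows "cdf Y n ** x = 0"
proof -
 obtain T' e u where e: "cov e T' T" and u: "hom u T' (cob Y (n - 1))" and xe: "x ** e = cdf Y (n - 1) ** u"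
  using b unfolding bdry_def by blast
 have "cdf Y n ** x ** e = 0" using assoc[OF cov_hom[OF e] x cpx_hom_d[OF Y]] xe cpx_ddx'[OF Y u] by simp
 thus ?thesis using cov_zero[OF e hom_comp[OF x cpx_hom_d[OF Y]]] by blast
qed

lemma trunc_SQ:
 assumes Y: "is_complex A Y"
 shows "SQ (cob Y n) (trunc_sq A lo b Y n)"
  and "(EX t. sqr (trunc_sq A lo b Y n) T x t) \<longleftrightarrow> tz lo b Y n T x"
  and "sqr (trunc_sq A lo b Y n) T x 0 \<longleftrightarrow> tz lo b Y n T x & tb lo Y n T x"
proof -
 note o = cpx_ob[OF Y] and d = cpx_hom_d[OF Y] and d' = cpx_hom_d'[OF Y]
 have f1: "finite {idt A (cob Y n)}" by simp
 have id: "EX Z. hom g (cob Y n) Z" if "g : {idt A (cob Y n)}" for g using that hom_id[OF o] by blast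
 have "SQ (cob Y n) (trunc_sq A lo b Y n) & ((EX t. sqr (trunc_sq A lo b Y n) T x t) \<longleftrightarrow> tz lo b Y n T x) &
  (sqr (trunc_sq A lo b Y n) T x 0 \<longleftrightarrow> tz lo b Y n T x & tb lo Y n T x)"
 proof (cases "n > b \<or> (EX a. lo = Some a & b < a)")
  case True
  define B where "B = (case lo of None => {} | Some a => (if n > a then {} else if n = a then {(cob Y (n - 1), cdf Y (n - 1))}
     else {(cob Y n, idt A (cob Y n))}))"
  have "U : obj A" if "(U, c) : B" for U c using that o unfolding B_def by (auto split: option.splits if_splits)
  \<comment> \<open>The subobject is zero here, so relations in \<open>B\<close> need not lie in it
    and \<open>subquot1\<close> is not applicable.\<close>
  hence "subquot A (cob Y n) {idt A (cob Y n)} B = subquot A (cob Y n) {idt A (cob Y n)} {}"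
   by (intro subquot_drop[OF o id]) auto
  hence e: "trunc_sq A lo b Y n = subquot A (cob Y n) {idt A (cob Y n)} {}"
   using True unfolding trunc_sq_def B_def by simp
  have z: "tz lo b Y n T x \<longleftrightarrow> hom x T (cob Y n) & x = 0"
   unfolding tz_def using True comp_zero[OF hom_dom d] by blast
  moreover have "tb lo Y n T x" if "hom x T (cob Y n) & x = 0"
   unfolding tb_def using that bdry_zero[OF Y hom_dom] by (auto split: option.splits)
  ultimately show ?thesis unfolding e
   using subquot0(1)[OF o f1 id] subquot0(2,3)[OF o f1 id, where x = x and T = T] id_comp by auto
 next
  case False
  let ?G = "if n = b then {cdf Y n} else {}"
  have G1: "finite ?G" and G2: "\<And>g. g : ?G ==> EX Z. hom g (cob Y n) Z" using d by (auto split: if_splits)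
  have z: "tz lo b Y n T x \<longleftrightarrow> hom x T (cob Y n) & (ALL g:?G. g ** x = 0)" unfolding tz_def using False by auto
  show ?thesis
  proof (cases "lo = None \<or> (EX a. lo = Some a & n > a)")
   case True
   hence e: "trunc_sq A lo b Y n = subquot A (cob Y n) ?G {}" using False unfolding trunc_sq_def by auto
   have "tb lo Y n T x \<longleftrightarrow> hom x T (cob Y n) & x = 0" unfolding tb_def using True by (auto split: option.splits)
   moreover have "g ** 0 = 0" if "hom x T (cob Y n)" "g : ?G" for g using that comp_zero[OF hom_dom d] by (auto split: if_splits)
   ultimately show ?thesis unfolding e z
    using subquot0(1)[OF o G1 G2] subquot0(2,3)[OF o G1 G2, where x = x and T = T] by auto
  next
   case 2: False
   then obtain a where a: "lo = Some a" "n \<le> a" by (cases lo) auto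
   show ?thesis
   proof (cases "n = a")
    case True
    hence e: "trunc_sq A lo b Y n = subquot A (cob Y n) ?G {(cob Y (n - 1), cdf Y (n - 1))}"
     using False a unfolding trunc_sq_def by auto
    have "g ** cdf Y (n - 1) = 0" if "g : ?G" for g using that cpx_dd[OF Y, of "n - 1"] by (auto split: if_splits)
    note s = subquot1(1)[OF o G1 G2 d' this] subquot1(2,3)[OF o G1 G2 d' this, where x = x and T = T]
    have "tb lo Y n T x \<longleftrightarrow> hom x T (cob Y n) & bdry Y n T x" unfolding tb_def using a True by simp
    thus ?thesis unfolding e z using s bdry_cycle[OF Y] unfolding bdry_def by (auto split: if_splits)
   next
    case 3: False
    hence e: "trunc_sq A lo b Y n = subquot A (cob Y n) ?G {(cob Y n, idt A (cob Y n))}" and nb: "n \<noteq> b"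
     using False a unfolding trunc_sq_def by auto
    have "g ** idt A (cob Y n) = 0" if "g : ?G" for g using that nb by simp
    note s = subquot1(1)[OF o G1 G2 hom_id[OF o] this] subquot1(2,3)[OF o G1 G2 hom_id[OF o] this, where x = x and T = T]
    have "EX T' e u. cov e T' T & hom u T' (cob Y n) & x ** e = idt A (cob Y n) ** u" if x: "hom x T (cob Y n)"
     using cov_id[OF hom_dom[OF x]] x comp_id[OF x] id_comp[OF x] by metis
    moreover have "tb lo Y n T x \<longleftrightarrow> hom x T (cob Y n)" unfolding tb_def using a 3 by auto
    ultimately show ?thesis unfolding e z using s nb by auto
   qed
  qed
 qed
 thus "SQ (cob Y n) (trunc_sq A lo b Y n)" and "(EX t. sqr (trunc_sq A lo b Y n) T x t) \<longleftrightarrow> tz lo b Y n T x"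
  and "sqr (trunc_sq A lo b Y n) T x 0 \<longleftrightarrow> tz lo b Y n T x & tb lo Y n T x" by blast+
qed

lemma sq_map_eqI_rel:
 assumes s: "SQ Y s" and s': "SQ Y' s'" and \<phi>: "hom \<phi> Y Y'"
  and \<theta>: "hom \<theta> (quo_ob s) (quo_ob s')" and rel: "\<And>T x t. sqr s T x t ==> sqr s' T (\<phi> ** x) (\<theta> ** t)"
 shows "sq_map A s s' \<phi> = \<theta>"
 by (rule sq_map_eqI[OF s s' \<phi> \<theta>]) (rule rel[OF SQ_generic[OF s]])

lemma trunc_map:
 assumes Y: "is_complex A Y" and Y': "is_complex A Y'" and \<phi>: "hom \<phi> (cob Y n) (cob Y' n')"
  and d: "\<And>T x. tz lo b Y n T x ==> tz lo' b' Y' n' T (\<phi> ** x)"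
  and k: "\<And>T x. tz lo b Y n T x ==> tb lo Y n T x ==> tb lo' Y' n' T (\<phi> ** x)"
 shows "hom (sq_map A (trunc_sq A lo b Y n) (trunc_sq A lo' b' Y' n') \<phi>) (quo_ob (trunc_sq A lo b Y n)) (quo_ob (trunc_sq A lo' b' Y' n'))"
  and "sqr (trunc_sq A lo b Y n) T x t ==>
   sqr (trunc_sq A lo' b' Y' n') T (\<phi> ** x) (sq_map A (trunc_sq A lo b Y n) (trunc_sq A lo' b' Y' n') \<phi> ** t)"
proof -
 have dom: "EX t'. sqr (trunc_sq A lo' b' Y' n') T (\<phi> ** x) t'" if "sqr (trunc_sq A lo b Y n) T x t" for T x t
  using that d trunc_SQ(2)[OF Y] trunc_SQ(2)[OF Y'] by blast
 have ker: "sqr (trunc_sq A lo' b' Y' n') T (\<phi> ** x) 0" if "sqr (trunc_sq A lo b Y n) T x 0" for T x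
  using that d k unfolding trunc_SQ(3)[OF Y] trunc_SQ(3)[OF Y'] by blast
 note s = sq_map_spec[OF trunc_SQ(1)[OF Y] trunc_SQ(1)[OF Y'] \<phi>]
 show "hom (sq_map A (trunc_sq A lo b Y n) (trunc_sq A lo' b' Y' n') \<phi>) (quo_ob (trunc_sq A lo b Y n)) (quo_ob (trunc_sq A lo' b' Y' n'))"
  by (rule s(1)) (use dom ker in blast)+
 show "sqr (trunc_sq A lo b Y n) T x t ==>
   sqr (trunc_sq A lo' b' Y' n') T (\<phi> ** x) (sq_map A (trunc_sq A lo b Y n) (trunc_sq A lo' b' Y' n') \<phi> ** t)"
  by (rule s(2)) (use dom ker in blast)+
qed

lemma d_tz:
 assumes Y: "is_complex A Y" and x: "tz lo b Y n T x"
 shows "tz lo b Y (n + 1) T (cdf Y n ** x)"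
proof -
 have h: "hom x T (cob Y n)" using x unfolding tz_def by blast
 have "cdf Y n ** x = 0" if "n + 1 > b \<or> (EX a. lo = Some a & b < a)"
  using x that comp_zero[OF hom_dom[OF h] cpx_hom_d[OF Y]] unfolding tz_def by (cases "n = b") auto
 thus ?thesis unfolding tz_def using hom_comp[OF h cpx_hom_d[OF Y]] cpx_ddx[OF Y h] by blast
qed

lemma d_tb:
 assumes Y: "is_complex A Y" and x: "tb lo Y n T x"
 shows "tb lo Y (n + 1) T (cdf Y n ** x)"
proof -
 have h: "hom x T (cob Y n)" using x unfolding tb_def by blast
 note hd = hom_comp[OF h cpx_hom_d[OF Y]]
 have z: "cdf Y n ** 0 = 0" using comp_zero[OF hom_dom[OF h] cpx_hom_d[OF Y]] .
 show ?thesis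
 proof (cases lo)
  case None
  thus ?thesis using x hd z unfolding tb_def by simp
 next
  case (Some a)
  have "cdf Y n ** x = 0" if "n + 1 > a" using x z that bdry_cycle[OF Y h] Some unfolding tb_def by (cases "n = a") auto
  moreover have "bdry Y (n + 1) T (cdf Y n ** x)" unfolding bdry_def
   using cov_id[OF hom_dom[OF h]] comp_id[OF hd] h by fastforce
  ultimately show ?thesis unfolding tb_def using hd Some by auto
 qed
qed

text \<open>\<open>r\<close> presents the values of the functor \<open>G\<close> as subquotients of those of \<open>F\<close>.\<close>

definition frel :: "('p, 'm::ab_group_add) dgcat => ('p, 'm, 'o, 'a) cfun => ('p, 'm, 'o, 'a) cfun =>
  ('p => int => 'o => 'a => 'a => bool) => bool" where
 "frel C F G r \<longleftrightarrow> (ALL P:dobj C. ALL n. pres (Fo F P n) (Fo G P n) (r P n) &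
    hom (Fd G P n) (Fo G P n) (Fo G P (n + 1)) &
    (ALL T x t. r P n T x t --> r P (n + 1) T (Fd F P n ** x) (Fd G P n ** t))) &
   (ALL P:dobj C. ALL Q:dobj C. ALL i. ALL f:dhom C i P Q. ALL n.
    hom (fmor G i P Q f n) (Fo G Q n) (Fo G P (n + i)) &
    (ALL T x t. r Q n T x t --> r P (n + i) T (fmor F i P Q f n ** x) (fmor G i P Q f n ** t)))"

lemma frelD:
 assumes "frel C F G r"
 shows "P : dobj C ==> pres (Fo F P n) (Fo G P n) (r P n)"
  and "P : dobj C ==> hom (Fd G P n) (Fo G P n) (Fo G P (n + 1))"
  and "P : dobj C ==> r P n T x t ==> r P (n + 1) T (Fd F P n ** x) (Fd G P n ** t)"
  and "P : dobj C ==> Q : dobj C ==> f : dhom C i P Q ==> hom (fmor G i P Q f n) (Fo G Q n) (Fo G P (n + i))"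
  and "P : dobj C ==> Q : dobj C ==> f : dhom C i P Q ==> r Q n T x t ==>
   r P (n + i) T (fmor F i P Q f n ** x) (fmor G i P Q f n ** t)"
 using assms unfolding frel_def by blast+

text \<open>Both functors are presented as subquotients of the same \<open>F\<close>; a family of
  arrows that preserves representatives commutes with everything induced from
  \<open>F\<close>.\<close>

lemma frel_nat:
 assumes r: "frel C F G r" and r': "frel C F G' r'"
  and \<eta>: "\<And>P n. P : dobj C ==> hom (\<eta> P n) (Fo G P n) (Fo G' P n)"
  and rel: "\<And>P n T x t. P : dobj C ==> r P n T x t ==> r' P n T x (\<eta> P n ** t)"
 shows "dg_transformation C A G G' \<eta>"
 unfolding dg_transformation_def
proof (intro conjI ballI allI)
 fix P assume P: "P : dobj C"
 note d = frelD(2,3)[OF r P] and d' = frelD(2,3)[OF r' P]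
 show "chain_map A (fob G P) (fob G' P) (\<eta> P)"
 proof (rule chain_mapI[OF \<eta>[OF P]])
  fix n
  show "Fd G' P n ** \<eta> P n = \<eta> P (n + 1) ** Fd G P n"
  proof (rule pres_eq[OF frelD(1)[OF r P] hom_comp[OF \<eta>[OF P] d'(1)] hom_comp[OF d(1) \<eta>[OF P]]])
   fix T x t assume a: "r P n T x t"
   note t = pres_hom2[OF frelD(1)[OF r P] a]
   show "Fd G' P n ** \<eta> P n ** t = \<eta> P (n + 1) ** Fd G P n ** t"
    unfolding assoc[OF t \<eta>[OF P] d'(1)] assoc[OF t d(1) \<eta>[OF P]]
    using pres_uniq[OF frelD(1)[OF r' P] d'(2)[OF rel[OF P a]] rel[OF P d(2)[OF a]]] .
  qed
 qed
 fix i Q f n assume Q: "Q : dobj C" and f: "f : dhom C i P Q"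
 note m = frelD(4,5)[OF r P Q f] and m' = frelD(4,5)[OF r' P Q f]
 show "\<eta> P (n + i) ** fmor G i P Q f n = fmor G' i P Q f n ** \<eta> Q n"
 proof (rule pres_eq[OF frelD(1)[OF r Q] hom_comp[OF m(1) \<eta>[OF P]] hom_comp[OF \<eta>[OF Q] m'(1)]])
  fix T x t assume a: "r Q n T x t"
  note t = pres_hom2[OF frelD(1)[OF r Q] a]
  show "\<eta> P (n + i) ** fmor G i P Q f n ** t = fmor G' i P Q f n ** \<eta> Q n ** t"
   unfolding assoc[OF t m(1) \<eta>[OF P]] assoc[OF t \<eta>[OF Q] m'(1)]
   using pres_uniq[OF frelD(1)[OF r' P] rel[OF P m(2)[OF a]] m'(2)[OF rel[OF Q a]]] .
 qed
qed

lemma frel_id: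
 assumes cf: "contra_dg_functor C A F"
 shows "frel C F F (\<lambda>P n T x t. hom x T (Fo F P n) & t = x)"
proof -
 have "pres Y Y (\<lambda>T x t. hom x T Y & t = x)" if Y: "Y : obj A" for Y
  using SQ_pres[OF SQ_whole[OF Y]] unfolding sqr_whole[OF Y, abs_def] by (simp add: whole_def)
 note p = this[OF cpx_ob[OF cf_cpx[OF cf]]]
 note d = cpx_hom_d[OF cf_cpx[OF cf]] and m = cf_hom[OF cf]
 show ?thesis unfolding frel_def
  by (intro conjI ballI allI impI) (simp_all add: p d m hom_comp[OF _ d] hom_comp[OF _ m])
qed

lemma pres_sum:
 assumes p: "pres Y Q \<rho>" and T: "T : obj A" and r: "\<And>j. j : L ==> \<rho> T (x j) (t j)"
 shows "\<rho> T (\<Sum>j\<in>L. x j) (\<Sum>j\<in>L. t j)"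
 using r by (induction L rule: infinite_finite_induct) (simp_all add: pres_zero[OF p T] pres_add[OF p])

definition BR :: "('p, 'm::ab_group_add, 'o, 'a) cfun => ('p, 'm, 'o, 'a) cfun => ('p => int => 'o => 'a => 'a => bool) =>
  int set => ('p, 'm) tw => int => 'o => 'a => 'a => bool" where
 "BR F G r S X n = brel S (\<lambda>i. r (fst X i) (n + i)) (tS F S X n) (tS G S X n)"

lemma BR_iff: "BR F G r S X n T x t \<longleftrightarrow> hom x T (cob (ttot F S X) n) & hom t T (cob (ttot G S X) n) &
  (ALL i:S. r (fst X i) (n + i) T (tP F S X n i ** x) (tP G S X n i ** t))"
 unfolding BR_def brel_def by (simp add: ttot_def)

section \<open>Total complexes of functors presented by subquotients of \<open>F\<close>\<close>

context
 fixes C :: "('p, 'm::ab_group_add) dgcat" and F G I r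
 assumes kF: "kills C I F" and kG: "kills C I G" and fr: "frel C F G r"
begin

context
 fixes S X assumes X: "twok C I S X"
begin

lemma BR_pres: "pres (cob (ttot F S X) n) (cob (ttot G S X) n) (BR F G r S X n)"
 unfolding BR_def cob_ttot[OF kF] cob_ttot[OF kG]
 by (rule pres_brel[OF tS_bip[OF kF X] tS_bip[OF kG X] frelD(1)[OF fr twok_simps(2)[OF kF X]]])

lemma BR_dom: "(EX t. BR F G r S X n T x t) \<longleftrightarrow> hom x T (cob (ttot F S X) n) & (ALL i:S. EX t. r (fst X i) (n + i) T (tP F S X n i ** x) t)"
 unfolding BR_def cob_ttot[OF kF]
 by (rule brel_dom[OF tS_bip[OF kF X] tS_bip[OF kG X] frelD(1)[OF fr twok_simps(2)[OF kF X]]])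

lemma BR_zero: "BR F G r S X n T x 0 \<longleftrightarrow> hom x T (cob (ttot F S X) n) & (ALL i:S. r (fst X i) (n + i) T (tP F S X n i ** x) 0)"
 unfolding BR_def cob_ttot[OF kF] by (rule brel_zero[OF tS_bip[OF kF X] tS_bip[OF kG X]])

lemma BR_d:
 assumes a: "BR F G r S X n T x t"
 shows "BR F G r S X (n + 1) T (cdf (ttot F S X) n ** x) (cdf (ttot G S X) n ** t)"
 unfolding BR_iff
proof (intro conjI ballI)
 note o = twok_simps(2)[OF kF X] and s = twok_simps(3)[OF kF X]
 have x: "hom x T (cob (ttot F S X) n)" and t: "hom t T (cob (ttot G S X) n)"
  and c: "\<And>i. i : S ==> r (fst X i) (n + i) T (tP F S X n i ** x) (tP G S X n i ** t)" using a unfolding BR_iff by auto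
 show "hom (cdf (ttot F S X) n ** x) T (cob (ttot F S X) (n + 1))" using hom_comp[OF x ttot_d(1)[OF kF X]] .
 show "hom (cdf (ttot G S X) n ** t) T (cob (ttot G S X) (n + 1))" using hom_comp[OF t ttot_d(1)[OF kG X]] .
 fix i assume i: "i : S"
 have e: "n + 1 + i = n + i + 1" by simp
 note p = frelD(1)[OF fr o, of i "n + i + 1"]
 have q: "r (fst X i) (n + i + 1) T (qq F X i j n ** (tP F S X n j ** x)) (qq G X i j n ** (tP G S X n j ** t))" if j: "j : S" for j
 proof -
  have e: "n + j + (i - j + 1) = n + i + 1" by simp
  show ?thesis using frelD(5)[OF fr o o s c[OF j], of i] unfolding qq_def[OF kF] qq_def[OF kG] e .
 qed
 have "r (fst X i) (n + i + 1) T (dd F X i n ** (tP F S X n i ** x)) (dd G X i n ** (tP G S X n i ** t))"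
  unfolding dd_def[OF kF] dd_def[OF kG] using frelD(3)[OF fr o c[OF i]] .
 note D = this
 have "r (fst X i) (n + i + 1) T (\<Sum>j\<in>S. qq F X i j n ** (tP F S X n j ** x)) (\<Sum>j\<in>S. qq G X i j n ** (tP G S X n j ** t))"
  by (rule pres_sum[OF p hom_dom[OF x] q])
 from pres_ksgn[OF p pres_diff[OF p D this]]
 show "r (fst X i) (n + 1 + i) T (tP F S X (n + 1) i ** (cdf (ttot F S X) n ** x)) (tP G S X (n + 1) i ** (cdf (ttot G S X) n ** t))"
  unfolding e ttot_d(2)[OF kF X x i] ttot_d(2)[OF kG X t i] .
qed

end

lemma BR_tmap:
 assumes X: "twok C I S X" and X': "twok C I S' X'" and f: "f : tw_hom C 0 X X'" and a: "BR F G r S' X' n T x t"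
 shows "BR F G r S X n T (tmap F S S' X X' f n ** x) (tmap G S S' X X' f n ** t)"
 unfolding BR_iff
proof (intro conjI ballI)
 note m = tmap_spec[OF kF X X' f] and m' = tmap_spec[OF kG X X' f]
 have x: "hom x T (cob (ttot F S' X') n)" and t: "hom t T (cob (ttot G S' X') n)"
  and c: "\<And>i. i : S' ==> r (fst X' i) (n + i) T (tP F S' X' n i ** x) (tP G S' X' n i ** t)" using a unfolding BR_iff by auto
 show "hom (tmap F S S' X X' f n ** x) T (cob (ttot F S X) n)" using hom_comp[OF x m(1)] .
 show "hom (tmap G S S' X X' f n ** t) T (cob (ttot G S X) n)" using hom_comp[OF t m'(1)] .
 fix i assume i: "i : S"
 note o = twok_simps(2)[OF kF X] and o' = twok_simps(2)[OF kF X']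
 have q: "r (fst X i) (n + i) T (ff F X X' f i j n ** (tP F S' X' n j ** x)) (ff G X X' f i j n ** (tP G S' X' n j ** t))" if j: "j : S'" for j
 proof -
  have e: "n + j + (i - j) = n + i" by simp
  have "f i j : dhom C (i - j) (fst X i) (fst X' j)" using f unfolding tw_hom_def by simp
  from frelD(5)[OF fr o o' this c[OF j]] show ?thesis unfolding ff_def[OF kF] ff_def[OF kG] e .
 qed
 show "r (fst X i) (n + i) T (tP F S X n i ** (tmap F S S' X X' f n ** x)) (tP G S X n i ** (tmap G S S' X X' f n ** t))"
  unfolding m(2)[OF x i] m'(2)[OF t i] by (rule pres_sum[OF frelD(1)[OF fr o] hom_dom[OF x] q])
qed

lemma BR_tnat:
 assumes kG': "kills C I G'" and X: "twok C I S X"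
  and \<eta>: "\<And>P n. P : dobj C ==> hom (\<eta> P n) (Fo G P n) (Fo G' P n)"
  and rel: "\<And>P n T x t. P : dobj C ==> r P n T x t ==> r' P n T x (\<eta> P n ** t)" and a: "BR F G r S X n T x t"
 shows "BR F G' r' S X n T x (tnat G G' \<eta> S X n ** t)"
proof -
 note s = tnat_spec[OF kG kG' X \<eta>]
 have t: "hom t T (cob (ttot G S X) n)" using a unfolding BR_iff by blast
 show ?thesis using a hom_comp[OF t s(1)] rel[OF twok_simps(2)[OF kF X]] unfolding BR_iff by (simp add: s(2)[OF _ t])
qed

end

section \<open>Truncations of a contravariant dg functor\<close>

lemma tf_simps:
 shows "Fo (trunc_fun A lo b F) P n = quo_ob (trunc_sq A lo b (fob F P) n)"
  and "Fd (trunc_fun A lo b F) P n = sq_map A (trunc_sq A lo b (fob F P) n) (trunc_sq A lo b (fob F P) (n + 1)) (Fd F P n)"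
  and "fmor (trunc_fun A lo b F) i P Q f n =
   sq_map A (trunc_sq A lo b (fob F Q) n) (trunc_sq A lo b (fob F P) (n + i)) (fmor F i P Q f n)"
 by (simp_all add: trunc_fun_def trunc_cpx_def)

context
 fixes C :: "('p, 'm::ab_group_add) dgcat" and F :: "('p, 'm, 'o, 'a) cfun"
 assumes cf: "contra_dg_functor C A F" and neg: "neg_dg C"
begin

lemma cf_pos: "P : dobj C ==> Q : dobj C ==> f : dhom C i P Q ==> i > 0 ==> fmor F i P Q f n = 0"
 using neg cf_zero[OF cf] unfolding neg_dg_def by force

text \<open>The differential of a morphism of degree 0 has degree 1 and is therefore zero, so
  \<open>F\<close> sends the morphism to a chain map.\<close>

lemma cf_0:
 assumes PQ: "P : dobj C" "Q : dobj C" and f: "f : dhom C 0 P Q" and x: "hom x T (Fo F Q n)"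
 shows "Fd F P n ** (fmor F 0 P Q f n ** x) = fmor F 0 P Q f (n + 1) ** (Fd F Q n ** x)"
proof -
 have "fmor F (0 + 1) P Q (ddiff C 0 P Q f) n = 0" by (rule cf_pos[OF PQ dg_diff[OF cf_cat[OF cf] PQ f]]) simp
 hence "Fd F P n ** fmor F 0 P Q f n = fmor F 0 P Q f (n + 1) ** Fd F Q n"
  using cf_diff[OF cf PQ f, of n] by (simp add: ksgn_even)
 moreover have "hom (fmor F 0 P Q f n) (Fo F Q n) (Fo F P n)" for n using cf_hom[OF cf PQ f] by simp
 ultimately show ?thesis
  using assoc[OF x _ cpx_hom_d[OF cf_cpx[OF cf PQ(1)]]] assoc[OF x cpx_hom_d[OF cf_cpx[OF cf PQ(2)]]] by metis
qed

text \<open>Morphisms of positive degree act by zero. So an element of degree at most b can have a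
  non-zero image in degree b only if it sits in degree b and i = 0, and there cocycles go to
  cocycles by \<open>cf_0\<close>.\<close>

lemma cf_tz:
 assumes PQ: "P : dobj C" "Q : dobj C" and f: "f : dhom C i P Q" and x: "tz lo b (fob F Q) n T x"
 shows "tz lo b (fob F P) (n + i) T (fmor F i P Q f n ** x)"
proof -
 have h: "hom x T (Fo F Q n)" using x unfolding tz_def by blast
 note hf = cf_hom[OF cf PQ f] and d = cpx_hom_d[OF cf_cpx[OF cf PQ(1)]]
 have z: "fmor F i P Q f n ** x = 0" if "x = 0 \<or> i > 0"
  using that comp_zero[OF hom_dom[OF h] hf] zero_comp[OF h hom_cod[OF hf]] cf_pos[OF PQ f] by auto
 have cz: "Fd F P (n + i) ** 0 = 0" using comp_zero[OF hom_dom[OF h] d] .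
 have "Fd F P (n + i) ** (fmor F i P Q f n ** x) = 0" if e: "n + i = b"
 proof (cases "x = 0 \<or> i > 0")
  case False
  hence "n = b" "i = 0" "Fd F Q n ** x = 0" using x e unfolding tz_def by auto
  thus ?thesis using cf_0[OF PQ _ h, of f] f comp_zero[OF hom_dom[OF h] cf_hom[OF cf PQ f]] by simp
 qed (use z cz in auto)
 moreover have "fmor F i P Q f n ** x = 0" if "n + i > b \<or> (EX a. lo = Some a & b < a)"
  using that x z unfolding tz_def by (cases "i > 0") auto
 ultimately show ?thesis unfolding tz_def using hom_comp[OF h hf] by blast
qed

text \<open>Dually, an element of the denominator can have a non-zero image in degree a only if it
  sits in degree a and i = 0, where boundaries go to boundaries.\<close>

lemma cf_tb:
 assumes PQ: "P : dobj C" "Q : dobj C" and f: "f : dhom C i P Q" and x: "tb lo (fob F Q) n T x"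
 shows "tb lo (fob F P) (n + i) T (fmor F i P Q f n ** x)"
proof -
 have h: "hom x T (Fo F Q n)" using x unfolding tb_def by blast
 note hf = cf_hom[OF cf PQ f]
 have z: "fmor F i P Q f n ** x = 0" if "x = 0 \<or> i > 0"
  using that comp_zero[OF hom_dom[OF h] hf] zero_comp[OF h hom_cod[OF hf]] cf_pos[OF PQ f] by auto
 show ?thesis
 proof (cases lo)
  case None
  thus ?thesis using x z hom_comp[OF h hf] unfolding tb_def by simp
 next
  case (Some a)
  have "fmor F i P Q f n ** x = 0" if "n + i > a" using that x z Some unfolding tb_def by (cases "i > 0") auto
  moreover have "bdry (fob F P) (n + i) T (fmor F i P Q f n ** x)" if e: "n + i = a"
  proof (cases "x = 0 \<or> i > 0")
   case True
   thus ?thesis using z bdry_zero[OF cf_cpx[OF cf PQ(1)] hom_dom[OF h]] by simp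
  next
   case False
   hence i: "i = 0" and b: "bdry (fob F Q) n T x" using x e Some unfolding tb_def by auto
   obtain T' e u where e: "cov e T' T" and u: "hom u T' (Fo F Q (n - 1))" and xe: "x ** e = Fd F Q (n - 1) ** u"
    using b unfolding bdry_def by blast
   have f0: "f : dhom C 0 P Q" using f i by simp
   have u': "hom (fmor F 0 P Q f (n - 1) ** u) T' (Fo F P (n - 1))" using hom_comp[OF u cf_hom[OF cf PQ f0]] by simp
   have "fmor F 0 P Q f n ** x ** e = Fd F P (n - 1) ** (fmor F 0 P Q f (n - 1) ** u)"
    using assoc[OF cov_hom[OF e] h cf_hom[OF cf PQ f0]] xe cf_0[OF PQ f0 u] by simp
   thus ?thesis unfolding bdry_def using e u' i by auto
  qed
  ultimately show ?thesis unfolding tb_def using hom_comp[OF h hf] Some by simp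
 qed
qed

abbreviation (input) "TF lo b \<equiv> trunc_fun A lo b F"
abbreviation (input) "tr lo b P n \<equiv> sqr (trunc_sq A lo b (fob F P) n)"

lemma tr_pres: "P : dobj C ==> pres (Fo F P n) (Fo (TF lo b) P n) (tr lo b P n)"
 unfolding tf_simps using SQ_pres[OF trunc_SQ(1)[OF cf_cpx[OF cf]]] .

lemma tf_d:
 assumes P: "P : dobj C"
 shows "hom (Fd (TF lo b) P n) (Fo (TF lo b) P n) (Fo (TF lo b) P (n + 1))"
  and "tr lo b P n T x t ==> tr lo b P (n + 1) T (Fd F P n ** x) (Fd (TF lo b) P n ** t)"
 unfolding tf_simps using trunc_map[OF cf_cpx[OF cf P] cf_cpx[OF cf P] cpx_hom_d[OF cf_cpx[OF cf P]] d_tz d_tb] cf_cpx[OF cf P] by blast+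

lemma tf_m:
 assumes PQ: "P : dobj C" "Q : dobj C" and f: "f : dhom C i P Q"
 shows "hom (fmor (TF lo b) i P Q f n) (Fo (TF lo b) Q n) (Fo (TF lo b) P (n + i))"
  and "tr lo b Q n T x t ==> tr lo b P (n + i) T (fmor F i P Q f n ** x) (fmor (TF lo b) i P Q f n ** t)"
 unfolding tf_simps
 using trunc_map[OF cf_cpx[OF cf PQ(2)] cf_cpx[OF cf PQ(1)] cf_hom[OF cf PQ f] cf_tz[OF PQ f] cf_tb[OF PQ f]] by blast+

text \<open>Arrows between truncations agree if both represent the same arrow \<open>\<phi>\<close>
  of untruncated terms; each equation required of the truncated functor is an instance.\<close>

lemma tf_eqI:
 assumes P: "P : dobj C" and Q: "Q : dobj C" and \<alpha>: "hom \<alpha> (Fo (TF lo b) P n) (Fo (TF lo b) Q k)"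
  and \<beta>: "hom \<beta> (Fo (TF lo b) P n) (Fo (TF lo b) Q k)"
  and eq: "\<And>T x t. tr lo b P n T x t ==> tr lo b Q k T (\<phi> ** x) (\<alpha> ** t) & tr lo b Q k T (\<phi> ** x) (\<beta> ** t)"
 shows "\<alpha> = \<beta>"
proof (rule pres_eq[OF tr_pres[OF P] \<alpha> \<beta>])
 fix T x t assume "tr lo b P n T x t"
 from eq[OF this] show "\<alpha> ** t = \<beta> ** t" using pres_uniq[OF tr_pres[OF Q]] by blast
qed

lemma trunc_fun_functor: "contra_dg_functor C A (TF lo b)"
 unfolding contra_dg_functor_def
proof (intro conjI ballI allI)
 note o = cpx_ob[OF cf_cpx[OF cf]]
 have ot: "Fo (TF lo b) P n : obj A" if "P : dobj C" for P n using pres_ob2[OF tr_pres[OF that]] .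
 show "dg_category C" using cf_cat[OF cf] .
 fix P assume P: "P : dobj C"
 note d = tf_d[OF P, of lo b]
 show "is_complex A (fob (TF lo b) P)" unfolding is_complex_def
 proof (intro conjI allI)
  fix n
  show "Fo (TF lo b) P n : obj A" "Fd (TF lo b) P n : arr A (Fo (TF lo b) P n) (Fo (TF lo b) P (n + 1))"
   using ot[OF P] hom_arr[OF d(1)] by auto
  show "Fd (TF lo b) P (n + 1) ** Fd (TF lo b) P n = 0"
  proof (rule tf_eqI[OF P P hom_comp[OF d(1) d(1)] hom_zero[OF ot[OF P] ot[OF P]], where \<phi> = 0])
   fix T x t assume a: "tr lo b P n T x t"
   have x: "hom x T (Fo F P n)" and t: "hom t T (Fo (TF lo b) P n)"
    using pres_hom1[OF tr_pres[OF P] a] pres_hom2[OF tr_pres[OF P] a] by auto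
   have "tr lo b P (n + 1 + 1) T 0 (Fd (TF lo b) P (n + 1) ** Fd (TF lo b) P n ** t)"
    using d(2)[OF d(2)[OF a]] cpx_ddx[OF cf_cpx[OF cf P] x] assoc[OF t d(1) d(1)] by simp
   thus "tr lo b P (n + 1 + 1) T (0 ** x) (Fd (TF lo b) P (n + 1) ** Fd (TF lo b) P n ** t) &
     tr lo b P (n + 1 + 1) T (0 ** x) (0 ** t)"
    using zero_comp[OF x o[OF P]] zero_comp[OF t ot[OF P]] pres_zero[OF tr_pres[OF P] hom_dom[OF x]] by simp
  qed
 qed
 show "fmor (TF lo b) 0 P P (did C P) n = idt A (Fo (TF lo b) P n)" for n
 proof -
  note m = tf_m[OF P P dg_did[OF cf_cat[OF cf] P], of lo b n, simplified]
  show ?thesis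
  proof (rule tf_eqI[OF P P m(1) hom_id[OF ot[OF P]], where \<phi> = "idt A (Fo F P n)"])
   fix T x t assume a: "tr lo b P n T x t"
   thus "tr lo b P n T (idt A (Fo F P n) ** x) (fmor (TF lo b) 0 P P (did C P) n ** t) &
    tr lo b P n T (idt A (Fo F P n) ** x) (idt A (Fo (TF lo b) P n) ** t)"
    using m(2)[OF a] cf_id[OF cf P] id_comp[OF pres_hom1[OF tr_pres[OF P] a]] id_comp[OF pres_hom2[OF tr_pres[OF P] a]] by simp
  qed
 qed
 fix i Q f assume Q: "Q : dobj C" and f: "f : dhom C i P Q"
 note hf = cf_hom[OF cf P Q] and dQ = tf_d[OF Q, of lo b]
 note m = tf_m[OF P Q f, of lo b]
 show "fmor (TF lo b) i P Q f : cpx_hom A i (fob (TF lo b) Q) (fob (TF lo b) P)" unfolding cpx_hom_def using hom_arr[OF m(1)] by blast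
 show "fmor (TF lo b) i P Q (f + g) n = fmor (TF lo b) i P Q f n + fmor (TF lo b) i P Q g n" if g: "g : dhom C i P Q" for g n
 proof -
  have fg: "f + g : dhom C i P Q" using subgrp_add[OF dg_subgrp[OF cf_cat[OF cf] P Q] f g] .
  note mg = tf_m[OF P Q g, of lo b] and mfg = tf_m[OF P Q fg, of lo b]
  show ?thesis
  proof (rule tf_eqI[OF Q P mfg(1) hom_add[OF m(1) mg(1)], where \<phi> = "fmor F i P Q (f + g) n"])
   fix T x t assume a: "tr lo b Q n T x t"
   show "tr lo b P (n + i) T (fmor F i P Q (f + g) n ** x) (fmor (TF lo b) i P Q (f + g) n ** t) &
    tr lo b P (n + i) T (fmor F i P Q (f + g) n ** x) ((fmor (TF lo b) i P Q f n + fmor (TF lo b) i P Q g n) ** t)"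
    using mfg(2)[OF a] pres_add[OF tr_pres[OF P] m(2)[OF a] mg(2)[OF a]] cf_add[OF cf P Q f g]
     add_comp[OF pres_hom1[OF tr_pres[OF Q] a] hf[OF f] hf[OF g]] add_comp[OF pres_hom2[OF tr_pres[OF Q] a] m(1) mg(1)] by simp
  qed
 qed
 have e: "n + i + 1 = n + (i + 1)" "n + 1 + i = n + (i + 1)" for n by auto
 show "fmor (TF lo b) (i + 1) P Q (ddiff C i P Q f) n = cpx_diff A i (fob (TF lo b) Q) (fob (TF lo b) P) (fmor (TF lo b) i P Q f) n" for n
  unfolding cpx_diff_def
 proof -
  note df = dg_diff[OF cf_cat[OF cf] P Q f]
  note md = tf_m[OF P Q df, of lo b]
  have h1: "hom (Fd (TF lo b) P (n + i) ** fmor (TF lo b) i P Q f n) (Fo (TF lo b) Q n) (Fo (TF lo b) P (n + (i + 1)))"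
   using hom_comp[OF m(1) d(1), of n] unfolding e .
  have h2: "hom (fmor (TF lo b) i P Q f (n + 1) ** Fd (TF lo b) Q n) (Fo (TF lo b) Q n) (Fo (TF lo b) P (n + (i + 1)))"
   using hom_comp[OF dQ(1) m(1), of n] unfolding e .
  show "fmor (TF lo b) (i + 1) P Q (ddiff C i P Q f) n =
   Fd (TF lo b) P (n + i) ** fmor (TF lo b) i P Q f n - ksgn i (fmor (TF lo b) i P Q f (n + 1) ** Fd (TF lo b) Q n)"
  proof (rule tf_eqI[OF Q P md(1) hom_diff[OF h1 hom_ksgn[OF h2]], where \<phi> = "fmor F (i + 1) P Q (ddiff C i P Q f) n"])
   fix T x t assume a: "tr lo b Q n T x t"
   have x: "hom x T (Fo F Q n)" and t: "hom t T (Fo (TF lo b) Q n)"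
    using pres_hom1[OF tr_pres[OF Q] a] pres_hom2[OF tr_pres[OF Q] a] by auto
   note dF = cpx_hom_d[OF cf_cpx[OF cf]]
   have k1: "hom (Fd F P (n + i) ** fmor F i P Q f n) (Fo F Q n) (Fo F P (n + (i + 1)))"
    using hom_comp[OF hf[OF f] dF[OF P], of n] unfolding e .
   have k2: "hom (fmor F i P Q f (n + 1) ** Fd F Q n) (Fo F Q n) (Fo F P (n + (i + 1)))"
    using hom_comp[OF dF[OF Q] hf[OF f], of n] unfolding e .
   have X: "fmor F (i + 1) P Q (ddiff C i P Q f) n ** x =
    Fd F P (n + i) ** (fmor F i P Q f n ** x) - ksgn i (fmor F i P Q f (n + 1) ** (Fd F Q n ** x))"
    unfolding cf_diff[OF cf P Q f] diff_comp[OF x k1 hom_ksgn[OF k2]] ksgn_comp[OF x k2]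
     assoc[OF x hf[OF f] dF[OF P]] assoc[OF x dF[OF Q] hf[OF f]] ..
   have Y: "(Fd (TF lo b) P (n + i) ** fmor (TF lo b) i P Q f n - ksgn i (fmor (TF lo b) i P Q f (n + 1) ** Fd (TF lo b) Q n)) ** t =
    Fd (TF lo b) P (n + i) ** (fmor (TF lo b) i P Q f n ** t) - ksgn i (fmor (TF lo b) i P Q f (n + 1) ** (Fd (TF lo b) Q n ** t))"
    unfolding diff_comp[OF t h1 hom_ksgn[OF h2]] ksgn_comp[OF t h2] assoc[OF t m(1) d(1)] assoc[OF t dQ(1) m(1)] ..
   have 1: "tr lo b P (n + (i + 1)) T (Fd F P (n + i) ** (fmor F i P Q f n ** x)) (Fd (TF lo b) P (n + i) ** (fmor (TF lo b) i P Q f n ** t))"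
    using d(2)[OF m(2)[OF a]] unfolding e .
   have 2: "tr lo b P (n + (i + 1)) T (fmor F i P Q f (n + 1) ** (Fd F Q n ** x)) (fmor (TF lo b) i P Q f (n + 1) ** (Fd (TF lo b) Q n ** t))"
    using m(2)[OF dQ(2)[OF a]] unfolding e .
   show "tr lo b P (n + (i + 1)) T (fmor F (i + 1) P Q (ddiff C i P Q f) n ** x) (fmor (TF lo b) (i + 1) P Q (ddiff C i P Q f) n ** t) &
    tr lo b P (n + (i + 1)) T (fmor F (i + 1) P Q (ddiff C i P Q f) n ** x)
     ((Fd (TF lo b) P (n + i) ** fmor (TF lo b) i P Q f n - ksgn i (fmor (TF lo b) i P Q f (n + 1) ** Fd (TF lo b) Q n)) ** t)"
    using md(2)[OF a] pres_diff[OF tr_pres[OF P] 1 pres_ksgn[OF tr_pres[OF P] 2]] unfolding X Y by blast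
  qed
 qed
 fix j R g n assume R: "R : dobj C" and g: "g : dhom C j Q R"
 note mg = tf_m[OF Q R g, of lo b] and mc = tf_m[OF P R dg_comp[OF cf_cat[OF cf] P Q R f g], of lo b]
 have e: "n + (i + j) = n + j + i" by simp
 show "fmor (TF lo b) (i + j) P R (dcmp C P Q R i j g f) n = fmor (TF lo b) i P Q f (n + j) ** fmor (TF lo b) j Q R g n"
 proof (rule tf_eqI[OF R P mc(1)[of n, unfolded e] hom_comp[OF mg(1) m(1)], where \<phi> = "fmor F (i + j) P R (dcmp C P Q R i j g f) n"])
  fix T x t assume a: "tr lo b R n T x t"
  have x: "hom x T (Fo F R n)" and t: "hom t T (Fo (TF lo b) R n)"
   using pres_hom1[OF tr_pres[OF R] a] pres_hom2[OF tr_pres[OF R] a] by auto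
  show "tr lo b P (n + j + i) T (fmor F (i + j) P R (dcmp C P Q R i j g f) n ** x) (fmor (TF lo b) (i + j) P R (dcmp C P Q R i j g f) n ** t) &
   tr lo b P (n + j + i) T (fmor F (i + j) P R (dcmp C P Q R i j g f) n ** x) (fmor (TF lo b) i P Q f (n + j) ** fmor (TF lo b) j Q R g n ** t)"
   using mc(2)[OF a, unfolded e] m(2)[OF mg(2)[OF a]] cf_cmp[OF cf P Q R f g] assoc[OF x cf_hom[OF cf Q R g] hf[OF f]] assoc[OF t mg(1) m(1)] by simp
 qed
qed

lemma kills_zero: "kills C zero_ideal F"
 unfolding kills_def zero_ideal_def using cf cf_zero[OF cf] by auto

text \<open>A morphism of degree below -N leaves the interval [a, b]. In degree -N only a map from b
  to a with N = b - a can survive; there F(\<delta> g) x is d (F(g) x) up to a term in d x, and d x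
  = 0 in the top degree b, so the value is a boundary in degree a and is divided out.\<close>

lemma kills_trunc:
 assumes N: "N \<ge> b - a"
 shows "kills C (trunc_ideal C N) (TF (Some a) b)"
 unfolding kills_def
proof (intro conjI allI ballI impI trunc_fun_functor)
 fix i n P Q f assume PQ: "P : dobj C" "Q : dobj C" and f: "f : dhom C i P Q" "f : trunc_ideal C N i P Q"
 note m = tf_m[OF PQ f(1), of "Some a" b]
 show "fmor (TF (Some a) b) i P Q f n = 0"
 proof (rule tf_eqI[OF PQ(2,1) m(1) hom_zero[OF hom_dom[OF m(1)] hom_cod[OF m(1)]], where \<phi> = "fmor F i P Q f n"])
  fix T x t assume a: "tr (Some a) b Q n T x t"
  have x: "tz (Some a) b (fob F Q) n T x" using a trunc_SQ(2)[OF cf_cpx[OF cf PQ(2)]] by blast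
  have h: "hom x T (Fo F Q n)" and t: "hom t T (Fo (TF (Some a) b) Q n)"
   using pres_hom1[OF tr_pres[OF PQ(2)] a] pres_hom2[OF tr_pres[OF PQ(2)] a] by auto
  note hf = hom_comp[OF h cf_hom[OF cf PQ f(1)]]
  have "tb (Some a) (fob F P) (n + i) T (fmor F i P Q f n ** x)"
  proof (cases "fmor F i P Q f n ** x = 0")
   case True
   thus ?thesis unfolding tb_def using hf bdry_zero[OF cf_cpx[OF cf PQ(1)] hom_dom[OF h]] by simp
  next
   case False
   have nb: "n \<le> b" using False x comp_zero[OF hom_dom[OF h] cf_hom[OF cf PQ f(1)]] unfolding tz_def by force
   have iN: "i \<le> - N" using False f(2) cf_zero[OF cf PQ] zero_comp[OF h hom_cod[OF cf_hom[OF cf PQ f(1)]]]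
    unfolding trunc_ideal_def by (auto split: if_splits)
   have "bdry (fob F P) (n + i) T (fmor F i P Q f n ** x)" if e: "n + i = a"
   proof -
    have n: "n = b" "i = - N" using e nb iN N by auto
    obtain g where g: "g : dhom C (i - 1) P Q" "f = ddiff C (i - 1) P Q g"
     using f(2) n unfolding trunc_ideal_def by auto
    have "Fd F Q n ** x = 0" using x n unfolding tz_def by simp
    have e1: "n + (i - 1) = n + i - 1" and e2: "n + 1 + (i - 1) = n + i" by auto
    have G: "hom (fmor F (i - 1) P Q g n) (Fo F Q n) (Fo F P (n + i - 1))" using cf_hom[OF cf PQ g(1), of n] unfolding e1 .
    have dP: "hom (Fd F P (n + i - 1)) (Fo F P (n + i - 1)) (Fo F P (n + i))" using cpx_hom_d'[OF cf_cpx[OF cf PQ(1)]] .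
    have dQ: "hom (Fd F Q n) (Fo F Q n) (Fo F Q (n + 1))" using cpx_hom_d[OF cf_cpx[OF cf PQ(2)]] .
    have G1: "hom (fmor F (i - 1) P Q g (n + 1)) (Fo F Q (n + 1)) (Fo F P (n + i))"
     using cf_hom[OF cf PQ g(1), of "n + 1"] unfolding e2 .
    have "fmor F i P Q f n = Fd F P (n + i - 1) ** fmor F (i - 1) P Q g n - ksgn (i - 1) (fmor F (i - 1) P Q g (n + 1) ** Fd F Q n)"
     using cf_diff[OF cf PQ g(1), of n] g(2) unfolding e1 by simp
    hence "fmor F i P Q f n ** x = Fd F P (n + i - 1) ** (fmor F (i - 1) P Q g n ** x) -
     ksgn (i - 1) (fmor F (i - 1) P Q g (n + 1) ** (Fd F Q n ** x))"
     using diff_comp[OF h hom_comp[OF G dP] hom_ksgn[OF hom_comp[OF dQ G1]]] ksgn_comp[OF h hom_comp[OF dQ G1]]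
      assoc[OF h G dP] assoc[OF h dQ G1] by simp
    hence "fmor F i P Q f n ** x = Fd F P (n + i - 1) ** (fmor F (i - 1) P Q g n ** x)"
     using x n comp_zero[OF hom_dom[OF h] G1] unfolding tz_def by simp
    thus ?thesis unfolding bdry_def using cov_id[OF hom_dom[OF h]] comp_id[OF hf] hom_comp[OF h G] by metis
   qed
   thus ?thesis unfolding tb_def using hf nb iN N by auto
  qed
  hence "tr (Some a) b P (n + i) T (fmor F i P Q f n ** x) 0"
   unfolding trunc_SQ(3)[OF cf_cpx[OF cf PQ(1)]] using cf_tz[OF PQ f(1) x] by blast
  thus "tr (Some a) b P (n + i) T (fmor F i P Q f n ** x) (fmor (TF (Some a) b) i P Q f n ** t) &
   tr (Some a) b P (n + i) T (fmor F i P Q f n ** x) (0 ** t)" using m(2)[OF a] zero_comp[OF t hom_cod[OF m(1)]] by simp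
 qed
qed

lemma frel_trunc: "frel C F (TF lo b) (\<lambda>P n. tr lo b P n)"
 unfolding frel_def by (intro conjI ballI allI impI) (assumption | rule tr_pres tf_d tf_m)+

lemma trunc_nat:
 fixes lo b b'
 assumes b: "b \<le> b'"
 defines "\<eta> \<equiv> \<lambda>P n. sq_map A (trunc_sq A lo b (fob F P) n) (trunc_sq A lo b' (fob F P) n) (idt A (Fo F P n))"
 shows "dg_transformation C A (TF lo b) (TF lo b') \<eta>"
  and "P : dobj C ==> tr lo b P n T x t ==> tr lo b' P n T x (\<eta> P n ** t)"
proof -
 have tz: "tz lo b' (fob F P) n T (idt A (Fo F P n) ** x)" if "P : dobj C" "tz lo b (fob F P) n T x" for P n T x
 proof -
  have "hom x T (Fo F P n)" using that(2) unfolding tz_def by blast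
  thus ?thesis using that(2) b id_comp comp_zero[OF hom_dom cpx_hom_d[OF cf_cpx[OF cf that(1)]]] unfolding tz_def by auto
 qed
 have tb: "tb lo (fob F P) n T (idt A (Fo F P n) ** x)" if "tb lo (fob F P) n T x" for P n T x
 proof -
  have "idt A (Fo F P n) ** x = x" using that id_comp unfolding tb_def by blast
  thus ?thesis using that by simp
 qed
 have \<eta>: "hom (\<eta> P n) (Fo (TF lo b) P n) (Fo (TF lo b') P n)"
   "tr lo b P n T x t ==> tr lo b' P n T x (\<eta> P n ** t)" if P: "P : dobj C" for P n T x t
 proof -
  note c = cf_cpx[OF cf P]
  note m = trunc_map[OF c c hom_id[OF cpx_ob[OF c]] tz[OF P] tb, where n = n and lo = lo]
  show "hom (\<eta> P n) (Fo (TF lo b) P n) (Fo (TF lo b') P n)" unfolding \<eta>_def tf_simps using m(1) by blast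
  assume a: "tr lo b P n T x t"
  show "tr lo b' P n T x (\<eta> P n ** t)" unfolding \<eta>_def using m(2)[OF _ _ a] id_comp[OF pres_hom1[OF tr_pres[OF P] a]] by simp
 qed
 show "P : dobj C ==> tr lo b P n T x t ==> tr lo b' P n T x (\<eta> P n ** t)" using \<eta>(2) .
 show "dg_transformation C A (TF lo b) (TF lo b') \<eta>"
  by (rule frel_nat[OF frel_trunc frel_trunc, where \<eta> = \<eta>]) (rule \<eta>; assumption)+
qed

end


section \<open>The descent filtration\<close>

definition RT :: "('p, 'm::ab_group_add) dgcat => ('p, 'm, 'o, 'a) cfun => ('p, 'm) tw => int option => int => int => 'o => 'a => 'a => bool" where
 "RT C F X lo b n = BR F (trunc_fun A lo b F) (\<lambda>P n. sqr (trunc_sq A lo b (fob F P) n)) (supp0 C X) X n"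

definition Wd :: "('p, 'm::ab_group_add) dgcat => ('p, 'm, 'o, 'a) cfun => ('p, 'm) tw => int => int => 'o => 'a => bool" where
 "Wd C F X b n T x \<longleftrightarrow> hom x T (cob (ttot F (supp0 C X) X) n) &
   (ALL i:supp0 C X. n + i > b --> tP F (supp0 C X) X n i ** x = 0)"

lemma descent_simps:
 shows "amb (dfil C F X) = ttot F (supp0 C X) X"
  and "stage (dfil C F X) b = ttot (trunc_fun A None b F) (supp0 C X) X"
  and "incl (dfil C F X) b = tnat (trunc_fun A None b F) F
    (\<lambda>P n. sq_map A (trunc_sq A None b (fob F P) n) (whole A (Fo F P n)) (idt A (Fo F P n)))
    (supp0 C X) X"
 by (simp_all add: descent_fil_def tot_ttot tot_nat_tnat)

lemma int_bound: "finite (S :: int set) ==> EX m. ALL i:S. \<bar>i\<bar> \<le> m"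
 by (rule exI[of _ "\<Sum>i\<in>S. \<bar>i\<bar>"]) (simp add: member_le_sum)

context
 fixes C :: "('p, 'm::ab_group_add) dgcat" and F :: "('p, 'm, 'o, 'a) cfun"
 assumes cf: "contra_dg_functor C A F" and neg: "neg_dg C"
begin

lemmas kz = kills_zero[OF cf neg] and kzT = kills_zero[OF trunc_fun_functor[OF cf neg] neg]

lemma tw_twok: "X : ob0 C ==> twok C zero_ideal (supp0 C X) X"
 unfolding twok_def tw_obj_def by blast

context
 fixes X assumes X: "X : ob0 C"
begin

private abbreviation (input) "S \<equiv> supp0 C X"
private abbreviation (input) "Mt \<equiv> ttot F (supp0 C X) X"
private abbreviation (input) "Fi \<equiv> dfil C F X"
private abbreviation (input) "pj n i \<equiv> tP F (supp0 C X) X n i"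
private abbreviation (input) "\<eta>i b P n \<equiv> sq_map A (trunc_sq A None b (fob F P) n) (whole A (Fo F P n)) (idt A (Fo F P n))"

lemmas tX = tw_twok[OF X]
lemmas o = twok_simps(2)[OF kz tX] and fS = twok_simps(1)[OF kz tX]
lemmas dM = ttot_d[OF kz tX] and cM = ttot_complex[OF kz tX] and pM = tP_hom[OF kz tX]

lemma RT_pres: "pres (cob Mt n) (cob (ttot (trunc_fun A lo b F) S X) n) (RT C F X lo b n)"
 unfolding RT_def using BR_pres[OF kz kzT frel_trunc[OF cf neg] tX] .

lemma RT_dom: "(EX t. RT C F X lo b n T x t) \<longleftrightarrow> hom x T (cob Mt n) & (ALL i:S. tz lo b (fob F (fst X i)) (n + i) T (pj n i ** x))"
 unfolding RT_def BR_dom[OF kz kzT frel_trunc[OF cf neg] tX] trunc_SQ(2)[OF cf_cpx[OF cf o]] ..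

lemma RT_zero: "RT C F X lo b n T x 0 \<longleftrightarrow> hom x T (cob Mt n) &
  (ALL i:S. tz lo b (fob F (fst X i)) (n + i) T (pj n i ** x) & tb lo (fob F (fst X i)) (n + i) T (pj n i ** x))"
 unfolding RT_def BR_zero[OF kz kzT frel_trunc[OF cf neg] tX] trunc_SQ(3)[OF cf_cpx[OF cf o]] ..

lemma RT_d: "RT C F X lo b n T x t ==> RT C F X lo b (n + 1) T (cdf Mt n ** x) (cdf (ttot (trunc_fun A lo b F) S X) n ** t)"
 unfolding RT_def by (rule BR_d[OF kz kzT frel_trunc[OF cf neg] tX])

lemma \<eta>i_spec:
 assumes P: "P : dobj C"
 shows "hom (\<eta>i b P n) (Fo (trunc_fun A None b F) P n) (Fo F P n)"
  and "sqr (trunc_sq A None b (fob F P) n) T x t ==> hom x T (Fo F P n) & \<eta>i b P n ** t = x"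
proof -
 note c = cf_cpx[OF cf P]
 note ob = cpx_ob[OF c, of n] and s = trunc_SQ[OF c, where n = n and lo = None and b = b]
 have k: "sqr (trunc_sq A None b (fob F P) n) T x t ==> hom x T (Fo F P n)" for T x t using pres_hom1[OF SQ_pres[OF s(1)]] .
 have d: "EX t'. sqr (whole A (Fo F P n)) T (idt A (Fo F P n) ** x) t'" if "sqr (trunc_sq A None b (fob F P) n) T x t" for T x t
  unfolding sqr_whole[OF ob] using id_comp[OF k[OF that]] k[OF that] by simp
 have z: "sqr (whole A (Fo F P n)) T (idt A (Fo F P n) ** x) 0" if "sqr (trunc_sq A None b (fob F P) n) T x 0" for T x
  unfolding sqr_whole[OF ob] using k[OF that] that unfolding s(3) tb_def id_comp[OF k[OF that]] by auto
 note m = sq_map_spec[OF s(1) SQ_whole[OF ob] hom_id[OF ob] d z]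
 show "hom (\<eta>i b P n) (Fo (trunc_fun A None b F) P n) (Fo F P n)"
  unfolding tf_simps using m(1) by (simp add: whole_def)
 assume a: "sqr (trunc_sq A None b (fob F P) n) T x t"
 show "hom x T (Fo F P n) & \<eta>i b P n ** t = x"
  using m(2)[OF _ _ a] k[OF a] id_comp[OF k[OF a]] unfolding sqr_whole[OF ob] by auto
qed

lemma stage_complex: "is_complex A (stage Fi b)"
 unfolding descent_simps using ttot_complex[OF kzT tX] .

lemma incl_hom: "hom (incl Fi b n) (cob (stage Fi b) n) (cob Mt n)"
 unfolding descent_simps using tnat_spec(1)[OF kzT kz tX \<eta>i_spec(1)] .

lemma incl_RT:
 assumes a: "RT C F X None b n T x t"
 shows "incl Fi b n ** t = x"
proof -
 have t: "hom t T (cob (stage Fi b) n)" and x: "hom x T (cob Mt n)"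
  using pres_hom2[OF RT_pres a] pres_hom1[OF RT_pres a] unfolding descent_simps by auto
 show ?thesis
 proof (rule ttot_ext[OF kz tX hom_comp[OF t incl_hom] x])
  fix i assume i: "i : S"
  have "sqr (trunc_sq A None b (fob F (fst X i)) (n + i)) T (pj n i ** x) (tP (trunc_fun A None b F) S X n i ** t)"
   using a i unfolding RT_def BR_iff by blast
  from \<eta>i_spec(2)[OF o this] show "pj n i ** (incl Fi b n ** t) = pj n i ** x"
   unfolding descent_simps using tnat_spec(2)[OF kzT kz tX \<eta>i_spec(1) t[unfolded descent_simps] i] by simp
 qed
qed

lemma incl_chain: "chain_map A (stage Fi b) Mt (incl Fi b)"
 unfolding descent_simps
proof (rule tnat_chain[OF kzT kz tX])
 show "dg_transformation C A (trunc_fun A None b F) F (\<eta>i b)"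
  by (rule frel_nat[OF frel_trunc[OF cf neg] frel_id[OF cf], where \<eta> = "\<eta>i b"]) (use \<eta>i_spec in auto)
qed

lemma incl_lift:
 assumes u: "hom u T (cob (stage Fi b) n)"
 shows "EX T' e. cov e T' T & RT C F X None b n T' (incl Fi b n ** u ** e) (u ** e)"
proof -
 obtain T' e y where e: "cov e T' T" and y: "RT C F X None b n T' y (u ** e)"
  using pres_surj[OF RT_pres] u unfolding descent_simps by blast
 have "y = incl Fi b n ** u ** e" using incl_RT[OF y] assoc[OF cov_hom[OF e] u incl_hom] by simp
 thus ?thesis using e y by blast
qed

lemma fG_RT: "fG Fi b n T x \<longleftrightarrow> (EX t. RT C F X None b n T x t)"
proof
 assume "fG Fi b n T x"
 then obtain u where u: "hom u T (cob (stage Fi b) n)" and x: "incl Fi b n ** u = x" unfolding fG_def by blast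
 obtain T' e where "cov e T' T" "RT C F X None b n T' (x ** e) (u ** e)" using incl_lift[OF u] x by blast
 thus "EX t. RT C F X None b n T x t" using pres_dom[OF RT_pres] hom_comp[OF u incl_hom] x by blast
next
 assume "EX t. RT C F X None b n T x t"
 then obtain t where t: "RT C F X None b n T x t" by blast
 thus "fG Fi b n T x" unfolding fG_def using incl_RT[OF t] pres_hom2[OF RT_pres t] unfolding descent_simps by blast
qed

lemma incl_mono: "is_mono A (cob (stage Fi b) n) (incl Fi b n)"
 unfolding mono_iff[OF incl_hom]
proof (intro allI impI)
 fix T u assume "hom u T (cob (stage Fi b) n) & incl Fi b n ** u = 0"
 hence u: "hom u T (cob (stage Fi b) n)" "incl Fi b n ** u = 0" by auto
 obtain T' e where e: "cov e T' T" and r: "RT C F X None b n T' (incl Fi b n ** u ** e) (u ** e)" using incl_lift[OF u(1)] by blast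
 have "incl Fi b n ** u ** e = 0" using u(2) zero_comp[OF cov_hom[OF e] hom_cod[OF incl_hom]] by simp
 thus "u = 0" using pres_0[OF RT_pres] r cov_zero[OF e u(1)] by metis
qed

text \<open>\<open>snd X i j\<close> has degree i - j + 1, hence acts by zero unless j > i; but then
  the component of x with index j has degree n + j > b and vanishes. Only the inner differential is
  left.\<close>

lemma W_pd:
 assumes x: "Wd C F X b n T x" and i: "i : S" and b: "n + i \<ge> b"
 shows "pj (n + 1) i ** (cdf Mt n ** x) = ksgn i (Fd F (fst X i) (n + i) ** (pj n i ** x))"
proof -
 have h: "hom x T (cob Mt n)" using x unfolding Wd_def by blast
 have "qq F X i j n ** (pj n j ** x) = 0" if j: "j : S" for j
 proof (cases "i - j + 1 > 0")
  case True
  thus ?thesis unfolding qq_def[OF kz]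
   using cf_pos[OF cf neg o o twok_simps(3)[OF kz tX]] zero_comp[OF hom_comp[OF h pM[OF j]] hom_cod[OF qq_hom[OF kz tX, of i j n]]] by simp
 next
  case False
  thus ?thesis using x j b comp_zero[OF hom_dom[OF h] qq_hom[OF kz tX]] unfolding Wd_def by simp
 qed
 thus ?thesis unfolding dM(2)[OF h i] dd_def[OF kz] by simp
qed

lemma fG_iff: "fG Fi b n T x \<longleftrightarrow> Wd C F X b n T x & (ALL i:S. n + i = b --> Fd F (fst X i) (n + i) ** (pj n i ** x) = 0)"
 unfolding fG_RT RT_dom tz_def Wd_def using hom_comp[OF _ pM] by auto

lemma Wd_d:
 assumes x: "Wd C F X b n T x"
 shows "Wd C F X (b + 1) (n + 1) T (cdf Mt n ** x)"
proof -
 have h: "hom x T (cob Mt n)" using x unfolding Wd_def by blast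
 have "pj (n + 1) i ** (cdf Mt n ** x) = 0" if "i : S" "n + 1 + i > b + 1" for i
  using W_pd[OF x that(1)] x that comp_zero[OF hom_dom[OF h] cpx_hom_d[OF cf_cpx[OF cf o]]] unfolding Wd_def by simp
 thus ?thesis unfolding Wd_def using hom_comp[OF h dM(1)] by simp
qed

text \<open>By \<open>W_pd\<close>, the condition in \<open>fG_iff\<close> that the components of
  degree b are cocycles says exactly that d x stays in W_b: this is the decalage.\<close>

lemma descent_W: "Wfil Fi (Wd C F X)"
proof -
 have hx: "hom x T (cob Mt n)" if "Wd C F X p n T x" for p n T x using that unfolding Wd_def by blast
 have G: "fG Fi p n T x \<longleftrightarrow> Wd C F X p n T x & Wd C F X p (n + 1) T (cdf Mt n ** x)" for p n T x
 proof (cases "Wd C F X p n T x")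
  case True
  note h = hx[OF True]
  have "Wd C F X p (n + 1) T (cdf Mt n ** x) \<longleftrightarrow> (ALL i:S. n + i \<ge> p --> Fd F (fst X i) (n + i) ** (pj n i ** x) = 0)"
   unfolding Wd_def[of _ _ _ _ "n + 1"] using W_pd[OF True] hom_comp[OF h dM(1)] by auto
  moreover have "Fd F (fst X i) (n + i) ** (pj n i ** x) = 0" if "i : S" "n + i > p" for i
   using True that comp_zero[OF hom_dom[OF h] cpx_hom_d[OF cf_cpx[OF cf o]]] unfolding Wd_def by simp
  ultimately show ?thesis unfolding fG_iff using True by (metis order_le_less)
 qed (simp add: fG_iff)
 have mono: "Wd C F X q n T x" if "p \<le> q" "Wd C F X p n T x" for p q n T x using that unfolding Wd_def by auto
 have ex: "EX u:arr A (cob (stage Fi p) n) (cob (stage Fi (p + 1)) n). incl Fi (p + 1) n ** u = incl Fi p n" for p n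
 proof -
  have "fG Fi p n (cob (stage Fi p) n) (incl Fi p n)" unfolding fG_def
   using hom_id[OF hom_dom[OF incl_hom]] comp_id[OF incl_hom] by blast
  hence "fG Fi (p + 1) n (cob (stage Fi p) n) (incl Fi p n)" unfolding G using mono[of p "p + 1"] by auto
  thus ?thesis unfolding fG_def using hom_arr by blast
 qed
 have f: "is_filtered A Fi" unfolding is_filtered_def
  using cM stage_complex incl_chain incl_mono ex unfolding descent_simps(1) by blast
 show ?thesis unfolding Wfil_def descent_simps(1)
 proof (intro conjI allI ballI impI f G; (elim conjE)?)
  show "Wd C F X p n T x ==> hom x T (cob Mt n)" for p n T x using hx .
  show "Wd C F X p n T' (x ** e)" if w: "Wd C F X p n T x" and e: "hom e T' T" for p n T x T' e
   using w hom_comp[OF e hx[OF w]] assoc[OF e hx[OF w] pM] zero_comp[OF e cpx_ob[OF cf_cpx[OF cf o]]] unfolding Wd_def by metis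
  show "Wd C F X p n T (x - y)" if w: "Wd C F X p n T x" and w': "Wd C F X p n T y" for p n T x y
   using w w' hom_diff[OF hx[OF w] hx[OF w']] comp_diff[OF hx[OF w] hx[OF w'] pM] unfolding Wd_def by simp
  show "Wd C F X p n T 0" if "T : obj A" for p n T
   unfolding Wd_def using hom_zero[OF that cpx_ob[OF cM]] comp_zero[OF that pM] by simp
  show "p \<le> q ==> Wd C F X p n T x ==> Wd C F X q n T x" for p q n T x using mono .
  show "Wd C F X p n T x ==> Wd C F X (p + 1) (n + 1) T (cdf Mt n ** x)" for p n T x using Wd_d .
 qed
qed

text \<open>The support is finite, so in total degree n all components have degrees between n - m
  and n + m.\<close>

lemma descent_bounded: "fbounded Fi"
 unfolding fbounded_def
proof (intro conjI allI)
 show "is_filtered A Fi" using Wfil_fil[OF descent_W] .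
 fix n
 obtain m where m: "ALL i:S. \<bar>i\<bar> \<le> m" using int_bound[OF fS] by blast
 have "x = 0" if p: "p \<le> n - m - 1" and g: "fG Fi p n T x" for p T x
 proof -
  have w: "Wd C F X p n T x" using g fG_iff by blast
  hence x: "hom x T (cob Mt n)" unfolding Wd_def by blast
  show ?thesis
  proof (rule ttot_ext[OF kz tX x hom_zero[OF hom_dom[OF x] hom_cod[OF x]]])
   fix i assume i: "i : S"
   hence "n + i > p" using m p by force
   thus "pj n i ** x = pj n i ** 0" using w i comp_zero[OF hom_dom[OF x] pM[OF i]] unfolding Wd_def by simp
  qed
 qed
 thus "EX p0. ALL p<=p0. ALL T x. fG Fi p n T x --> x = 0" by blast
 have "fG Fi p n T x" if p: "p \<ge> n + m + 1" and x: "hom x T (cob Mt n)" for p T x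
  unfolding fG_iff Wd_def using x m p by force
 thus "EX p1. ALL p>=p1. ALL T x. hom x T (Mo Fi n) --> fG Fi p n T x" unfolding descent_simps by blast
qed

text \<open>In components of degree at least \<open>a\<close>, d w' is the inner differential of a
  component of w' by \<open>W_pd\<close>. So the subcomplex generated by W_(a-1) is given
  componentwise: everything below degree \<open>a\<close>, boundaries in degree \<open>a\<close>,
  zero above.\<close>

lemma Kd_iff:
 "Kfil Fi (Wd C F X) (a - 1) n T x \<longleftrightarrow> hom x T (cob Mt n) & (ALL i:S. tb (Some a) (fob F (fst X i)) (n + i) T (pj n i ** x))"
proof
 assume "Kfil Fi (Wd C F X) (a - 1) n T x"
 then obtain T' e w w' where x: "hom x T (cob Mt n)" and e: "cov e T' T" and w: "Wd C F X (a - 1) n T' w"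
  and w': "Wd C F X (a - 1) (n - 1) T' w'" and xe: "x ** e = w + cdf Mt (n - 1) ** w'" unfolding Kfil_def descent_simps by blast
 have hw: "hom w T' (cob Mt n)" and hw': "hom w' T' (cob Mt (n - 1))" using w w' unfolding Wd_def by auto
 have hd: "hom (cdf Mt (n - 1) ** w') T' (cob Mt n)" using hom_comp[OF hw' cpx_hom_d'[OF cM]] .
 have "tb (Some a) (fob F (fst X i)) (n + i) T (pj n i ** x)" if i: "i : S" for i
 proof -
  note px = hom_comp[OF x pM[OF i]] and c = cf_cpx[OF cf o, of i]
  have en: "n - 1 + i = n + i - 1" by simp
  have pw': "hom (pj (n - 1) i ** w') T' (Fo F (fst X i) (n + i - 1))" using hom_comp[OF hw' pM[OF i]] unfolding en .
  have E: "pj n i ** x ** e = Fd F (fst X i) (n + i - 1) ** ksgn i (pj (n - 1) i ** w')" if "n + i \<ge> a"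
  proof -
   have "pj n i ** x ** e = pj n i ** w + pj n i ** (cdf Mt (n - 1) ** w')"
    using assoc[OF cov_hom[OF e] x pM[OF i]] xe comp_add[OF hw hd pM[OF i]] by simp
   moreover have "pj n i ** (cdf Mt (n - 1) ** w') = ksgn i (Fd F (fst X i) (n + i - 1) ** (pj (n - 1) i ** w'))"
    using W_pd[OF w' i] that by (simp add: algebra_simps)
   ultimately show ?thesis using w i that comp_ksgn[OF pw' cpx_hom_d'[OF c]] unfolding Wd_def by simp
  qed
  have "pj n i ** x = 0" if "n + i > a"
  proof -
   have "pj (n - 1) i ** w' = 0" using w' i that unfolding Wd_def by simp
   thus ?thesis using E that cov_zero[OF e px] comp_zero[OF hom_dom[OF hw] cpx_hom_d'[OF c]] by simp
  qed
  moreover have "bdry (fob F (fst X i)) (n + i) T (pj n i ** x)" if "n + i = a"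
   unfolding bdry_def using E that e hom_ksgn[OF pw'] by (metis order_refl)
  ultimately show ?thesis unfolding tb_def using px by simp
 qed
 thus "hom x T (cob Mt n) & (ALL i:S. tb (Some a) (fob F (fst X i)) (n + i) T (pj n i ** x))" using x by blast
next
 assume "hom x T (cob Mt n) & (ALL i:S. tb (Some a) (fob F (fst X i)) (n + i) T (pj n i ** x))"
 hence x: "hom x T (cob Mt n)" and t: "\<And>i. i : S ==> n + i > a ==> pj n i ** x = 0"
  "\<And>i. i : S ==> n + i = a ==> bdry (fob F (fst X i)) (n + i) T (pj n i ** x)" unfolding tb_def by auto
 show "Kfil Fi (Wd C F X) (a - 1) n T x"
 proof (cases "a - n : S")
  case False
  hence "n + i \<noteq> a" if "i : S" for i using that by (metis add_diff_cancel_left')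
  hence "Wd C F X (a - 1) n T x" unfolding Wd_def using x t(1) by fastforce
  thus ?thesis using Kfil_W[OF descent_W] by blast
 next
  case True
  define i where "i = a - n"
  have i: "i : S" and e: "n + i = a" "n - 1 + i = a - 1" using True by (auto simp: i_def)
  note c = cf_cpx[OF cf o, of i]
  obtain T' e u where ec: "cov e T' T" and u: "hom u T' (Fo F (fst X i) (n + i - 1))" and pe: "pj n i ** x ** e = Fd F (fst X i) (n + i - 1) ** u"
   using t(2)[OF i e(1)] unfolding bdry_def by blast
  have en: "n + i - 1 = n - 1 + i" for i by simp
  \<comment> \<open>The single index with n + i = a carries the boundary; the sign compensates the
    (-1)^i of the total differential.\<close>
  define w' where "w' = tI F S X (n - 1) i ** ksgn i u"
  have ku: "hom (ksgn i u) T' (Fo F (fst X i) (n - 1 + i))" using hom_ksgn[OF u] unfolding en .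
  have hw': "hom w' T' (cob Mt (n - 1))" unfolding w'_def using hom_comp[OF ku tI_hom[OF kz tX i]] .
  have pw': "pj (n - 1) j ** w' = (if j = i then ksgn i u else 0)" if j: "j : S" for j
   unfolding w'_def assoc[OF ku tI_hom[OF kz tX i] pM[OF j], symmetric] bip_comp[OF tS_bip[OF kz tX] j i]
   using id_comp[OF ku] zero_comp[OF ku cpx_ob[OF cf_cpx[OF cf o]]] by simp
  have w': "Wd C F X (a - 1) (n - 1) T' w'" unfolding Wd_def using hw' pw' e(2) by auto
  define w where "w = x ** e - cdf Mt (n - 1) ** w'"
  have xe: "hom (x ** e) T' (cob Mt n)" and dw: "hom (cdf Mt (n - 1) ** w') T' (cob Mt n)"
   using hom_comp[OF cov_hom[OF ec] x] hom_comp[OF hw' cpx_hom_d'[OF cM]] by auto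
  have "pj n j ** w = 0" if j: "j : S" "n + j > a - 1" for j
  proof -
   note cj = cf_cpx[OF cf o, of j]
   have "pj n j ** (cdf Mt (n - 1) ** w') = ksgn j (Fd F (fst X j) (n + j - 1) ** (pj (n - 1) j ** w'))"
    using W_pd[OF w' j(1)] j(2) by (simp add: algebra_simps)
   hence d: "pj n j ** (cdf Mt (n - 1) ** w') = (if j = i then Fd F (fst X i) (n + i - 1) ** u else 0)"
    using pw'[OF j(1)] comp_ksgn[OF u cpx_hom_d'[OF c]] comp_zero[OF hom_dom[OF u] cpx_hom_d'[OF cj]] by (simp add: ksgn_ksgn ksgn_even)
   have "pj n j ** (x ** e) = (if j = i then Fd F (fst X i) (n + i - 1) ** u else 0)"
    using assoc[OF cov_hom[OF ec] x pM[OF j(1)]] pe t(1)[OF j(1)] j(2) e(1) zero_comp[OF cov_hom[OF ec] cpx_ob[OF cj]] by auto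
   thus ?thesis unfolding w_def using comp_diff[OF xe dw pM[OF j(1)]] d by simp
  qed
  hence w: "Wd C F X (a - 1) n T' w" unfolding Wd_def using hom_diff[OF xe dw] w_def by simp
  have "x ** e = w + cdf Mt (n - 1) ** w'" unfolding w_def by simp
  thus ?thesis unfolding Kfil_def descent_simps(1) using x ec w w' by blast
 qed
qed

text \<open>Identifies truncated realizations with the quotients of \<open>TP\<close>: numerators
  agree through \<open>fG_RT\<close> and \<open>RT_dom\<close>, denominators through
  \<open>Kd_iff\<close>. The shift by one between \<open>a\<close> and \<open>c\<close> is that
  between the lowest surviving degree and the last degree divided out.\<close>

lemma treal_TP:
 assumes c: "c = a - 1"
 shows "TP Fi (Wd C F X) b c (ttot (trunc_fun A (Some a) b F) S X) (RT C F X (Some a) b)"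
 unfolding TP_def descent_simps(1) c
proof (intro conjI allI descent_W RT_pres impI)
 show "hom (cdf (ttot (trunc_fun A (Some a) b F) S X) n) (cob (ttot (trunc_fun A (Some a) b F) S X) n)
  (cob (ttot (trunc_fun A (Some a) b F) S X) (n + 1))" for n using ttot_d(1)[OF kzT tX] .
 fix n T x
 show "EX k. RT C F X (Some a) b (n + 1) T (cdf Mt n ** x) (ksgn k (cdf (ttot (trunc_fun A (Some a) b F) S X) n ** t))"
  if "RT C F X (Some a) b n T x t" for t using RT_d[OF that] by (intro exI[of _ 0]) (simp add: ksgn_even)
 show "(EX t. RT C F X (Some a) b n T x t) \<longleftrightarrow> (if a - 1 < b then fG Fi b n T x else T : obj A & x = 0)"
 proof (cases "a - 1 < b")
  case True
  thus ?thesis unfolding fG_RT RT_dom tz_def by auto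
 next
  case False
  have z: "tz (Some a) b (fob F (fst X i)) (n + i) T (pj n i ** x) \<longleftrightarrow> pj n i ** x = 0" if "i : S" "hom x T (cob Mt n)" for i
   unfolding tz_def using False hom_comp[OF that(2) pM[OF that(1)]] comp_zero[OF hom_dom[OF that(2)] cpx_hom_d[OF cf_cpx[OF cf o]]] by auto
  have "x = 0" if x: "hom x T (cob Mt n)" and "ALL i:S. pj n i ** x = 0"
   using ttot_ext[OF kz tX x hom_zero[OF hom_dom[OF x] hom_cod[OF x]]] that comp_zero[OF hom_dom[OF x] pM] by metis
  hence "(EX t. RT C F X (Some a) b n T x t) \<longleftrightarrow> T : obj A & x = 0"
   unfolding RT_dom using z hom_dom hom_zero[OF _ cpx_ob[OF cM]] comp_zero[OF _ pM] by metis
  thus ?thesis using False by simp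
 qed
 assume "a - 1 < b"
 hence "tz (Some a) b (fob F (fst X i)) (n + i) T y" if "tb (Some a) (fob F (fst X i)) (n + i) T y" for i y
 proof -
  have y: "hom y T (Fo F (fst X i) (n + i))" using that unfolding tb_def by blast
  have "Fd F (fst X i) (n + i) ** y = 0" if e: "n + i = b"
  proof (cases "n + i = a")
   case True
   thus ?thesis using \<open>tb _ _ _ _ _\<close> bdry_cycle[OF cf_cpx[OF cf o] y] unfolding tb_def by simp
  next
   case False
   hence "y = 0" using \<open>tb _ _ _ _ _\<close> e \<open>a - 1 < b\<close> unfolding tb_def by simp
   thus ?thesis using comp_zero[OF hom_dom[OF y] cpx_hom_d[OF cf_cpx[OF cf o]]] by simp
  qed
  thus ?thesis using that y \<open>a - 1 < b\<close> unfolding tz_def tb_def by auto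
 qed
 thus "RT C F X (Some a) b n T x 0 \<longleftrightarrow> Kfil Fi (Wd C F X) (a - 1) n T x" unfolding RT_zero Kd_iff by blast
qed

end

end


section \<open>Functoriality\<close>

text \<open>G is determined by W and d, so a chain map that respects W respects G.\<close>

lemma fmapI:
 assumes w: "Wfil Fi W" and w': "Wfil Fi' W'" and c: "chain_map A (amb Fi) (amb Fi') \<phi>"
  and W: "\<And>p n T x. W p n T x ==> W' p n T (\<phi> n ** x)"
 shows "fmap Fi Fi' \<phi>"
 unfolding fmap_def
proof (intro conjI allI impI c)
 show "is_filtered A Fi" "is_filtered A Fi'" using Wfil_fil[OF w] Wfil_fil[OF w'] by auto
 fix p n T x assume "fG Fi p n T x"
 hence x: "W p n T x" "W p (n + 1) T (Md Fi n ** x)" unfolding W_G[OF w] by auto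
 have "Md Fi' n ** (\<phi> n ** x) = \<phi> (n + 1) ** (Md Fi n ** x)"
  using chain_map_dx[OF c wC[OF w] wC[OF w'] W_hom[OF w x(1)]] .
 thus "fG Fi' p n T (\<phi> n ** x)" unfolding W_G[OF w'] using W[OF x(1)] W[OF x(2)] by simp
qed

lemma is_iso_comp:
 assumes "is_iso A X Y f" "is_iso A Y Z g" and o: "X : obj A" "Y : obj A" "Z : obj A"
 shows "is_iso A X Z (g ** f)"
proof -
 obtain f' g' where f: "f' : arr A Y X" "f' ** f = idt A X" "f ** f' = idt A Y"
  and g: "g' : arr A Z Y" "g' ** g = idt A Y" "g ** g' = idt A Z" using assms(1,2) unfolding is_iso_def by blast
 have h: "hom f X Y" "hom g Y Z" "hom f' Y X" "hom g' Z Y" using assms f(1) g(1) unfolding is_iso_def hom_def by auto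
 have "f' ** g' ** (g ** f) = f' ** (g' ** g ** f)" using assoc[OF hom_comp[OF h(1,2)] h(4,3)] assoc[OF h(1,2,4)] by simp
 moreover have "g ** f ** (f' ** g') = g ** (f ** f' ** g')" using assoc[OF hom_comp[OF h(4,3)] h(1,2)] assoc[OF h(4,3,1)] by simp
 ultimately show ?thesis unfolding is_iso_def
  using f g id_comp[OF h(1)] id_comp[OF h(4)] hom_arr[OF hom_comp[OF h(1,2)]] hom_arr[OF hom_comp[OF h(4,3)]] by auto
qed

context
 fixes C :: "('p, 'm::ab_group_add) dgcat" and F :: "('p, 'm, 'o, 'a) cfun"
 assumes cf: "contra_dg_functor C A F" and neg: "neg_dg C"
begin

text \<open>Components of positive degree act by zero; for the others j \<ge> L + i, so a component
  of degree above b is fed only by components of degree above b. The lemma covers maps and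
  homotopies.\<close>

lemma tmL_W:
 assumes X: "X : ob0 C" and X': "X' : ob0 C"
  and f: "f : tw_hom C L X X'" and w: "Wd C F X' b n T x"
 shows "Wd C F X b (n + L) T (tmL L F (supp0 C X) (supp0 C X') X X' f n ** x)"
proof -
 note k = kz[OF cf neg] and t = tX[OF cf neg X] and t' = tX[OF cf neg X']
 note m = tmL_spec[OF k t t' f] and o = twok_simps(2)[OF k t] and o' = twok_simps(2)[OF k t']
 have x: "hom x T (cob (ttot F (supp0 C X') X') n)" using w unfolding Wd_def by blast
 have "fL F L X X' f i j n ** (tP F (supp0 C X') X' n j ** x) = 0"
  if i: "n + L + i > b" and j: "j : supp0 C X'" for i j
 proof (cases "L + i - j > 0")
  case True
  have "f i j : dhom C (L + i - j) (fst X i) (fst X' j)" using f unfolding tw_hom_def by simp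
  thus ?thesis unfolding fL_def[OF k] using cf_pos[OF cf neg o o' _ True]
    zero_comp[OF hom_comp[OF x tP_hom[OF k t' j]] cpx_ob[OF cf_cpx[OF cf o]]] by simp
 next
  case False
  thus ?thesis using w i j comp_zero[OF hom_dom[OF x] fL_hom[OF k t t' f]] unfolding Wd_def by simp
 qed
 thus ?thesis unfolding Wd_def using hom_comp[OF x m(1)] m(2)[OF x] by (simp add: ksgn_def)
qed

lemma tot_map_W:
 assumes "X : ob0 C" "X' : ob0 C" "f : tw_hom C 0 X X'" "Wd C F X' b n T x"
 shows "Wd C F X b n T (tot_map A C F X X' f n ** x)"
 using tmL_W[OF assms] unfolding tot_map_tmap tmap_tmL by simp

lemma tot_map_fmap:
 assumes X: "X : ob0 C" and X': "X' : ob0 C" and f: "f : Tr_mor C zero_ideal X X'"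
 shows "fmap (dfil C F X') (dfil C F X) (tot_map A C F X X' f)"
proof (rule fmapI[OF descent_W[OF cf neg X'] descent_W[OF cf neg X]])
 show "chain_map A (amb (dfil C F X')) (amb (dfil C F X)) (tot_map A C F X X' f)"
  unfolding descent_simps tot_map_tmap using tmap_chain[OF kz[OF cf neg] tX[OF cf neg X] tX[OF cf neg X'] f] .
 show "Wd C F X p n T (tot_map A C F X X' f n ** x)" if "Wd C F X' p n T x" for p n T x
  using tot_map_W[OF X X' _ that] f unfolding Tr_mor_def by blast
qed

lemma tot_nat_fmap:
 assumes cf': "contra_dg_functor C A F'" and \<eta>: "dg_transformation C A F F' \<eta>" and X: "X : ob0 C"
 shows "fmap (dfil C F X) (dfil C F' X) (tot_nat A C F F' \<eta> X)"
proof (rule fmapI[OF descent_W[OF cf neg X] descent_W[OF cf' neg X]])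
 note k = kz[OF cf neg] and k' = kz[OF cf' neg]
 show "chain_map A (amb (dfil C F X)) (amb (dfil C F' X)) (tot_nat A C F F' \<eta> X)"
  unfolding descent_simps tot_nat_tnat using tnat_chain[OF k k' tX[OF cf neg X] \<eta>] .
 note h = dg_trD(1)[OF \<eta> k k']
 fix p n T x assume w: "Wd C F X p n T x"
 hence x: "hom x T (cob (ttot F (supp0 C X) X) n)" unfolding Wd_def by blast
 note s = tnat_spec[OF k k' tX[OF cf neg X] h]
 show "Wd C F' X p n T (tot_nat A C F F' \<eta> X n ** x)"
  using w hom_comp[OF x s(1)] s(2)[OF _ x] comp_zero[OF hom_dom[OF x] h[OF o[OF cf neg X]]] unfolding Wd_def tot_nat_tnat by simp
qed

lemma E_term_simps:
 assumes "X : ob0 C"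
 shows "fst (E_term A C F r i j) X = qE (dfil C F X) r j (i + j)"
 unfolding E_term_def descent_ss_def using ss_of_simps(1)[OF Wfil_fil[OF descent_W[OF cf neg assms]]] by simp

text \<open>Homotopic morphisms of twisted complexes differ by a homotopy respecting W, and
  \<open>ss_map_homotopy\<close> then makes each page a functor on the homotopy category.\<close>

lemma E_term_functor:
 assumes r: "r \<ge> 1"
 shows "tr_functor C zero_ideal A (E_term A C F r i j)"
 unfolding tr_functor_def
proof (intro conjI ballI impI)
 note k = kz[OF cf neg]
 have snd: "snd (E_term A C F r i j) X Y f = ss_map A (dfil C F Y) (dfil C F X) (tot_map A C F X Y f) r i j" for X Y f
  unfolding E_term_def descent_map_def by simp
 fix X assume X: "X : ob0 C"
 note E = E_term_simps[OF X]
 show "fst (E_term A C F r i j) X : obj A"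
  unfolding E using pres_ob2[OF fil_E_pres[OF Wfil_fil[OF descent_W[OF cf neg X]] r]] .
 have id: "tot_map A C F X X (Tr_id C X) n = idt A (Mo (dfil C F X) n)" for n
  unfolding tot_map_tmap descent_simps using tmap_id[OF k tX[OF cf neg X]] .
 have "fmap (dfil C F X) (dfil C F X) (tot_map A C F X X (Tr_id C X))"
 proof (rule fmapI[OF descent_W[OF cf neg X] descent_W[OF cf neg X]])
  show "chain_map A (amb (dfil C F X)) (amb (dfil C F X)) (tot_map A C F X X (Tr_id C X))"
   unfolding id[abs_def] by (rule chain_map_id[OF wC[OF descent_W[OF cf neg X]]])
  show "Wd C F X p n T (tot_map A C F X X (Tr_id C X) n ** x)" if "Wd C F X p n T x" for p n T x
   unfolding id using id_comp[OF W_hom[OF descent_W[OF cf neg X] that]] that by simp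
 qed
 thus "snd (E_term A C F r i j) X X (Tr_id C X) = idt A (fst (E_term A C F r i j) X)"
  unfolding snd E by (rule ss_map_id) (rule id r)+
 fix Y f assume Y: "Y : ob0 C" and f: "f : Tr_mor C zero_ideal X Y"
 note fm = tot_map_fmap[OF X Y f]
 have fh: "f : tw_hom C 0 X Y" using f unfolding Tr_mor_def by blast
 show "snd (E_term A C F r i j) X Y f : arr A (fst (E_term A C F r i j) Y) (fst (E_term A C F r i j) X)"
  unfolding E E_term_simps[OF Y] snd ss_map_fEm[OF fm] using hom_arr[OF fEm_spec(1)[OF fm r]] .
 show "snd (E_term A C F r i j) X Y f = snd (E_term A C F r i j) X Y g" if g: "g : Tr_mor C zero_ideal X Y" and e: "Tr_eq C zero_ideal X Y f g" for g
 proof -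
  have gh: "g : tw_hom C 0 X Y" using g unfolding Tr_mor_def by blast
  obtain h where h: "h : tw_hom C (- 1) X Y" and eq: "\<And>i j. f i j - g i j - tw_diff C zero_ideal (- 1) X Y h i j : zero_ideal (i - j) (fst X i) (fst Y j)"
   using e unfolding Tr_eq_def by blast
  show ?thesis unfolding snd
  proof (rule ss_map_homotopy[OF fm tot_map_fmap[OF X Y g] descent_W[OF cf neg Y] descent_W[OF cf neg X] _ tmL_W[OF X Y h, simplified] _ r])
   fix n
   show "hom (tmL (- 1) F (supp0 C X) (supp0 C Y) X Y h n) (Mo (dfil C F Y) n) (Mo (dfil C F X) (n - 1))"
    unfolding descent_simps using tmL_hom1[OF k tX[OF cf neg X] tX[OF cf neg Y] h] .
   show "tot_map A C F X Y f n - tot_map A C F X Y g n =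
    Md (dfil C F X) (n - 1) ** tmL (- 1) F (supp0 C X) (supp0 C Y) X Y h n +
    tmL (- 1) F (supp0 C X) (supp0 C Y) X Y h (n + 1) ** Md (dfil C F Y) n"
    unfolding descent_simps tot_map_tmap using tmap_homotopic[OF k tX[OF cf neg X] tX[OF cf neg Y] fh gh h eq] .
  qed
 qed
 fix Z g assume Z: "Z : ob0 C" and g: "g : Tr_mor C zero_ideal Y Z"
 have gh: "g : tw_hom C 0 Y Z" using g unfolding Tr_mor_def by blast
 note gm = tot_map_fmap[OF Y Z g] and tc = tmap_comp[OF k tX[OF cf neg X] tX[OF cf neg Y] tX[OF cf neg Z] fh gh]
 have eq: "tot_map A C F X Z (Tr_comp C zero_ideal X Y Z g f) n = tot_map A C F X Y f n ** tot_map A C F Y Z g n" for n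
  unfolding tot_map_tmap using tc(2) .
 have "fmap (dfil C F Z) (dfil C F X) (tot_map A C F X Z (Tr_comp C zero_ideal X Y Z g f))"
 proof (rule fmapI[OF descent_W[OF cf neg Z] descent_W[OF cf neg X]])
  show "chain_map A (amb (dfil C F Z)) (amb (dfil C F X)) (tot_map A C F X Z (Tr_comp C zero_ideal X Y Z g f))"
   using chain_map_comp[OF fmapD(3)[OF gm] fmapD(3)[OF fm] fmapD(4)[OF gm] fmapD(4)[OF fm] fmapD(5)[OF fm]] unfolding eq[abs_def, symmetric] by (simp add: eq)
  show "Wd C F X p n T (tot_map A C F X Z (Tr_comp C zero_ideal X Y Z g f) n ** x)" if "Wd C F Z p n T x" for p n T x
   using tot_map_W[OF X Z tc(1) that] .
 qed
 thus "snd (E_term A C F r i j) X Z (Tr_comp C zero_ideal X Y Z g f) = snd (E_term A C F r i j) X Y f ** snd (E_term A C F r i j) Y Z g"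
  unfolding snd by (rule ss_map_comp[OF gm fm]) (rule eq r)+
qed

text \<open>Naturality comes for free: \<open>R\<close> presents the values of \<open>V\<close> by
  elements of the same total complexes, and both sides of the square are the class of the image of
  one element.\<close>

lemma E_term_nat_iso:
 assumes r: "r \<ge> 1"
  and iso: "\<And>X. X : ob0 C ==> EX \<theta>. is_iso A (qE (dfil C F X) r j (i + j)) (fst V X) \<theta> &
   (ALL T x t. sE (dfil C F X) r j (i + j) T x t --> R X T x (\<theta> ** t))"
  and R: "\<And>X. X : ob0 C ==> pres (cob (ttot F (supp0 C X) X) (i + j)) (fst V X) (R X)"
  and m: "\<And>X Y f. X : ob0 C ==> Y : ob0 C ==> f : Tr_mor C zero_ideal X Y ==>
   hom (snd V X Y f) (fst V Y) (fst V X)"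
  and nat: "\<And>X Y f T x h. X : ob0 C ==> Y : ob0 C ==> f : Tr_mor C zero_ideal X Y ==>
   R Y T x h ==> R X T (tot_map A C F X Y f (i + j) ** x) (snd V X Y f ** h)"
 shows "tr_nat_iso C zero_ideal A (E_term A C F r i j) V"
proof -
 let ?E = "\<lambda>X. fil_E A (dfil C F X) r j (i + j)"
 obtain \<theta> where \<theta>: "\<And>X. X : ob0 C ==> is_iso A (quo_ob (?E X)) (fst V X) (\<theta> X)"
  "\<And>X T x t. X : ob0 C ==> sqr (?E X) T x t ==> R X T x (\<theta> X ** t)"
  using iso by metis
 have "\<theta> X ** snd (E_term A C F r i j) X Y f = snd V X Y f ** \<theta> Y"
  if X: "X : ob0 C" and Y: "Y : ob0 C" and f: "f : Tr_mor C zero_ideal X Y" for X Y f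
 proof -
  note fm = tot_map_fmap[OF X Y f]
  note e = fEm_spec[OF fm r, of j "i + j"] and pY = fil_E_pres[OF Wfil_fil[OF descent_W[OF cf neg Y]] r]
   and pX = fil_E_pres[OF Wfil_fil[OF descent_W[OF cf neg X]] r]
  have hX: "hom (\<theta> X) (quo_ob (?E X)) (fst V X)" using is_iso_hom[OF \<theta>(1)[OF X] pres_ob2[OF pX] pres_ob2[OF R[OF X]]] .
  have hY: "hom (\<theta> Y) (quo_ob (?E Y)) (fst V Y)" using is_iso_hom[OF \<theta>(1)[OF Y] pres_ob2[OF pY] pres_ob2[OF R[OF Y]]] .
  have "\<theta> X ** fEm (dfil C F Y) (dfil C F X) (tot_map A C F X Y f) r j (i + j) = snd V X Y f ** \<theta> Y"
  proof (rule pres_eq[OF pY hom_comp[OF e(1) hX] hom_comp[OF hY m[OF X Y f]]])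
   fix T x t assume a: "sqr (?E Y) T x t"
   note t = pres_hom2[OF pY a]
   show "\<theta> X ** fEm (dfil C F Y) (dfil C F X) (tot_map A C F X Y f) r j (i + j) ** t = snd V X Y f ** \<theta> Y ** t"
    unfolding assoc[OF t e(1) hX] assoc[OF t hY m[OF X Y f]]
    using pres_uniq[OF R[OF X] \<theta>(2)[OF X e(2)[OF a]] nat[OF X Y f \<theta>(2)[OF Y a]]] .
  qed
  thus ?thesis unfolding E_term_def descent_map_def by (simp add: ss_map_fEm[OF fm])
 qed
 thus ?thesis unfolding tr_nat_iso_def using \<theta>(1) E_term_simps by metis
qed

end


section \<open>Truncated realizations\<close>

lemma treal_simps: "treal A C F b N X = ttot (trunc_fun A (Some (b - N)) b F) (supp0 C X) X"
 by (simp add: treal_def treal_fun_def tot_ttot)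

definition ttn :: "('p, 'm::ab_group_add, 'o, 'a) cfun => int => int => int => int set => ('p, 'm) tw => int => 'a" where
 "ttn F a b b' S X = tnat (trunc_fun A (Some a) b F) (trunc_fun A (Some a) b' F)
   (\<lambda>P n. sq_map A (trunc_sq A (Some a) b (fob F P) n) (trunc_sq A (Some a) b' (fob F P) n) (idt A (Fo F P n))) S X"

abbreviation (input) "TT F a b S X \<equiv> ttot (trunc_fun A (Some a) b F) S X"

definition cohm where "cohm F a b m S S' X X' f = coh_map A (TT F a b S' X') (TT F a b S X) (tmap (trunc_fun A (Some a) b F) S S' X X' f) m"

definition cohn where "cohn F a b b' m S X = coh_map A (TT F a b S X) (TT F a b' S X) (ttn F a b b' S X) m"

definition dim where
 "dim F a j b m S X = im_quot A (qH (TT F a b S X) m) (cohn F a j b m S X)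
   (qH (TT F a (j - 1) S X) m) (cohn F a (j - 1) b m S X)"

definition dmap where
 "dmap F a j b m S S' X X' f = sq_map A (dim F a j b m S' X') (dim F a j b m S X) (cohm F a b m S S' X X' f)"

text \<open>The three truncations in the formula share the lower end j - n + 1; only the upper ends
  j - 1, j and j + n - 1 differ. The later arguments use these ends instead of \<open>N\<close> and
  \<open>l\<close>.\<close>

lemma descent_im_dim:
 shows "descent_im A C F n i j X = dim F (j - int n + 1) j (j + int n - 1) (i + j) (supp0 C X) X"
  and "snd (descent_im_fun A C F n i j) X X' f =
   dmap F (j - int n + 1) j (j + int n - 1) (i + j) (supp0 C X) (supp0 C X') X X' f"
proof -
 have e: "j + int n - 1 - (2 * int n - 2) = j - int n + 1" "j - (int n - 1) = j - int n + 1" "j - 1 - (int n - 2) = j - int n + 1"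
  "j + int n - 1 - (int n - 1) = j" "2 * int n - 2 - (int n - 1) = int n - 1" "j + int n - 1 - int n = j - 1" "2 * int n - 2 - int n = int n - 2" by auto
 show *: "descent_im A C F n i j X = dim F (j - int n + 1) j (j + int n - 1) (i + j) (supp0 C X) X" for X
  unfolding descent_im_def Let_def treal_simps treal_nat_def tot_nat_tnat treal_fun_def e dim_def cohn_def ttn_def ..
 show "snd (descent_im_fun A C F n i j) X X' f =
   dmap F (j - int n + 1) j (j + int n - 1) (i + j) (supp0 C X) (supp0 C X') X X' f"
  unfolding descent_im_fun_def * treal_coh_def treal_simps tot_map_tmap treal_fun_def e dmap_def cohm_def by (simp add: e)
qed

lemma coh_square:
 assumes c: "chain_map A Y Y1 \<phi>" "chain_map A Y1 W \<psi>" "chain_map A Y Y2 \<phi>'" "chain_map A Y2 W \<psi>'"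
  and o: "is_complex A Y" "is_complex A Y1" "is_complex A Y2" "is_complex A W"
  and eq: "\<And>n. \<psi> n ** \<phi> n = \<psi>' n ** \<phi>' n"
 shows "coh_map A Y1 W \<psi> n ** coh_map A Y Y1 \<phi> n = coh_map A Y2 W \<psi>' n ** coh_map A Y Y2 \<phi>' n"
proof -
 note k = chain_map_comp[OF c(1,2) o(1,2,4)]
 have "coh_map A Y W (\<lambda>n. \<psi> n ** \<phi> n) n = coh_map A Y2 W \<psi>' n ** coh_map A Y Y2 \<phi>' n"
  by (rule coh_map_comp[OF c(3,4) o(1,3,4) eq k])
 thus ?thesis using coh_map_comp[OF c(1,2) o(1,2,4) refl k] by simp
qed

context
 fixes C :: "('p, 'm::ab_group_add) dgcat" and F :: "('p, 'm, 'o, 'a) cfun" and I and a j b :: int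
 assumes cf: "contra_dg_functor C A F" and neg: "neg_dg C" and jb: "j \<le> b"
  and kT: "\<And>b'. b' \<le> b ==> kills C I (trunc_fun A (Some a) b' F)"
begin

lemma ttn_chain:
 assumes X: "twok C I S X" and b: "b' \<le> b''" "b'' \<le> b"
 shows "chain_map A (TT F a b' S X) (TT F a b'' S X) (ttn F a b' b'' S X)"
 unfolding ttn_def by (rule tnat_chain[OF kT kT X trunc_nat(1)[OF cf neg b(1)]]) (use b in auto)

lemma cohn_hom:
 assumes X: "twok C I S X" and b: "b' \<le> b''" "b'' \<le> b"
 shows "hom (cohn F a b' b'' m S X) (qH (TT F a b' S X) m) (qH (TT F a b'' S X) m)"
 unfolding cohn_def by (rule coh_map_spec(1)[OF ttn_chain[OF X b] ttot_complex[OF kT X] ttot_complex[OF kT X]]) (use b in auto)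

lemma cohm_hom:
 assumes X: "twok C I S X" and X': "twok C I S' X'" and f: "f : Tr_mor C I X X'" and b: "b' \<le> b"
 shows "hom (cohm F a b' m S S' X X' f) (qH (TT F a b' S' X') m) (qH (TT F a b' S X) m)"
 unfolding cohm_def using coh_map_spec(1)[OF tmap_chain[OF kT[OF b] X X' f] ttot_complex[OF kT[OF b] X'] ttot_complex[OF kT[OF b] X]] .

lemma cohn_cohm:
 assumes X: "twok C I S X" and X': "twok C I S' X'" and f: "f : Tr_mor C I X X'" and b: "b' \<le> b"
 shows "cohm F a b m S S' X X' f ** cohn F a b' b m S' X' = cohn F a b' b m S X ** cohm F a b' m S S' X X' f"
proof -
 note k = kT[OF b] and k' = kT[OF order_refl]
 have "f : tw_hom C 0 X X'" using f unfolding Tr_mor_def by blast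
 from tnat_tmap[OF k k' X X' trunc_nat(1)[OF cf neg b] this, symmetric]
 show ?thesis unfolding cohm_def cohn_def
  using coh_square[OF ttn_chain[OF X' b order_refl] tmap_chain[OF k' X X' f] tmap_chain[OF k X X' f] ttn_chain[OF X b order_refl]
   ttot_complex[OF k X'] ttot_complex[OF k' X'] ttot_complex[OF k X] ttot_complex[OF k' X]] unfolding ttn_def by blast
qed

lemma ttn_comp:
 assumes X: "twok C I S X"
 shows "ttn F a j b S X n ** ttn F a (j - 1) j S X n = ttn F a (j - 1) b S X n"
proof -
 let ?\<eta> = "\<lambda>b b' P n. sq_map A (trunc_sq A (Some a) b (fob F P) n) (trunc_sq A (Some a) b' (fob F P) n) (idt A (Fo F P n))"
 have le: "j - 1 \<le> j" "j - 1 \<le> b" using jb by auto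
 note k = kT[OF jb] and k1 = kT[OF le(2)] and kb = kT[OF order_refl]
 note t1 = trunc_nat[OF cf neg le(1), where lo = "Some a"] and t2 = trunc_nat[OF cf neg jb, where lo = "Some a"]
  and t3 = trunc_nat[OF cf neg le(2), where lo = "Some a"]
 note h1 = dg_trD(1)[OF t1(1) k1 k] and h2 = dg_trD(1)[OF t2(1) k kb] and h3 = dg_trD(1)[OF t3(1) k1 kb]
 note s1 = tnat_spec[OF k1 k X h1] and s2 = tnat_spec[OF k kb X h2] and s3 = tnat_spec[OF k1 kb X h3]
 define x where "x = idt A (cob (TT F a (j - 1) S X) n)"
 have x: "hom x (cob (TT F a (j - 1) S X) n) (cob (TT F a (j - 1) S X) n)" unfolding x_def using hom_id[OF hom_dom[OF s1(1)]] .
 note x1 = hom_comp[OF x s1(1)]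
 have "ttn F a j b S X n ** (ttn F a (j - 1) j S X n ** x) = ttn F a (j - 1) b S X n ** x"
  unfolding ttn_def
 proof (rule ttot_ext[OF kb X hom_comp[OF x1 s2(1)] hom_comp[OF x s3(1)]])
  fix i assume i: "i : S"
  note o = twok_simps(2)[OF k X, of i]
  have E: "?\<eta> j b (fst X i) (n + i) ** ?\<eta> (j - 1) j (fst X i) (n + i) = ?\<eta> (j - 1) b (fst X i) (n + i)"
  proof (rule pres_eq[OF tr_pres[OF cf neg o] hom_comp[OF h1[OF o] h2[OF o]] h3[OF o]])
   fix T x t assume r: "sqr (trunc_sq A (Some a) (j - 1) (fob F (fst X i)) (n + i)) T x t"
   note p = tr_pres[OF cf neg o, of "n + i" "Some a"]
   show "?\<eta> j b (fst X i) (n + i) ** ?\<eta> (j - 1) j (fst X i) (n + i) ** t = ?\<eta> (j - 1) b (fst X i) (n + i) ** t"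
    unfolding assoc[OF pres_hom2[OF p r] h1[OF o] h2[OF o]] using pres_uniq[OF p t2(2)[OF o t1(2)[OF o r]] t3(2)[OF o r]] .
  qed
  have px: "hom (tP (trunc_fun A (Some a) (j - 1) F) S X n i ** x) (cob (TT F a (j - 1) S X) n) (Fo (trunc_fun A (Some a) (j - 1) F) (fst X i) (n + i))"
   using hom_comp[OF x tP_hom[OF k1 X i]] .
  show "tP (trunc_fun A (Some a) b F) S X n i ** (tnat (trunc_fun A (Some a) j F) (trunc_fun A (Some a) b F) (?\<eta> j b) S X n **
    (tnat (trunc_fun A (Some a) (j - 1) F) (trunc_fun A (Some a) j F) (?\<eta> (j - 1) j) S X n ** x)) =
   tP (trunc_fun A (Some a) b F) S X n i ** (tnat (trunc_fun A (Some a) (j - 1) F) (trunc_fun A (Some a) b F) (?\<eta> (j - 1) b) S X n ** x)"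
   using s2(2)[OF _ x1 i] s1(2)[OF _ x i] s3(2)[OF _ x i] E assoc[OF px h1[OF o] h2[OF o]] by simp
 qed
 thus ?thesis unfolding x_def using comp_id[OF s1(1)] comp_id[OF s3(1)] unfolding ttn_def by simp
qed

lemma cohn_coker:
 assumes X: "twok C I S X"
 shows "coker_ar A (qH (TT F a b S X) m) (cohn F a j b m S X) ** cohn F a (j - 1) b m S X = 0"
proof -
 have le: "j - 1 \<le> j" "j - 1 \<le> b" using jb by auto
 have "cohn F a (j - 1) b m S X = cohn F a j b m S X ** cohn F a (j - 1) j m S X"
  unfolding cohn_def
  by (rule coh_map_comp[OF ttn_chain[OF X le(1) jb] ttn_chain[OF X jb order_refl] ttot_complex[OF kT[OF le(2)] X]
   ttot_complex[OF kT[OF jb] X] ttot_complex[OF kT[OF order_refl] X] ttn_comp[OF X, symmetric] ttn_chain[OF X le(2) order_refl]])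
 thus ?thesis using coker_factor_zero[OF cohn_hom[OF X jb order_refl] cohn_hom[OF X le(1) jb]] by simp
qed

lemma dim_SQ:
 assumes X: "twok C I S X"
 shows "SQ (qH (TT F a b S X) m) (dim F a j b m S X)"
 unfolding dim_def using im_quot_SQ(1)[OF cohn_hom[OF X jb order_refl] cohn_hom[OF X _ order_refl] cohn_coker[OF X]] jb by simp

lemma dmap_spec:
 assumes X: "twok C I S X" and X': "twok C I S' X'" and f: "f : Tr_mor C I X X'"
 shows "hom (dmap F a j b m S S' X X' f) (quo_ob (dim F a j b m S' X')) (quo_ob (dim F a j b m S X))"
  and "sqr (dim F a j b m S' X') T x t ==> sqr (dim F a j b m S X) T (cohm F a b m S S' X X' f ** x) (dmap F a j b m S S' X X' f ** t)"
proof -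
 have le: "j - 1 \<le> b" using jb by simp
 note m = im_quot_map[OF cohn_hom[OF X' jb order_refl] cohn_hom[OF X' le order_refl] cohn_coker[OF X']
  cohn_hom[OF X jb order_refl] cohn_hom[OF X le order_refl] cohn_coker[OF X] cohm_hom[OF X X' f order_refl]
  cohm_hom[OF X X' f jb] cohn_cohm[OF X X' f jb] cohm_hom[OF X X' f le] cohn_cohm[OF X X' f le], folded dim_def, folded dmap_def]
 show "hom (dmap F a j b m S S' X X' f) (quo_ob (dim F a j b m S' X')) (quo_ob (dim F a j b m S X))" using m(1) .
 show "sqr (dim F a j b m S' X') T x t ==> sqr (dim F a j b m S X) T (cohm F a b m S S' X X' f ** x) (dmap F a j b m S S' X X' f ** t)" using m(2) .
qed

text \<open>The ideal \<open>I\<close> is arbitrary as long as the truncations kill it: this is what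
  produces functors on the target of t_N, where objects, morphisms and homotopies satisfy their
  equations only modulo \<open>I\<close>.\<close>

lemma dim_functor:
 assumes S: "\<And>X. X : tw_obj C I ==> twok C I (S X) X"
 shows "tr_functor C I A (\<lambda>X. quo_ob (dim F a j b m (S X) X), \<lambda>X X' f. dmap F a j b m (S X) (S X') X X' f)"
 unfolding tr_functor_def fst_conv snd_conv
proof (intro conjI ballI impI)
 note kb = kT[OF order_refl]
 fix X assume "X : tw_obj C I"
 hence X: "twok C I (S X) X" using S by blast
 note D = dim_SQ[OF X, of m] and cX = ttot_complex[OF kb X]
 show obX: "quo_ob (dim F a j b m (S X) X) : obj A" using pres_ob2[OF SQ_pres[OF D]] .
 have tid: "tmap (trunc_fun A (Some a) b F) (S X) (S X) X X (Tr_id C X) n = idt A (cob (TT F a b (S X) X) n)" for n using tmap_id[OF kb X] .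
 have "cohm F a b m (S X) (S X) X X (Tr_id C X) = idt A (qH (TT F a b (S X) X) m)"
  unfolding cohm_def
 proof (rule coh_map_id[OF cX])
  show "tmap (trunc_fun A (Some a) b F) (S X) (S X) X X (Tr_id C X) m = idt A (cob (TT F a b (S X) X) m)" by (rule tid)
  show "chain_map A (TT F a b (S X) X) (TT F a b (S X) X) (tmap (trunc_fun A (Some a) b F) (S X) (S X) X X (Tr_id C X))"
   unfolding tid[abs_def] by (rule chain_map_id[OF cX])
 qed
 thus "dmap F a j b m (S X) (S X) X X (Tr_id C X) = idt A (quo_ob (dim F a j b m (S X) X))"
  unfolding dmap_def
  using sq_map_eqI_rel[OF D D hom_id[OF pres_ob1[OF SQ_pres[OF D]]] hom_id[OF obX]]
   id_comp[OF pres_hom1[OF SQ_pres[OF D]]] id_comp[OF pres_hom2[OF SQ_pres[OF D]]] by simp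
 fix Y f assume "Y : tw_obj C I" and f: "f : Tr_mor C I X Y"
 hence Y: "twok C I (S Y) Y" using S by blast
 have fh: "f : tw_hom C 0 X Y" using f unfolding Tr_mor_def by blast
 note tf = tmap_chain[OF kb X Y f] and cY = ttot_complex[OF kb Y] and df = dmap_spec[OF X Y f, of m]
 show "dmap F a j b m (S X) (S Y) X Y f : arr A (quo_ob (dim F a j b m (S Y) Y)) (quo_ob (dim F a j b m (S X) X))"
  using hom_arr[OF df(1)] .
 show "dmap F a j b m (S X) (S Y) X Y f = dmap F a j b m (S X) (S Y) X Y g" if g: "g : Tr_mor C I X Y" and e: "Tr_eq C I X Y f g" for g
 proof -
  have gh: "g : tw_hom C 0 X Y" using g unfolding Tr_mor_def by blast
  obtain h where h: "h : tw_hom C (- 1) X Y" and eq: "\<And>i j. f i j - g i j - tw_diff C I (- 1) X Y h i j : I (i - j) (fst X i) (fst Y j)"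
   using e unfolding Tr_eq_def by blast
  note hs = tmL_hom1[OF kb X Y h] and ht = tmap_homotopic[OF kb X Y fh gh h eq]
  have "homotopic A (TT F a b (S Y) Y) (TT F a b (S X) X) (tmap (trunc_fun A (Some a) b F) (S X) (S Y) X Y f) (tmap (trunc_fun A (Some a) b F) (S X) (S Y) X Y g)"
   unfolding homotopic_def
  proof (intro bexI allI)
   show "tmL (- 1) (trunc_fun A (Some a) b F) (S X) (S Y) X Y h : cpx_hom A (- 1) (TT F a b (S Y) Y) (TT F a b (S X) X)"
    unfolding cpx_hom_def using hom_arr[OF hs] by simp
   show "tmap (trunc_fun A (Some a) b F) (S X) (S Y) X Y f n - tmap (trunc_fun A (Some a) b F) (S X) (S Y) X Y g n =
    cpx_diff A (- 1) (TT F a b (S Y) Y) (TT F a b (S X) X) (tmL (- 1) (trunc_fun A (Some a) b F) (S X) (S Y) X Y h) n" for n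
    unfolding ht cpx_diff_def by (simp add: ksgn_def)
  qed
  hence "cohm F a b m (S X) (S Y) X Y f = cohm F a b m (S X) (S Y) X Y g"
   unfolding cohm_def using coh_map_homotopic[OF tf tmap_chain[OF kb X Y g] cY cX] by blast
  thus ?thesis unfolding dmap_def by simp
 qed
 fix Z g assume "Z : tw_obj C I" and g: "g : Tr_mor C I Y Z"
 hence Z: "twok C I (S Z) Z" using S by blast
 have gh: "g : tw_hom C 0 Y Z" using g unfolding Tr_mor_def by blast
 note tg = tmap_chain[OF kb Y Z g] and cZ = ttot_complex[OF kb Z] and dg = dmap_spec[OF Y Z g, of m]
 note tc = tmap_comp(2)[OF kb X Y Z fh gh]
 have "chain_map A (TT F a b (S Z) Z) (TT F a b (S X) X) (tmap (trunc_fun A (Some a) b F) (S X) (S Z) X Z (Tr_comp C I X Y Z g f))"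
  using chain_map_comp[OF tg tf cZ cY cX] unfolding tc[symmetric] .
 note tcc = this
 have c: "cohm F a b m (S X) (S Z) X Z (Tr_comp C I X Y Z g f) = cohm F a b m (S X) (S Y) X Y f ** cohm F a b m (S Y) (S Z) Y Z g"
  unfolding cohm_def by (rule coh_map_comp[OF tg tf cZ cY cX]) (rule tc tcc)+
 note hf = cohm_hom[OF X Y f order_refl, of m] and hg = cohm_hom[OF Y Z g order_refl, of m] and DZ = dim_SQ[OF Z, of m]
 show "dmap F a j b m (S X) (S Z) X Z (Tr_comp C I X Y Z g f) = dmap F a j b m (S X) (S Y) X Y f ** dmap F a j b m (S Y) (S Z) Y Z g"
  unfolding dmap_def[of _ _ _ _ _ "S X" "S Z"] c
 proof (rule sq_map_eqI_rel[OF DZ D hom_comp[OF hg hf] hom_comp[OF dg(1) df(1)]])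
  fix T x t assume r: "sqr (dim F a j b m (S Z) Z) T x t"
  show "sqr (dim F a j b m (S X) X) T (cohm F a b m (S X) (S Y) X Y f ** cohm F a b m (S Y) (S Z) Y Z g ** x)
   (dmap F a j b m (S X) (S Y) X Y f ** dmap F a j b m (S Y) (S Z) Y Z g ** t)"
   unfolding assoc[OF pres_hom1[OF SQ_pres[OF DZ] r] hg hf] assoc[OF pres_hom2[OF SQ_pres[OF DZ] r] dg(1) df(1)]
   using df(2)[OF dg(2)[OF r]] .
 qed
qed

end


context
 fixes C :: "('p, 'm::ab_group_add) dgcat" and F :: "('p, 'm, 'o, 'a) cfun"
 assumes cf: "contra_dg_functor C A F" and neg: "neg_dg C"
begin

definition RC where "RC X a b n = rcomp (RT C F X (Some a) b n) (sH (TT F a b (supp0 C X) X) n)"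

lemma RC_pres:
 assumes X: "X : ob0 C"
 shows "pres (cob (ttot F (supp0 C X) X) n) (qH (TT F a b (supp0 C X) X) n) (RC X a b n)"
 unfolding RC_def using TP_coh(2)[OF treal_TP[OF cf neg X refl], of n a b] unfolding descent_simps .

lemma RC_map:
 assumes X: "X : ob0 C" and Y: "Y : ob0 C" and f: "f : Tr_mor C zero_ideal X Y" and r: "RC Y a b n T x h"
 shows "RC X a b n T (tot_map A C F X Y f n ** x) (cohm F a b n (supp0 C X) (supp0 C Y) X Y f ** h)"
proof -
 note k = kzT[OF cf neg, of "Some a" b] and t = tX[OF cf neg X] and t' = tX[OF cf neg Y]
 obtain q where q: "RT C F Y (Some a) b n T x q" "sH (TT F a b (supp0 C Y) Y) n T q h" using r unfolding RC_def rcomp_def by blast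
 have fh: "f : tw_hom C 0 X Y" using f unfolding Tr_mor_def by blast
 show ?thesis unfolding RC_def rcomp_def tot_map_tmap cohm_def
  using BR_tmap[OF kz[OF cf neg] k frel_trunc[OF cf neg] t t' fh] q(1)
   coh_map_spec(2)[OF tmap_chain[OF k t t' f] ttot_complex[OF k t'] ttot_complex[OF k t] q(2)] unfolding RT_def by blast
qed

lemma RC_nat:
 assumes X: "X : ob0 C" and b: "b \<le> b'" and r: "RC X a b n T x h"
 shows "RC X a b' n T x (cohn F a b b' n (supp0 C X) X ** h)"
proof -
 note k = kzT[OF cf neg, of "Some a" b] and k' = kzT[OF cf neg, of "Some a" b'] and t = tX[OF cf neg X]
 note \<eta> = trunc_nat[OF cf neg b, where lo = "Some a"]
 obtain q where q: "RT C F X (Some a) b n T x q" "sH (TT F a b (supp0 C X) X) n T q h" using r unfolding RC_def rcomp_def by blast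
 have "RT C F X (Some a) b' n T x (ttn F a b b' (supp0 C X) X n ** q)" unfolding RT_def ttn_def
  by (rule BR_tnat[OF kz[OF cf neg] k frel_trunc[OF cf neg] k' t])
   (rule dg_trD(1)[OF \<eta>(1) k k'] \<eta>(2) q(1)[unfolded RT_def]; assumption?)+
 moreover have "chain_map A (TT F a b (supp0 C X) X) (TT F a b' (supp0 C X) X) (ttn F a b b' (supp0 C X) X)"
  unfolding ttn_def using tnat_chain[OF k k' t \<eta>(1)] .
 ultimately show ?thesis unfolding RC_def rcomp_def cohn_def
  using coh_map_spec(2)[OF _ ttot_complex[OF k t] ttot_complex[OF k' t] q(2)] by blast
qed

lemma E1_treal: "tr_nat_iso C zero_ideal A (E_term A C F 1 i j) (treal_coh A C F j 0 (i + j))"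
proof (rule E_term_nat_iso[OF cf neg order_refl, where R = "\<lambda>X. RC X j j (i + j)"])
 have fs: "fst (treal_coh A C F j 0 (i + j)) X = qH (TT F j j (supp0 C X) X) (i + j)" for X
  unfolding treal_coh_def treal_simps by simp
 have sn: "snd (treal_coh A C F j 0 (i + j)) X Y f = cohm F j j (i + j) (supp0 C X) (supp0 C Y) X Y f" for X Y f
  unfolding treal_coh_def treal_simps cohm_def tot_map_tmap treal_fun_def by simp
 fix X assume X: "X : ob0 C"
 show "EX \<theta>. is_iso A (qE (dfil C F X) 1 j (i + j)) (fst (treal_coh A C F j 0 (i + j)) X) \<theta> &
  (ALL T x t. sE (dfil C F X) 1 j (i + j) T x t --> RC X j j (i + j) T x (\<theta> ** t))"
  unfolding fs RC_def using TP_E1_iso[OF treal_TP[OF cf neg X refl]] .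
 show "pres (cob (ttot F (supp0 C X) X) (i + j)) (fst (treal_coh A C F j 0 (i + j)) X) (RC X j j (i + j))"
  unfolding fs using RC_pres[OF X] .
 fix Y f assume Y: "Y : ob0 C" and f: "f : Tr_mor C zero_ideal X Y"
 show "hom (snd (treal_coh A C F j 0 (i + j)) X Y f) (fst (treal_coh A C F j 0 (i + j)) Y) (fst (treal_coh A C F j 0 (i + j)) X)"
  unfolding fs sn using cohm_hom[OF cf neg order_refl kzT[OF cf neg] tX[OF cf neg X] tX[OF cf neg Y] f order_refl] .
 show "RC Y j j (i + j) T x h ==> RC X j j (i + j) T (tot_map A C F X Y f (i + j) ** x) (snd (treal_coh A C F j 0 (i + j)) X Y f ** h)" for T x h
  unfolding sn using RC_map[OF X Y f] .
qed

lemma En_descent_im: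
 assumes n: "n \<ge> 1"
 shows "tr_nat_iso C zero_ideal A (E_term A C F n i j) (descent_im_fun A C F n i j)"
proof -
 define a b where "a = j - int n + 1" and "b = j + int n - 1"
 have jb: "j \<le> b" "j - 1 \<le> b" using n unfolding b_def by auto
 let ?S = "tw_supp C zero_ideal" and ?m = "i + j"
 let ?D = "\<lambda>X. dim F a j b ?m (?S X) X"
 have fs: "fst (descent_im_fun A C F n i j) X = quo_ob (?D X)" for X
  unfolding descent_im_fun_def descent_im_dim(1) a_def b_def by simp
 have sn: "snd (descent_im_fun A C F n i j) X Y f = dmap F a j b ?m (?S X) (?S Y) X Y f" for X Y f
  unfolding descent_im_dim(2) a_def b_def ..
 let ?R = "\<lambda>X. rcomp (RC X a b ?m) (sqr (?D X))"
 note kT = kzT[OF cf neg, where lo = "Some a"]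
 show ?thesis
 proof (rule E_term_nat_iso[OF cf neg n, where R = ?R])
  fix X assume X: "X : ob0 C"
  note t = tX[OF cf neg X]
  note D = dim_SQ[OF cf neg jb(1) kT t, of ?m]
  note c = cohn_hom[OF cf neg jb(1) kT t _ order_refl]
  have a': "j - int n = a - 1" unfolding a_def by simp
  note TPb = treal_TP[OF cf neg X a', of b] and TPj = treal_TP[OF cf neg X a', of j] and TP1 = treal_TP[OF cf neg X a', of "j - 1"]
  note b' = b_def[symmetric]
  show "EX \<theta>. is_iso A (qE (dfil C F X) n j ?m) (fst (descent_im_fun A C F n i j) X) \<theta> &
   (ALL T x t. sE (dfil C F X) n j ?m T x t --> ?R X T x (\<theta> ** t))"
   unfolding fs dim_def RC_def
   by (rule TP_En_iso[OF n TPb[unfolded b_def] TPj TP1, folded b_def])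
    (rule c jb cohn_coker[OF cf neg jb(1) kT t] RC_nat[OF X, unfolded RC_def]; assumption?)+
  show "pres (cob (ttot F (?S X) X) ?m) (fst (descent_im_fun A C F n i j) X) (?R X)"
   unfolding fs using pres_rcomp[OF RC_pres[OF X] SQ_pres[OF D]] .
  fix Y f assume Y: "Y : ob0 C" and f: "f : Tr_mor C zero_ideal X Y"
  note dm = dmap_spec[OF cf neg jb(1) kT t tX[OF cf neg Y] f, of ?m]
  show "hom (snd (descent_im_fun A C F n i j) X Y f) (fst (descent_im_fun A C F n i j) Y) (fst (descent_im_fun A C F n i j) X)"
   unfolding fs sn using dm(1) .
  show "?R Y T x h ==> ?R X T (tot_map A C F X Y f ?m ** x) (snd (descent_im_fun A C F n i j) X Y f ** h)" for T x h
   unfolding sn rcomp_def using RC_map[OF X Y f] dm(2) by blast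
 qed
qed

text \<open>The quotient of images in \<open>En_descent_im\<close> already makes sense over J_N with
  N = 2n - 2, because the truncations in it have at most this length and kill
  \<open>trunc_ideal\<close>. It is the functor through which E_n factors.\<close>

lemma En_factors:
 assumes n: "n \<ge> 1"
 shows "factors_through_t C (2 * int n - 2) A (E_term A C F n i j)"
proof -
 define a b N where "a = j - int n + 1" and "b = j + int n - 1" and "N = 2 * int n - 2"
 have jb: "j \<le> b" using n unfolding b_def by simp
 let ?I = "trunc_ideal C N"
 \<comment> \<open>For an object over the quotient the support in \<open>C\<close> may be infinite,
   and then the support modulo the ideal is taken. For objects over \<open>C\<close> the former is
   kept, so that \<open>V\<close> is literally \<open>descent_im_fun\<close> on them.\<close>
 define S where "S X = (if finite (supp0 C X) then supp0 C X else tw_supp C ?I X)" for X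
 have kT: "kills C ?I (trunc_fun A (Some a) b' F)" if "b' \<le> b" for b'
  by (rule kills_trunc[OF cf neg]) (use that in \<open>simp add: a_def b_def N_def\<close>)
 have S: "twok C ?I (S X) X" if X: "X : tw_obj C ?I" for X
 proof -
  have o: "fst X i : dobj C" for i using X unfolding tw_obj_def by blast
  \<comment> \<open>Needed for N = 0, where the ideal in degree 0 is an image of the differential
    and must be seen to contain 0.\<close>
  have "ddiff C (- 1) P P 0 = 0" if P: "P : dobj C" for P
   using cf_cat[OF cf] P subgrp_zero[OF dg_subgrp[OF cf_cat[OF cf] P P]] unfolding dg_category_def by (metis add_cancel_right_right)
  hence "0 : ?I 0 (fst X i) (fst X i)" for i
   using subgrp_zero[OF dg_subgrp[OF cf_cat[OF cf] o o]] o unfolding trunc_ideal_def by (auto intro: image_eqI[of _ _ 0])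
  hence "tw_supp C ?I X \<subseteq> supp0 C X" unfolding tw_supp_def zero_ideal_def by auto
  moreover have "finite (tw_supp C ?I X)" using X unfolding tw_obj_def by blast
  ultimately show ?thesis unfolding twok_def S_def using X by auto
 qed
 define V where "V = (\<lambda>X. quo_ob (dim F a j b (i + j) (S X) X), \<lambda>X X' f. dmap F a j b (i + j) (S X) (S X') X X' f)"
 have V: "tr_functor C ?I A V" unfolding V_def using dim_functor[OF cf neg jb kT S] .
 have fS: "S X = supp0 C X" if "X : ob0 C" for X
  using that unfolding S_def tw_obj_def by simp
 have "fst V X = fst (descent_im_fun A C F n i j) X" if "X : ob0 C" for X
  unfolding descent_im_fun_def descent_im_dim(1) using fS[OF that] by (simp add: V_def a_def b_def)
 moreover have "snd V X Y f = snd (descent_im_fun A C F n i j) X Y f" if "X : ob0 C" "Y : ob0 C" for X Y f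
  unfolding descent_im_dim(2) using fS[OF that(1)] fS[OF that(2)] by (simp add: V_def a_def b_def)
 ultimately have "tr_nat_iso C zero_ideal A (E_term A C F n i j) V"
  using En_descent_im[OF n, of i j] unfolding tr_nat_iso_def by simp
 thus ?thesis unfolding factors_through_t_def using V unfolding N_def by blast
qed

end


section \<open>The first page\<close>

lemma pres_of_iso:
 assumes f: "is_iso A Y Q f" and Y: "Y : obj A" and Q: "Q : obj A"
 shows "pres Y Q (\<lambda>T x t. hom x T Y & t = f ** x)" and "hom x T Y ==> f ** x = 0 ==> x = 0"
proof -
 have h: "hom f Y Q" using is_iso_hom[OF f Y Q] .
 obtain g where g: "hom g Q Y" "g ** f = idt A Y" "f ** g = idt A Q" using f Y Q unfolding is_iso_def hom_def by blast
 show z: "x = 0" if "hom x T Y" "f ** x = 0" for x T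
  using assoc[OF that(1) h g(1)] g(2) id_comp[OF that(1)] that(2) comp_zero[OF hom_dom[OF that(1)] g(1)] by simp
 show "pres Y Q (\<lambda>T x t. hom x T Y & t = f ** x)" unfolding pres_def
 proof (intro conjI allI impI ballI Y Q; (elim conjE exE)?)
  show "hom x T Y ==> hom x T Y" "hom x T Y ==> t = f ** x ==> hom t T Q" for T x t using hom_comp[OF _ h] by auto
  show "hom x T Y ==> hom e T' T ==> hom (x ** e) T' Y" "hom x T Y ==> t = f ** x ==> hom e T' T ==> t ** e = f ** (x ** e)" for T x t T' e
   using hom_comp assoc[OF _ _ h] by auto
  show "hom x T Y ==> hom y T Y ==> hom (x - y) T Y" "hom x T Y ==> t = f ** x ==> hom y T Y ==> s = f ** y ==> t - s = f ** (x - y)" for T x t y s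
   using hom_diff comp_diff[OF _ _ h] by auto
  show "hom 0 T Y ==> t = f ** 0 ==> t = 0" for T t using comp_zero[OF hom_dom h] by auto
  show "T : obj A ==> hom 0 T Y" "T : obj A ==> 0 = f ** 0" for T using hom_zero[OF _ Y] comp_zero[OF _ h] by auto
  show "EX T' e x. cov e T' T & hom x T' Y & t ** e = f ** x" if t: "hom t T Q" for T t
  proof -
   have "t ** idt A T = f ** (g ** t)" using comp_id[OF t] assoc[OF t g(1) h] g(3) id_comp[OF t] by simp
   thus ?thesis using cov_id[OF hom_dom[OF t]] hom_comp[OF t g(1)] by blast
  qed
  show "hom x T Y ==> EX t. hom x T Y & t = f ** x" for T x by blast
 qed
qed

context
 fixes C :: "('p, 'm::ab_group_add) dgcat" and F :: "('p, 'm, 'o, 'a) cfun" and j :: int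
 assumes cf: "contra_dg_functor C A F" and neg: "neg_dg C"
begin

private abbreviation (input) "G \<equiv> trunc_fun A (Some j) j F"
private abbreviation (input) "Z X \<equiv> ttot (trunc_fun A (Some j) j F) (supp0 C X) X"

text \<open>In the only degree of the [j, j]-truncation the defining subquotient is literally the
  one of cohomology, so these are equalities and not just isomorphisms.\<close>

lemma trunc_coh:
 shows "Fo G P j = qH (fob F P) j"
  and "fmor G 0 P Q f j = coh_map A (fob F Q) (fob F P) (fmor F 0 P Q f) j"
proof -
 have "trunc_sq A (Some j) j Y j = coh A Y j" for Y :: "('o, 'a) cpx" unfolding trunc_sq_def coh_def by simp
 thus "Fo G P j = qH (fob F P) j" "fmor G 0 P Q f j = coh_map A (fob F Q) (fob F P) (fmor F 0 P Q f) j"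
  unfolding tf_simps coh_map_def by simp_all
qed

lemma trunc_trivial:
 assumes P: "P : dobj C" and n: "n \<noteq> j" and t: "hom t T (Fo G P n)"
 shows "t = 0"
proof -
 note p = tr_pres[OF cf neg P, of n "Some j" j]
 obtain T' e x where e: "cov e T' T" and x: "sqr (trunc_sq A (Some j) j (fob F P) n) T' x (t ** e)" using pres_surj[OF p t] by blast
 have z: "tz (Some j) j (fob F P) n T' x" using x trunc_SQ(2)[OF cf_cpx[OF cf P]] by blast
 hence "tb (Some j) (fob F P) n T' x" using n unfolding tz_def tb_def by auto
 hence "sqr (trunc_sq A (Some j) j (fob F P) n) T' x 0" using z trunc_SQ(3)[OF cf_cpx[OF cf P]] by blast
 hence "t ** e = 0" using pres_uniq[OF p x] by blast
 thus ?thesis using cov_zero[OF e t] by blast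
qed

text \<open>In total degree \<open>n\<close> only the index j - n contributes to the total complex
  of the [j, j]-truncation; if it is outside the support, source and target are zero
  objects.\<close>

definition row_proj where
 "row_proj X n = (if j - n : supp0 C X then tP G (supp0 C X) X n (j - n) else 0)"

definition row_rel where
 "row_rel X n T q t \<longleftrightarrow> hom q T (cob (Z X) n) & t = row_proj X n ** q"

text \<open>\<open>row_cpx\<close> placed in the degrees of the total complex: the row index l sits
  in total degree l + j.\<close>

definition row_shift where
 "row_shift X = \<lparr>cob = (\<lambda>n. cob (row_cpx A F j X) (n - j)), cdf = (\<lambda>n. cdf (row_cpx A F j X) (n - j))\<rparr>"

lemma row_shift_simps:
 shows "cob (row_shift X) n = Fo G (fst X (j - n)) j"
  and "cdf (row_shift X) n = fmor G 0 (fst X (j - n - 1)) (fst X (j - n)) (snd X (j - n - 1) (j - n)) j"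
  and "coh A (row_shift X) (i + j) = coh A (row_cpx A F j X) i"
 unfolding trunc_coh by (simp_all add: row_shift_def row_cpx_def coh_def)

context
 fixes X assumes X: "X : ob0 C"
begin

private abbreviation (input) "Sj \<equiv> supp0 C X"
private lemmas k = kzT[OF cf neg, of "Some j" j] and t = tX[OF cf neg X]
private lemmas og = twok_simps(2)[OF k t]
private lemmas cg = cpx_ob[OF cf_cpx[OF trunc_fun_functor[OF cf neg] og]]

lemma row_shift_d: "hom (cdf (row_shift X) n) (cob (row_shift X) n) (cob (row_shift X) (n + 1))"
proof -
 have "snd X (j - n - 1) (j - n) : dhom C 0 (fst X (j - n - 1)) (fst X (j - n))" using twok_simps(3)[OF k t, of "j - n - 1" "j - n"] by simp
 from cf_hom[OF trunc_fun_functor[OF cf neg] og og this, of "Some j" j j]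
 show ?thesis unfolding row_shift_simps by (simp add: algebra_simps)
qed

lemma row_outside: "j - n \<notin> Sj ==> idt A (cob (row_shift X) n) = 0"
 unfolding row_shift_simps using twok_outside[OF k t] .

lemma row_comp_zero:
 assumes i: "i : Sj" "n + i \<noteq> j" and x: "hom x T (cob (Z X) n)"
 shows "tP G Sj X n i ** x = 0"
 using trunc_trivial[OF og i(2) hom_comp[OF x tP_hom[OF k t i(1)]]] .

lemma row_proj_iso:
 shows "is_iso A (cob (Z X) n) (cob (row_shift X) n) (row_proj X n)"
proof (cases "j - n : Sj")
 case True
 define i where "i = j - n"
 have i: "i : Sj" "n + i = j" using True by (auto simp: i_def)
 have p: "hom (tP G Sj X n i) (cob (Z X) n) (cob (row_shift X) n)"
  and q: "hom (tI G Sj X n i) (cob (row_shift X) n) (cob (Z X) n)"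
  using tP_hom[OF k t i(1), of n] tI_hom[OF k t i(1), of n] unfolding row_shift_simps i(2) i_def by auto
 have b: "tP G Sj X n i' ** tI G Sj X n i = (if i' = i then idt A (cob (row_shift X) n) else 0)" if "i' : Sj" for i'
  using bip_comp[OF tS_bip[OF k t, of n] that i(1)] i(2) by (auto simp: row_shift_simps i_def)
 have id: "hom (idt A (cob (Z X) n)) (cob (Z X) n) (cob (Z X) n)" using hom_id[OF hom_dom[OF p]] .
 have "tI G Sj X n i ** tP G Sj X n i = idt A (cob (Z X) n)"
 proof (rule ttot_ext[OF k t hom_comp[OF p q] id])
  fix i' assume i': "i' : Sj"
  show "tP G Sj X n i' ** (tI G Sj X n i ** tP G Sj X n i) = tP G Sj X n i' ** idt A (cob (Z X) n)"
  proof (cases "i' = i")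
   case True
   thus ?thesis using assoc[OF p q p] b[OF i(1)] id_comp[OF p] comp_id[OF p] by simp
  next
   case False
   hence "n + i' \<noteq> j" using i(2) by auto
   thus ?thesis using row_comp_zero[OF i'] hom_comp[OF p q] id by metis
  qed
 qed
 thus ?thesis unfolding is_iso_def row_proj_def using True hom_arr[OF p] hom_arr[OF q] b[OF i(1)] by (auto simp: i_def)
next
 case False
 have oZ: "cob (Z X) n : obj A" using cpx_ob[OF ttot_complex[OF k t]] .
 have oR: "cob (row_shift X) n : obj A" using hom_dom[OF row_shift_d] .
 have "idt A (cob (Z X) n) = 0"
 proof (rule ttot_ext[OF k t hom_id[OF oZ] hom_zero[OF oZ oZ]])
  fix i assume i: "i : Sj"
  hence "n + i \<noteq> j" using False by auto
  thus "tP G Sj X n i ** idt A (cob (Z X) n) = tP G Sj X n i ** 0"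
   using row_comp_zero[OF i _ hom_id[OF oZ]] comp_zero[OF oZ tP_hom[OF k t i]] by simp
 qed
 thus ?thesis unfolding is_iso_def row_proj_def
  using False row_outside[OF False] hom_arr[OF hom_zero[OF oZ oR]] hom_arr[OF hom_zero[OF oR oZ]]
   comp_zero[OF oZ hom_zero[OF oR oZ]] comp_zero[OF oR hom_zero[OF oZ oR]] by auto
qed

lemma row_proj_hom: "hom (row_proj X n) (cob (Z X) n) (cob (row_shift X) n)"
 using is_iso_hom[OF row_proj_iso cpx_ob[OF ttot_complex[OF k t]] hom_dom[OF row_shift_d]] .

lemma row_pres: "pres (cob (Z X) n) (cob (row_shift X) n) (row_rel X n)"
 using pres_of_iso(1)[OF row_proj_iso cpx_ob[OF ttot_complex[OF k t]] hom_dom[OF row_shift_d]] unfolding row_rel_def[abs_def] .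

lemma row_rel_zero: "row_rel X n T x 0 ==> x = 0"
 using pres_of_iso(2)[OF row_proj_iso cpx_ob[OF ttot_complex[OF k t]] hom_dom[OF row_shift_d]] unfolding row_rel_def by metis

text \<open>The sign arises because the total differential carries (-1)^i and a minus sign before
  the twisting, with target index i = j - n - 1. \<open>coh_pres\<close> tolerates it.\<close>

lemma row_rel_d:
 assumes r: "row_rel X n T q s"
 shows "row_rel X (n + 1) T (cdf (Z X) n ** q) (ksgn (j - n) (cdf (row_shift X) n ** s))"
proof -
 note d = ttot_d[OF k t] and rp = row_proj_hom and rd = row_shift_d
 have q: "hom q T (cob (Z X) n)" and s: "s = row_proj X n ** q" using r unfolding row_rel_def by auto
 have hs: "hom s T (cob (row_shift X) n)" unfolding s using hom_comp[OF q rp] .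
 define i where "i = j - n - 1"
 have e: "j - (n + 1) = i" "i + 1 = j - n" "n + (i + 1) = j" "n + 1 + i = j" "i - (i + 1) + 1 = 0" unfolding i_def by auto
 have "row_proj X (n + 1) ** (cdf (Z X) n ** q) = ksgn (j - n) (cdf (row_shift X) n ** s)"
 proof (cases "i : Sj")
  case False
  hence z: "idt A (cob (row_shift X) (n + 1)) = 0" using row_outside[of "n + 1"] e by simp
  show ?thesis using hom_to_zero[OF hom_comp[OF hom_comp[OF q d(1)] rp] z] hom_to_zero[OF hom_comp[OF hs rd] z] by simp
 next
  case True
  have z: "dd G X i n ** (tP G Sj X n i ** q) = 0"
   using row_comp_zero[OF True _ q] e comp_zero[OF hom_dom[OF q] dd_hom[OF k t]] by simp
  have "qq G X i m n ** (tP G Sj X n m ** q) = (if m = i + 1 then cdf (row_shift X) n ** s else 0)" if m: "m : Sj" for m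
  proof (cases "m = i + 1")
   case m1: True
   hence "row_proj X n = tP G Sj X n m" using m unfolding row_proj_def by (simp add: i_def)
   moreover have "qq G X i m n = cdf (row_shift X) n" unfolding qq_def[OF k] m1 e row_shift_simps by (simp add: i_def)
   ultimately show ?thesis using m1 unfolding s by simp
  next
   case False
   hence "n + m \<noteq> j" using e by auto
   thus ?thesis using False row_comp_zero[OF m _ q] comp_zero[OF hom_dom[OF q] qq_hom[OF k t]] by simp
  qed
  hence "(\<Sum>m\<in>Sj. qq G X i m n ** (tP G Sj X n m ** q)) = (\<Sum>m\<in>Sj. if m = i + 1 then cdf (row_shift X) n ** s else 0)" by simp
  also have "\<dots> = cdf (row_shift X) n ** s"
  proof (cases "i + 1 : Sj")
   case False
   hence "s = 0" unfolding s row_proj_def using e zero_comp[OF q hom_dom[OF rd]] hom_cod[OF rp] zero_comp[OF q hom_cod[OF rp]] by simp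
   hence z: "cdf (row_shift X) n ** s = 0" using comp_zero[OF hom_dom[OF q] rd] by simp
   show ?thesis unfolding z by simp
  qed (use twok_simps(1)[OF k t] in simp)
  finally have "tP G Sj X (n + 1) i ** (cdf (Z X) n ** q) = ksgn i (- (cdf (row_shift X) n ** s))"
   unfolding d(2)[OF q True] z by simp
  moreover have "ksgn i (- y) = ksgn (j - n) y" for y :: 'a unfolding e(2)[symmetric] ksgn_def by auto
  moreover have "row_proj X (n + 1) = tP G Sj X (n + 1) i" unfolding row_proj_def e(1) using True by simp
  ultimately show ?thesis by simp
 qed
 thus ?thesis unfolding row_rel_def using hom_comp[OF q d(1)] by simp
qed

lemma row_coh_spec:
 shows "is_complex A (row_shift X)"
  and "pres (cob (Z X) n) (qH (row_shift X) n) (rcomp (row_rel X n) (sH (row_shift X) n))"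
  and "(EX h. rcomp (row_rel X n) (sH (row_shift X) n) T x h) \<longleftrightarrow> hom x T (cob (Z X) n) & cdf (Z X) n ** x = 0"
  and "rcomp (row_rel X n) (sH (row_shift X) n) T x 0 \<longleftrightarrow> sH (Z X) n T x 0"
proof -
 note cZ = ttot_complex[OF k t]
 have ex: "EX k. row_rel X (n + 1) T (cdf (Z X) n ** x) (ksgn k (cdf (row_shift X) n ** s))" if "row_rel X n T x s" for n T x s
  using row_rel_d[OF that] by blast
 have z: "row_rel X n T x 0 \<longleftrightarrow> T : obj A & x = 0" for n T x
  using row_rel_zero pres_hom1[OF row_pres] hom_dom pres_zero[OF row_pres] by metis
 show "is_complex A (row_shift X)" by (rule coh_pres(1)[OF cZ row_pres row_shift_d ex])
 show "pres (cob (Z X) n) (qH (row_shift X) n) (rcomp (row_rel X n) (sH (row_shift X) n))"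
  by (rule coh_pres(2)[OF cZ row_pres row_shift_d ex])
 have c3: "(EX h. rcomp (row_rel X n) (sH (row_shift X) n) T x h) \<longleftrightarrow> (EX t. row_rel X n T x t) & row_rel X (n + 1) T (cdf (Z X) n ** x) 0"
  by (rule coh_pres(3)[OF cZ row_pres row_shift_d ex])
 have c4: "rcomp (row_rel X n) (sH (row_shift X) n) T x 0 \<longleftrightarrow> (EX t. row_rel X n T x t) &
   (EX T' e y u. cov e T' T & row_rel X (n - 1) T' y u & row_rel X n T' (x ** e - cdf (Z X) (n - 1) ** y) 0)"
  by (rule coh_pres(4)[OF cZ row_pres row_shift_d ex])
 show "(EX h. rcomp (row_rel X n) (sH (row_shift X) n) T x h) \<longleftrightarrow> hom x T (cob (Z X) n) & cdf (Z X) n ** x = 0"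
  unfolding c3 z unfolding row_rel_def using hom_dom by blast
 show "rcomp (row_rel X n) (sH (row_shift X) n) T x 0 \<longleftrightarrow> sH (Z X) n T x 0"
  unfolding c4 coh_SQ(3)[OF cZ] z unfolding row_rel_def using hom_dom by fastforce
qed

lemma row_cpx_complex: "is_complex A (row_cpx A F j X)"
 unfolding is_complex_def
proof
 fix l
 have "cob (row_shift X) (l + j) : obj A & cdf (row_shift X) (l + j) : arr A (cob (row_shift X) (l + j)) (cob (row_shift X) (l + j + 1)) &
  cdf (row_shift X) (l + j + 1) ** cdf (row_shift X) (l + j) = 0" using row_coh_spec(1) unfolding is_complex_def by blast
 moreover have "l + j + 1 - j = l + 1" by simp
 ultimately show "cob (row_cpx A F j X) l : obj A & cdf (row_cpx A F j X) l : arr A (cob (row_cpx A F j X) l) (cob (row_cpx A F j X) (l + 1)) &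
  cdf (row_cpx A F j X) (l + 1) ** cdf (row_cpx A F j X) l = 0" unfolding row_shift_def by (simp del: add_diff_cancel_right')
qed

lemma row_coh_iso:
 "EX \<theta>. is_iso A (qH (Z X) n) (qH (row_shift X) n) \<theta> &
  (ALL T x h. sH (Z X) n T x h --> rcomp (row_rel X n) (sH (row_shift X) n) T x (\<theta> ** h))"
proof -
 note cZ = ttot_complex[OF k t]
 note s = coh_SQ[OF cZ, where n = n]
 show ?thesis
 proof (rule pres_iso_ex[OF SQ_pres[OF s(1)] row_coh_spec(2)])
  show "sH (Z X) n T x h ==> EX h'. rcomp (row_rel X n) (sH (row_shift X) n) T x h'" for T x h
   unfolding row_coh_spec(3) s(2)[symmetric] by blast
  show "rcomp (row_rel X n) (sH (row_shift X) n) T x 0" if "sH (Z X) n T x 0" for T x using that row_coh_spec(4) by blast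
  show "sH (Z X) n T x 0" if "rcomp (row_rel X n) (sH (row_shift X) n) T x 0" for T x using that row_coh_spec(4) by blast
  show "EX T' e x h. cov e T' T & sH (Z X) n T' x h & rcomp (row_rel X n) (sH (row_shift X) n) T' (x - x' ** e) 0"
   if r: "rcomp (row_rel X n) (sH (row_shift X) n) T x' h'" for T x' h'
  proof -
   have x: "hom x' T (cob (Z X) n)" using pres_hom1[OF row_coh_spec(2) r] .
   obtain h where "sH (Z X) n T x' h" using r row_coh_spec(3) s(2) by metis
   thus ?thesis using cov_id[OF hom_dom[OF x]] comp_id[OF x] pres_zero[OF row_coh_spec(2) hom_dom[OF x]] by (metis diff_self)
  qed
 qed
qed

end

text \<open>Only one index survives in each total degree, so the off-diagonal components of
  \<open>f\<close> do not contribute.\<close>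

lemma row_map:
 fixes n
 assumes X: "X : ob0 C" and Y: "Y : ob0 C" and f: "f : Tr_mor C zero_ideal X Y"
 defines "\<phi> \<equiv> tmap G (supp0 C X) (supp0 C Y) X Y f n"
  and "\<psi> \<equiv> sq_map A (coh A (row_shift Y) n) (coh A (row_shift X) n) (fmor G 0 (fst X (j - n)) (fst Y (j - n)) (f (j - n) (j - n)) j)"
 shows "hom \<psi> (qH (row_shift Y) n) (qH (row_shift X) n)"
  and "rcomp (row_rel Y n) (sH (row_shift Y) n) T x h ==> rcomp (row_rel X n) (sH (row_shift X) n) T (\<phi> ** x) (\<psi> ** h)"
proof -
 note k = kzT[OF cf neg, of "Some j" j] and t = tX[OF cf neg X] and t' = tX[OF cf neg Y]
 note og = twok_simps(2)[OF k t] and og' = twok_simps(2)[OF k t']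
 note cZ = ttot_complex[OF k t] and cZ' = ttot_complex[OF k t']
 have fh: "f : tw_hom C 0 X Y" using f unfolding Tr_mor_def by blast
 note m = tmap_spec[OF k t t' fh, where n = n] and tc = tmap_chain[OF k t t' f]
 define i where "i = j - n"
 have ni: "n + i = j" unfolding i_def by simp
 have "f i i : dhom C (0 + i - i) (fst X i) (fst Y i)" using fh unfolding tw_hom_def by blast
 hence fi: "f i i : dhom C 0 (fst X i) (fst Y i)" by simp
 let ?g = "fmor G 0 (fst X i) (fst Y i) (f i i) j"
 have g: "hom ?g (cob (row_shift Y) n) (cob (row_shift X) n)"
  using cf_hom[OF trunc_fun_functor[OF cf neg] og og' fi, of "Some j" j j] unfolding row_shift_simps i_def by simp
 have rel: "row_rel X n T (\<phi> ** q) (?g ** s)" if r: "row_rel Y n T q s" for T q s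
 proof -
  have q: "hom q T (cob (Z Y) n)" and s: "s = row_proj Y n ** q" using r unfolding row_rel_def by auto
  have hs: "hom s T (cob (row_shift Y) n)" unfolding s using hom_comp[OF q row_proj_hom[OF Y]] .
  have pq: "hom (\<phi> ** q) T (cob (Z X) n)" using hom_comp[OF q m(1)] unfolding \<phi>_def .
  have "row_proj X n ** (\<phi> ** q) = ?g ** s"
  proof (cases "i : supp0 C X")
   case False
   hence z: "idt A (cob (row_shift X) n) = 0" using row_outside[OF X] unfolding i_def by blast
   show ?thesis using hom_to_zero[OF hom_comp[OF pq row_proj_hom[OF X]] z] hom_to_zero[OF hom_comp[OF hs g] z] by simp
  next
   case True
   have "ff G X Y f i l n ** (tP G (supp0 C Y) Y n l ** q) = (if l = i then ?g ** s else 0)" if l: "l : supp0 C Y" for l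
   proof (cases "l = i")
    case True
    hence "s = tP G (supp0 C Y) Y n l ** q" using l unfolding s row_proj_def i_def by simp
    thus ?thesis using True ni unfolding ff_def[OF k] by simp
   next
    case False
    hence "n + l \<noteq> j" using ni by auto
    thus ?thesis using False row_comp_zero[OF Y l _ q] comp_zero[OF hom_dom[OF q] ff_hom[OF k t t' fh]] by simp
   qed
   hence "(\<Sum>l\<in>supp0 C Y. ff G X Y f i l n ** (tP G (supp0 C Y) Y n l ** q)) =
    (\<Sum>l\<in>supp0 C Y. if l = i then ?g ** s else 0)" by simp
   also have "\<dots> = ?g ** s"
   proof (cases "i : supp0 C Y")
    case False
    hence "s = 0" unfolding s row_proj_def i_def using zero_comp[OF q hom_cod[OF row_proj_hom[OF Y]]] by simp
    hence z: "?g ** s = 0" using comp_zero[OF hom_dom[OF q] g] by simp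
    show ?thesis unfolding z by simp
   qed (use twok_simps(1)[OF k t'] in simp)
   finally show ?thesis unfolding \<phi>_def row_proj_def i_def[symmetric] using True m(2)[OF q True] by simp
  qed
  thus ?thesis unfolding row_rel_def using pq by simp
 qed
 have dom: "EX t'. rcomp (row_rel X n) (sH (row_shift X) n) T (\<phi> ** x) t'" if "rcomp (row_rel Y n) (sH (row_shift Y) n) T x t" for T x t
 proof -
  have x: "hom x T (cob (Z Y) n)" "cdf (Z Y) n ** x = 0" using that row_coh_spec(3)[OF Y] by blast+
  thus ?thesis unfolding row_coh_spec(3)[OF X] \<phi>_def
   using hom_comp[OF x(1) m(1)] chain_map_dx[OF tc cZ' cZ x(1)] comp_zero[OF hom_dom[OF x(1)] tmap_spec(1)[OF k t t' fh]] by simp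
 qed
 have ker: "rcomp (row_rel X n) (sH (row_shift X) n) T (\<phi> ** x) 0" if "rcomp (row_rel Y n) (sH (row_shift Y) n) T x 0" for T x
 proof -
  have x: "sH (Z Y) n T x 0" using that row_coh_spec(4)[OF Y] by blast
  have "coh_map A (Z Y) (Z X) (tmap G (supp0 C X) (supp0 C Y) X Y f) n ** 0 = 0"
   using comp_zero[OF hom_dom[OF pres_hom1[OF SQ_pres[OF coh_SQ(1)[OF cZ']] x]] coh_map_spec(1)[OF tc cZ' cZ]] .
  thus ?thesis unfolding row_coh_spec(4)[OF X] \<phi>_def using coh_map_spec(2)[OF tc cZ' cZ x] by simp
 qed
 note sq = coh_SQ(1)[OF row_coh_spec(1)]
 note r = rcomp_sq_map[OF row_pres[OF Y] row_pres[OF X] sq[OF Y] sq[OF X] g, where \<phi> = \<phi>]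
 show "hom \<psi> (qH (row_shift Y) n) (qH (row_shift X) n)"
  unfolding \<psi>_def i_def[symmetric] by (rule r(1)) (fact rel dom ker)+
 show "rcomp (row_rel Y n) (sH (row_shift Y) n) T x h ==> rcomp (row_rel X n) (sH (row_shift X) n) T (\<phi> ** x) (\<psi> ** h)"
  unfolding \<psi>_def i_def[symmetric] by (rule r(3)) ((rule rel, assumption) | (rule dom, assumption) | (rule ker, assumption) | assumption)+
qed

lemma E1_row: "tr_nat_iso C zero_ideal A (E_term A C F 1 i j) (row_coh A F i j)"
proof (rule E_term_nat_iso[OF cf neg order_refl, where
  R = "\<lambda>X. rcomp (RT C F X (Some j) j (i + j)) (rcomp (row_rel X (i + j)) (sH (row_shift X) (i + j)))"])
 let ?n = "i + j"
 have fs: "fst (row_coh A F i j) X = qH (row_shift X) ?n" for X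
  unfolding row_coh_def row_shift_simps by simp
 have sn: "snd (row_coh A F i j) X Y f =
  sq_map A (coh A (row_shift Y) ?n) (coh A (row_shift X) ?n) (fmor G 0 (fst X (j - ?n)) (fst Y (j - ?n)) (f (j - ?n) (j - ?n)) j)" for X Y f
  unfolding row_coh_def row_shift_simps trunc_coh coh_map_def by simp
 fix X assume X: "X : ob0 C"
 note c = ttot_complex[OF kzT[OF cf neg] tX[OF cf neg X]]
 show "pres (cob (ttot F (supp0 C X) X) ?n) (fst (row_coh A F i j) X)
  (rcomp (RT C F X (Some j) j ?n) (rcomp (row_rel X ?n) (sH (row_shift X) ?n)))"
  unfolding fs using pres_rcomp[OF RT_pres[OF cf neg X] row_coh_spec(2)[OF X]] .
 obtain \<theta> where \<theta>: "is_iso A (qE (dfil C F X) 1 j ?n) (qH (Z X) ?n) \<theta>"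
  "\<And>T x t. sE (dfil C F X) 1 j ?n T x t ==> rcomp (RT C F X (Some j) j ?n) (sH (Z X) ?n) T x (\<theta> ** t)"
  using TP_E1_iso[OF treal_TP[OF cf neg X refl], of j ?n] by blast
 obtain \<kappa> where \<kappa>: "is_iso A (qH (Z X) ?n) (qH (row_shift X) ?n) \<kappa>"
  "\<And>T x h. sH (Z X) ?n T x h ==> rcomp (row_rel X ?n) (sH (row_shift X) ?n) T x (\<kappa> ** h)"
  using row_coh_iso[OF X] by blast
 note pE = fil_E_pres[OF Wfil_fil[OF descent_W[OF cf neg X]] order_refl]
 note o = pres_ob2[OF pE, of j ?n] pres_ob2[OF SQ_pres[OF coh_SQ(1)[OF c]]] pres_ob2[OF row_coh_spec(2)[OF X]]
 show "EX \<theta>. is_iso A (qE (dfil C F X) 1 j ?n) (fst (row_coh A F i j) X) \<theta> &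
  (ALL T x t. sE (dfil C F X) 1 j ?n T x t -->
   rcomp (RT C F X (Some j) j ?n) (rcomp (row_rel X ?n) (sH (row_shift X) ?n)) T x (\<theta> ** t))"
  unfolding fs
 proof (intro exI[of _ "\<kappa> ** \<theta>"] conjI allI impI is_iso_comp[OF \<theta>(1) \<kappa>(1) o])
  fix T x t assume a: "sE (dfil C F X) 1 j ?n T x t"
  have "\<kappa> ** \<theta> ** t = \<kappa> ** (\<theta> ** t)"
   using assoc[OF pres_hom2[OF pE a] is_iso_hom[OF \<theta>(1) o(1,2)] is_iso_hom[OF \<kappa>(1) o(2,3)]] .
  thus "rcomp (RT C F X (Some j) j ?n) (rcomp (row_rel X ?n) (sH (row_shift X) ?n)) T x (\<kappa> ** \<theta> ** t)"
   using \<theta>(2)[OF a] \<kappa>(2) unfolding rcomp_def[of "RT C F X (Some j) j ?n"] by auto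
 qed
 fix Y f assume Y: "Y : ob0 C" and f: "f : Tr_mor C zero_ideal X Y"
 note rm = row_map[OF X Y f, of ?n]
 show "hom (snd (row_coh A F i j) X Y f) (fst (row_coh A F i j) Y) (fst (row_coh A F i j) X)"
  unfolding fs sn using rm(1) .
 have fh: "f : tw_hom C 0 X Y" using f unfolding Tr_mor_def by blast
 note br = BR_tmap[OF kz[OF cf neg] kzT[OF cf neg] frel_trunc[OF cf neg] tX[OF cf neg X] tX[OF cf neg Y] fh, folded RT_def]
 show "rcomp (RT C F Y (Some j) j ?n) (rcomp (row_rel Y ?n) (sH (row_shift Y) ?n)) T x h ==>
  rcomp (RT C F X (Some j) j ?n) (rcomp (row_rel X ?n) (sH (row_shift X) ?n)) T (tot_map A C F X Y f ?n ** x)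
   (snd (row_coh A F i j) X Y f ** h)" for T x h
  unfolding sn tot_map_tmap rcomp_def[of "RT C F _ (Some j) j ?n"] using br rm(2) by blast
qed

end

end

section \<open>Transformations that agree up to homotopy\<close>

lemma dg_zero:
 assumes C: "dg_category C" and o: "P : dobj C" "Q : dobj C"
 shows dg_diff_zero: "ddiff C i P Q 0 = 0" and dg_comp_zero: "R : dobj C ==> dcmp C P Q R i j 0 0 = 0"
proof -
 note z = subgrp_zero[OF dg_subgrp[OF C]]
 have "ddiff C i P Q (0 + 0) = ddiff C i P Q 0 + ddiff C i P Q 0"
  using C o z[OF o, of i] unfolding dg_category_def by blast
 thus "ddiff C i P Q 0 = 0" by simp
 assume R: "R : dobj C"
 have "dcmp C P Q R i j 0 (0 + 0) = dcmp C P Q R i j 0 0 + dcmp C P Q R i j 0 0"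
  using C o R z[OF o, of i] z[OF o(2) R, of j] unfolding dg_category_def by blast
 thus "dcmp C P Q R i j 0 0 = 0" by simp
qed

context abcat begin

context
 fixes C :: "('p, 'm::ab_group_add) dgcat" and F F' :: "('p, 'm, 'o, 'a) cfun" and \<eta> \<eta>' :: "'p => int => 'a" and Oz
 assumes cf: "contra_dg_functor C A F" and cf': "contra_dg_functor C A F'" and neg: "neg_dg C"
  and \<eta>: "dg_transformation C A F F' \<eta>" and \<eta>': "dg_transformation C A F F' \<eta>'"
  and Oz: "Oz : dobj C" "did C Oz = 0"
  and hyp: "\<And>X. X : ob0 C ==>
   homotopic A (tot A C F X) (tot A C F' X) (tot_nat A C F F' \<eta> X) (tot_nat A C F F' \<eta>' X)"
begin

text \<open>This is \<open>hyp\<close> for the twisted complex \<open>[P]\<close> concentrated in degree \<open>0\<close>; the zero object \<open>Oz\<close> fills the other degrees.\<close>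

lemma transformation_bdry:
 assumes P: "P : dobj C" and x: "hom x T (Fo F P n)" and dx: "Fd F P n ** x = 0"
 shows "bdry (fob F' P) n T (\<eta> P n ** x - \<eta>' P n ** x)"
proof -
 note dg = cf_cat[OF cf] and k = kz[OF cf neg] and k' = kz[OF cf' neg]
 note h = dg_trD(1)[OF \<eta> k k'] and h' = dg_trD(1)[OF \<eta>' k k']
 define X :: "('p, 'm) tw" where "X = (\<lambda>i. if i = 0 then P else Oz, \<lambda>_ _. 0)"
 let ?S = "supp0 C X"
 have S: "?S \<subseteq> {0}" unfolding tw_supp_def X_def zero_ideal_def using Oz by auto
 have o: "fst X i : dobj C" for i unfolding X_def using P Oz by simp
 have s0: "snd X i j = 0" for i j unfolding X_def by simp
 have X: "X : ob0 C" unfolding tw_obj_def s0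
  using o finite_subset[OF S] subgrp_zero[OF dg_subgrp[OF dg o o]] dg_diff_zero[OF dg o o] dg_comp_zero[OF dg o o o] s0
  by (simp add: zero_ideal_def)
 note t = tX[OF cf neg X] and X0 = fst_conv[of "\<lambda>i. if i = 0 then P else Oz", folded X_def]
 have P0: "fst X 0 = P" unfolding X_def by simp
 note c = ttot_complex[OF k t] and c' = ttot_complex[OF k' t]
 note N = tnat_spec[OF k k' t h] and N' = tnat_spec[OF k k' t h'] and d = ttot_d[OF k t] and d' = ttot_d[OF k' t]
 show ?thesis
 proof (cases "0 : ?S")
  \<comment> \<open>\<open>P\<close> may itself be a zero object, and then the support is
    empty.\<close>
  case False
  hence "x = 0" using hom_to_zero[OF x] twok_outside[OF k t, of 0] P0 by simp
  thus ?thesis using comp_zero[OF hom_dom[OF x] h[OF P]] comp_zero[OF hom_dom[OF x] h'[OF P]]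
    bdry_zero[OF cf_cpx[OF cf' P] hom_dom[OF x]] by simp
 next
  case True
  define y where "y = tI F ?S X n 0 ** x"
  have pI: "hom (tI F ?S X n 0) (Fo F P n) (cob (ttot F ?S X) n)" "hom (tP F ?S X n 0) (cob (ttot F ?S X) n) (Fo F P n)"
   using tI_hom[OF k t True, of n] tP_hom[OF k t True, of n] P0 by auto
  have y: "hom y T (cob (ttot F ?S X) n)" unfolding y_def using hom_comp[OF x pI(1)] .
  have py: "tP F ?S X n 0 ** y = x"
   unfolding y_def using assoc[OF x pI] bip_comp[OF tS_bip[OF k t, of n] True True] P0 id_comp[OF x] by simp
  have q0: "qq F X i j m = 0" "qq F' X i j m = 0" for i j m
   unfolding qq_def[OF k] qq_def[OF k'] s0 using cf_zero[OF cf o o] cf_zero[OF cf' o o] by auto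
  have dy: "cdf (ttot F ?S X) n ** y = 0"
  proof (rule ttot_ext[OF k t hom_comp[OF y d(1)] hom_zero[OF hom_dom[OF y] cpx_ob[OF c]]])
   fix i assume i: "i : ?S"
   hence i0: "i = 0" using S by blast
   have "qq F X i j n ** (tP F ?S X n j ** y) = 0" if "j : ?S" for j
    unfolding q0 using zero_comp[OF hom_comp[OF y tP_hom[OF k t that]]] cpx_ob[OF cf_cpx[OF cf o]] hom_cod[OF qq_hom[OF k t]] by blast
   thus "tP F ?S X (n + 1) i ** (cdf (ttot F ?S X) n ** y) = tP F ?S X (n + 1) i ** 0"
    unfolding d(2)[OF y i] using py dx P0 i0 comp_zero[OF hom_dom[OF y] tP_hom[OF k t i]] by (simp add: dd_def[OF k])
  qed
  obtain g where g: "g : cpx_hom A (- 1) (ttot F ?S X) (ttot F' ?S X)"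
   "\<And>n. tnat F F' \<eta> ?S X n - tnat F F' \<eta>' ?S X n = cpx_diff A (- 1) (ttot F ?S X) (ttot F' ?S X) g n"
   using hyp[OF X] unfolding homotopic_def tot_ttot tot_nat_tnat by blast
  have gh: "hom (g m) (cob (ttot F ?S X) m) (cob (ttot F' ?S X) (m - 1))" for m
   using g(1) cpx_ob[OF c] cpx_ob[OF c'] unfolding cpx_hom_def hom_def by simp
  have gh1: "hom (g (n + 1)) (cob (ttot F ?S X) (n + 1)) (cob (ttot F' ?S X) n)" using gh[of "n + 1"] by simp
  have n1: "hom (tnat F F' \<eta> ?S X n) (cob (ttot F ?S X) n) (cob (ttot F' ?S X) n)"
   and n1': "hom (tnat F F' \<eta>' ?S X n) (cob (ttot F ?S X) n) (cob (ttot F' ?S X) n)" using N(1) N'(1) by blast+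
  define u where "u = g n ** y"
  have u: "hom u T (cob (ttot F' ?S X) (n - 1))" unfolding u_def using hom_comp[OF y gh] .
  have "tnat F F' \<eta> ?S X n - tnat F F' \<eta>' ?S X n = cdf (ttot F' ?S X) (n - 1) ** g n + g (n + 1) ** cdf (ttot F ?S X) n"
   unfolding g(2) cpx_diff_def by (simp add: ksgn_def)
  hence "(tnat F F' \<eta> ?S X n - tnat F F' \<eta>' ?S X n) ** y = cdf (ttot F' ?S X) (n - 1) ** u + g (n + 1) ** (cdf (ttot F ?S X) n ** y)"
   unfolding u_def using add_comp[OF y hom_comp[OF gh cpx_hom_d'[OF c']] hom_comp[OF d(1) gh1]]
    assoc[OF y gh cpx_hom_d'[OF c']] assoc[OF y d(1) gh1] by simp
  hence E: "tnat F F' \<eta> ?S X n ** y - tnat F F' \<eta>' ?S X n ** y = cdf (ttot F' ?S X) (n - 1) ** u"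
   using diff_comp[OF y n1 n1'] comp_zero[OF hom_dom[OF y] gh1] dy by simp
  have pu: "hom (tP F' ?S X (n - 1) 0 ** u) T (Fo F' P (n - 1))" using hom_comp[OF u tP_hom[OF k' t True]] P0 by simp
  have qz: "qq F' X 0 j (n - 1) ** (tP F' ?S X (n - 1) j ** u) = 0" if "j : ?S" for j
   unfolding q0 using zero_comp[OF hom_comp[OF u tP_hom[OF k' t that]] hom_cod[OF qq_hom[OF k' t]]] by blast
  have e: "n - 1 + 1 = n" by simp
  have "tP F' ?S X n 0 ** (cdf (ttot F' ?S X) (n - 1) ** u) = Fd F' P (n - 1) ** (tP F' ?S X (n - 1) 0 ** u)"
   using d'(2)[OF u True, unfolded e] qz P0 by (simp add: dd_def[OF k'] ksgn_even)
  moreover have "tP F' ?S X n 0 ** (tnat F F' \<eta> ?S X n ** y - tnat F F' \<eta>' ?S X n ** y) = \<eta> P n ** x - \<eta>' P n ** x"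
   using comp_diff[OF hom_comp[OF y N(1)] hom_comp[OF y N'(1)] tP_hom[OF k' t True]] N(2)[OF _ y True] N'(2)[OF _ y True] py P0 by simp
  ultimately have eq: "\<eta> P n ** x - \<eta>' P n ** x = Fd F' P (n - 1) ** (tP F' ?S X (n - 1) 0 ** u)" unfolding E by simp
  have "hom (\<eta> P n ** x - \<eta>' P n ** x) T (Fo F' P n)" using hom_diff[OF hom_comp[OF x h[OF P]] hom_comp[OF x h'[OF P]]] .
  thus ?thesis unfolding bdry_def using cov_id[OF hom_dom[OF x]] comp_id pu eq by metis
 qed
qed

text \<open>On an element of Z_r the components of degree j are cocycles, where the transformations
  differ by boundaries (\<open>transformation_bdry\<close>); components above j are zero, and those
  below need no control. By \<open>Kd_iff\<close> the difference lies in W_(j-1) + d W_(j-1), and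
  \<open>Kfil_fB\<close> makes it zero on E_r.\<close>

lemma descent_nat_eq:
 assumes X: "X : ob0 C" and r: "r \<ge> 1"
 shows "descent_nat A C F F' \<eta> X r i j = descent_nat A C F F' \<eta>' X r i j"
proof -
 note f = tot_nat_fmap[OF cf neg cf' \<eta> X] and f' = tot_nat_fmap[OF cf neg cf' \<eta>' X]
 note k = kz[OF cf neg] and k' = kz[OF cf' neg] and t = tX[OF cf neg X]
 note h = dg_trD(1)[OF \<eta> k k'] and h' = dg_trD(1)[OF \<eta>' k k'] and o = twok_simps(2)[OF k t]
 note N = tnat_spec[OF k k' t h] and N' = tnat_spec[OF k k' t h']
 let ?Fi = "dfil C F X" and ?Fi' = "dfil C F' X" and ?n = "i + j" and ?S = "supp0 C X"
 show ?thesis unfolding descent_nat_def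
 proof (rule ss_map_eq[OF f f' r])
  fix T x assume z: "fZ ?Fi (int r) j ?n T x"
  let ?y = "tot_nat A C F F' \<eta> X ?n ** x - tot_nat A C F F' \<eta>' X ?n ** x"
  have zy: "fZ ?Fi' (int r) j ?n T ?y" using fZ_diff[OF fmapD(2)[OF f] fmap_fZ[OF f z] fmap_fZ[OF f' z]] .
  have G: "fG ?Fi j ?n T x" using z unfolding fZ_def by blast
  have x: "hom x T (cob (ttot F ?S X) ?n)" using fG_hom[OF fmapD(1)[OF f] G] unfolding descent_simps .
  have y: "hom ?y T (cob (ttot F' ?S X) ?n)" using fZ_hom[OF fmapD(2)[OF f] zy] unfolding descent_simps .
  have "tb (Some j) (fob F' (fst X l)) (?n + l) T (tP F' ?S X ?n l ** ?y)" if l: "l : ?S" for l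
  proof -
   let ?x = "tP F ?S X ?n l ** x"
   have px: "hom ?x T (Fo F (fst X l) (?n + l))" using hom_comp[OF x tP_hom[OF k t l]] .
   have e: "tP F' ?S X ?n l ** ?y = \<eta> (fst X l) (?n + l) ** ?x - \<eta>' (fst X l) (?n + l) ** ?x"
    unfolding tot_nat_tnat using comp_diff[OF hom_comp[OF x N(1)] hom_comp[OF x N'(1)] tP_hom[OF k' t l]] N(2)[OF _ x l] N'(2)[OF _ x l] by simp
   have "tP F' ?S X ?n l ** ?y = 0" if "?n + l > j"
   proof -
    have "?x = 0" using G l that unfolding fG_iff[OF cf neg X] Wd_def by blast
    thus ?thesis unfolding e using comp_zero[OF hom_dom[OF x] h[OF o]] comp_zero[OF hom_dom[OF x] h'[OF o]] by simp
   qed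
   moreover have "bdry (fob F' (fst X l)) (?n + l) T (tP F' ?S X ?n l ** ?y)" if "?n + l = j"
    unfolding e using transformation_bdry[OF o px] G l that unfolding fG_iff[OF cf neg X] by blast
   ultimately show ?thesis unfolding tb_def using hom_comp[OF y tP_hom[OF k' t l]] by simp
  qed
  hence "Kfil ?Fi' (Wd C F' X) (j - 1) ?n T ?y" unfolding Kd_iff[OF cf' neg X] using y by blast
  thus "fB ?Fi' (int r) j ?n T ?y" using Kfil_fB[OF descent_W[OF cf' neg X] _ zy] r by simp
 qed
qed

end

end

section \<open>The category of smooth projective varieties\<close>

lemma Jcat_neg: "neg_dg (Jcat :: ('k::field_char_0 variety, 'k cycle) dgcat)"
 unfolding neg_dg_def Jcat_def suslin_def by simp

text \<open>The zero object that pads [P] to a twisted complex: the empty subscheme of the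
  projective space of dimension 0. It is closed because a prime ideal cannot contain all
  polynomials, and its identity is an empty sum of cycles.\<close>

lemma empty_variety:
 fixes V :: "'k::field_char_0 variety"
 defines "V \<equiv> ([Proj 0], {})"
 shows "V : dobj Jcat" and "did Jcat V = 0"
proof -
 have "{p : points [Proj 0]. polys [Proj 0] \<subseteq> p} = ({} :: 'k mpol set set)"
 proof (intro equals0I)
  fix p :: "'k mpol set" assume p: "p : {p : points [Proj 0]. polys [Proj 0] \<subseteq> p}"
  hence i: "primeideal p (polyring [Proj 0])" unfolding points_def by blast
  have "p \<subseteq> carrier (polyring [Proj 0])"
   using additive_subgroup.a_subset[OF ideal.axioms(1)[OF primeideal.axioms(1)[OF i]]] .
  hence "carrier (polyring [Proj 0]) = p" using p unfolding polyring_def by auto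
  thus False using primeideal.I_notcarr[OF i] by blast
 qed
 hence "zariski_closed [Proj 0] ({} :: 'k mpol set set)"
  unfolding zariski_closed_def by (intro exI[of _ "polys [Proj 0]"]) blast
 hence "V : SmPrVar" unfolding V_def SmPrVar_def smooth_def by simp
 thus "V : dobj Jcat" unfolding Jcat_def by simp
 show "did Jcat V = 0" unfolding V_def Jcat_def cor_id_def graph_def minimal_elts_def by simp
qed

theorem mainTheorem15:
  fixes A :: "('o, 'a::ab_group_add) acat"
    and F :: "('k::field_char_0 variety, 'k cycle, 'o, 'a) cfun"
  assumes "abelian_category A"
    and "contra_dg_functor Jcat A F"
  shows
    "(\<forall>X\<in>tw_obj Jcat zero_ideal.
        is_filtered A (descent_fil A Jcat F X) \<and>
        is_spectral_sequence A (descent_ss A Jcat F X) \<and>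
        ss_converges A (descent_fil A Jcat F X)) \<and>
     (\<forall>i j. tr_nat_iso Jcat zero_ideal A (E_term A Jcat F 1 i j) (treal_coh A Jcat F j 0 (i + j))) \<and>
     \<comment> \<open>(a)\<close>
     (\<forall>X\<in>tw_obj Jcat zero_ideal. \<forall>j. is_complex A (row_cpx A F j X)) \<and>
     (\<forall>i j. tr_nat_iso Jcat zero_ideal A (E_term A Jcat F 1 i j) (row_coh A F i j) \<and>
        factors_through_t Jcat 0 A (E_term A Jcat F 1 i j)) \<and>
     \<comment> \<open>(b)\<close>
     (\<forall>n\<ge>1. \<forall>i j.
        tr_nat_iso Jcat zero_ideal A (E_term A Jcat F n i j) (descent_im_fun A Jcat F n i j) \<and>
        factors_through_t Jcat (2 * int n - 2) A (E_term A Jcat F n i j)) \<and>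
     \<comment> \<open>(c)\<close>
     (\<forall>r\<ge>1. \<forall>i j. tr_functor Jcat zero_ideal A (E_term A Jcat F r i j)) \<and>
     (\<forall>X\<in>tw_obj Jcat zero_ideal. \<forall>X'\<in>tw_obj Jcat zero_ideal. \<forall>f\<in>Tr_mor Jcat zero_ideal X X'.
        is_ss_morphism A (descent_ss A Jcat F X') (descent_ss A Jcat F X)
          (descent_map A Jcat F X X' f) \<and>
        abutment_compat A (descent_fil A Jcat F X') (descent_fil A Jcat F X)
          (tot_map A Jcat F X X' f)) \<and>
     (\<forall>F'. contra_dg_functor Jcat A F' \<longrightarrow>
        (\<forall>\<eta>. dg_transformation Jcat A F F' \<eta> \<longrightarrow>
           (\<forall>X\<in>tw_obj Jcat zero_ideal.
              is_ss_morphism A (descent_ss A Jcat F X) (descent_ss A Jcat F' X)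
                (descent_nat A Jcat F F' \<eta> X) \<and>
              abutment_compat A (descent_fil A Jcat F X) (descent_fil A Jcat F' X)
                (tot_nat A Jcat F F' \<eta> X)) \<and>
           (\<forall>\<eta>'. dg_transformation Jcat A F F' \<eta>' \<and>
              (\<forall>X\<in>tw_obj Jcat zero_ideal. homotopic A (tot A Jcat F X) (tot A Jcat F' X)
                 (tot_nat A Jcat F F' \<eta> X) (tot_nat A Jcat F F' \<eta>' X)) \<longrightarrow>
              (\<forall>X\<in>tw_obj Jcat zero_ideal. \<forall>r\<ge>1. \<forall>i j.
                 descent_nat A Jcat F F' \<eta> X r i j = descent_nat A Jcat F F' \<eta>' X r i j))))"
proof -
  interpret abcat A using assms(1) by unfold_locales
  note cf = assms(2) and neg = Jcat_neg
  have fil: "is_filtered A (descent_fil A Jcat F X)" if "X \<in> tw_obj Jcat zero_ideal" for X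
    using Wfil_fil[OF descent_W[OF cf neg that]] .
  have 1: "is_filtered A (descent_fil A Jcat F X) \<and> is_spectral_sequence A (descent_ss A Jcat F X) \<and>
      ss_converges A (descent_fil A Jcat F X)" if X: "X \<in> tw_obj Jcat zero_ideal" for X
    using fil[OF X] ss_of_spectral_sequence[OF fil[OF X]] fbounded_converges[OF descent_bounded[OF cf neg X]]
    unfolding descent_ss_def by blast
  \<comment> \<open>For n = 1 the length 2n - 2 is 0.\<close>
  have a: "factors_through_t Jcat 0 A (E_term A Jcat F 1 i j)" for i j
    using En_factors[OF cf neg order_refl, of i j] by simp
  have map: "is_ss_morphism A (descent_ss A Jcat F X') (descent_ss A Jcat F X) (descent_map A Jcat F X X' f) \<and>
      abutment_compat A (descent_fil A Jcat F X') (descent_fil A Jcat F X) (tot_map A Jcat F X X' f)"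
    if X: "X \<in> tw_obj Jcat zero_ideal" and X': "X' \<in> tw_obj Jcat zero_ideal" and f: "f \<in> Tr_mor Jcat zero_ideal X X'" for X X' f
    unfolding descent_ss_def descent_map_def
    using ss_map_morphism[OF tot_map_fmap[OF cf neg X X' f]]
      fmap_abutment_compat[OF tot_map_fmap[OF cf neg X X' f] descent_bounded[OF cf neg X'] descent_bounded[OF cf neg X]] by blast
  have nat: "is_ss_morphism A (descent_ss A Jcat F X) (descent_ss A Jcat F' X) (descent_nat A Jcat F F' \<eta> X) \<and>
      abutment_compat A (descent_fil A Jcat F X) (descent_fil A Jcat F' X) (tot_nat A Jcat F F' \<eta> X)"
    if cf': "contra_dg_functor Jcat A F'" and \<eta>: "dg_transformation Jcat A F F' \<eta>" and X: "X \<in> tw_obj Jcat zero_ideal" for F' \<eta> X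
    unfolding descent_ss_def descent_nat_def
    using ss_map_morphism[OF tot_nat_fmap[OF cf neg cf' \<eta> X]]
      fmap_abutment_compat[OF tot_nat_fmap[OF cf neg cf' \<eta> X] descent_bounded[OF cf neg X] descent_bounded[OF cf' neg X]] by blast
  have eq: "descent_nat A Jcat F F' \<eta> X r i j = descent_nat A Jcat F F' \<eta>' X r i j"
    if cf': "contra_dg_functor Jcat A F'" and \<eta>: "dg_transformation Jcat A F F' \<eta>"
      and \<eta>': "dg_transformation Jcat A F F' \<eta>' \<and> (\<forall>X\<in>tw_obj Jcat zero_ideal. homotopic A (tot A Jcat F X) (tot A Jcat F' X)
                 (tot_nat A Jcat F F' \<eta> X) (tot_nat A Jcat F F' \<eta>' X))"
      and X: "X \<in> tw_obj Jcat zero_ideal" and r: "r \<ge> 1" for F' \<eta> \<eta>' X r i j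
    by (rule descent_nat_eq[OF cf cf' neg \<eta> _ empty_variety _ X r]) (use \<eta>' in blast)+
  show ?thesis
    by (intro conjI ballI allI impI)
      (rule 1[THEN conjunct1] 1[THEN conjunct2, THEN conjunct1] 1[THEN conjunct2, THEN conjunct2] a
        E1_treal[OF cf neg] row_cpx_complex[OF cf neg] E1_row[OF cf neg] En_descent_im[OF cf neg] En_factors[OF cf neg]
        E_term_functor[OF cf neg] map[THEN conjunct1] map[THEN conjunct2] nat[THEN conjunct1] nat[THEN conjunct2] eq; assumption)+
qed

end
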